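(* Let $F:\mathbb{R}\to\mathbb{R}$ be Lipschitz continuous, $u_0\in C^1_b(\mathbb{R})$, $u_1\in C_b(\mathbb{R})$, and let $\xi$ be a space-time white noise on $\mathbb{R}\times\mathbb{R}$. Let $u$ be the solution of the stochastic wave equation \[ \partial_t^2u-\partial_x^2u=F(u)\xi,\qquad (u,\partial_tu)|_{t=0}=(u_0,u_1), \] and let $Z$ be the solution of $\partial_t^2Z-\partial_x^2Z=\xi$, $(Z,\partial_tZ)|_{t=0}=(0,0)$. Define, for $\varepsilon>0$, \begin{align*} \Delta^{(1)}_\varepsilon f(t,x)&=f(t,x+2\varepsilon)-f(t-\varepsilon,x+\varepsilon)-f(t+\varepsilon,x+\varepsilon)+f(t,x),\\ \Delta^{(2)}_\varepsilon f(t,x)&=f(t+2\varepsilon,x)-f(t+\varepsilon,x-\varepsilon)-f(t+\varepsilon,x+\varepsilon)+f(t,x). \end{align*} Then for any $(t,x)\in\mathbb{R}^2$ and finite $p\ge2$ there is $C(p,t,x)$ such that \[ \|\Delta^{(1)}_\varepsilon u(t,x)-F(u(t,x))\Delta^{(1)}_\varepsilon Z(t,x)\|_{L^p(\Omega)}+\|\Delta^{(2)}_\varepsilon u(t,x)-F(u(t,x))\Delta^{(2)}_\varepsilon Z(t,x)\|_{L^p(\Omega)}\le C(p,t,x)\,\varepsilon^{3/2} \] uniformly in small $\varepsilon>0$.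
   Context: Space-time white noise $\xi$ on $\mathbb{R}^2$: a family of centered Gaussian random variables $\{\xi(\varphi):\varphi\in L^2(\mathbb{R}^2)\}$ with $\mathbb{E}[\xi(\varphi_1)\xi(\varphi_2)]=\langle\varphi_1,\varphi_2\rangle_{L^2(\mathbb{R}^2)}$. Solutions are understood in the Walsh (Itô) sense, e.g. via the mild formulation $u(t,x)=\partial_t\int G(t,x-y)u_0(y)dy+\int G(t,x-y)u_1(y)dy+\int_0^t\int G(t-s,x-y)F(u(s,y))\xi(dy\,ds)$ with $G(t,x)=\frac12\mathbf 1_{\{|x|<t\}}$, equivalently via the integral equation in null coordinates $x_1=(x-t)/\sqrt2$, $x_2=(x+t)/\sqrt2$. $C^1_b$ / $C_b$ denote bounded $C^1$ functions with bounded derivative / bounded continuous functions. *)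

theory Defs
  imports "HOL-Probability.Probability"
begin

text \<open>Test functions are functions of (time, space) = (s, y) in L2(R^2).\<close>

definition L2fun :: "(real \<times> real \<Rightarrow> real) \<Rightarrow> bool" where
  "L2fun \<phi> \<longleftrightarrow> \<phi> \<in> borel_measurable lborel \<and> integrable lborel (\<lambda>z. (\<phi> z)\<^sup>2)"

definition centered_gaussian :: "'a measure \<Rightarrow> ('a \<Rightarrow> real) \<Rightarrow> bool" where
  "centered_gaussian M X \<longleftrightarrow>
     (\<exists>\<sigma>>0. distributed M lborel X (normal_density 0 \<sigma>)) \<or> (AE \<omega> in M. X \<omega> = 0)"

definition white_noise :: "'a measure \<Rightarrow> ((real \<times> real \<Rightarrow> real) \<Rightarrow> 'a \<Rightarrow> real) \<Rightarrow> bool" where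
  "white_noise M \<xi> \<longleftrightarrow> prob_space M
     \<and> (\<forall>\<phi>. L2fun \<phi> \<longrightarrow> \<xi> \<phi> \<in> borel_measurable M)
     \<and> (\<forall>(I::nat set) \<phi>s c. finite I \<longrightarrow> (\<forall>i\<in>I. L2fun (\<phi>s i)) \<longrightarrow>
           centered_gaussian M (\<lambda>\<omega>. \<Sum>i\<in>I. c i * \<xi> (\<phi>s i) \<omega>))
     \<and> (\<forall>\<phi> \<psi>. L2fun \<phi> \<longrightarrow> L2fun \<psi> \<longrightarrow>
           (\<integral>\<omega>. \<xi> \<phi> \<omega> * \<xi> \<psi> \<omega> \<partial>M) = (\<integral>z. \<phi> z * \<psi> z \<partial>lborel))"

definition reflect_noise :: "((real \<times> real \<Rightarrow> real) \<Rightarrow> 'a \<Rightarrow> real) \<Rightarrow> (real \<times> real \<Rightarrow> real) \<Rightarrow> 'a \<Rightarrow> real" where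
  "reflect_noise \<xi> \<phi> = \<xi> (\<lambda>(s, y). \<phi> (- s, y))"

definition rect :: "real \<Rightarrow> real \<Rightarrow> real \<Rightarrow> real \<Rightarrow> (real \<times> real) set" where
  "rect a b c d = {a<..b} \<times> {c<..d}"

definition nat_filt :: "'a measure \<Rightarrow> ((real \<times> real \<Rightarrow> real) \<Rightarrow> 'a \<Rightarrow> real) \<Rightarrow> real \<Rightarrow> 'a measure" where
  "nat_filt M \<xi> t = sigma (space M)
     ({\<xi> (indicator (rect a b c d)) -` B \<inter> space M | a b c d B.
         0 \<le> a \<and> a \<le> b \<and> b \<le> t \<and> B \<in> sets borel}
      \<union> {N \<in> sets M. emeasure M N = 0})"

text \<open>Simple predictable processes, represented by lists of (X, a, b, c, d) meaning
  X(\<omega>) 1_{(a,b]}(s) 1_{(c,d]}(y).\<close>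
type_synonym 'a sp = "(('a \<Rightarrow> real) \<times> real \<times> real \<times> real \<times> real) list"

definition sp_valid :: "'a measure \<Rightarrow> ((real \<times> real \<Rightarrow> real) \<Rightarrow> 'a \<Rightarrow> real) \<Rightarrow> 'a sp \<Rightarrow> bool" where
  "sp_valid M \<xi> R \<longleftrightarrow> (\<forall>(X, a, b, c, d) \<in> set R. 0 \<le> a \<and> a < b \<and> c < d
      \<and> X \<in> borel_measurable (nat_filt M \<xi> a) \<and> (\<exists>B. \<forall>\<omega>\<in>space M. \<bar>X \<omega>\<bar> \<le> B))"

definition sp_fun :: "'a sp \<Rightarrow> real \<times> real \<Rightarrow> 'a \<Rightarrow> real" where
  "sp_fun R z \<omega> = sum_list (map (\<lambda>(X, a, b, c, d). X \<omega> * indicator (rect a b c d) z) R)"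

definition sp_int :: "((real \<times> real \<Rightarrow> real) \<Rightarrow> 'a \<Rightarrow> real) \<Rightarrow> 'a sp \<Rightarrow> 'a \<Rightarrow> real" where
  "sp_int \<xi> R \<omega> = sum_list (map (\<lambda>(X, a, b, c, d). X \<omega> * \<xi> (indicator (rect a b c d)) \<omega>) R)"

definition walsh_integral :: "'a measure \<Rightarrow> ((real \<times> real \<Rightarrow> real) \<Rightarrow> 'a \<Rightarrow> real)
    \<Rightarrow> (real \<times> real \<Rightarrow> 'a \<Rightarrow> real) \<Rightarrow> ('a \<Rightarrow> real) \<Rightarrow> bool" where
  "walsh_integral M \<xi> H I \<longleftrightarrow>
     (\<lambda>(z, \<omega>). H z \<omega>) \<in> borel_measurable (lborel \<Otimes>\<^sub>M M) \<and> I \<in> borel_measurable M \<and>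
     (\<exists>R :: nat \<Rightarrow> 'a sp. (\<forall>k. sp_valid M \<xi> (R k)) \<and>
        (\<lambda>k. \<integral>\<^sup>+ (z, \<omega>). ennreal ((sp_fun (R k) z \<omega> - H z \<omega>)\<^sup>2) \<partial>(lborel \<Otimes>\<^sub>M M)) \<longlonglongrightarrow> 0 \<and>
        (\<lambda>k. \<integral>\<^sup>+ \<omega>. ennreal ((sp_int \<xi> (R k) \<omega> - I \<omega>)\<^sup>2) \<partial>M) \<longlonglongrightarrow> 0)"

definition waveG :: "real \<Rightarrow> real \<Rightarrow> real" where
  "waveG t x = (if \<bar>x\<bar> < t then 1/2 else 0)"

text \<open>Mild solution for t \<ge> 0 of  u_tt - u_xx = F(u) \<xi>, (u, u_t)(0) = (u0, u1);
  the term \<partial>_t \<integral>G(t,x-y)u0(y)dy is written out as (u0(x+t)+u0(x-t))/2.\<close>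
definition mild_solution_fwd :: "'a measure \<Rightarrow> ((real \<times> real \<Rightarrow> real) \<Rightarrow> 'a \<Rightarrow> real)
    \<Rightarrow> (real \<Rightarrow> real) \<Rightarrow> (real \<Rightarrow> real) \<Rightarrow> (real \<Rightarrow> real) \<Rightarrow> (real \<Rightarrow> real \<Rightarrow> 'a \<Rightarrow> real) \<Rightarrow> bool" where
  "mild_solution_fwd M \<xi> F u0 u1 v \<longleftrightarrow>
     (\<forall>t\<ge>0. \<forall>x. v t x \<in> borel_measurable M \<and>
        (\<exists>I. walsh_integral M \<xi>
               (\<lambda>(s, y) \<omega>. indicator {0<..t} s * waveG (t - s) (x - y) * F (v s y \<omega>)) I
           \<and> (AE \<omega> in M. v t x \<omega> = (u0 (x + t) + u0 (x - t)) / 2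
                 + integral {x - t..x + t} u1 / 2 + I \<omega>)))"

text \<open>Solution on all of R^2: forward in time for t \<ge> 0 with noise \<xi>; for negative
  times, by time reversal, u(-t,x) solves the equation driven by the reflected
  noise with data (u0, -u1).\<close>
definition wave_solution :: "'a measure \<Rightarrow> ((real \<times> real \<Rightarrow> real) \<Rightarrow> 'a \<Rightarrow> real)
    \<Rightarrow> (real \<Rightarrow> real) \<Rightarrow> (real \<Rightarrow> real) \<Rightarrow> (real \<Rightarrow> real) \<Rightarrow> (real \<Rightarrow> real \<Rightarrow> 'a \<Rightarrow> real) \<Rightarrow> bool" where
  "wave_solution M \<xi> F u0 u1 u \<longleftrightarrow>
     mild_solution_fwd M \<xi> F u0 u1 u \<and>
     mild_solution_fwd M (reflect_noise \<xi>) F u0 (\<lambda>x. - u1 x) (\<lambda>t x. u (- t) x)"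

definition C1b :: "(real \<Rightarrow> real) \<Rightarrow> bool" where
  "C1b f \<longleftrightarrow> (\<exists>f'. (\<forall>x. (f has_real_derivative f' x) (at x)) \<and> continuous_on UNIV f'
               \<and> bounded (range f) \<and> bounded (range f'))"

definition Cb :: "(real \<Rightarrow> real) \<Rightarrow> bool" where
  "Cb f \<longleftrightarrow> continuous_on UNIV f \<and> bounded (range f)"

definition delta1 :: "real \<Rightarrow> (real \<Rightarrow> real \<Rightarrow> real) \<Rightarrow> real \<Rightarrow> real \<Rightarrow> real" where
  "delta1 \<epsilon> f t x = f t (x + 2*\<epsilon>) - f (t - \<epsilon>) (x + \<epsilon>) - f (t + \<epsilon>) (x + \<epsilon>) + f t x"

definition delta2 :: "real \<Rightarrow> (real \<Rightarrow> real \<Rightarrow> real) \<Rightarrow> real \<Rightarrow> real \<Rightarrow> real" where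
  "delta2 \<epsilon> f t x = f (t + 2*\<epsilon>) x - f (t + \<epsilon>) (x - \<epsilon>) - f (t + \<epsilon>) (x + \<epsilon>) + f t x"

definition lp_norm :: "'a measure \<Rightarrow> real \<Rightarrow> ('a \<Rightarrow> real) \<Rightarrow> real" where
  "lp_norm M p X = (\<integral>\<omega>. \<bar>X \<omega>\<bar> powr p \<partial>M) powr (1 / p)"

end

theory Submission
  imports Defs
begin

text \<open>
  For a simple predictable process the rectangles generate disjoint atoms; ordered by starting
  time, each atom adds a product of an adapted coefficient and an independent Gaussian variable to
  the stochastic integral. A one-step Taylor estimate and a discrete Gronwall argument bound
  \<open>E \<phi>(I)\<close> by the space-time average of \<open>E \<phi>(sqrt A * H)\<close>, where \<open>A\<close> bounds the area of the support
  of \<open>H\<close> and \<open>\<phi>\<close> is \<open>x ^ (2 * q + 2)\<close> with growth cut to quadratic beyond a level \<open>L\<close>. The constant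
  does not depend on \<open>L\<close>. The cut is what allows one to start from a mild solution that is merely
  square integrable: the truncated moments are finite, a weighted supremum over a backward cone
  absorbs the stochastic term uniformly in \<open>L\<close>, and letting \<open>L\<close> tend to infinity shows that all
  moments are locally bounded. Hoelder continuity of order 1/2 of \<open>u\<close> in every \<open>L ^ p\<close> follows from
  the same bound.

  Both increments are stochastic integrals over a space-time diamond of area of order
  \<open>\<epsilon> ^ 2\<close>. Freezing the integrand at the bottom vertex, where it is adapted, costs
  \<open>\<epsilon> ^ (1 / 2) * (\<epsilon> ^ 2) ^ (1 / 2)\<close>. Replacing the bottom vertex by \<open>(t, x)\<close> costs the same, by
  Hoelder's inequality. Negative times are handled by reflecting the noise.
\<close>

section \<open>Powers truncated to quadratic growth\<close>

text \<open>The definition of the integral offers only mean-square limits of simple processes, so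
  every estimate is proved for simple processes and must survive such a limit. A function of
  quadratic growth does: an error that is small in mean square costs a factor \<open>L ^ q\<close>,
  and it disappears in the limit before \<open>L\<close> is moved. Independence is taken from
  orthogonality of test functions rather than from the order of time: an atom may reach beyond the
  starting time of a later one, so partial sums of the integral need not be adapted, but they depend
  only on noise orthogonal to the next atom. Powers are even throughout, \<open>2 * q + 2\<close>,
  so that they are polynomials with explicit Gaussian moments; a general \<open>p\<close> is
  recovered at the end. In the unit \<open>\<epsilon> ^ (q + 1)\<close> the order
  \<open>2 * q + 2\<close> turns an area of order \<open>\<epsilon> ^ 2\<close> into the square of
  the unit and a Hoelder error into its first power, whence the cube in all increment
  bounds.\<close>

definition trunc_pow :: "nat \<Rightarrow> real \<Rightarrow> real \<Rightarrow> real" where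
  "trunc_pow q L x = x\<^sup>2 * (min (x\<^sup>2) L) ^ q"

text \<open>The derivative of \<open>trunc_pow\<close> away from the kink
  \<open>m\<^sup>2 = L\<close>; at the kink it is the derivative from the outer side.\<close>

definition trunc_pow_slope :: "nat \<Rightarrow> real \<Rightarrow> real \<Rightarrow> real" where
  "trunc_pow_slope q L m =
     (if m\<^sup>2 < L then real (2 * q + 2) * m ^ (2 * q + 1) else 2 * L ^ q * m)"

lemma borel_measurable_trunc_pow [measurable]: "trunc_pow q L \<in> borel_measurable borel"
  unfolding trunc_pow_def by measurable

lemma borel_measurable_trunc_pow_slope [measurable]:
  "trunc_pow_slope q L \<in> borel_measurable borel"
  unfolding trunc_pow_slope_def by measurable

lemma trunc_pow_nonneg: "0 \<le> L \<Longrightarrow> 0 \<le> trunc_pow q L x"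
  by (simp add: trunc_pow_def)

lemma trunc_pow_0 [simp]: "trunc_pow q L 0 = 0"
  by (simp add: trunc_pow_def)

lemma trunc_pow_zero_exponent: "trunc_pow 0 L x = x\<^sup>2"
  by (simp add: trunc_pow_def)

lemma trunc_pow_le_square: "0 \<le> L \<Longrightarrow> trunc_pow q L x \<le> L ^ q * x\<^sup>2"
  unfolding trunc_pow_def by (subst mult.commute) (intro mult_right_mono power_mono, auto)

lemma trunc_pow_le_power: "0 \<le> L \<Longrightarrow> trunc_pow q L x \<le> x ^ (2 * q + 2)"
proof -
  assume "0 \<le> L"
  have "trunc_pow q L x \<le> x\<^sup>2 * (x\<^sup>2) ^ q"
    unfolding trunc_pow_def using \<open>0 \<le> L\<close> by (intro mult_left_mono power_mono) auto
  also have "\<dots> = x ^ (2 * q + 2)"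
    by (simp add: power_mult [symmetric] power_add [symmetric] algebra_simps)
  finally show ?thesis .
qed

lemma trunc_pow_eq_power: "x\<^sup>2 \<le> L \<Longrightarrow> trunc_pow q L x = x ^ (2 * q + 2)"
  by (simp add: trunc_pow_def power_mult [symmetric] power_add [symmetric] algebra_simps min_def)

lemma trunc_pow_mono: 
  assumes "0 \<le> L" "x\<^sup>2 \<le> y\<^sup>2" shows "trunc_pow q L x \<le> trunc_pow q L y"
  unfolding trunc_pow_def using assms
  by (intro mult_mono[OF assms(2)] power_mono) auto

lemma trunc_pow_cross:
  assumes "0 \<le> L"
  shows "x\<^sup>2 * (min (y\<^sup>2) L) ^ q \<le> trunc_pow q L x + trunc_pow q L y"
proof (cases "x\<^sup>2 \<le> y\<^sup>2")
  case True
  then have "x\<^sup>2 * (min (y\<^sup>2) L) ^ q \<le> trunc_pow q L y"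
    unfolding trunc_pow_def using assms by (intro mult_right_mono) auto
  then show ?thesis using trunc_pow_nonneg[OF assms, of q x] by simp
next
  case False
  then have "x\<^sup>2 * (min (y\<^sup>2) L) ^ q \<le> trunc_pow q L x"
    unfolding trunc_pow_def using assms by (intro mult_left_mono power_mono) auto
  then show ?thesis using trunc_pow_nonneg[OF assms, of q y] by simp
qed

text \<open>Cutting is almost homogeneous: \<open>min ((a * b)\<^sup>2) L\<close> is at most
  \<open>max 1 (b\<^sup>2)\<close> times \<open>min (a\<^sup>2) L\<close>. The factor
  \<open>b\<close> leaves the truncated power as a polynomial free of \<open>L\<close>; it will be a
  Gaussian variable.\<close>

lemma trunc_pow_mult:
  assumes "0 \<le> L"
  shows "trunc_pow q L (a * b) \<le> trunc_pow q L a * (b\<^sup>2 + b ^ (2 * q + 2))"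
proof -
  have 1: "min ((a * b)\<^sup>2) L \<le> max 1 (b\<^sup>2) * min (a\<^sup>2) L"
  proof (cases "a\<^sup>2 \<le> L")
    case True
    have "min ((a * b)\<^sup>2) L \<le> b\<^sup>2 * a\<^sup>2" by (simp add: power_mult_distrib mult.commute)
    also have "\<dots> \<le> max 1 (b\<^sup>2) * a\<^sup>2" by (intro mult_right_mono) auto
    finally show ?thesis using True by (simp add: min_def)
  next
    case False
    have "1 * L \<le> max 1 (b\<^sup>2) * L" using assms by (intro mult_right_mono) auto
    then show ?thesis using False by (simp add: min_def)
  qed
  have 2: "max 1 (b\<^sup>2) ^ q \<le> 1 + b ^ (2 * q)"
    by (cases "b\<^sup>2 \<le> 1") (auto simp: max_def power_mult)
  have "trunc_pow q L (a * b) \<le> (a * b)\<^sup>2 * (max 1 (b\<^sup>2) * min (a\<^sup>2) L) ^ q"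
    unfolding trunc_pow_def using assms by (intro mult_left_mono power_mono 1) auto
  also have "\<dots> = (a\<^sup>2 * (min (a\<^sup>2) L) ^ q * b\<^sup>2) * max 1 (b\<^sup>2) ^ q"
    by (simp add: power_mult_distrib)
  also have "\<dots> \<le> (a\<^sup>2 * (min (a\<^sup>2) L) ^ q * b\<^sup>2) * (1 + b ^ (2 * q))"
    using assms by (intro mult_left_mono 2) auto
  also have "\<dots> = trunc_pow q L a * (b\<^sup>2 + b ^ (2 * q + 2))"
    by (simp add: trunc_pow_def algebra_simps power2_eq_square)
  finally show ?thesis .
qed

text \<open>Both arguments are replaced by the one of larger modulus, so that only doubling has to
  be controlled. The constant is independent of \<open>L\<close>.\<close>

lemma trunc_pow_add:
  assumes "0 \<le> L"
  shows "trunc_pow q L (x + y) \<le> 2 * 4 ^ (q + 1) * (trunc_pow q L x + trunc_pow q L y)"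
proof -
  define z where "z = max \<bar>x\<bar> \<bar>y\<bar>"
  have "\<bar>x + y\<bar> \<le> \<bar>z * 2\<bar>" unfolding z_def by linarith
  then have "(x + y)\<^sup>2 \<le> (z * 2)\<^sup>2" by (simp only: abs_le_square_iff)
  then have "trunc_pow q L (x + y) \<le> trunc_pow q L (z * 2)"
    by (rule trunc_pow_mono[OF assms])
  also have "\<dots> \<le> trunc_pow q L z * (2\<^sup>2 + 2 ^ (2 * q + 2))"
    by (rule trunc_pow_mult[OF assms])
  also have "\<dots> \<le> trunc_pow q L z * (2 * 4 ^ (q + 1))"
    using trunc_pow_nonneg[OF assms] by (intro mult_left_mono) (auto simp: power_mult)
  also have "trunc_pow q L z \<le> trunc_pow q L x + trunc_pow q L y"
    using trunc_pow_nonneg[OF assms, of q x] trunc_pow_nonneg[OF assms, of q y]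
    unfolding z_def by (auto simp: max_def trunc_pow_def)
  finally show ?thesis by (simp add: mult.commute)
qed

lemma power_times_power_le:
  fixes a b :: real
  assumes "0 \<le> a" "0 \<le> b"
  shows "a ^ i * b ^ j \<le> a ^ (i + j) + b ^ (i + j)"
proof (cases "a \<le> b")
  case True
  then have "a ^ i * b ^ j \<le> b ^ i * b ^ j" using assms by (intro mult_right_mono power_mono) auto
  then show ?thesis using assms by (simp add: power_add add_increasing)
next
  case False
  then have "a ^ i * b ^ j \<le> a ^ i * a ^ j" using assms by (intro mult_left_mono power_mono) auto
  then show ?thesis using assms by (simp add: power_add add_increasing2)
qed

text \<open>In the binomial expansion each term from the second order on contains
  \<open>h\<^sup>2\<close> and a monomial of degree \<open>2 * q\<close> in \<open>m\<close> and
  \<open>h\<close>; the binomial coefficients add up to at most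
  \<open>2 ^ (2 * q + 2)\<close>.\<close>

lemma even_power_taylor:
  fixes m h :: real
  shows "(m + h) ^ (2 * q + 2) \<le> m ^ (2 * q + 2) + real (2 * q + 2) * m ^ (2 * q + 1) * h
     + 2 ^ (2 * q + 2) * h\<^sup>2 * (m ^ (2 * q) + h ^ (2 * q))"
proof -
  let ?N = "2 * q + 2"
  let ?t = "\<lambda>k. real (?N choose k) * h ^ k * m ^ (?N - k)"
  have expand: "(m + h) ^ ?N = ?t 0 + ?t 1 + (\<Sum>k=2..?N. ?t k)"
  proof -
    have "(m + h) ^ ?N = (\<Sum>k\<le>?N. ?t k)"
      by (subst add.commute) (rule binomial_ring)
    moreover have "{..?N} = {0, 1} \<union> {2..?N}" by auto
    moreover have "(\<Sum>k\<in>{0,1} \<union> {2..?N}. ?t k) = ?t 0 + ?t 1 + (\<Sum>k=2..?N. ?t k)"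
      by (subst sum.union_disjoint) auto
    ultimately show ?thesis by (simp only:)
  qed
  define e where "e = h\<^sup>2 * (m ^ (2 * q) + h ^ (2 * q))"
  have e: "0 \<le> e" by (simp add: e_def power_mult)
  have term_le: "?t k \<le> real (?N choose k) * e" if k: "k \<in> {2..?N}" for k
  proof -
    have "2 + (k - 2) = k" using k by auto
    then have "\<bar>h\<bar> ^ k = \<bar>h\<bar>\<^sup>2 * \<bar>h\<bar> ^ (k - 2)" by (metis power_add)
    then have "\<bar>h ^ k * m ^ (?N - k)\<bar> = h\<^sup>2 * (\<bar>h\<bar> ^ (k - 2) * \<bar>m\<bar> ^ (?N - k))"
      by (simp add: abs_mult power_abs)
    moreover have "h\<^sup>2 * (\<bar>h\<bar> ^ (k - 2) * \<bar>m\<bar> ^ (?N - k))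
        \<le> h\<^sup>2 * (\<bar>h\<bar> ^ (k - 2 + (?N - k)) + \<bar>m\<bar> ^ (k - 2 + (?N - k)))"
      by (intro mult_left_mono power_times_power_le) auto
    moreover have "k - 2 + (?N - k) = 2 * q" using k by auto
    moreover have "h\<^sup>2 * (\<bar>h\<bar> ^ (2 * q) + \<bar>m\<bar> ^ (2 * q)) = e"
      by (simp add: e_def power_mult add.commute)
    ultimately have "h ^ k * m ^ (?N - k) \<le> e" by (metis abs_ge_self order_trans)
    then show ?thesis by (simp only: mult.assoc) (intro mult_left_mono, auto)
  qed
  have "(\<Sum>k=2..?N. ?t k) \<le> (\<Sum>k=2..?N. real (?N choose k) * e)"
    by (intro sum_mono term_le)
  moreover have "(\<Sum>k=2..?N. real (?N choose k) * e) = (\<Sum>k=2..?N. real (?N choose k)) * e"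
    by (rule sum_distrib_right [symmetric])
  moreover have "(\<Sum>k=2..?N. real (?N choose k)) * e \<le> 2 ^ ?N * e"
  proof (rule mult_right_mono[OF _ e])
    have "(\<Sum>k=2..?N. real (?N choose k)) \<le> (\<Sum>k\<le>?N. real (?N choose k))"
      by (intro sum_mono2) auto
    moreover have "(\<Sum>k\<le>?N. real (?N choose k)) = real (\<Sum>k\<le>?N. ?N choose k)"
      by (rule of_nat_sum [symmetric])
    moreover have "real (\<Sum>k\<le>?N. ?N choose k) = 2 ^ ?N"
      by (simp only: choose_row_sum of_nat_power of_nat_numeral)
    ultimately show "(\<Sum>k=2..?N. real (?N choose k)) \<le> 2 ^ ?N" by linarith
  qed
  ultimately have "(\<Sum>k=2..?N. ?t k) \<le> 2 ^ ?N * e" by linarith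
  then have "(m + h) ^ ?N \<le> ?t 0 + ?t 1 + 2 ^ ?N * e" using expand by linarith
  moreover have "?t 0 = m ^ ?N" by simp
  moreover have "?t 1 = real ?N * m ^ (2 * q + 1) * h"
  proof -
    have "?N - 1 = 2 * q + 1" by simp
    then show ?thesis by (simp only: choose_one power_one_right) (simp only: mult_ac)
  qed
  moreover have "2 ^ ?N * e = 2 ^ ?N * h\<^sup>2 * (m ^ (2 * q) + h ^ (2 * q))"
    unfolding e_def by (rule mult.assoc [symmetric])
  ultimately show ?thesis by (simp only:)
qed

definition trunc_pow_const :: "nat \<Rightarrow> real" where
  "trunc_pow_const q = 2 ^ (2 * q + 2) + real (2 * q + 2) + 4"

text \<open>The kink of \<^const>\<open>trunc_pow\<close> at \<open>x\<^sup>2 = L\<close> is concave, so a second order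
  upper Taylor bound survives although the function is not differentiable there.\<close>

lemma trunc_pow_taylor:
  assumes L: "0 \<le> L"
  shows "trunc_pow q L (m + h) \<le> trunc_pow q L m + trunc_pow_slope q L m * h
    + trunc_pow_const q * h\<^sup>2 * ((min (m\<^sup>2) L) ^ q + (min (h\<^sup>2) L) ^ q)"
proof -
  let ?P = "(min (m\<^sup>2) L) ^ q + (min (h\<^sup>2) L) ^ q"
  have P: "0 \<le> h\<^sup>2 * ?P" using L by auto
  have C: "2 ^ (2 * q + 2) \<le> trunc_pow_const q" "real (2 * q + 2) + 4 \<le> trunc_pow_const q"
    "1 \<le> trunc_pow_const q"
    by (auto simp: trunc_pow_const_def)
  consider "m\<^sup>2 < L" "h\<^sup>2 \<le> L" | "m\<^sup>2 < L" "L < h\<^sup>2" | "L \<le> m\<^sup>2" by linarith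
  \<comment> \<open>Below the kink with a moderate \<open>h\<close> the Taylor bound for the pure
    power applies. With \<open>m\<close> below the kink and \<open>h\<^sup>2\<close> above
    \<open>L\<close>, the value and the linear term, whose sign is not known, are both at most of
    the size \<open>L ^ q * h\<^sup>2\<close>. From the kink on, the parabola
    \<open>L ^ q * x\<^sup>2\<close> lies above \<open>trunc_pow\<close> and agrees with it at
    \<open>m\<close>.\<close>
  then show ?thesis
  proof cases
    case 1
    have "trunc_pow q L (m + h) \<le> (m + h) ^ (2 * q + 2)" by (rule trunc_pow_le_power[OF L])
    also have "\<dots> \<le> m ^ (2 * q + 2) + real (2 * q + 2) * m ^ (2 * q + 1) * h
       + 2 ^ (2 * q + 2) * h\<^sup>2 * (m ^ (2 * q) + h ^ (2 * q))" by (rule even_power_taylor)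
    also have "\<dots> = trunc_pow q L m + trunc_pow_slope q L m * h + 2 ^ (2 * q + 2) * (h\<^sup>2 * ?P)"
      using 1 by (simp add: trunc_pow_eq_power trunc_pow_slope_def min_def power_mult)
    also have "2 ^ (2 * q + 2) * (h\<^sup>2 * ?P) \<le> trunc_pow_const q * (h\<^sup>2 * ?P)"
      using C P by (intro mult_right_mono) auto
    finally show ?thesis by (simp add: mult.assoc)
  next
    case 2
    have mh: "\<bar>m\<bar> \<le> \<bar>h\<bar>" using 2 by (meson abs_le_square_iff less_imp_le order_trans)
    have "\<bar>m + h\<bar> \<le> \<bar>2 * h\<bar>" using mh by linarith
    then have "(m + h)\<^sup>2 \<le> (2 * h)\<^sup>2" by (simp only: abs_le_square_iff)
    then have "trunc_pow q L (m + h) \<le> L ^ q * (2 * h)\<^sup>2"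
      using trunc_pow_le_square[OF L, of q "m + h"] L
      by (smt (verit, best) mult_left_mono zero_le_power)
    then have a: "trunc_pow q L (m + h) \<le> 4 * (L ^ q * h\<^sup>2)" by (simp add: power_mult_distrib)
    have "- (trunc_pow_slope q L m * h) \<le> \<bar>trunc_pow_slope q L m * h\<bar>" by simp
    also have "\<dots> = real (2 * q + 2) * ((m\<^sup>2) ^ q * (\<bar>m\<bar> * \<bar>h\<bar>))"
      using 2 by (simp add: trunc_pow_slope_def abs_mult power_abs power_mult [symmetric])
        (simp add: power_mult)
    also have "\<dots> \<le> real (2 * q + 2) * (L ^ q * (\<bar>h\<bar> * \<bar>h\<bar>))"
      using 2 mh L by (intro mult_left_mono mult_mono power_mono) auto
    finally have b: "- (trunc_pow_slope q L m * h) \<le> real (2 * q + 2) * (L ^ q * h\<^sup>2)"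
      by (simp add: power2_eq_square abs_mult_self_eq)
    have "L ^ q * h\<^sup>2 \<le> h\<^sup>2 * ?P" using 2 L by (simp add: min_def distrib_left mult.commute)
    moreover have "0 \<le> trunc_pow_const q" using C(3) by linarith
    moreover have "0 \<le> L ^ q * h\<^sup>2" using L by simp
    ultimately
    have "(real (2 * q + 2) + 4) * (L ^ q * h\<^sup>2) \<le> trunc_pow_const q * (h\<^sup>2 * ?P)"
      by (rule mult_mono[OF C(2)])
    then have "trunc_pow q L (m + h) \<le> trunc_pow_slope q L m * h + trunc_pow_const q * (h\<^sup>2 * ?P)"
      using a b by (simp only: distrib_right)
    then show ?thesis using trunc_pow_nonneg[OF L, of q m] by (simp add: mult.assoc)
  next
    case 3
    have "trunc_pow q L (m + h) \<le> L ^ q * (m + h)\<^sup>2" by (rule trunc_pow_le_square[OF L])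
    also have "\<dots> = trunc_pow q L m + trunc_pow_slope q L m * h + 1 * (L ^ q * h\<^sup>2)"
      using 3 by (simp add: trunc_pow_def trunc_pow_slope_def power2_eq_square algebra_simps)
    also have "1 * (L ^ q * h\<^sup>2) \<le> trunc_pow_const q * (h\<^sup>2 * ?P)"
    proof (rule mult_mono[OF C(3)])
      show "L ^ q * h\<^sup>2 \<le> h\<^sup>2 * ?P"
        using 3 L by (simp add: min_def distrib_left mult.commute)
      show "0 \<le> trunc_pow_const q" using C(3) by linarith
      show "0 \<le> L ^ q * h\<^sup>2" using L by simp
    qed
    finally show ?thesis by (simp add: mult.assoc)
  qed
qed

text \<open>Linear growth makes the slope at a square integrable variable integrable. Only
  integrability is drawn from this, so the factor \<open>L ^ q\<close> does no harm.\<close>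

lemma trunc_pow_slope_bound:
  assumes L: "0 \<le> L"
  shows "\<bar>trunc_pow_slope q L m\<bar> \<le> real (2 * q + 2) * L ^ q * \<bar>m\<bar>"
proof (cases "m\<^sup>2 < L")
  case True
  have "\<bar>trunc_pow_slope q L m\<bar> = real (2 * q + 2) * ((m\<^sup>2) ^ q * \<bar>m\<bar>)"
    using True by (simp add: trunc_pow_slope_def abs_mult power_abs power_mult [symmetric])
      (simp add: power_mult)
  also have "\<dots> \<le> real (2 * q + 2) * (L ^ q * \<bar>m\<bar>)"
    using True by (intro mult_left_mono mult_right_mono power_mono) auto
  finally show ?thesis by simp
next
  case False
  have "2 * (L ^ q * \<bar>m\<bar>) \<le> real (2 * q + 2) * (L ^ q * \<bar>m\<bar>)"
    using L by (intro mult_right_mono) auto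
  with False show ?thesis using L by (simp add: trunc_pow_slope_def abs_mult mult.assoc)
qed

section \<open>Gaussian noise and independence\<close>

lemma (in prob_space) integrable_bounded:
  fixes f :: "'a \<Rightarrow> 'b :: {banach, second_countable_topology}"
  assumes "f \<in> borel_measurable M" "\<And>\<omega>. \<omega> \<in> space M \<Longrightarrow> norm (f \<omega>) \<le> B"
  shows "integrable M f"
  by (rule integrable_const_bound[where B = B]) (use assms in auto)

text \<open>A small multiple of \<open>w\<close> added to 1 is a probability density: the hypothesis
  at \<open>t = 0\<close> says that \<open>w\<close> has mean 0. Under this density \<open>X\<close>
  keeps its characteristic function, hence its law by Levy's uniqueness theorem. The difference of
  the two probabilities of \<open>B\<close> is the integral in question divided by
  \<open>c\<close>.\<close>

lemma (in prob_space) weight_char_zero_real: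
  fixes w X :: "'a \<Rightarrow> real"
  assumes [measurable]: "w \<in> borel_measurable M" "X \<in> borel_measurable M" "B \<in> sets borel"
    and bd: "\<And>\<omega>. \<omega> \<in> space M \<Longrightarrow> \<bar>w \<omega>\<bar> \<le> C"
    and zero: "\<And>t. (\<integral>\<omega>. of_real (w \<omega>) * iexp (t * X \<omega>) \<partial>M) = 0"
  shows "(\<integral>\<omega>. w \<omega> * indicator B (X \<omega>) \<partial>M) = 0"
proof -
  \<comment> \<open>Larger than the bound on \<open>w\<close>, so that the density \<open>g\<close>
    is nonnegative, and positive in every case.\<close>
  define c where "c = \<bar>C\<bar> + 1"
  have c: "c > 0" by (simp add: c_def)
  define g where "g \<omega> = 1 + w \<omega> / c" for \<omega>
  have g_meas [measurable]: "g \<in> borel_measurable M" unfolding g_def by measurable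
  have g0: "0 \<le> g \<omega>" if "\<omega> \<in> space M" for \<omega>
  proof -
    have "- w \<omega> \<le> c" using bd[OF that] unfolding c_def by linarith
    then have "- w \<omega> / c \<le> 1" using c by (simp add: field_simps)
    then show ?thesis unfolding g_def by simp
  qed
  have int_w: "integrable M w" by (rule integrable_bounded[where B = C]) (use bd in auto)
  have int_wX: "complex_integrable M (\<lambda>\<omega>. of_real (w \<omega>) * iexp (t * X \<omega>))" for t
    by (rule integrable_bounded[where B = C]) (use bd in \<open>auto simp: norm_mult\<close>)
  have int_X: "complex_integrable M (\<lambda>\<omega>. iexp (t * X \<omega>))" for t
    by (rule integrable_bounded[where B = 1]) auto
  have w0: "(\<integral>\<omega>. w \<omega> \<partial>M) = 0"
    using zero[of 0] by simp
  have gint: "integrable M g" unfolding g_def using int_w by auto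
  have g1: "(\<integral>\<omega>. g \<omega> \<partial>M) = 1"
    unfolding g_def using int_w w0 by (simp add: prob_space)
  have AEg: "AE \<omega> in M. 0 \<le> g \<omega>" using g0 by auto
  let ?N = "density M g"
  have "emeasure ?N (space ?N) = (\<integral>\<^sup>+\<omega>. ennreal (g \<omega>) \<partial>M)"
    by (subst emeasure_density) (auto intro!: nn_integral_cong)
  also have "\<dots> = 1" using g1 by (subst nn_integral_eq_integral[OF gint AEg]) simp
  finally interpret N: prob_space ?N by (rule prob_spaceI)
  have [measurable]: "X \<in> borel_measurable ?N" by simp
  have r1: "real_distribution (distr M borel X)"
    by (rule real_distribution_distr) measurable
  have r2: "real_distribution (distr ?N borel X)"
    by (rule N.real_distribution_distr) measurable
  have "char (distr M borel X) = char (distr ?N borel X)"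
  proof
    fix t
    have "char (distr ?N borel X) t = (\<integral>\<omega>. iexp (t * X \<omega>) \<partial>?N)"
      unfolding char_def by (subst integral_distr) auto
    also have "\<dots> = (\<integral>\<omega>. g \<omega> *\<^sub>R iexp (t * X \<omega>) \<partial>M)"
      by (rule integral_density) (use AEg in auto)
    also have "\<dots> = (\<integral>\<omega>. iexp (t * X \<omega>) + (of_real (w \<omega>) * iexp (t * X \<omega>)) / of_real c \<partial>M)"
      by (simp add: g_def scaleR_conv_of_real algebra_simps)
    also have "\<dots> = (\<integral>\<omega>. iexp (t * X \<omega>) \<partial>M) + (\<integral>\<omega>. of_real (w \<omega>) * iexp (t * X \<omega>) \<partial>M) / of_real c"
      using int_X int_wX by simp
    also have "\<dots> = char (distr M borel X) t"
      unfolding char_def zero by (subst integral_distr) auto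
    finally show "char (distr M borel X) t = char (distr ?N borel X) t" by simp
  qed
  with r1 r2 have "distr M borel X = distr ?N borel X" by (rule Levy_uniqueness)
  then have "measure (distr M borel X) B = measure (distr ?N borel X) B" by simp
  then have eq: "measure M (X -` B \<inter> space M) = measure ?N (X -` B \<inter> space M)"
    by (simp add: measure_distr)
  have sB [measurable]: "X -` B \<inter> space M \<in> sets M" by measurable
  have "measure ?N (X -` B \<inter> space M) = (\<integral>\<omega>. indicator (X -` B \<inter> space M) \<omega> \<partial>?N)"
    by simp
  also have "\<dots> = (\<integral>\<omega>. g \<omega> *\<^sub>R indicator (X -` B \<inter> space M) \<omega> \<partial>M)"
    by (rule integral_density) (use AEg in auto)
  also have "\<dots> = (\<integral>\<omega>. indicator (X -` B \<inter> space M) \<omega> + (w \<omega> * indicator B (X \<omega>)) / c \<partial>M)"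
    by (rule Bochner_Integration.integral_cong) (auto simp: g_def indicator_def)
  also have "\<dots> = measure M (X -` B \<inter> space M) + (\<integral>\<omega>. w \<omega> * indicator B (X \<omega>) \<partial>M) / c"
  proof -
    have "integrable M (\<lambda>\<omega>. w \<omega> * indicator B (X \<omega>))"
      by (rule integrable_bounded[where B = "\<bar>C\<bar>"]) (use bd in \<open>force simp: indicator_def\<close>)+
    moreover have "integrable M (indicat_real (X -` B \<inter> space M))"
      by (rule integrable_bounded[where B = 1]) (auto simp: indicator_def)
    ultimately show ?thesis by simp
  qed
  finally show ?thesis using eq c by simp
qed

text \<open>Conjugation turns \<open>t\<close> into \<open>- t\<close>, so the conjugate of
  \<open>w\<close> satisfies the same hypothesis; hence so do the real and the imaginary part, to
  which the real case applies.\<close>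

lemma (in prob_space) weight_char_zero:
  fixes w :: "'a \<Rightarrow> complex" and X :: "'a \<Rightarrow> real"
  assumes [measurable]: "w \<in> borel_measurable M" "X \<in> borel_measurable M" "B \<in> sets borel"
    and bd: "\<And>\<omega>. \<omega> \<in> space M \<Longrightarrow> norm (w \<omega>) \<le> C"
    and zero: "\<And>t. (\<integral>\<omega>. w \<omega> * iexp (t * X \<omega>) \<partial>M) = 0"
  shows "(\<integral>\<omega>. w \<omega> * indicator B (X \<omega>) \<partial>M) = 0"
proof -
  have int: "complex_integrable M (\<lambda>\<omega>. w \<omega> * iexp (t * X \<omega>))" for t
    by (rule integrable_bounded[where B = C]) (use bd in \<open>auto simp: norm_mult\<close>)
  have zc: "(\<integral>\<omega>. cnj (w \<omega>) * iexp (t * X \<omega>) \<partial>M) = 0" for t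
  proof -
    have "(\<integral>\<omega>. cnj (w \<omega>) * iexp (t * X \<omega>) \<partial>M) = (\<integral>\<omega>. cnj (w \<omega> * iexp ((- t) * X \<omega>)) \<partial>M)"
      by (intro Bochner_Integration.integral_cong) (auto simp: exp_cnj)
    also have "\<dots> = cnj (\<integral>\<omega>. w \<omega> * iexp ((- t) * X \<omega>) \<partial>M)"
      by (rule integral_bounded_linear[OF bounded_linear_cnj int])
    finally show ?thesis using zero[of "- t"] by simp
  qed
  have [measurable]: "cnj \<in> borel_measurable borel"
    by (intro borel_measurable_continuous_onI continuous_intros)
  have intc: "complex_integrable M (\<lambda>\<omega>. cnj (w \<omega>) * iexp (t * X \<omega>))" for t
    by (rule integrable_bounded[where B = C]) (use bd in \<open>auto simp: norm_mult\<close>)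
  have re: "(\<integral>\<omega>. of_real (Re (w \<omega>)) * iexp (t * X \<omega>) \<partial>M) = 0" for t
  proof -
    have "(\<integral>\<omega>. of_real (Re (w \<omega>)) * iexp (t * X \<omega>) \<partial>M)
      = (\<integral>\<omega>. (w \<omega> * iexp (t * X \<omega>) + cnj (w \<omega>) * iexp (t * X \<omega>)) / 2 \<partial>M)"
      by (intro Bochner_Integration.integral_cong)
        (auto simp: distrib_right [symmetric] complex_add_cnj)
    also have "\<dots> = 0" using zero zc int intc by simp
    finally show ?thesis .
  qed
  have Im_eq: "of_real (Im z) * y = (z * y - cnj z * y) / (2 * \<i>)" for z y
  proof -
    have "z * y - cnj z * y = (2 * \<i>) * (of_real (Im z) * y)"
      by (simp add: complex_eq_iff algebra_simps)
    then show ?thesis by simp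
  qed
  have im: "(\<integral>\<omega>. of_real (Im (w \<omega>)) * iexp (t * X \<omega>) \<partial>M) = 0" for t
  proof -
    have "(\<integral>\<omega>. of_real (Im (w \<omega>)) * iexp (t * X \<omega>) \<partial>M)
      = (\<integral>\<omega>. (w \<omega> * iexp (t * X \<omega>) - cnj (w \<omega>) * iexp (t * X \<omega>)) / (2 * \<i>) \<partial>M)"
      by (simp only: Im_eq)
    also have "\<dots> = 0" using zero zc int intc by simp
    finally show ?thesis .
  qed
  have R: "(\<integral>\<omega>. Re (w \<omega>) * indicator B (X \<omega>) \<partial>M) = 0"
    by (rule weight_char_zero_real[where C = C, OF _ _ _ _ re])
      (use bd in \<open>auto intro: order_trans[OF abs_Re_le_cmod]\<close>)
  have I: "(\<integral>\<omega>. Im (w \<omega>) * indicator B (X \<omega>) \<partial>M) = 0"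
    by (rule weight_char_zero_real[where C = C, OF _ _ _ _ im])
      (use bd in \<open>auto intro: order_trans[OF abs_Im_le_cmod]\<close>)
  have int': "complex_integrable M (\<lambda>\<omega>. w \<omega> * indicator B (X \<omega>))"
    by (rule integrable_bounded[where B = "\<bar>C\<bar>"])
      (use bd in \<open>force simp: norm_mult indicator_def\<close>)+
  show ?thesis
  proof (rule complex_eqI)
    show "Re (\<integral>\<omega>. w \<omega> * indicator B (X \<omega>) \<partial>M) = Re 0"
    proof -
      have "Re (w \<omega> * indicator B (X \<omega>)) = Re (w \<omega>) * indicator B (X \<omega>)" for \<omega>
        by (simp add: indicator_def)
      then have "(\<integral>\<omega>. Re (w \<omega> * indicator B (X \<omega>)) \<partial>M) = 0" using R by simp
      then show ?thesis unfolding integral_Re[OF int'] by simp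
    qed
    show "Im (\<integral>\<omega>. w \<omega> * indicator B (X \<omega>) \<partial>M) = Im 0"
    proof -
      have "Im (w \<omega> * indicator B (X \<omega>)) = Im (w \<omega>) * indicator B (X \<omega>)" for \<omega>
        by (simp add: indicator_def)
      then have "(\<integral>\<omega>. Im (w \<omega> * indicator B (X \<omega>)) \<partial>M) = 0" using I by simp
      then show ?thesis unfolding integral_Im[OF int'] by simp
    qed
  qed
qed

section \<open>Moments, characteristic function and linearity of the noise\<close>

lemma L2funD:
  assumes "L2fun \<phi>"
  shows "\<phi> \<in> borel_measurable borel" "integrable lborel (\<lambda>z. (\<phi> z)\<^sup>2)"
  using assms by (auto simp: L2fun_def)

lemma abs_mult_le_squares: "\<bar>a * b\<bar> \<le> a\<^sup>2 + b\<^sup>2" for a b :: real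
proof -
  have "0 \<le> \<bar>a\<bar> * \<bar>b\<bar>" by simp
  moreover have "2 * (\<bar>a\<bar> * \<bar>b\<bar>) \<le> a\<^sup>2 + b\<^sup>2"
    using sum_squares_bound[of "\<bar>a\<bar>" "\<bar>b\<bar>"] by simp
  ultimately show ?thesis unfolding abs_mult by linarith
qed

lemma L2fun_integrable_mult:
  assumes "L2fun \<phi>" "L2fun \<psi>"
  shows "integrable lborel (\<lambda>z. \<phi> z * \<psi> z)"
proof (rule Bochner_Integration.integrable_bound)
  show "integrable lborel (\<lambda>z. (\<phi> z)\<^sup>2 + (\<psi> z)\<^sup>2)"
    using assms by (auto simp: L2fun_def)
  show "(\<lambda>z. \<phi> z * \<psi> z) \<in> borel_measurable lborel"
    using assms by (auto simp: L2fun_def)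
  show "AE x in lborel. norm (\<phi> x * \<psi> x) \<le> norm ((\<phi> x)\<^sup>2 + (\<psi> x)\<^sup>2)"
    using abs_mult_le_squares by auto
qed

lemma L2fun_scale: "L2fun \<phi> \<Longrightarrow> L2fun (\<lambda>z. a * \<phi> z)"
  by (auto simp: L2fun_def power_mult_distrib)

lemma L2fun_add:
  assumes "L2fun \<phi>" "L2fun \<psi>"
  shows "L2fun (\<lambda>z. \<phi> z + \<psi> z)"
proof -
  have "integrable lborel (\<lambda>z. (\<phi> z)\<^sup>2 + 2 * (\<phi> z * \<psi> z) + (\<psi> z)\<^sup>2)"
    using assms L2fun_integrable_mult[OF assms] by (intro Bochner_Integration.integrable_add) (auto simp: L2fun_def)
  then have "integrable lborel (\<lambda>z. (\<phi> z + \<psi> z)\<^sup>2)"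
    by (simp add: power2_sum algebra_simps)
  then show ?thesis using assms by (auto simp: L2fun_def)
qed

lemma L2fun_indicator:
  assumes "A \<in> sets borel" "emeasure lborel A < \<infinity>"
  shows "L2fun (indicator A)"
proof -
  have "(indicator A z)\<^sup>2 = (indicator A z :: real)" for z :: "real \<times> real" by (auto simp: indicator_def)
  then show ?thesis using assms by (auto simp: L2fun_def)
qed

locale gaussian_noise =
  fixes M :: "'a measure" and \<xi> :: "(real \<times> real \<Rightarrow> real) \<Rightarrow> 'a \<Rightarrow> real"
  assumes white_noise: "white_noise M \<xi>"

sublocale gaussian_noise \<subseteq> prob_space M
  using white_noise unfolding white_noise_def by blast

context gaussian_noise
begin

lemma noise_measurable: "L2fun \<phi> \<Longrightarrow> \<xi> \<phi> \<in> borel_measurable M"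
  using white_noise unfolding white_noise_def by blast

lemma noise_covariance:
  "L2fun \<phi> \<Longrightarrow> L2fun \<psi> \<Longrightarrow> (\<integral>\<omega>. \<xi> \<phi> \<omega> * \<xi> \<psi> \<omega> \<partial>M) = (\<integral>z. \<phi> z * \<psi> z \<partial>lborel)"
  using white_noise unfolding white_noise_def by blast

lemma noise_gaussian:
  assumes "L2fun \<phi>"
  shows "centered_gaussian M (\<xi> \<phi>)"
proof -
  have "centered_gaussian M (\<lambda>\<omega>. \<Sum>i\<in>{0::nat}. 1 * \<xi> \<phi> \<omega>)"
    using white_noise assms unfolding white_noise_def
    by (elim conjE allE[of _ "{0::nat}"] allE[of _ "\<lambda>_. \<phi>"] allE[of _ "\<lambda>_. 1"]) auto
  then show ?thesis by simp
qed

text \<open>Computing the second moment by the density and by the covariance identifies \<sigma>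
  with the norm of \<open>\<phi>\<close>. The degenerate law is a separate case because it has no
  density.\<close>

lemma noise_cases:
  assumes "L2fun \<phi>"
  obtains (density) \<sigma> where "0 < \<sigma>" "distributed M lborel (\<xi> \<phi>) (normal_density 0 \<sigma>)"
      "(\<integral>z. (\<phi> z)\<^sup>2 \<partial>lborel) = \<sigma>\<^sup>2"
  | (null) "AE \<omega> in M. \<xi> \<phi> \<omega> = 0" "(\<integral>z. (\<phi> z)\<^sup>2 \<partial>lborel) = 0"
proof -
  have cov: "(\<integral>\<omega>. (\<xi> \<phi> \<omega>)\<^sup>2 \<partial>M) = (\<integral>z. (\<phi> z)\<^sup>2 \<partial>lborel)"
    using noise_covariance[OF assms assms] by (simp add: power2_eq_square)
  consider (a) \<sigma> where "0 < \<sigma>" "distributed M lborel (\<xi> \<phi>) (normal_density 0 \<sigma>)"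
    | (b) "AE \<omega> in M. \<xi> \<phi> \<omega> = 0"
    using noise_gaussian[OF assms] unfolding centered_gaussian_def by blast
  then show ?thesis
  proof cases
    case a
    have "(\<integral>\<omega>. (\<xi> \<phi> \<omega>)\<^sup>2 \<partial>M) = (\<integral>x. normal_density 0 \<sigma> x * x\<^sup>2 \<partial>lborel)"
      using distributed_integral[OF a(2), of "\<lambda>x. x\<^sup>2"] by simp
    also have "\<dots> = \<sigma>\<^sup>2"
      using integral_normal_moment_even[OF a(1), of 0 1] by (simp add: power2_eq_square)
    finally show ?thesis using density a cov by simp
  next
    case b
    have "(\<integral>\<omega>. (\<xi> \<phi> \<omega>)\<^sup>2 \<partial>M) = (\<integral>\<omega>. 0 \<partial>M)"
      by (rule integral_cong_AE) (use b noise_measurable[OF assms] in auto)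
    then show ?thesis using null b cov by simp
  qed
qed

lemma noise_integrable_power:
  assumes "L2fun \<phi>" shows "integrable M (\<lambda>\<omega>. \<xi> \<phi> \<omega> ^ k)"
  using assms
proof (cases rule: noise_cases)
  case (density \<sigma>)
  have "integrable lborel (\<lambda>x. normal_density 0 \<sigma> x * x ^ k)"
    using integrable_normal_moment[OF density(1), of 0 k] by simp
  then show ?thesis
    using distributed_integrable[OF density(2), of "\<lambda>x. x ^ k"] by simp
next
  case null
  have "integrable M (\<lambda>\<omega>. 0 ^ k :: real)" by simp
  then show ?thesis
    by (rule integrable_cong_AE_imp) (use null noise_measurable[OF assms] in auto)
qed

lemma noise_mean:
  assumes "L2fun \<phi>" shows "(\<integral>\<omega>. \<xi> \<phi> \<omega> \<partial>M) = 0"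
  using assms
proof (cases rule: noise_cases)
  case (density \<sigma>)
  have "(\<integral>\<omega>. \<xi> \<phi> \<omega> \<partial>M) = (\<integral>x. normal_density 0 \<sigma> x * x \<partial>lborel)"
    using distributed_integral[OF density(2), of "\<lambda>x. x"] by simp
  also have "\<dots> = 0"
    using integral_normal_moment_odd[OF density(1), of 0 0] by simp
  finally show ?thesis .
next
  case null
  have "(\<integral>\<omega>. \<xi> \<phi> \<omega> \<partial>M) = (\<integral>\<omega>. 0 \<partial>M)"
    by (rule integral_cong_AE) (use null noise_measurable[OF assms] in auto)
  then show ?thesis by simp
qed

text \<open>The factor is the double factorial of \<open>2 * k - 1\<close>, the moment of order
  \<open>2 * k\<close> of a standard Gaussian variable.\<close>

lemma noise_moment_even:
  assumes "L2fun \<phi>"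
  shows "(\<integral>\<omega>. \<xi> \<phi> \<omega> ^ (2 * k) \<partial>M) = fact (2 * k) / (2 ^ k * fact k) * (\<integral>z. (\<phi> z)\<^sup>2 \<partial>lborel) ^ k"
  using assms
proof (cases rule: noise_cases)
  case (density \<sigma>)
  have "(\<integral>\<omega>. \<xi> \<phi> \<omega> ^ (2 * k) \<partial>M) = (\<integral>x. normal_density 0 \<sigma> x * x ^ (2 * k) \<partial>lborel)"
    using distributed_integral[OF density(2), of "\<lambda>x. x ^ (2 * k)"] by simp
  also have "\<dots> = fact (2 * k) / ((2 / \<sigma>\<^sup>2) ^ k * fact k)"
    using integral_normal_moment_even[OF density(1), of 0 k] by simp
  also have "\<dots> = fact (2 * k) / (2 ^ k * fact k) * (\<sigma>\<^sup>2) ^ k"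
    using density(1) by (simp add: field_simps)
  finally show ?thesis using density(3) by simp
next
  case null
  have "(\<integral>\<omega>. \<xi> \<phi> \<omega> ^ (2 * k) \<partial>M) = (\<integral>\<omega>. 0 ^ (2 * k) \<partial>M)"
    by (rule integral_cong_AE) (use null noise_measurable[OF assms] in auto)
  then show ?thesis using null(2) by (cases k) (auto simp: prob_space)
qed

lemma noise_variance:
  "L2fun \<phi> \<Longrightarrow> (\<integral>\<omega>. (\<xi> \<phi> \<omega>)\<^sup>2 \<partial>M) = (\<integral>z. (\<phi> z)\<^sup>2 \<partial>lborel)"
  using noise_covariance[of \<phi> \<phi>] by (simp add: power2_eq_square)

lemma noise_char:
  assumes "L2fun \<phi>"
  shows "(\<integral>\<omega>. iexp (\<xi> \<phi> \<omega>) \<partial>M) = of_real (exp (- (\<integral>z. (\<phi> z)\<^sup>2 \<partial>lborel) / 2))"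
  using assms
proof (cases rule: noise_cases)
  case (density \<sigma>)
  have D: "distributed M lborel (\<lambda>\<omega>. (\<xi> \<phi> \<omega> - 0) / \<sigma>) std_normal_density"
    using density(2) normal_standard_normal_convert[OF density(1)] by blast
  have m: "(\<lambda>\<omega>. \<xi> \<phi> \<omega> / \<sigma>) \<in> borel_measurable M"
    using noise_measurable[OF assms] by simp
  have dist: "distr M borel (\<lambda>\<omega>. \<xi> \<phi> \<omega> / \<sigma>) = std_normal_distribution"
    using distributed_distr_eq_density[OF D] by (simp cong: distr_cong)
  have "of_real (exp (- (\<sigma>\<^sup>2) / 2)) = char std_normal_distribution \<sigma>"
    by (simp add: char_std_normal_distribution)
  also have "\<dots> = (\<integral>\<omega>. iexp (\<sigma> * (\<xi> \<phi> \<omega> / \<sigma>)) \<partial>M)"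
    unfolding dist [symmetric] char_def by (rule integral_distr) (use m in auto)
  also have "\<dots> = (\<integral>\<omega>. iexp (\<xi> \<phi> \<omega>) \<partial>M)"
    using density(1) by simp
  finally show ?thesis using density(3) by simp
next
  case null
  have "(\<integral>\<omega>. iexp (\<xi> \<phi> \<omega>) \<partial>M) = (\<integral>\<omega>. 1 \<partial>M)"
    by (rule integral_cong_AE) (use null noise_measurable[OF assms] in auto)
  then show ?thesis using null(2) by (simp add: prob_space)
qed

lemma noise_integrable_mult:
  assumes "L2fun \<phi>" "L2fun \<psi>"
  shows "integrable M (\<lambda>\<omega>. \<xi> \<phi> \<omega> * \<xi> \<psi> \<omega>)"
proof (rule Bochner_Integration.integrable_bound)
  show "integrable M (\<lambda>\<omega>. (\<xi> \<phi> \<omega>)\<^sup>2 + (\<xi> \<psi> \<omega>)\<^sup>2)"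
    using assms noise_integrable_power by auto
  show "(\<lambda>\<omega>. \<xi> \<phi> \<omega> * \<xi> \<psi> \<omega>) \<in> borel_measurable M"
    using assms noise_measurable by auto
  show "AE x in M. norm (\<xi> \<phi> x * \<xi> \<psi> x) \<le> norm ((\<xi> \<phi> x)\<^sup>2 + (\<xi> \<psi> x)\<^sup>2)"
    using abs_mult_le_squares by auto
qed

text \<open>Linearity is not part of the definition of white noise. Expanding the second moment of
  the defect by the covariance gives 0, so linearity holds outside a null set that depends on the
  test functions and the coefficients.\<close>

lemma noise_add:
  assumes \<phi>: "L2fun \<phi>" and \<psi>: "L2fun \<psi>"
  shows "AE \<omega> in M. \<xi> (\<lambda>z. a * \<phi> z + b * \<psi> z) \<omega> = a * \<xi> \<phi> \<omega> + b * \<xi> \<psi> \<omega>"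
proof -
  let ?\<chi> = "\<lambda>z. a * \<phi> z + b * \<psi> z"
  have \<chi>: "L2fun ?\<chi>" using assms by (intro L2fun_add L2fun_scale)
  note [measurable] = noise_measurable[OF \<phi>] noise_measurable[OF \<psi>] noise_measurable[OF \<chi>]
  note [simp] = noise_integrable_mult[OF \<phi> \<phi>] noise_integrable_mult[OF \<psi> \<psi>]
    noise_integrable_mult[OF \<chi> \<chi>] noise_integrable_mult[OF \<chi> \<phi>] noise_integrable_mult[OF \<chi> \<psi>]
    noise_integrable_mult[OF \<phi> \<psi>]
  note [simp] = L2fun_integrable_mult[OF \<phi> \<phi>] L2fun_integrable_mult[OF \<phi> \<psi>] L2fun_integrable_mult[OF \<psi> \<psi>]
  let ?d = "\<lambda>\<omega>. \<xi> ?\<chi> \<omega> - a * \<xi> \<phi> \<omega> - b * \<xi> \<psi> \<omega>"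
  have sq: "(?d \<omega>)\<^sup>2 = \<xi> ?\<chi> \<omega> * \<xi> ?\<chi> \<omega> + a * a * (\<xi> \<phi> \<omega> * \<xi> \<phi> \<omega>) + b * b * (\<xi> \<psi> \<omega> * \<xi> \<psi> \<omega>)
      - 2 * a * (\<xi> ?\<chi> \<omega> * \<xi> \<phi> \<omega>) - 2 * b * (\<xi> ?\<chi> \<omega> * \<xi> \<psi> \<omega>) + 2 * a * b * (\<xi> \<phi> \<omega> * \<xi> \<psi> \<omega>)" for \<omega>
    by (simp add: power2_eq_square algebra_simps)
  have int: "integrable M (\<lambda>\<omega>. (?d \<omega>)\<^sup>2)" unfolding sq by simp
  have [simp]: "(\<integral>z. ?\<chi> z * ?\<chi> z \<partial>lborel) = a * a * (\<integral>z. \<phi> z * \<phi> z \<partial>lborel)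
     + 2 * a * b * (\<integral>z. \<phi> z * \<psi> z \<partial>lborel) + b * b * (\<integral>z. \<psi> z * \<psi> z \<partial>lborel)"
  proof -
    have "?\<chi> z * ?\<chi> z = a * a * (\<phi> z * \<phi> z) + 2 * a * b * (\<phi> z * \<psi> z) + b * b * (\<psi> z * \<psi> z)" for z
      by (simp add: algebra_simps)
    then show ?thesis by simp
  qed
  have [simp]: "(\<integral>z. ?\<chi> z * \<phi> z \<partial>lborel) = a * (\<integral>z. \<phi> z * \<phi> z \<partial>lborel) + b * (\<integral>z. \<phi> z * \<psi> z \<partial>lborel)"
  proof -
    have "?\<chi> z * \<phi> z = a * (\<phi> z * \<phi> z) + b * (\<phi> z * \<psi> z)" for z by (simp add: algebra_simps)
    then show ?thesis by simp
  qed
  have [simp]: "(\<integral>z. ?\<chi> z * \<psi> z \<partial>lborel) = a * (\<integral>z. \<phi> z * \<psi> z \<partial>lborel) + b * (\<integral>z. \<psi> z * \<psi> z \<partial>lborel)"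
  proof -
    have "?\<chi> z * \<psi> z = a * (\<phi> z * \<psi> z) + b * (\<psi> z * \<psi> z)" for z by (simp add: algebra_simps)
    then show ?thesis by simp
  qed
  have "(\<integral>\<omega>. (?d \<omega>)\<^sup>2 \<partial>M) = 0"
    unfolding sq
    by (simp add: noise_covariance[OF \<phi> \<phi>] noise_covariance[OF \<psi> \<psi>] noise_covariance[OF \<chi> \<chi>]
      noise_covariance[OF \<chi> \<phi>] noise_covariance[OF \<chi> \<psi>] noise_covariance[OF \<phi> \<psi>])
      (simp add: algebra_simps)
  then have "AE \<omega> in M. (?d \<omega>)\<^sup>2 = 0"
    using integral_nonneg_eq_0_iff_AE[OF int] by simp
  then show ?thesis by eventually_elim simp
qed

lemma noise_sum:
  assumes "finite I" "\<And>i. i \<in> I \<Longrightarrow> L2fun (\<phi> i)"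
  shows "L2fun (\<lambda>z. \<Sum>i\<in>I. \<phi> i z) \<and> (AE \<omega> in M. \<xi> (\<lambda>z. \<Sum>i\<in>I. \<phi> i z) \<omega> = (\<Sum>i\<in>I. \<xi> (\<phi> i) \<omega>))"
  using assms
proof (induction I rule: finite_induct)
  case empty
  have z: "L2fun (\<lambda>z. 0)" by (simp add: L2fun_def)
  have "AE \<omega> in M. \<xi> (\<lambda>z. 0) \<omega> = 0"
    using noise_add[OF z z, of 0 0] by simp
  with z show ?case by simp
next
  case (insert i I)
  then have i: "L2fun (\<phi> i)" and I: "L2fun (\<lambda>z. \<Sum>i\<in>I. \<phi> i z)" by auto
  have "AE \<omega> in M. \<xi> (\<lambda>z. \<Sum>i\<in>I. \<phi> i z) \<omega> = (\<Sum>i\<in>I. \<xi> (\<phi> i) \<omega>)" using insert by auto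
  then have "AE \<omega> in M. \<xi> (\<lambda>z. \<phi> i z + (\<Sum>i\<in>I. \<phi> i z)) \<omega> = \<xi> (\<phi> i) \<omega> + (\<Sum>i\<in>I. \<xi> (\<phi> i) \<omega>)"
    using noise_add[OF i I, of 1 1] by eventually_elim simp
  then show ?case using insert.hyps L2fun_add[OF i I] by simp
qed

end

section \<open>Independence of the noise in orthogonal directions\<close>

lemma Int_stable_vimage: "Int_stable {f -` A \<inter> S |A. A \<in> sets N}"
proof (rule Int_stableI)
  fix a b assume "a \<in> {f -` A \<inter> S |A. A \<in> sets N}" "b \<in> {f -` A \<inter> S |A. A \<in> sets N}"
  then obtain A B where "A \<in> sets N" "B \<in> sets N" "a = f -` A \<inter> S" "b = f -` B \<inter> S" by auto
  then have "a \<inter> b = f -` (A \<inter> B) \<inter> S" "A \<inter> B \<in> sets N" by auto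
  then show "a \<inter> b \<in> {f -` A \<inter> S |A. A \<in> sets N}" by blast
qed

context gaussian_noise
begin

definition orth :: "(real \<times> real \<Rightarrow> real) \<Rightarrow> (real \<times> real \<Rightarrow> real) set" where
  "orth h = {g. L2fun g \<and> (\<integral>z. g z * h z \<partial>lborel) = 0}"

lemma orth_add:
  assumes "L2fun h" "g \<in> orth h" "g' \<in> orth h"
  shows "(\<lambda>z. a * g z + b * g' z) \<in> orth h"
proof -
  have g: "L2fun g" "L2fun g'" using assms by (auto simp: orth_def)
  have "(\<integral>z. (a * g z + b * g' z) * h z \<partial>lborel)
    = (\<integral>z. a * (g z * h z) + b * (g' z * h z) \<partial>lborel)" by (simp add: algebra_simps)
  also have "\<dots> = 0"
    using assms L2fun_integrable_mult[OF g(1) assms(1)] L2fun_integrable_mult[OF g(2) assms(1)]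
    by (simp add: orth_def)
  finally show ?thesis using g by (auto simp: orth_def intro: L2fun_add L2fun_scale)
qed

text \<open>The characteristic function of \<open>\<xi> h\<close> at \<open>s\<close>.\<close>

definition char_const :: "(real \<times> real \<Rightarrow> real) \<Rightarrow> real \<Rightarrow> complex" where
  "char_const h s = of_real (exp (- (s\<^sup>2 * (\<integral>z. (h z)\<^sup>2 \<partial>lborel)) / 2))"

lemma norm_char_const: "norm (char_const h s) \<le> 1"
  by (simp add: char_const_def)

lemma noise_char_scaled:
  assumes "L2fun h"
  shows "(\<integral>\<omega>. iexp (s * \<xi> h \<omega>) \<partial>M) = char_const h s"
proof -
  have "AE \<omega> in M. \<xi> (\<lambda>z. s * h z + 0 * h z) \<omega> = s * \<xi> h \<omega> + 0 * \<xi> h \<omega>"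
    by (rule noise_add[OF assms assms])
  then have ae: "AE \<omega> in M. \<xi> (\<lambda>z. s * h z) \<omega> = s * \<xi> h \<omega>" by simp
  have "(\<integral>\<omega>. iexp (s * \<xi> h \<omega>) \<partial>M) = (\<integral>\<omega>. iexp (\<xi> (\<lambda>z. s * h z) \<omega>) \<partial>M)"
    by (rule integral_cong_AE)
      (use ae noise_measurable[OF assms] noise_measurable[OF L2fun_scale[OF assms, of s]] in auto)
  then show ?thesis
    using noise_char[OF L2fun_scale[OF assms, of s]] by (simp add: char_const_def power_mult_distrib)
qed

text \<open>By orthogonality the squared norm of \<open>s * h + g\<close> is the sum of the two
  squared norms, so the characteristic function of the combined Gaussian variable factors.\<close>

lemma char_factor:
  assumes h: "L2fun h" and g: "g \<in> orth h"
  shows "(\<integral>\<omega>. (iexp (s * \<xi> h \<omega>) - char_const h s) * iexp (\<xi> g \<omega>) \<partial>M) = 0"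
proof -
  have g': "L2fun g" and o: "(\<integral>z. g z * h z \<partial>lborel) = 0" using g by (auto simp: orth_def)
  let ?f = "\<lambda>z. s * h z + 1 * g z"
  have f: "L2fun ?f" using h g' by (intro L2fun_add L2fun_scale)
  note [measurable] = noise_measurable[OF h] noise_measurable[OF g'] noise_measurable[OF f]
    noise_measurable[OF f, simplified]
  have sq: "(\<integral>z. (?f z)\<^sup>2 \<partial>lborel) = s\<^sup>2 * (\<integral>z. (h z)\<^sup>2 \<partial>lborel) + (\<integral>z. (g z)\<^sup>2 \<partial>lborel)"
  proof -
    have "(?f z)\<^sup>2 = s\<^sup>2 * (h z)\<^sup>2 + 2 * s * (g z * h z) + (g z)\<^sup>2" for z
      by (simp add: power2_eq_square algebra_simps)
    then show ?thesis
      using L2funD(2)[OF h] L2funD(2)[OF g'] L2fun_integrable_mult[OF g' h] o by simp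
  qed
  have "(\<integral>\<omega>. iexp (s * \<xi> h \<omega>) * iexp (\<xi> g \<omega>) \<partial>M) = (\<integral>\<omega>. iexp (\<xi> ?f \<omega>) \<partial>M)"
  proof (rule integral_cong_AE)
    show "AE \<omega> in M. iexp (s * \<xi> h \<omega>) * iexp (\<xi> g \<omega>) = iexp (\<xi> ?f \<omega>)"
      using noise_add[OF h g', of s 1]
    proof eventually_elim
      case (elim \<omega>)
      show ?case unfolding elim by (simp add: exp_add [symmetric] algebra_simps)
    qed
  qed auto
  also have "\<dots> = char_const h s * (\<integral>\<omega>. iexp (\<xi> g \<omega>) \<partial>M)"
    unfolding noise_char[OF f] noise_char[OF g'] sq char_const_def
    by (simp add: exp_add [symmetric] of_real_mult [symmetric] add_divide_distrib del: of_real_mult)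
  finally have eq: "(\<integral>\<omega>. iexp (s * \<xi> h \<omega>) * iexp (\<xi> g \<omega>) \<partial>M)
     = char_const h s * (\<integral>\<omega>. iexp (\<xi> g \<omega>) \<partial>M)" .
  have i1: "complex_integrable M (\<lambda>\<omega>. iexp (s * \<xi> h \<omega>) * iexp (\<xi> g \<omega>))"
    by (rule integrable_bounded[where B = 1]) (auto simp: norm_mult)
  have i2: "complex_integrable M (\<lambda>\<omega>. iexp (\<xi> g \<omega>))"
    by (rule integrable_bounded[where B = 1]) auto
  show ?thesis using eq i1 i2 by (simp add: left_diff_distrib)
qed

text \<open>The exponentials \<open>exp (i \<xi> g)\<close> of the factors are replaced by indicators one at a time;
  keeping a free \<open>g\<close> in the statement is what makes the induction go through.\<close>

lemma char_factor_indicators: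
  assumes h: "L2fun h" and "finite J" and J: "\<And>j. j \<in> J \<Longrightarrow> fst j \<in> orth h \<and> snd j \<in> sets borel"
    and g: "g \<in> orth h"
  shows "(\<integral>\<omega>. (iexp (s * \<xi> h \<omega>) - char_const h s) * iexp (\<xi> g \<omega>)
     * (\<Prod>j\<in>J. indicator (snd j) (\<xi> (fst j) \<omega>)) \<partial>M) = 0"
  using \<open>finite J\<close> J g
proof (induction J arbitrary: g rule: finite_induct)
  case empty
  then show ?case using char_factor[OF h] by simp
next
  case (insert j J)
  note [measurable] = noise_measurable[OF h]
  have L: "L2fun g" if "g \<in> orth h" for g using that by (simp add: orth_def)
  note mg [measurable] = noise_measurable[OF L[OF insert.prems(2)]]
  have j: "fst j \<in> orth h" and B [measurable]: "snd j \<in> sets borel" using insert.prems by auto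
  note mj [measurable] = noise_measurable[OF L[OF j]]
  have [measurable]: "\<xi> (fst i) \<in> borel_measurable M" "snd i \<in> sets borel" if "i \<in> J" for i
    using insert.prems(1)[of i] that L noise_measurable by auto
  let ?P = "\<lambda>\<omega>. (\<Prod>j\<in>J. indicator (snd j) (\<xi> (fst j) \<omega>)) :: complex"
  have Pm [measurable]: "?P \<in> borel_measurable M" by measurable
  have P1: "norm (?P \<omega>) \<le> 1" for \<omega>
    unfolding prod_norm [symmetric] by (intro prod_le_1) (auto simp: indicator_def)
  let ?w = "\<lambda>\<omega>. (iexp (s * \<xi> h \<omega>) - char_const h s) * iexp (\<xi> g \<omega>) * ?P \<omega>"
  have bd: "norm (?w \<omega>) \<le> 2" for \<omega>
  proof -
    have "norm (iexp (s * \<xi> h \<omega>) - char_const h s) \<le> 1 + 1"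
      using norm_triangle_ineq4[of "iexp (s * \<xi> h \<omega>)" "char_const h s"] norm_char_const[of h s]
      by simp
    then have "norm (iexp (s * \<xi> h \<omega>) - char_const h s) * norm (?P \<omega>) \<le> 2 * 1"
      using P1 by (intro mult_mono) auto
    then show ?thesis by (simp add: norm_mult)
  qed
  \<comment> \<open>The exponential of \<open>\<xi> (fst j)\<close> is absorbed into that of
    \<open>g\<close>: the function \<open>g + t * fst j\<close> is again orthogonal to
    \<open>h\<close>. The induction hypothesis then provides the vanishing transform from which the
    new indicator is obtained.\<close>
  have "(\<integral>\<omega>. ?w \<omega> * iexp (t * \<xi> (fst j) \<omega>) \<partial>M) = 0" for t
  proof -
    let ?g = "\<lambda>z. 1 * g z + t * fst j z"
    have go: "?g \<in> orth h" using orth_add[OF h insert.prems(2) j] .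
    note [measurable] = noise_measurable[OF L[OF go]] noise_measurable[OF L[OF go], simplified]
    have "(\<integral>\<omega>. ?w \<omega> * iexp (t * \<xi> (fst j) \<omega>) \<partial>M)
      = (\<integral>\<omega>. (iexp (s * \<xi> h \<omega>) - char_const h s) * iexp (\<xi> ?g \<omega>) * ?P \<omega> \<partial>M)"
    proof (rule integral_cong_AE)
      show "AE \<omega> in M. ?w \<omega> * iexp (t * \<xi> (fst j) \<omega>)
          = (iexp (s * \<xi> h \<omega>) - char_const h s) * iexp (\<xi> ?g \<omega>) * ?P \<omega>"
        using noise_add[OF L[OF insert.prems(2)] L[OF j], of 1 t]
      proof eventually_elim
        case (elim \<omega>)
        have "iexp (\<xi> ?g \<omega>) = iexp (\<xi> g \<omega>) * iexp (t * \<xi> (fst j) \<omega>)"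
          unfolding elim by (simp add: exp_add [symmetric] algebra_simps)
        then show ?case by (simp add: mult_ac)
      qed
    qed auto
    also have "\<dots> = 0" using insert.IH[OF _ go] insert.prems(1) by auto
    finally show ?thesis .
  qed
  then have "(\<integral>\<omega>. ?w \<omega> * indicator (snd j) (\<xi> (fst j) \<omega>) \<partial>M) = 0"
    by (intro weight_char_zero[where C = 2]) (use bd in auto)
  then show ?case using insert.hyps by (simp add: mult_ac)
qed

text \<open>All information in the noise orthogonal to \<open>h\<close>. The null sets are adjoined
  because \<open>nat_filt\<close> contains them and is to be compared with this
  sigma-algebra.\<close>

definition orth_sigma :: "(real \<times> real \<Rightarrow> real) \<Rightarrow> 'a measure" where
  "orth_sigma h = sigma (space M)
     ({\<xi> g -` B \<inter> space M | g B. g \<in> orth h \<and> B \<in> sets borel} \<union> {N \<in> sets M. emeasure M N = 0})"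

lemma orth_sigma_generators:
  "{\<xi> g -` B \<inter> space M | g B. g \<in> orth h \<and> B \<in> sets borel} \<union> {N \<in> sets M. emeasure M N = 0} \<subseteq> sets M"
  using noise_measurable by (auto simp: orth_def)

lemma space_orth_sigma [simp]: "space (orth_sigma h) = space M"
  unfolding orth_sigma_def by (rule space_measure_of_conv)

lemma sets_orth_sigma:
  "sets (orth_sigma h) = sigma_sets (space M)
     ({\<xi> g -` B \<inter> space M | g B. g \<in> orth h \<and> B \<in> sets borel} \<union> {N \<in> sets M. emeasure M N = 0})"
  unfolding orth_sigma_def
  by (rule sets_measure_of) (use orth_sigma_generators sets.sets_into_space in blast)

lemma sets_orth_sigma_subset: "sets (orth_sigma h) \<subseteq> sets M"
  unfolding sets_orth_sigma by (rule sets.sigma_sets_subset[OF orth_sigma_generators])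

lemma measurable_orth_sigma: "f \<in> borel_measurable (orth_sigma h) \<Longrightarrow> f \<in> borel_measurable M"
  using sets_orth_sigma_subset[of h] by (auto simp: measurable_def)

lemma noise_orth_sigma: "g \<in> orth h \<Longrightarrow> \<xi> g \<in> borel_measurable (orth_sigma h)"
  by (rule measurableI) (auto simp: sets_orth_sigma)

text \<open>Orthogonality to the centered exponential passes from finite intersections of preimages
  to the generated sigma-algebra by Dynkin's argument. Complements are harmless since the
  exponential has mean \<open>char_const h s\<close>.\<close>

lemma orth_sigma_weight:
  assumes h: "L2fun h" and A: "A \<in> sets (orth_sigma h)"
  shows "(LINT \<omega>:A|M. iexp (s * \<xi> h \<omega>) - char_const h s) = 0"
proof -
  note [measurable] = noise_measurable[OF h]
  let ?w = "\<lambda>\<omega>. iexp (s * \<xi> h \<omega>) - char_const h s"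
  \<comment> \<open>Null sets are a second kind of generator next to the cylinders; intersecting
    with a null set gives a null set, so the family is closed under intersection.\<close>
  define G where "G = {{\<omega> \<in> space M. \<forall>j\<in>J. \<xi> (fst j) \<omega> \<in> snd j} | J.
     finite J \<and> J \<subseteq> orth h \<times> sets borel} \<union> {N \<in> sets M. emeasure M N = 0}"
  have EJ: "{\<omega> \<in> space M. \<forall>j\<in>J. \<xi> (fst j) \<omega> \<in> snd j} \<in> sets M"
    if "finite J" "J \<subseteq> orth h \<times> sets borel" for J
  proof (rule sets.sets_Collect_finite_All[OF _ that(1)])
    fix j assume "j \<in> J"
    then have "\<xi> (fst j) \<in> borel_measurable M" "snd j \<in> sets borel"
      using that(2) noise_measurable by (auto simp: orth_def)
    then have "\<xi> (fst j) -` snd j \<inter> space M \<in> sets M" by (rule measurable_sets)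
    also have "\<xi> (fst j) -` snd j \<inter> space M = {\<omega> \<in> space M. \<xi> (fst j) \<omega> \<in> snd j}" by auto
    finally show "{\<omega> \<in> space M. \<xi> (fst j) \<omega> \<in> snd j} \<in> sets M" .
  qed
  have GM: "G \<subseteq> sets M" using EJ unfolding G_def by auto
  have wint: "complex_integrable M ?w"
    by (rule integrable_bounded[where B = 2])
      (use norm_char_const[of h s] in \<open>auto intro!: order_trans[OF norm_triangle_ineq4]\<close>)
  have wset: "set_integrable M B ?w" if "B \<in> sets M" for B
    using wint that by (auto simp: set_integrable_def intro: integrable_mult_indicator)
  have AG: "A \<in> sigma_sets (space M) G"
  proof -
    have "\<xi> g -` B \<inter> space M \<in> G" if "g \<in> orth h" "B \<in> sets borel" for g B
      unfolding G_def using that by (intro UnI1 CollectI exI[of _ "{(g, B)}"]) auto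
    then have "sigma_sets (space M)
     ({\<xi> g -` B \<inter> space M | g B. g \<in> orth h \<and> B \<in> sets borel} \<union> {N \<in> sets M. emeasure M N = 0})
       \<subseteq> sigma_sets (space M) G"
      by (intro sigma_sets_mono') (auto simp: G_def)
    then show ?thesis using A unfolding sets_orth_sigma by blast
  qed
  have "Int_stable G"
  proof (rule Int_stableI)
    fix a b assume ab: "a \<in> G" "b \<in> G"
    show "a \<inter> b \<in> G"
    proof (cases "emeasure M a = 0 \<or> emeasure M b = 0")
      case True
      have "a \<in> sets M" "b \<in> sets M" using ab GM by auto
      then have "emeasure M (a \<inter> b) \<le> emeasure M a" "emeasure M (a \<inter> b) \<le> emeasure M b"
        by (auto intro: emeasure_mono)
      then have "emeasure M (a \<inter> b) = 0" using True by auto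
      then show ?thesis using \<open>a \<in> sets M\<close> \<open>b \<in> sets M\<close> unfolding G_def by auto
    next
      case False
      then obtain J K where
        J: "finite J" "J \<subseteq> orth h \<times> sets borel" "a = {\<omega> \<in> space M. \<forall>j\<in>J. \<xi> (fst j) \<omega> \<in> snd j}" and
        K: "finite K" "K \<subseteq> orth h \<times> sets borel" "b = {\<omega> \<in> space M. \<forall>j\<in>K. \<xi> (fst j) \<omega> \<in> snd j}"
        using ab unfolding G_def by auto
      show ?thesis unfolding G_def
        by (intro UnI1 CollectI exI[of _ "J \<union> K"]) (use J K in auto)
    qed
  qed
  moreover have "G \<subseteq> Pow (space M)" using GM sets.sets_into_space by blast
  ultimately have "A \<in> sets M \<and> (LINT \<omega>:A|M. ?w \<omega>) = 0"
    using AG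
  proof (induction A rule: sigma_sets_induct_disjoint)
    case (basic A)
    show ?case
    proof (cases "emeasure M A = 0")
      case True
      have "A \<in> sets M" using basic GM by auto
      with True have "A \<in> null_sets M" by auto
      then have "AE \<omega> in M. \<omega> \<notin> A" by (rule AE_not_in)
      then have "(LINT \<omega>:A|M. ?w \<omega>) = (\<integral>\<omega>. 0 \<partial>M)"
        unfolding set_lebesgue_integral_def
        by (intro integral_cong_AE) (use \<open>A \<in> sets M\<close> in \<open>auto simp: indicator_def\<close>)
      then show ?thesis using \<open>A \<in> sets M\<close> by simp
    next
      case False
      then obtain J where
        J: "finite J" "J \<subseteq> orth h \<times> sets borel" "A = {\<omega> \<in> space M. \<forall>j\<in>J. \<xi> (fst j) \<omega> \<in> snd j}"
        using basic unfolding G_def by auto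
      \<comment> \<open>The statement about products of indicators carries a free exponential; with
        the zero test function this exponential is 1 almost everywhere.\<close>
      have z: "(\<lambda>z. 0) \<in> orth h" by (simp add: orth_def L2fun_def)
      have z0: "AE \<omega> in M. \<xi> (\<lambda>z. 0) \<omega> = 0"
        using noise_sum[of "{}"] by simp
      have ind: "(\<Prod>j\<in>J. indicator (snd j) (\<xi> (fst j) \<omega>)) = (indicator A \<omega> :: complex)"
        if "\<omega> \<in> space M" for \<omega>
        using that J by (auto simp: indicator_def intro!: prod.neutral prod_zero)
      have Am: "A \<in> sets M" using basic GM by auto
      have mz [measurable]: "\<xi> (\<lambda>z. 0) \<in> borel_measurable M" 
        using z by (auto simp: orth_def intro: noise_measurable)
      have mJ [measurable]: "(\<lambda>\<omega>. \<Prod>j\<in>J. indicator (snd j) (\<xi> (fst j) \<omega>) :: complex) \<in> borel_measurable M"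
        by (subst measurable_cong[OF ind]) (use Am in auto)
      have "(LINT \<omega>:A|M. ?w \<omega>) = (\<integral>\<omega>. ?w \<omega> * iexp (\<xi> (\<lambda>z. 0) \<omega>)
           * (\<Prod>j\<in>J. indicator (snd j) (\<xi> (fst j) \<omega>)) \<partial>M)"
        unfolding set_lebesgue_integral_def
      proof (rule integral_cong_AE)
        show "AE \<omega> in M. indicat_real A \<omega> *\<^sub>R ?w \<omega> = ?w \<omega> * iexp (\<xi> (\<lambda>z. 0) \<omega>)
           * (\<Prod>j\<in>J. indicator (snd j) (\<xi> (fst j) \<omega>))"
          using z0 AE_space
        proof eventually_elim
          case (elim \<omega>)
          then show ?case using ind[of \<omega>] by (simp add: indicator_def)
        qed
      qed (use Am in auto)
      also have "\<dots> = 0"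
        by (rule char_factor_indicators[OF h J(1) _ z]) (use J in auto)
      finally show ?thesis using Am by simp
    qed
  next
    case empty
    show ?case by (simp add: set_lebesgue_integral_def)
  next
    case (compl A)
    have "(LINT \<omega>:space M - A|M. ?w \<omega>) = (\<integral>\<omega>. ?w \<omega> \<partial>M) - (LINT \<omega>:A|M. ?w \<omega>)"
    proof -
      have "(LINT \<omega>:space M - A|M. ?w \<omega>) = (\<integral>\<omega>. ?w \<omega> - indicator A \<omega> *\<^sub>R ?w \<omega> \<partial>M)"
        unfolding set_lebesgue_integral_def
        by (rule Bochner_Integration.integral_cong) (auto simp: indicator_def)
      also have "\<dots> = (\<integral>\<omega>. ?w \<omega> \<partial>M) - (LINT \<omega>:A|M. ?w \<omega>)"
        unfolding set_lebesgue_integral_def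
        by (rule Bochner_Integration.integral_diff[OF wint])
          (use wset[of A] compl in \<open>simp add: set_integrable_def\<close>)
      finally show ?thesis .
    qed
    moreover have "(\<integral>\<omega>. ?w \<omega> \<partial>M) = 0"
    proof -
      have "complex_integrable M (\<lambda>\<omega>. iexp (s * \<xi> h \<omega>))"
        by (rule integrable_bounded[where B = 1]) auto
      then show ?thesis using noise_char_scaled[OF h, of s] by (simp add: prob_space)
    qed
    ultimately show ?case using compl by auto
  next
    case (union A)
    have A: "A i \<in> sets M" "(LINT \<omega>:A i|M. ?w \<omega>) = 0" for i using union.IH by auto
    then have U: "(\<Union>i. A i) \<in> sets M" by auto
    have "(LINT \<omega>:(\<Union>i. A i)|M. ?w \<omega>) = (\<Sum>i. LINT \<omega>:A i|M. ?w \<omega>)"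
      by (rule lebesgue_integral_countable_add[OF _ _ wset[OF U]])
        (use union.hyps A in \<open>auto simp: disjoint_family_on_def\<close>)
    then show ?case using A U by auto
  qed
  then show ?thesis by simp
qed

text \<open>\<open>indicator A - prob A\<close> is a bounded weight whose transform along
  \<open>\<xi> h\<close> vanishes, so it integrates to 0 over each event of
  \<open>\<xi> h\<close>.\<close>

lemma orth_sigma_indep_event:
  assumes h: "L2fun h" and A: "A \<in> sets (orth_sigma h)" and B [measurable]: "B \<in> sets borel"
  shows "prob (A \<inter> (\<xi> h -` B \<inter> space M)) = prob A * prob (\<xi> h -` B \<inter> space M)"
proof -
  note [measurable] = noise_measurable[OF h]
  have Am [measurable]: "A \<in> sets M" using A sets_orth_sigma_subset by blast
  have "(\<integral>\<omega>. of_real (indicator A \<omega> - prob A) * iexp (t * \<xi> h \<omega>) \<partial>M) = 0" for t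
  proof -
    have i1: "complex_integrable M (\<lambda>\<omega>. iexp (t * \<xi> h \<omega>))"
      by (rule integrable_bounded[where B = 1]) auto
    have i2: "complex_integrable M (\<lambda>\<omega>. indicator A \<omega> *\<^sub>R (iexp (t * \<xi> h \<omega>) - char_const h t))"
      using i1 Am by (intro integrable_mult_indicator) auto
    have i3: "complex_integrable M (\<lambda>\<omega>. indicator A \<omega> *\<^sub>R char_const h t)"
      using Am by (intro integrable_mult_indicator) auto
    have "(\<integral>\<omega>. of_real (indicator A \<omega> - prob A) * iexp (t * \<xi> h \<omega>) \<partial>M)
      = (\<integral>\<omega>. indicator A \<omega> *\<^sub>R (iexp (t * \<xi> h \<omega>) - char_const h t)
          + indicator A \<omega> *\<^sub>R char_const h t - of_real (prob A) * iexp (t * \<xi> h \<omega>) \<partial>M)"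
      by (intro Bochner_Integration.integral_cong) (auto simp: indicator_def algebra_simps)
    also have "\<dots> = (LINT \<omega>:A|M. iexp (t * \<xi> h \<omega>) - char_const h t)
          + (\<integral>\<omega>. indicator A \<omega> *\<^sub>R char_const h t \<partial>M) - of_real (prob A) * char_const h t"
      unfolding set_lebesgue_integral_def noise_char_scaled[OF h, of t, symmetric]
      using i1 i2 i3 noise_char_scaled[OF h, of t] by simp
    also have "(\<integral>\<omega>. indicator A \<omega> *\<^sub>R char_const h t \<partial>M) = of_real (prob A) * char_const h t"
      using Am by (simp add: scaleR_conv_of_real)
    finally show ?thesis using orth_sigma_weight[OF h A] by simp
  qed
  then have "(\<integral>\<omega>. (indicator A \<omega> - prob A) * indicator B (\<xi> h \<omega>) \<partial>M) = 0"
    by (intro weight_char_zero_real[where C = 1]) (auto simp: indicator_def)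
  moreover have "(indicator A \<omega> - prob A) * indicator B (\<xi> h \<omega>)
     = indicator (A \<inter> (\<xi> h -` B \<inter> space M)) \<omega> - prob A * indicator (\<xi> h -` B \<inter> space M) \<omega>"
    if "\<omega> \<in> space M" for \<omega>
    using that by (auto simp: indicator_def)
  ultimately have "(\<integral>\<omega>. indicator (A \<inter> (\<xi> h -` B \<inter> space M)) \<omega>
       - prob A * indicator (\<xi> h -` B \<inter> space M) \<omega> \<partial>M) = 0"
    by (metis (no_types, lifting) Bochner_Integration.integral_cong)
  moreover have "integrable M (indicat_real E)" if "E \<in> sets M" for E
    by (rule integrable_bounded[where B = 1]) (use that in \<open>auto simp: indicator_def\<close>)
  ultimately show ?thesis by (subst (asm) Bochner_Integration.integral_diff) auto
qed

lemma orth_sigma_indep_mult: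
  fixes Y :: "'a \<Rightarrow> real" and f :: "real \<Rightarrow> real"
  assumes h: "L2fun h" and Y: "Y \<in> borel_measurable (orth_sigma h)"
    and f [measurable]: "f \<in> borel_measurable borel"
    and "integrable M Y" "integrable M (\<lambda>\<omega>. f (\<xi> h \<omega>))"
  shows "integrable M (\<lambda>\<omega>. Y \<omega> * f (\<xi> h \<omega>))"
    and "(\<integral>\<omega>. Y \<omega> * f (\<xi> h \<omega>) \<partial>M) = (\<integral>\<omega>. Y \<omega> \<partial>M) * (\<integral>\<omega>. f (\<xi> h \<omega>) \<partial>M)"
proof -
  note [measurable] = noise_measurable[OF h] measurable_orth_sigma[OF Y]
  have "indep_var borel Y borel (\<xi> h)"
    unfolding indep_var_eq
  proof (intro conjI indep_set_sigma_sets)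
    show "random_variable borel Y" "random_variable borel (\<xi> h)" by measurable
    show "indep_set {Y -` A \<inter> space M |A. A \<in> sets borel} {\<xi> h -` A \<inter> space M |A. A \<in> sets borel}"
      unfolding indep_sets2_eq
    proof (intro conjI ballI)
      fix a b assume "a \<in> {Y -` A \<inter> space M |A. A \<in> sets borel}"
        and "b \<in> {\<xi> h -` A \<inter> space M |A. A \<in> sets borel}"
      then obtain A B where AB: "A \<in> sets borel" "B \<in> sets borel"
        "a = Y -` A \<inter> space M" "b = \<xi> h -` B \<inter> space M" by auto
      have "a \<in> sets (orth_sigma h)" using measurable_sets[OF Y AB(1)] AB by simp
      then show "prob (a \<inter> b) = prob a * prob b" using orth_sigma_indep_event[OF h _ AB(2)] AB by simp
    qed auto
    show "Int_stable {Y -` A \<inter> space M |A. A \<in> sets borel}"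
      by (rule Int_stable_vimage)
    show "Int_stable {\<xi> h -` A \<inter> space M |A. A \<in> sets borel}"
      by (rule Int_stable_vimage)
  qed
  then have "indep_var borel ((\<lambda>y. y) \<circ> Y) borel (f \<circ> \<xi> h)"
    by (rule indep_var_compose) auto
  then have iv: "indep_var borel Y borel (\<lambda>\<omega>. f (\<xi> h \<omega>))" by (simp add: comp_def)
  show "integrable M (\<lambda>\<omega>. Y \<omega> * f (\<xi> h \<omega>))"
    by (rule indep_var_integrable[OF iv]) fact+
  show "(\<integral>\<omega>. Y \<omega> * f (\<xi> h \<omega>) \<partial>M) = (\<integral>\<omega>. Y \<omega> \<partial>M) * (\<integral>\<omega>. f (\<xi> h \<omega>) \<partial>M)"
    by (rule indep_var_lebesgue_integral[OF iv]) fact+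
qed

section \<open>One step of the truncated moment estimate\<close>

definition step_const :: "nat \<Rightarrow> real" where
  "step_const q = trunc_pow_const q * (2 + fact (2 * q + 2) / (2 ^ (q + 1) * fact (q + 1)))"

lemma step_const_nonneg: "0 \<le> step_const q"
  by (simp add: step_const_def trunc_pow_const_def)

lemma trunc_pow_integrable:
  assumes "Y \<in> borel_measurable M" "integrable M (\<lambda>\<omega>. (Y \<omega>)\<^sup>2)" "0 \<le> L"
  shows "integrable M (\<lambda>\<omega>. trunc_pow q L (Y \<omega>))"
proof (rule Bochner_Integration.integrable_bound)
  show "integrable M (\<lambda>\<omega>. L ^ q * (Y \<omega>)\<^sup>2)" using assms by simp
  show "(\<lambda>\<omega>. trunc_pow q L (Y \<omega>)) \<in> borel_measurable M" using assms by measurable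
  show "AE x in M. norm (trunc_pow q L (Y x)) \<le> norm (L ^ q * (Y x)\<^sup>2)"
    using trunc_pow_le_square[OF assms(3)] trunc_pow_nonneg[OF assms(3)] assms(3) by auto
qed

lemma square_integrable_add:
  assumes [measurable]: "Y \<in> borel_measurable M" "W \<in> borel_measurable M"
    and "integrable M (\<lambda>\<omega>. (Y \<omega>)\<^sup>2)" "integrable M (\<lambda>\<omega>. (W \<omega>)\<^sup>2)"
  shows "integrable M (\<lambda>\<omega>. (Y \<omega> + W \<omega>)\<^sup>2 :: real)"
proof (rule Bochner_Integration.integrable_bound)
  show "integrable M (\<lambda>\<omega>. 2 * (Y \<omega>)\<^sup>2 + 2 * (W \<omega>)\<^sup>2)" using assms by simp
  have "(a + b)\<^sup>2 \<le> 2 * a\<^sup>2 + 2 * b\<^sup>2" for a b :: real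
    using sum_squares_bound[of a b] by (simp add: power2_sum)
  then show "AE x in M. norm ((Y x + W x)\<^sup>2) \<le> norm (2 * (Y x)\<^sup>2 + 2 * (W x)\<^sup>2)" by auto
qed measurable

lemma square_integrable_imp_integrable:
  assumes [measurable]: "Y \<in> borel_measurable M"
    and "integrable M (\<lambda>\<omega>. (Y \<omega>)\<^sup>2)"
  shows "integrable M (Y :: 'a \<Rightarrow> real)"
proof (rule Bochner_Integration.integrable_bound)
  show "integrable M (\<lambda>\<omega>. 1 + (Y \<omega>)\<^sup>2)" using assms by simp
  have "\<bar>a\<bar> \<le> 1 + a\<^sup>2" for a :: real using abs_mult_le_squares[of 1 a] by simp
  then show "AE x in M. norm (Y x) \<le> norm (1 + (Y x)\<^sup>2)" by auto
qed measurable

lemma bounded_times_square_integrable: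
  assumes [measurable]: "X \<in> borel_measurable M" "Y \<in> borel_measurable M"
    and bd: "\<And>\<omega>. \<omega> \<in> space M \<Longrightarrow> \<bar>X \<omega>\<bar> \<le> B" and "integrable M (\<lambda>\<omega>. (Y \<omega>)\<^sup>2)"
  shows "integrable M (\<lambda>\<omega>. (X \<omega> * Y \<omega>)\<^sup>2 :: real)"
proof (rule Bochner_Integration.integrable_bound)
  show "integrable M (\<lambda>\<omega>. B\<^sup>2 * (Y \<omega>)\<^sup>2)" using assms by simp
  show "AE x in M. norm ((X x * Y x)\<^sup>2) \<le> norm (B\<^sup>2 * (Y x)\<^sup>2)"
  proof (rule AE_I2)
    fix \<omega> assume "\<omega> \<in> space M"
    then have "\<bar>X \<omega>\<bar> \<le> \<bar>B\<bar>" using bd by force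
    then have "(X \<omega>)\<^sup>2 \<le> B\<^sup>2" by (simp add: abs_le_square_iff)
    then show "norm ((X \<omega> * Y \<omega>)\<^sup>2) \<le> norm (B\<^sup>2 * (Y \<omega>)\<^sup>2)"
      by (simp add: power_mult_distrib mult_right_mono)
  qed
qed measurable

text \<open>The increment is written with \<open>\<xi> h / sqrt D\<close> for a \<open>D\<close>
  common to all steps, so that the cost of a step is proportional to its share \<alpha> and the
  shares can be added. The linear Taylor term has mean 0 by independence; the cross term and the
  pure increment give what remains.\<close>

lemma trunc_pow_step:
  assumes h: "L2fun h" and Y: "Y \<in> borel_measurable (orth_sigma h)" and X: "X \<in> borel_measurable (orth_sigma h)"
    and Ysq: "integrable M (\<lambda>\<omega>. (Y \<omega>)\<^sup>2)" and bd: "\<And>\<omega>. \<omega> \<in> space M \<Longrightarrow> \<bar>X \<omega>\<bar> \<le> B"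
    and D: "0 < D" "(\<integral>z. (h z)\<^sup>2 \<partial>lborel) \<le> D" and L: "0 \<le> L"
  defines "\<alpha> \<equiv> (\<integral>z. (h z)\<^sup>2 \<partial>lborel) / D"
  shows "(\<integral>\<omega>. trunc_pow q L (Y \<omega> + X \<omega> * \<xi> h \<omega>) \<partial>M)
    \<le> (1 + step_const q * \<alpha>) * (\<integral>\<omega>. trunc_pow q L (Y \<omega>) \<partial>M)
      + step_const q * \<alpha> * (\<integral>\<omega>. trunc_pow q L (sqrt D * X \<omega>) \<partial>M)"
proof -
  let ?N = "\<xi> h" and ?\<phi> = "trunc_pow q L" and ?v = "\<integral>z. (h z)\<^sup>2 \<partial>lborel"
  let ?C = "trunc_pow_const q" and ?c = "fact (2 * q + 2) / (2 ^ (q + 1) * fact (q + 1)) :: real"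
  note [measurable] = noise_measurable[OF h]
  note mY [measurable] = measurable_orth_sigma[OF Y]
  note mX [measurable] = measurable_orth_sigma[OF X]
  have \<alpha>: "0 \<le> \<alpha>" "\<alpha> \<le> 1" using D by (auto simp: \<alpha>_def)
  have C0: "0 \<le> ?C" by (simp add: trunc_pow_const_def)
  have Nsq: "integrable M (\<lambda>\<omega>. (?N \<omega>)\<^sup>2)" by (rule noise_integrable_power[OF h])
  have N1: "integrable M ?N" using noise_integrable_power[OF h, of 1] by simp
  have XN: "integrable M (\<lambda>\<omega>. (X \<omega> * ?N \<omega>)\<^sup>2)"
    by (rule bounded_times_square_integrable[OF _ _ bd Nsq]) auto
  have int\<phi>Y: "integrable M (\<lambda>\<omega>. ?\<phi> (Y \<omega>))" by (rule trunc_pow_integrable[OF _ Ysq L]) auto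
  have int\<phi>XD: "integrable M (\<lambda>\<omega>. ?\<phi> (sqrt D * X \<omega>))"
  proof (rule trunc_pow_integrable[OF _ _ L])
    show "integrable M (\<lambda>\<omega>. (sqrt D * X \<omega>)\<^sup>2)"
      using bounded_times_square_integrable[OF mX _ bd, of "\<lambda>_. sqrt D"] by (simp add: mult.commute)
  qed auto
  let ?S = "\<lambda>\<omega>. trunc_pow_slope q L (Y \<omega>) * X \<omega>"
  let ?Q = "\<lambda>\<omega>. (X \<omega>)\<^sup>2 * (min ((Y \<omega>)\<^sup>2) L) ^ q"
  have intY: "integrable M Y" by (rule square_integrable_imp_integrable[OF mY Ysq])
  have intS: "integrable M ?S"
  proof (rule Bochner_Integration.integrable_bound)
    show "integrable M (\<lambda>\<omega>. real (2 * q + 2) * L ^ q * \<bar>Y \<omega>\<bar> * \<bar>B\<bar>)" using intY by simp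
    show "AE x in M. norm (?S x) \<le> norm (real (2 * q + 2) * L ^ q * \<bar>Y x\<bar> * \<bar>B\<bar>)"
    proof (rule AE_I2)
      fix \<omega> assume "\<omega> \<in> space M"
      then have "\<bar>X \<omega>\<bar> \<le> \<bar>B\<bar>" using bd by force
      then have "\<bar>trunc_pow_slope q L (Y \<omega>)\<bar> * \<bar>X \<omega>\<bar> \<le> (real (2 * q + 2) * L ^ q * \<bar>Y \<omega>\<bar>) * \<bar>B\<bar>"
        by (intro mult_mono trunc_pow_slope_bound[OF L]) (use L in auto)
      then show "norm (?S \<omega>) \<le> norm (real (2 * q + 2) * L ^ q * \<bar>Y \<omega>\<bar> * \<bar>B\<bar>)"
        using L by (simp add: abs_mult)
    qed
  qed measurable
  have Sm: "?S \<in> borel_measurable (orth_sigma h)" using X Y by measurable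
  have Qm: "?Q \<in> borel_measurable (orth_sigma h)" using X Y by measurable
  have intQ: "integrable M ?Q"
  proof (rule integrable_bounded)
    fix \<omega> assume "\<omega> \<in> space M"
    then have "\<bar>X \<omega>\<bar> \<le> \<bar>B\<bar>" using bd by force
    then have XB: "(X \<omega>)\<^sup>2 \<le> B\<^sup>2" by (simp add: abs_le_square_iff)
    have "(X \<omega>)\<^sup>2 * (min ((Y \<omega>)\<^sup>2) L) ^ q \<le> B\<^sup>2 * L ^ q"
      by (intro mult_mono[OF XB] power_mono) (use L in auto)
    then show "norm (?Q \<omega>) \<le> B\<^sup>2 * L ^ q" using L by (simp add: abs_mult)
  qed measurable
  note S = orth_sigma_indep_mult[OF h Sm, of "\<lambda>x. x", OF _ intS N1, simplified]
  note Q = orth_sigma_indep_mult[OF h Qm, of "\<lambda>x. x\<^sup>2", OF _ intQ Nsq, simplified]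
  let ?R = "\<lambda>\<omega>. ?\<phi> (sqrt D * X \<omega>)"
  let ?f = "\<lambda>x. (x / sqrt D)\<^sup>2 + (x / sqrt D) ^ (2 * q + 2)"
  have intf: "integrable M (\<lambda>\<omega>. ?f (?N \<omega>))"
    using noise_integrable_power[OF h, of 2] noise_integrable_power[OF h, of "2 * q + 2"]
    by (simp add: power_divide)
  have Rm: "?R \<in> borel_measurable (orth_sigma h)" using X by measurable
  note R = orth_sigma_indep_mult[OF h Rm, of ?f, OF _ int\<phi>XD intf]
  have fmean: "(\<integral>\<omega>. ?f (?N \<omega>) \<partial>M) \<le> (1 + ?c) * \<alpha>"
  proof -
    have f_eq: "?f x = x\<^sup>2 / D + x ^ (2 * (q + 1)) / D ^ (q + 1)" for x
    proof -
      have sq: "(x / sqrt D)\<^sup>2 = x\<^sup>2 / D" using D by (simp add: power_divide)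
      have "2 * q + 2 = 2 * (q + 1)" by simp
      then have "(x / sqrt D) ^ (2 * q + 2) = ((x / sqrt D)\<^sup>2) ^ (q + 1)"
        by (simp only: power_mult)
      also have "\<dots> = x ^ (2 * (q + 1)) / D ^ (q + 1)"
        unfolding sq by (simp only: power_divide power_mult)
      finally show ?thesis using sq by simp
    qed
    have "(\<integral>\<omega>. ?f (?N \<omega>) \<partial>M) = (\<integral>\<omega>. (?N \<omega>)\<^sup>2 \<partial>M) / D + (\<integral>\<omega>. ?N \<omega> ^ (2 * (q + 1)) \<partial>M) / D ^ (q + 1)"
      unfolding f_eq
      using noise_integrable_power[OF h, of 2] noise_integrable_power[OF h, of "2 * (q + 1)"]
      by (simp del: power_Suc)
    also have "\<dots> = \<alpha> + ?c * \<alpha> ^ (q + 1)"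
      unfolding noise_variance[OF h] noise_moment_even[OF h] by (simp add: \<alpha>_def power_divide)
    finally have eq: "(\<integral>\<omega>. ?f (?N \<omega>) \<partial>M) = \<alpha> + ?c * \<alpha> ^ (q + 1)" .
    \<comment> \<open>Here \<alpha> \<le> 1 enters: the contribution of the Gaussian moment of order
      \<open>2 * q + 2\<close> also becomes linear in the share.\<close>
    have "\<alpha> ^ (q + 1) \<le> \<alpha>" using \<alpha> power_decreasing[of 1 "q + 1" \<alpha>] by simp
    moreover have "0 \<le> ?c" by (intro divide_nonneg_nonneg) simp_all
    ultimately have "?c * \<alpha> ^ (q + 1) \<le> ?c * \<alpha>" by (rule mult_left_mono)
    then show ?thesis unfolding eq by (simp only: distrib_right mult_1_left add_le_cancel_left)
  qed
  have pointwise: "?\<phi> (Y \<omega> + X \<omega> * ?N \<omega>)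
     \<le> ?\<phi> (Y \<omega>) + ?S \<omega> * ?N \<omega> + ?C * (?Q \<omega> * (?N \<omega>)\<^sup>2) + ?C * (?R \<omega> * ?f (?N \<omega>))" for \<omega>
  proof -
    let ?h = "X \<omega> * ?N \<omega>"
    have "?\<phi> ?h = ?\<phi> ((sqrt D * X \<omega>) * (?N \<omega> / sqrt D))" using D by simp
    also have "\<dots> \<le> ?R \<omega> * ?f (?N \<omega>)" by (rule trunc_pow_mult[OF L])
    finally have "?C * ?\<phi> ?h \<le> ?C * (?R \<omega> * ?f (?N \<omega>))" by (rule mult_left_mono[OF _ C0])
    moreover have "?C * ?h\<^sup>2 * ((min ((Y \<omega>)\<^sup>2) L) ^ q + (min (?h\<^sup>2) L) ^ q)
       = ?C * (?Q \<omega> * (?N \<omega>)\<^sup>2) + ?C * ?\<phi> ?h"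
      by (simp add: trunc_pow_def power_mult_distrib algebra_simps)
    ultimately show ?thesis using trunc_pow_taylor[OF L, of q "Y \<omega>" ?h] by (simp add: mult.assoc)
  qed
  have "(\<integral>\<omega>. ?\<phi> (Y \<omega> + X \<omega> * ?N \<omega>) \<partial>M) \<le>
     (\<integral>\<omega>. ?\<phi> (Y \<omega>) + ?S \<omega> * ?N \<omega> + ?C * (?Q \<omega> * (?N \<omega>)\<^sup>2) + ?C * (?R \<omega> * ?f (?N \<omega>)) \<partial>M)"
  proof (rule integral_mono)
    show "integrable M (\<lambda>\<omega>. ?\<phi> (Y \<omega> + X \<omega> * ?N \<omega>))"
      by (rule trunc_pow_integrable[OF _ square_integrable_add[OF mY _ Ysq XN] L]) auto
    show "integrable M (\<lambda>\<omega>. ?\<phi> (Y \<omega>) + ?S \<omega> * ?N \<omega> + ?C * (?Q \<omega> * (?N \<omega>)\<^sup>2) + ?C * (?R \<omega> * ?f (?N \<omega>)))"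
      by (intro Bochner_Integration.integrable_add integrable_mult_right int\<phi>Y S(1) Q(1) R(1)) measurable
  qed (rule pointwise)
  also have "\<dots> = (\<integral>\<omega>. ?\<phi> (Y \<omega>) \<partial>M) + (\<integral>\<omega>. ?S \<omega> * ?N \<omega> \<partial>M) + ?C * (\<integral>\<omega>. ?Q \<omega> * (?N \<omega>)\<^sup>2 \<partial>M)
     + ?C * (\<integral>\<omega>. ?R \<omega> * ?f (?N \<omega>) \<partial>M)"
  proof -
    have f: "?f \<in> borel_measurable borel" by measurable
    show ?thesis
      by (simp only: Bochner_Integration.integral_add Bochner_Integration.integrable_add
        integrable_mult_right integral_mult_right_zero int\<phi>Y S(1) Q(1) R(1)[OF f])
  qed
  also have "(\<integral>\<omega>. ?S \<omega> * ?N \<omega> \<partial>M) = 0" using S(2) noise_mean[OF h] by simp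
  also have "(\<integral>\<omega>. ?Q \<omega> * (?N \<omega>)\<^sup>2 \<partial>M) = (\<integral>\<omega>. ?Q \<omega> \<partial>M) * ?v" using Q(2) noise_variance[OF h] by simp
  also have "\<dots> \<le> ((\<integral>\<omega>. ?\<phi> (Y \<omega>) \<partial>M) + (\<integral>\<omega>. ?\<phi> (sqrt D * X \<omega>) \<partial>M)) * \<alpha>"
  proof -
    \<comment> \<open>Since \<open>D * \<alpha>\<close> is the variance, the factor \<open>D\<close>
      can be moved into the cross term, where it makes \<open>sqrt D * X\<close> out of
      \<open>X\<close> before the two variables are separated.\<close>
    have "(\<integral>\<omega>. D * ?Q \<omega> \<partial>M) \<le> (\<integral>\<omega>. ?\<phi> (sqrt D * X \<omega>) + ?\<phi> (Y \<omega>) \<partial>M)"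
    proof (rule integral_mono)
      show "integrable M (\<lambda>\<omega>. D * ?Q \<omega>)" using intQ by simp
      show "D * ?Q \<omega> \<le> ?\<phi> (sqrt D * X \<omega>) + ?\<phi> (Y \<omega>)" for \<omega>
        using trunc_pow_cross[OF L, of "sqrt D * X \<omega>" "Y \<omega>" q] D by (simp add: power_mult_distrib)
    qed (use int\<phi>XD int\<phi>Y in simp)
    then have "D * (\<integral>\<omega>. ?Q \<omega> \<partial>M) * \<alpha> \<le> ((\<integral>\<omega>. ?\<phi> (Y \<omega>) \<partial>M) + (\<integral>\<omega>. ?\<phi> (sqrt D * X \<omega>) \<partial>M)) * \<alpha>"
      using int\<phi>XD int\<phi>Y \<alpha> by (intro mult_right_mono) (auto simp: add.commute)
    moreover have "D * (\<integral>\<omega>. ?Q \<omega> \<partial>M) * \<alpha> = (\<integral>\<omega>. ?Q \<omega> \<partial>M) * ?v" using D by (simp add: \<alpha>_def)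
    ultimately show ?thesis by simp
  qed
  also have "(\<integral>\<omega>. ?R \<omega> * ?f (?N \<omega>) \<partial>M) \<le> (\<integral>\<omega>. ?R \<omega> \<partial>M) * ((1 + ?c) * \<alpha>)"
  proof -
    have f: "?f \<in> borel_measurable borel" by measurable
    have "0 \<le> (\<integral>\<omega>. ?R \<omega> \<partial>M)" using trunc_pow_nonneg[OF L] by (intro Bochner_Integration.integral_nonneg) auto
    then show ?thesis unfolding R(2)[OF f] by (intro mult_left_mono fmean)
  qed
  finally have *: "(\<integral>\<omega>. ?\<phi> (Y \<omega> + X \<omega> * ?N \<omega>) \<partial>M)
    \<le> (\<integral>\<omega>. ?\<phi> (Y \<omega>) \<partial>M) + 0 + ?C * (((\<integral>\<omega>. ?\<phi> (Y \<omega>) \<partial>M) + (\<integral>\<omega>. ?R \<omega> \<partial>M)) * \<alpha>)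
      + ?C * ((\<integral>\<omega>. ?R \<omega> \<partial>M) * ((1 + ?c) * \<alpha>))"
    using C0 by (simp add: mult_left_mono)
  have y0: "0 \<le> (\<integral>\<omega>. ?\<phi> (Y \<omega>) \<partial>M)" using trunc_pow_nonneg[OF L] by (intro Bochner_Integration.integral_nonneg) auto
  \<comment> \<open>The coefficient of the moment of \<open>Y\<close> is enlarged so that both terms
    carry \<open>step_const\<close>. Of its second factor, 1 stems from the cross term, and another
    1 plus the Gaussian moment from the pure increment.\<close>
  have "0 \<le> ?C * ((1 + ?c) * \<alpha>) * (\<integral>\<omega>. ?\<phi> (Y \<omega>) \<partial>M)"
    using C0 \<alpha> y0 by (intro mult_nonneg_nonneg) auto
  then show ?thesis using * unfolding step_const_def by (simp add: algebra_simps)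
qed

section \<open>Moments of simple processes\<close>

lemma nat_filt_generators:
  "{\<xi> (indicator (rect a b c d)) -` B \<inter> space M | a b c d B. 0 \<le> a \<and> a \<le> b \<and> b \<le> t \<and> B \<in> sets borel}
      \<union> {N \<in> sets M. emeasure M N = 0} \<subseteq> Pow (space M)"
  using sets.sets_into_space by auto

lemma space_nat_filt [simp]: "space (nat_filt M \<xi> t) = space M"
  unfolding nat_filt_def by (rule space_measure_of_conv)

lemma sets_nat_filt:
  "sets (nat_filt M \<xi> t) = sigma_sets (space M)
    ({\<xi> (indicator (rect a b c d)) -` B \<inter> space M | a b c d B. 0 \<le> a \<and> a \<le> b \<and> b \<le> t \<and> B \<in> sets borel}
      \<union> {N \<in> sets M. emeasure M N = 0})"
  unfolding nat_filt_def by (rule sets_measure_of[OF nat_filt_generators])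

lemma rect_borel [measurable]: "rect a b c d \<in> sets borel"
  unfolding rect_def by (simp add: borel_Times)

lemma emeasure_rect: "emeasure lborel (rect a b c d) < \<infinity>"
proof -
  have "emeasure lborel (rect a b c d) = emeasure lborel {a<..b} * emeasure lborel {c<..d}"
    unfolding rect_def lborel_prod[symmetric] by (rule lborel.emeasure_pair_measure_Times) auto
  also have "\<dots> < \<infinity>"
    by (cases "a \<le> b"; cases "c \<le> d") (auto simp: ennreal_mult_less_top)
  finally show ?thesis .
qed

lemma L2fun_rect: "L2fun (indicator (rect a b c d))"
  by (rule L2fun_indicator) (auto simp: emeasure_rect[simplified])

lemma nat_filt_mono:
  assumes "s \<le> t" "X \<in> borel_measurable (nat_filt M \<xi> s)"
  shows "X \<in> borel_measurable (nat_filt M \<xi> t)"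
proof -
  have "b \<le> t" if "b \<le> s" for b using assms(1) that by simp
  then have "sets (nat_filt M \<xi> s) \<subseteq> sets (nat_filt M \<xi> t)"
    unfolding sets_nat_filt by (intro sigma_sets_mono' Un_mono) blast+
  then show ?thesis using assms(2) by (auto simp: measurable_def)
qed

text \<open>Adaptedness turns into independence: rectangles that end by \<open>t\<close> do not meet
  a set after \<open>t\<close>, so their indicators are orthogonal to that of
  \<open>A\<close>.\<close>

lemma nat_filt_subset_orth_sigma:
  assumes A: "A \<in> sets borel" "emeasure lborel A < \<infinity>" "A \<subseteq> {t<..} \<times> UNIV"
    and X: "X \<in> borel_measurable (nat_filt M \<xi> t)"
  shows "X \<in> borel_measurable (orth_sigma (indicator A))"
proof -
  have "indicator (rect a b c d) \<in> orth (indicator A)" if "b \<le> t" for a b c d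
  proof -
    have 0: "indicat_real (rect a b c d) z * indicator A z = 0" for z
      using that A(3) by (auto simp: rect_def indicator_def)
    have "(\<integral>z. indicat_real (rect a b c d) z * indicator A z \<partial>lborel) = 0"
      unfolding 0 by simp
    then show ?thesis by (simp add: orth_def L2fun_rect)
  qed
  then have "sets (nat_filt M \<xi> t) \<subseteq> sets (orth_sigma (indicator A))"
    unfolding sets_nat_filt sets_orth_sigma by (intro sigma_sets_mono') blast
  then show ?thesis using X by (auto simp: measurable_def)
qed

text \<open>The empty set lies after every time, so the comparison with \<open>orth_sigma\<close>
  applies.\<close>

lemma measurable_nat_filt: "X \<in> borel_measurable (nat_filt M \<xi> t) \<Longrightarrow> X \<in> borel_measurable M"
  by (rule measurable_orth_sigma[of _ "indicator {}"], rule nat_filt_subset_orth_sigma[of _ t]) auto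

lemma square_integral_indicator:
  assumes "A \<in> sets borel"
  shows "(\<integral>z. (indicator A z)\<^sup>2 \<partial>lborel) = measure lborel (A :: (real \<times> real) set)"
proof -
  have "(indicator A z)\<^sup>2 = (indicator A z :: real)" for z by (auto simp: indicator_def)
  then show ?thesis using assms by simp
qed

text \<open>The induction adds the index with the latest \<open>a\<close> last. The earlier
  coefficients are then known at its start, and the earlier noise terms are orthogonal to the new
  one by disjointness alone, even where their sets reach beyond that start. Each step multiplies the
  bound by at most \<open>exp (step_const q * \<alpha> x)\<close>.\<close>

lemma orthogonal_sum_moment:
  fixes A :: "'i \<Rightarrow> (real \<times> real) set" and X :: "'i \<Rightarrow> 'a \<Rightarrow> real" and a :: "'i \<Rightarrow> real"
  assumes "finite S"
    and X: "\<And>i. i \<in> S \<Longrightarrow> X i \<in> borel_measurable (nat_filt M \<xi> (a i))"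
    and bd: "\<And>i. i \<in> S \<Longrightarrow> \<exists>B. \<forall>\<omega>\<in>space M. \<bar>X i \<omega>\<bar> \<le> B"
    and A: "\<And>i. i \<in> S \<Longrightarrow> A i \<in> sets borel" "\<And>i. i \<in> S \<Longrightarrow> emeasure lborel (A i) < \<infinity>"
      "\<And>i. i \<in> S \<Longrightarrow> A i \<subseteq> {a i<..} \<times> UNIV" "disjoint_family_on A S"
    and D: "0 < D" "\<And>i. i \<in> S \<Longrightarrow> measure lborel (A i) \<le> D" and L: "0 \<le> L"
  defines "\<alpha> \<equiv> \<lambda>i. measure lborel (A i) / D"
  shows "(\<lambda>\<omega>. \<Sum>i\<in>S. X i \<omega> * \<xi> (indicator (A i)) \<omega>) \<in> borel_measurable M
    \<and> integrable M (\<lambda>\<omega>. (\<Sum>i\<in>S. X i \<omega> * \<xi> (indicator (A i)) \<omega>)\<^sup>2)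
    \<and> (\<integral>\<omega>. trunc_pow q L (\<Sum>i\<in>S. X i \<omega> * \<xi> (indicator (A i)) \<omega>) \<partial>M)
     \<le> exp (step_const q * (\<Sum>i\<in>S. \<alpha> i)) * step_const q
        * (\<Sum>i\<in>S. \<alpha> i * (\<integral>\<omega>. trunc_pow q L (sqrt D * X i \<omega>) \<partial>M))"
  using \<open>finite S\<close> X bd A D(2)
proof (induction S rule: finite_ranking_induct[where f = a])
  case empty
  then show ?case by simp
next
  case (insert x S)
  show ?case
  proof (cases "x \<in> S")
    case True
    then have "insert x S = S" by auto
    then show ?thesis using insert by simp
  next
    case False
    let ?h = "indicator (A x) :: real \<times> real \<Rightarrow> real"
    let ?Y = "\<lambda>\<omega>. \<Sum>i\<in>S. X i \<omega> * \<xi> (indicator (A i)) \<omega>"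
    let ?C = "step_const q"
    let ?E = "\<lambda>i. \<integral>\<omega>. trunc_pow q L (sqrt D * X i \<omega>) \<partial>M"
    have C0: "0 \<le> ?C" by (rule step_const_nonneg)
    have L2: "L2fun (indicator (A i))" if "i \<in> insert x S" for i
      using insert that by (intro L2fun_indicator) auto
    have Ax: "A x \<in> sets borel" "emeasure lborel (A x) < \<infinity>" "A x \<subseteq> {a x<..} \<times> UNIV" using insert by auto
    have Xo: "X i \<in> borel_measurable (orth_sigma ?h)" if "i \<in> insert x S" for i
      by (rule nat_filt_subset_orth_sigma[OF Ax nat_filt_mono[of "a i"]]) (use insert that in auto)
    have No: "\<xi> (indicator (A i)) \<in> borel_measurable (orth_sigma ?h)" if "i \<in> S" for i
    proof (rule noise_orth_sigma)
      have "A i \<inter> A x = {}" using insert.prems(6) that False by (auto simp: disjoint_family_on_def)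
      then have 0: "indicat_real (A i) z * ?h z = 0" for z by (auto simp: indicator_def)
      have "(\<integral>z. indicat_real (A i) z * ?h z \<partial>lborel) = 0"
        unfolding 0 by simp
      then show "indicator (A i) \<in> orth ?h" using L2 that by (simp add: orth_def)
    qed
    have Yo: "?Y \<in> borel_measurable (orth_sigma ?h)" using Xo No by measurable
    have IH: "?Y \<in> borel_measurable M" "integrable M (\<lambda>\<omega>. (?Y \<omega>)\<^sup>2)"
      "(\<integral>\<omega>. trunc_pow q L (?Y \<omega>) \<partial>M) \<le> exp (?C * (\<Sum>i\<in>S. \<alpha> i)) * ?C * (\<Sum>i\<in>S. \<alpha> i * ?E i)"
      using insert by (auto simp: disjoint_family_on_def)
    obtain B where B: "\<And>\<omega>. \<omega> \<in> space M \<Longrightarrow> \<bar>X x \<omega>\<bar> \<le> B" using insert.prems(2)[of x] by auto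
    have Xx: "X x \<in> borel_measurable M" "\<xi> ?h \<in> borel_measurable M"
      using Xo[of x] measurable_orth_sigma noise_measurable[OF L2[of x]] by auto
    have eq: "(\<Sum>i\<in>insert x S. X i \<omega> * \<xi> (indicator (A i)) \<omega>) = ?Y \<omega> + X x \<omega> * \<xi> ?h \<omega>" for \<omega>
      using False insert.hyps(1) by simp
    have sqx: "integrable M (\<lambda>\<omega>. (X x \<omega> * \<xi> ?h \<omega>)\<^sup>2)"
      by (rule bounded_times_square_integrable[OF Xx B noise_integrable_power[OF L2[of x]]]) auto
    have m: "(\<lambda>\<omega>. \<Sum>i\<in>insert x S. X i \<omega> * \<xi> (indicator (A i)) \<omega>) \<in> borel_measurable M"
      unfolding eq using IH(1) Xx by measurable
    have sq: "integrable M (\<lambda>\<omega>. (\<Sum>i\<in>insert x S. X i \<omega> * \<xi> (indicator (A i)) \<omega>)\<^sup>2)"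
      unfolding eq by (rule square_integrable_add[OF IH(1) _ IH(2) sqx]) (use Xx in measurable)
    have hx: "(\<integral>z. (?h z)\<^sup>2 \<partial>lborel) = measure lborel (A x)" by (rule square_integral_indicator[OF Ax(1)])
    have step: "(\<integral>\<omega>. trunc_pow q L (?Y \<omega> + X x \<omega> * \<xi> ?h \<omega>) \<partial>M)
      \<le> (1 + ?C * \<alpha> x) * (\<integral>\<omega>. trunc_pow q L (?Y \<omega>) \<partial>M) + ?C * \<alpha> x * ?E x"
      using trunc_pow_step[OF L2[of x] Yo Xo[of x] IH(2) B D(1) _ L, of q] insert.prems(7)[of x]
      unfolding \<alpha>_def hx by auto
    have \<alpha>0: "0 \<le> \<alpha> i" for i using D(1) by (simp add: \<alpha>_def)
    have E0: "0 \<le> ?E i" for i using trunc_pow_nonneg[OF L] by (intro Bochner_Integration.integral_nonneg) auto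
    let ?s = "\<Sum>i\<in>S. \<alpha> i" and ?b = "\<Sum>i\<in>S. \<alpha> i * ?E i"
    have b0: "0 \<le> ?b" using \<alpha>0 E0 by (intro sum_nonneg mult_nonneg_nonneg) auto
    have s0: "0 \<le> ?s" using \<alpha>0 by (intro sum_nonneg) auto
    have "(1 + ?C * \<alpha> x) * (\<integral>\<omega>. trunc_pow q L (?Y \<omega>) \<partial>M)
       \<le> exp (?C * \<alpha> x) * (exp (?C * ?s) * ?C * ?b)"
      using IH(3) C0 \<alpha>0 b0 trunc_pow_nonneg[OF L]
      by (intro mult_mono exp_ge_add_one_self Bochner_Integration.integral_nonneg) auto
    also have "\<dots> = exp (?C * (\<alpha> x + ?s)) * ?C * ?b"
      by (simp add: exp_add distrib_left)
    finally have 1: "(1 + ?C * \<alpha> x) * (\<integral>\<omega>. trunc_pow q L (?Y \<omega>) \<partial>M) \<le> exp (?C * (\<alpha> x + ?s)) * ?C * ?b" .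
    \<comment> \<open>The new term is given the full exponential factor, so that both contributions
      carry the same prefactor.\<close>
    have "1 * (?C * (\<alpha> x * ?E x)) \<le> exp (?C * (\<alpha> x + ?s)) * (?C * (\<alpha> x * ?E x))"
      using C0 \<alpha>0 s0 E0 by (intro mult_right_mono) auto
    with 1 step have "(\<integral>\<omega>. trunc_pow q L (?Y \<omega> + X x \<omega> * \<xi> ?h \<omega>) \<partial>M)
       \<le> exp (?C * (\<alpha> x + ?s)) * ?C * (\<alpha> x * ?E x + ?b)"
      by (simp add: distrib_left mult.assoc)
    then show ?thesis using m sq unfolding eq using False insert.hyps(1) by simp
  qed
qed

text \<open>The intersection of a rectangle with \<open>D\<close> need not be a rectangle, so this
  is in general not the integral of another simple process and is expressed by the noise
  directly.\<close>

definition sp_int_on :: "(real \<times> real) set \<Rightarrow> 'a sp \<Rightarrow> 'a \<Rightarrow> real" where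
  "sp_int_on D R \<omega> = sum_list (map (\<lambda>(X, a, b, c, d). X \<omega> * \<xi> (indicator (rect a b c d \<inter> D)) \<omega>) R)"

definition sp_coeff :: "'a sp \<Rightarrow> nat \<Rightarrow> 'a \<Rightarrow> real" where
  "sp_coeff R i = fst (R ! i)"

definition sp_rect :: "'a sp \<Rightarrow> nat \<Rightarrow> (real \<times> real) set" where
  "sp_rect R i = (case R ! i of (X, a, b, c, d) \<Rightarrow> rect a b c d)"

definition sp_start :: "'a sp \<Rightarrow> nat \<Rightarrow> real" where
  "sp_start R i = fst (snd (R ! i))"

lemma sp_int_on_eq: "sp_int_on D R \<omega> = (\<Sum>i<length R. sp_coeff R i \<omega> * \<xi> (indicator (sp_rect R i \<inter> D)) \<omega>)"
  unfolding sp_int_on_def sum_list_sum_nth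
  by (simp add: atLeast0LessThan sp_coeff_def sp_rect_def split_beta)

lemma sp_int_eq: "sp_int \<xi> R \<omega> = (\<Sum>i<length R. sp_coeff R i \<omega> * \<xi> (indicator (sp_rect R i)) \<omega>)"
  unfolding sp_int_def sum_list_sum_nth
  by (simp add: atLeast0LessThan sp_coeff_def sp_rect_def split_beta)

lemma sp_fun_eq: "sp_fun R z \<omega> = (\<Sum>i<length R. sp_coeff R i \<omega> * indicator (sp_rect R i) z)"
  unfolding sp_fun_def sum_list_sum_nth
  by (simp add: atLeast0LessThan sp_coeff_def sp_rect_def split_beta)

lemma sp_validD:
  assumes "sp_valid M \<xi> R" "i < length R"
  shows "sp_coeff R i \<in> borel_measurable (nat_filt M \<xi> (sp_start R i))"
    and "\<exists>B. \<forall>\<omega>\<in>space M. \<bar>sp_coeff R i \<omega>\<bar> \<le> B"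
    and "sp_rect R i \<in> sets borel" "emeasure lborel (sp_rect R i) < \<infinity>"
    and "sp_rect R i \<subseteq> {sp_start R i<..} \<times> UNIV"
    and "sp_coeff R i \<in> borel_measurable M"
proof -
  obtain X a b c d where R: "R ! i = (X, a, b, c, d)" by (cases "R ! i") auto
  have "(X, a, b, c, d) \<in> set R" using nth_mem[OF assms(2)] R by simp
  with assms(1) have "X \<in> borel_measurable (nat_filt M \<xi> a)" "\<exists>B. \<forall>\<omega>\<in>space M. \<bar>X \<omega>\<bar> \<le> B"
    unfolding sp_valid_def by auto
  moreover have "sp_coeff R i = X" "sp_start R i = a" "sp_rect R i = rect a b c d"
    using R by (simp_all add: sp_coeff_def sp_start_def sp_rect_def)
  moreover have "rect a b c d \<subseteq> {a<..} \<times> UNIV" by (auto simp: rect_def)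
  ultimately show "sp_coeff R i \<in> borel_measurable (nat_filt M \<xi> (sp_start R i))"
    and "\<exists>B. \<forall>\<omega>\<in>space M. \<bar>sp_coeff R i \<omega>\<bar> \<le> B"
    and "sp_rect R i \<in> sets borel" "emeasure lborel (sp_rect R i) < \<infinity>"
    and "sp_rect R i \<subseteq> {sp_start R i<..} \<times> UNIV"
    and "sp_coeff R i \<in> borel_measurable M"
    by (simp_all only: rect_borel emeasure_rect) (rule measurable_nat_filt)
qed

text \<open>The Gronwall factor for pieces whose shares of the area add up to at most 1.\<close>

definition moment_const :: "nat \<Rightarrow> real" where
  "moment_const q = exp (step_const q) * step_const q"

lemma moment_const_nonneg: "0 \<le> moment_const q"
  by (simp add: moment_const_def step_const_nonneg)

text \<open>The rectangles of a simple process may overlap. The atoms they generate are disjoint, and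
  on an atom the process is the sum of the coefficients of the rectangles containing it, which is
  known at the latest of their starting times.\<close>

lemma sp_moment:
  assumes R: "sp_valid M \<xi> R" and D: "D \<in> sets borel" "emeasure lborel D \<le> ennreal A"
    and A: "0 < A" and L: "0 \<le> L"
  shows "(\<integral>\<^sup>+\<omega>. ennreal (trunc_pow q L (sp_int_on D R \<omega>)) \<partial>M)
    \<le> ennreal (moment_const q / A) *
      (\<integral>\<^sup>+z. indicator D z * (\<integral>\<^sup>+\<omega>. ennreal (trunc_pow q L (sqrt A * sp_fun R z \<omega>)) \<partial>M) \<partial>lborel)"
proof -
  define n where "n = length R"
  define X where "X = sp_coeff R"
  define r where "r = sp_rect R"
  define atom where "atom S = {z \<in> D. \<forall>i<n. z \<in> r i \<longleftrightarrow> i \<in> S}" for S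
  define XS where "XS S \<omega> = (\<Sum>i\<in>S. X i \<omega>)" for S \<omega>
  define aS where "aS S = Max (sp_start R ` S)" for S
  \<comment> \<open>The empty pattern is left out: on that part of \<open>D\<close> the process
    vanishes.\<close>
  define I where "I = Pow {..<n} - {{}}"
  note V = sp_validD[OF R, folded n_def X_def r_def]
  have finI: "finite I" by (simp add: I_def)
  have I: "S \<subseteq> {..<n}" "finite S" "S \<noteq> {}" if "S \<in> I" for S
    using that finite_subset[of S "{..<n}"] by (auto simp: I_def)
  have at_borel: "atom S \<in> sets borel" for S
  proof -
    have "(if i \<in> S then r i else - r i) \<in> sets borel" if "i < n" for i
      using V(3)[OF that] by auto
    then have "D \<inter> (\<Inter>i\<in>{..<n}. if i \<in> S then r i else - r i) \<in> sets borel" if "0 < n"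
      using that D(1) by (intro sets.Int sets.finite_INT) auto
    moreover have "atom S = D \<inter> (\<Inter>i\<in>{..<n}. if i \<in> S then r i else - r i)" if "0 < n"
      unfolding atom_def using that by (auto split: if_splits)
    moreover have "atom S = D" if "n = 0" using that by (simp add: atom_def)
    ultimately show ?thesis using D(1) by (cases "n = 0") simp_all
  qed
  have at_fin: "emeasure lborel (atom S) \<le> ennreal A" for S
    by (rule order_trans[OF emeasure_mono D(2)]) (use D(1) in \<open>auto simp: atom_def\<close>)
  have disj: "disjoint_family_on atom I"
    unfolding disjoint_family_on_def
  proof (intro ballI impI)
    fix S T assume ST: "S \<in> I" "T \<in> I" "S \<noteq> T"
    then obtain i where "i < n" "(i \<in> S) \<noteq> (i \<in> T)" using I by blast
    then show "atom S \<inter> atom T = {}" by (auto simp: atom_def)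
  qed
  have sub: "atom S \<subseteq> {aS S<..} \<times> UNIV" if S: "S \<in> I" for S
  proof -
    have "aS S \<in> sp_start R ` S" unfolding aS_def using I[OF S] by (intro Max_in) auto
    then obtain i where i: "i \<in> S" "aS S = sp_start R i" by auto
    then have "i < n" using I[OF S] by auto
    then have "atom S \<subseteq> r i" using i by (auto simp: atom_def)
    then show ?thesis using V(5)[OF \<open>i < n\<close>] i by auto
  qed
  have XSm: "XS S \<in> borel_measurable (nat_filt M \<xi> (aS S))" if S: "S \<in> I" for S
    unfolding XS_def
  proof (rule borel_measurable_sum)
    fix i assume i: "i \<in> S"
    then have "sp_start R i \<le> aS S" unfolding aS_def using I[OF S] by (intro Max_ge) auto
    then show "X i \<in> borel_measurable (nat_filt M \<xi> (aS S))"
      using V(1)[of i] i I[OF S] by (auto intro: nat_filt_mono)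
  qed
  have XSb: "\<exists>B. \<forall>\<omega>\<in>space M. \<bar>XS S \<omega>\<bar> \<le> B" if S: "S \<in> I" for S
  proof -
    have "\<forall>i\<in>S. \<exists>B. \<forall>\<omega>\<in>space M. \<bar>X i \<omega>\<bar> \<le> B" using V(2) I[OF S] by auto
    then obtain B where "\<forall>i\<in>S. \<forall>\<omega>\<in>space M. \<bar>X i \<omega>\<bar> \<le> B i" by metis
    then have "\<forall>\<omega>\<in>space M. \<bar>XS S \<omega>\<bar> \<le> (\<Sum>i\<in>S. B i)"
      unfolding XS_def by (auto intro!: order_trans[OF sum_abs] sum_mono)
    then show ?thesis by blast
  qed
  let ?M = "\<lambda>\<omega>. \<Sum>S\<in>I. XS S \<omega> * \<xi> (indicator (atom S)) \<omega>"
  have fin: "emeasure lborel (atom S) < \<infinity>" for S using at_fin[of S] by (simp add: less_top order_le_less_trans)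
  have meas_le: "measure lborel (atom S) \<le> A" for S
    unfolding measure_def by (rule enn2real_leI) (use at_fin[of S] A in auto)
  have moment: "?M \<in> borel_measurable M" "integrable M (\<lambda>\<omega>. (?M \<omega>)\<^sup>2)"
    "(\<integral>\<omega>. trunc_pow q L (?M \<omega>) \<partial>M)
     \<le> exp (step_const q * (\<Sum>S\<in>I. measure lborel (atom S) / A)) * step_const q
        * (\<Sum>S\<in>I. measure lborel (atom S) / A * (\<integral>\<omega>. trunc_pow q L (sqrt A * XS S \<omega>) \<partial>M))"
    using orthogonal_sum_moment[OF finI XSm XSb at_borel fin sub disj A meas_le L] by auto
  \<comment> \<open>Disjointness keeps the total share at most 1, however many rectangles the
    process has; the constant is therefore the same for all simple processes.\<close>
  have sum_le: "(\<Sum>S\<in>I. measure lborel (atom S) / A) \<le> 1"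
  proof -
    have "(\<Sum>S\<in>I. measure lborel (atom S)) = measure lborel (\<Union>S\<in>I. atom S)"
      by (rule measure_finite_Union [symmetric]) (use finI disj at_borel fin in \<open>auto simp: less_top\<close>)
    also have "\<dots> \<le> A"
    proof -
      have "emeasure lborel (\<Union>S\<in>I. atom S) \<le> ennreal A"
        by (rule order_trans[OF emeasure_mono D(2)]) (use D(1) in \<open>auto simp: atom_def\<close>)
      then show ?thesis using A unfolding measure_def by (intro enn2real_leI) auto
    qed
    finally show ?thesis using A by (simp add: sum_divide_distrib [symmetric])
  qed
  let ?E = "\<lambda>S. \<integral>\<omega>. trunc_pow q L (sqrt A * XS S \<omega>) \<partial>M"
  have E0: "0 \<le> ?E S" for S using trunc_pow_nonneg[OF L] by (intro Bochner_Integration.integral_nonneg) auto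
  have b0: "0 \<le> (\<Sum>S\<in>I. measure lborel (atom S) / A * ?E S)"
    using E0 A by (intro sum_nonneg mult_nonneg_nonneg) auto
  have real_bound: "(\<integral>\<omega>. trunc_pow q L (?M \<omega>) \<partial>M) \<le> moment_const q / A * (\<Sum>S\<in>I. measure lborel (atom S) * ?E S)"
  proof -
    have "exp (step_const q * (\<Sum>S\<in>I. measure lborel (atom S) / A)) * step_const q \<le> moment_const q"
      unfolding moment_const_def using step_const_nonneg[of q] mult_left_mono[OF sum_le step_const_nonneg[of q]]
      by (intro mult_right_mono) auto
    from mult_right_mono[OF this b0] moment(3)
    have "(\<integral>\<omega>. trunc_pow q L (?M \<omega>) \<partial>M) \<le> moment_const q * (\<Sum>S\<in>I. measure lborel (atom S) / A * ?E S)"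
      by linarith
    also have "(\<Sum>S\<in>I. measure lborel (atom S) / A * ?E S) = (\<Sum>S\<in>I. measure lborel (atom S) * ?E S) / A"
      by (simp add: sum_divide_distrib)
    finally show ?thesis by simp
  qed
  have L2at: "L2fun (indicator (atom S))" for S by (rule L2fun_indicator[OF at_borel fin])
  have AE_eq: "AE \<omega> in M. sp_int_on D R \<omega> = ?M \<omega>"
  proof -
    \<comment> \<open>Each restricted rectangle is the disjoint union of the atoms whose pattern
      contains its index. Additivity of the noise holds almost everywhere, which suffices for
      moments.\<close>
    have "AE \<omega> in M. \<xi> (indicator (r i \<inter> D)) \<omega> = (\<Sum>S\<in>{S\<in>I. i \<in> S}. \<xi> (indicator (atom S)) \<omega>)"
      if i: "i < n" for i
    proof -
      have "indicator (r i \<inter> D) = (\<lambda>z. \<Sum>S\<in>{S\<in>I. i \<in> S}. indicat_real (atom S) z)"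
      proof
        fix z
        let ?S = "{i. i < n \<and> z \<in> r i}"
        show "indicator (r i \<inter> D) z = (\<Sum>S\<in>{S\<in>I. i \<in> S}. indicat_real (atom S) z)"
        proof (cases "z \<in> r i \<inter> D")
          case True
          then have z: "z \<in> atom ?S" "?S \<in> {S\<in>I. i \<in> S}" using i by (auto simp: atom_def I_def)
          have "S = ?S" if "z \<in> atom S" "S \<in> I" for S
            using that I(1)[of S] by (auto simp: atom_def)
          then have "indicat_real (atom S) z = 0" if "S \<in> {S\<in>I. i \<in> S} - {?S}" for S
            using that by (cases "z \<in> atom S") auto
          then have "(\<Sum>S\<in>{S\<in>I. i \<in> S}. indicat_real (atom S) z) = indicator (atom ?S) z"
            using z finI by (subst sum.remove[of _ ?S]) auto
          then show ?thesis using True z by simp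
        next
          case False
          then have "\<forall>S\<in>{S\<in>I. i \<in> S}. indicat_real (atom S) z = 0" using i by (auto simp: atom_def indicator_def)
          then show ?thesis using False by simp
        qed
      qed
      then show ?thesis using noise_sum[of "{S\<in>I. i \<in> S}" "\<lambda>S. indicator (atom S)"] finI L2at by simp
    qed
    then have "AE \<omega> in M. \<forall>i\<in>{..<n}. \<xi> (indicator (r i \<inter> D)) \<omega> = (\<Sum>S\<in>{S\<in>I. i \<in> S}. \<xi> (indicator (atom S)) \<omega>)"
      by (intro AE_finite_allI) auto
    then show ?thesis
    proof eventually_elim
      case (elim \<omega>)
      have "sp_int_on D R \<omega> = (\<Sum>i\<in>{..<n}. \<Sum>S\<in>{S\<in>I. i \<in> S}. X i \<omega> * \<xi> (indicator (atom S)) \<omega>)"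
        unfolding sp_int_on_eq n_def[symmetric] X_def[symmetric] r_def[symmetric]
        using elim by (intro sum.cong) (auto simp: sum_distrib_left)
      also have "\<dots> = (\<Sum>S\<in>I. \<Sum>i\<in>{i\<in>{..<n}. i \<in> S}. X i \<omega> * \<xi> (indicator (atom S)) \<omega>)"
        by (rule sum.swap_restrict) (use finI in auto)
      also have "\<dots> = ?M \<omega>"
      proof (rule sum.cong[OF refl])
        fix S assume "S \<in> I"
        then have "{i\<in>{..<n}. i \<in> S} = S" using I by auto
        then show "(\<Sum>i\<in>{i\<in>{..<n}. i \<in> S}. X i \<omega> * \<xi> (indicator (atom S)) \<omega>) = XS S \<omega> * \<xi> (indicator (atom S)) \<omega>"
          by (simp add: XS_def sum_distrib_right)
      qed
      finally show ?case .
    qed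
  qed
  have nnE: "(\<integral>\<^sup>+\<omega>. ennreal (trunc_pow q L (sqrt A * XS S \<omega>)) \<partial>M) = ennreal (?E S)" if S: "S \<in> I" for S
  proof (rule nn_integral_eq_integral)
    obtain B where B: "\<forall>\<omega>\<in>space M. \<bar>XS S \<omega>\<bar> \<le> B" using XSb[OF S] by auto
    have m: "XS S \<in> borel_measurable M" using XSm[OF S] by (rule measurable_nat_filt)
    have "integrable M (\<lambda>\<omega>. (XS S \<omega> * sqrt A)\<^sup>2)"
      by (rule bounded_times_square_integrable[where B = B]) (use m B in auto)
    then show "integrable M (\<lambda>\<omega>. trunc_pow q L (sqrt A * XS S \<omega>))"
      using m by (intro trunc_pow_integrable[OF _ _ L]) (auto simp: mult.commute)
  qed (use trunc_pow_nonneg[OF L] in auto)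
  have "(\<integral>\<^sup>+\<omega>. ennreal (trunc_pow q L (sp_int_on D R \<omega>)) \<partial>M) = (\<integral>\<^sup>+\<omega>. ennreal (trunc_pow q L (?M \<omega>)) \<partial>M)"
    by (rule nn_integral_cong_AE) (use AE_eq in auto)
  also have "\<dots> = ennreal (\<integral>\<omega>. trunc_pow q L (?M \<omega>) \<partial>M)"
    by (rule nn_integral_eq_integral[OF trunc_pow_integrable[OF moment(1,2) L]])
      (use trunc_pow_nonneg[OF L] in auto)
  also have "\<dots> \<le> ennreal (moment_const q / A * (\<Sum>S\<in>I. measure lborel (atom S) * ?E S))"
    by (rule ennreal_leI[OF real_bound])
  also have "\<dots> = ennreal (moment_const q / A) * (\<Sum>S\<in>I. emeasure lborel (atom S) * ennreal (?E S))"
  proof -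
    have "(\<Sum>S\<in>I. emeasure lborel (atom S) * ennreal (?E S)) = (\<Sum>S\<in>I. ennreal (measure lborel (atom S) * ?E S))"
      using fin E0 by (intro sum.cong) (auto simp: emeasure_eq_ennreal_measure less_top ennreal_mult)
    also have "\<dots> = ennreal (\<Sum>S\<in>I. measure lborel (atom S) * ?E S)"
      using E0 by (intro sum_ennreal) auto
    finally have eq: "(\<Sum>S\<in>I. emeasure lborel (atom S) * ennreal (?E S))
      = ennreal (\<Sum>S\<in>I. measure lborel (atom S) * ?E S)" .
    show ?thesis unfolding eq
      by (rule ennreal_mult) (use moment_const_nonneg[of q] A E0 in \<open>auto intro!: sum_nonneg mult_nonneg_nonneg\<close>)
  qed
  also have "(\<Sum>S\<in>I. emeasure lborel (atom S) * ennreal (?E S))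
     \<le> (\<integral>\<^sup>+z. indicator D z * (\<integral>\<^sup>+\<omega>. ennreal (trunc_pow q L (sqrt A * sp_fun R z \<omega>)) \<partial>M) \<partial>lborel)"
  proof -
    have "(\<Sum>S\<in>I. emeasure lborel (atom S) * ennreal (?E S)) = (\<Sum>S\<in>I. \<integral>\<^sup>+z. ennreal (?E S) * indicator (atom S) z \<partial>lborel)"
      using at_borel by (intro sum.cong refl) (subst nn_integral_cmult_indicator, auto simp: mult.commute)
    also have "\<dots> = (\<integral>\<^sup>+z. (\<Sum>S\<in>I. ennreal (?E S) * indicator (atom S) z) \<partial>lborel)"
      using at_borel by (intro nn_integral_sum [symmetric]) auto
    also have "\<dots> \<le> (\<integral>\<^sup>+z. indicator D z * (\<integral>\<^sup>+\<omega>. ennreal (trunc_pow q L (sqrt A * sp_fun R z \<omega>)) \<partial>M) \<partial>lborel)"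
    proof (rule nn_integral_mono)
      fix z
      show "(\<Sum>S\<in>I. ennreal (?E S) * indicator (atom S) z)
        \<le> indicator D z * (\<integral>\<^sup>+\<omega>. ennreal (trunc_pow q L (sqrt A * sp_fun R z \<omega>)) \<partial>M)"
      \<comment> \<open>At most one atom contains \<open>z\<close>, and there the process equals the
        sum of the coefficients of its pattern.\<close>
      proof (cases "\<exists>S\<in>I. z \<in> atom S")
        case True
        then obtain S where S: "S \<in> I" "z \<in> atom S" by auto
        have "indicator (atom T) z = (0::ennreal)" if "T \<in> I - {S}" for T
          using that S disj by (auto simp: disjoint_family_on_def indicator_def)
        then have "(\<Sum>S\<in>I. ennreal (?E S) * indicator (atom S) z) = ennreal (?E S)"
          using S finI by (subst sum.remove[of _ S]) auto
        moreover have "sp_fun R z \<omega> = XS S \<omega>" for \<omega>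
        proof -
          have "sp_fun R z \<omega> = (\<Sum>i<n. X i \<omega> * indicator (r i) z)"
            unfolding sp_fun_eq n_def X_def r_def ..
          also have "\<dots> = (\<Sum>i\<in>S. X i \<omega>)"
            using I[OF S(1)] S(2)
            by (intro sum.mono_neutral_cong_right) (auto simp: atom_def indicator_def)
          finally show ?thesis by (simp add: XS_def)
        qed
        moreover have "z \<in> D" using S by (auto simp: atom_def)
        ultimately show ?thesis using nnE[OF S(1)] by simp
      next
        case False
        then have "(\<Sum>S\<in>I. ennreal (?E S) * indicator (atom S) z) = 0" by (auto simp: indicator_def)
        then show ?thesis by simp
      qed
    qed
    finally show ?thesis .
  qed
  finally show ?thesis by (simp add: mult_left_mono)
qed

section \<open>Moments of Walsh integrals\<close>

lemma nn_integral_square_add_le: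
  fixes f g :: "'b \<Rightarrow> real"
  assumes [measurable]: "f \<in> borel_measurable N" "g \<in> borel_measurable N"
  shows "(\<integral>\<^sup>+x. ennreal ((f x + g x)\<^sup>2) \<partial>N)
    \<le> 2 * (\<integral>\<^sup>+x. ennreal ((f x)\<^sup>2) \<partial>N) + 2 * (\<integral>\<^sup>+x. ennreal ((g x)\<^sup>2) \<partial>N)"
proof -
  have "(a + b)\<^sup>2 \<le> 2 * a\<^sup>2 + 2 * b\<^sup>2" for a b :: real
    using sum_squares_bound[of a b] by (simp add: power2_sum)
  then have "(\<integral>\<^sup>+x. ennreal ((f x + g x)\<^sup>2) \<partial>N) \<le> (\<integral>\<^sup>+x. ennreal (2 * (f x)\<^sup>2 + 2 * (g x)\<^sup>2) \<partial>N)"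
    by (intro nn_integral_mono ennreal_leI) auto
  also have "\<dots> = (\<integral>\<^sup>+x. 2 * ennreal ((f x)\<^sup>2) + 2 * ennreal ((g x)\<^sup>2) \<partial>N)"
    by (simp add: ennreal_mult)
  also have "\<dots> = 2 * (\<integral>\<^sup>+x. ennreal ((f x)\<^sup>2) \<partial>N) + 2 * (\<integral>\<^sup>+x. ennreal ((g x)\<^sup>2) \<partial>N)"
    by (subst nn_integral_add) (auto simp: nn_integral_cmult)
  finally show ?thesis .
qed

lemma sp_fun_measurable:
  assumes "sp_valid M \<xi> R"
  shows "(\<lambda>(z, \<omega>). sp_fun R z \<omega>) \<in> borel_measurable (lborel \<Otimes>\<^sub>M M)"
proof -
  have "(\<lambda>p. sp_coeff R i (snd p) * indicator (sp_rect R i) (fst p)) \<in> borel_measurable (lborel \<Otimes>\<^sub>M M)"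
    if "i < length R" for i
  proof -
    note [measurable] = sp_validD(3,6)[OF assms that]
    show ?thesis by measurable
  qed
  then show ?thesis unfolding sp_fun_eq case_prod_beta by (intro borel_measurable_sum) auto
qed

lemma sp_fun_measurable2:
  assumes "sp_valid M \<xi> R" shows "sp_fun R z \<in> borel_measurable M"
  unfolding sp_fun_eq using sp_validD(6)[OF assms] by (intro borel_measurable_sum borel_measurable_times) auto

lemma sp_int_on_measurable:
  assumes "sp_valid M \<xi> R" "D \<in> sets borel" shows "sp_int_on D R \<in> borel_measurable M"
  unfolding sp_int_on_eq
proof (intro borel_measurable_sum borel_measurable_times)
  fix i assume i: "i \<in> {..<length R}"
  then show "sp_coeff R i \<in> borel_measurable M" using sp_validD(6)[OF assms(1)] by auto
  have "emeasure lborel (sp_rect R i \<inter> D) \<le> emeasure lborel (sp_rect R i)"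
    using sp_validD(3)[OF assms(1)] i by (intro emeasure_mono) auto
  also have "\<dots> < \<infinity>" using sp_validD(4)[OF assms(1)] i by auto
  finally show "\<xi> (indicator (sp_rect R i \<inter> D)) \<in> borel_measurable M"
    using sp_validD(3)[OF assms(1)] i assms(2) by (intro noise_measurable L2fun_indicator) auto
qed

lemma sp_int_on_UNIV: "sp_int_on UNIV R = sp_int \<xi> R"
  by (rule ext) (simp add: sp_int_on_eq sp_int_eq)

lemma sp_int_measurable: "sp_valid M \<xi> R \<Longrightarrow> sp_int \<xi> R \<in> borel_measurable M"
  using sp_int_on_measurable[of R UNIV] by (simp add: sp_int_on_UNIV)

lemma sp_int_split:
  assumes R: "sp_valid M \<xi> R" and D: "D \<in> sets borel"
  shows "AE \<omega> in M. sp_int \<xi> R \<omega> = sp_int_on D R \<omega> + sp_int_on (- D) R \<omega>"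
proof -
  have "AE \<omega> in M. \<xi> (indicator (sp_rect R i)) \<omega>
     = \<xi> (indicator (sp_rect R i \<inter> D)) \<omega> + \<xi> (indicator (sp_rect R i \<inter> - D)) \<omega>" if "i < length R" for i
  proof -
    note r = sp_validD(3,4)[OF R that]
    have fin: "emeasure lborel (sp_rect R i \<inter> E) < \<infinity>" for E
      by (rule order_le_less_trans[OF emeasure_mono r(2)]) (use r in auto)
    have "indicator (sp_rect R i) = (\<lambda>z. 1 * indicator (sp_rect R i \<inter> D) z + 1 * indicat_real (sp_rect R i \<inter> - D) z)"
      by (rule ext) (auto simp: indicator_def)
    then show ?thesis
      using noise_add[of "indicator (sp_rect R i \<inter> D)" "indicator (sp_rect R i \<inter> - D)" 1 1] fin r(1) D
      by (simp add: L2fun_indicator)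
  qed
  then have "AE \<omega> in M. \<forall>i\<in>{..<length R}. \<xi> (indicator (sp_rect R i)) \<omega>
     = \<xi> (indicator (sp_rect R i \<inter> D)) \<omega> + \<xi> (indicator (sp_rect R i \<inter> - D)) \<omega>"
    by (intro AE_finite_allI) auto
  then show ?thesis
    by eventually_elim (simp add: sp_int_on_eq sp_int_eq sum.distrib [symmetric] distrib_left)
qed

text \<open>For \<open>q = 0\<close> the truncated power is the square, and the normalisation by the
  area cancels. The bound, an isometry up to a constant, therefore holds on sets of infinite area as
  well: \<open>D\<close> is cut down to the rectangles of \<open>R\<close>.\<close>

lemma sp_int_on_square_le:
  assumes R: "sp_valid M \<xi> R" and D: "D \<in> sets borel"
  shows "(\<integral>\<^sup>+\<omega>. ennreal ((sp_int_on D R \<omega>)\<^sup>2) \<partial>M)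
    \<le> ennreal (moment_const 0) * (\<integral>\<^sup>+z. indicator D z * (\<integral>\<^sup>+\<omega>. ennreal ((sp_fun R z \<omega>)\<^sup>2) \<partial>M) \<partial>lborel)"
proof -
  define E where "E = D \<inter> (\<Union>i<length R. sp_rect R i)"
  \<comment> \<open>The added 1 keeps \<open>A\<close> positive when \<open>E\<close> is a null
    set.\<close>
  define A where "A = measure lborel E + 1"
  note r = sp_validD(3,4)[OF R]
  have Eb: "E \<in> sets borel" unfolding E_def using D r(1) by auto
  have "emeasure lborel E \<le> emeasure lborel (\<Union>i<length R. sp_rect R i)"
    unfolding E_def using r(1) by (intro emeasure_mono) auto
  also have "\<dots> < \<infinity>"
  proof -
    have "(\<Union>i<length R. sp_rect R i) \<in> fmeasurable lborel"
      using r by (intro fmeasurable.finite_UN fmeasurableI) auto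
    then show ?thesis by (auto simp: fmeasurable_def)
  qed
  finally have Ef: "emeasure lborel E < \<infinity>" .
  have A: "0 < A" "emeasure lborel E \<le> ennreal A"
    using Ef by (auto simp: A_def add_nonneg_pos emeasure_eq_ennreal_measure less_top intro!: ennreal_leI)
  have eq: "sp_int_on D R \<omega> = sp_int_on E R \<omega>" for \<omega>
    unfolding sp_int_on_eq
  proof (rule sum.cong[OF refl])
    fix i assume "i \<in> {..<length R}"
    then have "sp_rect R i \<inter> D = sp_rect R i \<inter> E" by (auto simp: E_def)
    then show "sp_coeff R i \<omega> * \<xi> (indicator (sp_rect R i \<inter> D)) \<omega> = sp_coeff R i \<omega> * \<xi> (indicator (sp_rect R i \<inter> E)) \<omega>"
      by simp
  qed
  have "(\<integral>\<^sup>+\<omega>. ennreal ((sp_int_on D R \<omega>)\<^sup>2) \<partial>M)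
     \<le> ennreal (moment_const 0 / A) * (\<integral>\<^sup>+z. indicator E z * (\<integral>\<^sup>+\<omega>. ennreal ((sqrt A * sp_fun R z \<omega>)\<^sup>2) \<partial>M) \<partial>lborel)"
    using sp_moment[OF R Eb A(2,1), of 0 0] by (simp add: eq trunc_pow_zero_exponent)
  also have "(\<integral>\<^sup>+z. indicator E z * (\<integral>\<^sup>+\<omega>. ennreal ((sqrt A * sp_fun R z \<omega>)\<^sup>2) \<partial>M) \<partial>lborel)
     \<le> ennreal A * (\<integral>\<^sup>+z. indicator D z * (\<integral>\<^sup>+\<omega>. ennreal ((sp_fun R z \<omega>)\<^sup>2) \<partial>M) \<partial>lborel)"
  proof -
    have m: "sp_fun R z \<in> borel_measurable M" for z by (rule sp_fun_measurable2[OF R])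
    have m2: "(\<lambda>z. \<integral>\<^sup>+\<omega>. ennreal ((sp_fun R z \<omega>)\<^sup>2) \<partial>M) \<in> borel_measurable lborel"
      by (rule borel_measurable_nn_integral) (use sp_fun_measurable[OF R] in measurable)
    have "ennreal ((sqrt A * sp_fun R z \<omega>)\<^sup>2) = ennreal A * ennreal ((sp_fun R z \<omega>)\<^sup>2)" for z \<omega>
      using A by (simp add: power_mult_distrib ennreal_mult)
    then have "(\<integral>\<^sup>+\<omega>. ennreal ((sqrt A * sp_fun R z \<omega>)\<^sup>2) \<partial>M) = ennreal A * (\<integral>\<^sup>+\<omega>. ennreal ((sp_fun R z \<omega>)\<^sup>2) \<partial>M)" for z
      using m by (simp add: nn_integral_cmult)
    then have "(\<integral>\<^sup>+z. indicator E z * (\<integral>\<^sup>+\<omega>. ennreal ((sqrt A * sp_fun R z \<omega>)\<^sup>2) \<partial>M) \<partial>lborel)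
      = (\<integral>\<^sup>+z. indicator E z * (ennreal A * (\<integral>\<^sup>+\<omega>. ennreal ((sp_fun R z \<omega>)\<^sup>2) \<partial>M)) \<partial>lborel)"
      by simp
    also have "\<dots> \<le> (\<integral>\<^sup>+z. ennreal A * (indicator D z * (\<integral>\<^sup>+\<omega>. ennreal ((sp_fun R z \<omega>)\<^sup>2) \<partial>M)) \<partial>lborel)"
      by (rule nn_integral_mono) (auto simp: E_def indicator_def)
    also have "\<dots> = ennreal A * (\<integral>\<^sup>+z. indicator D z * (\<integral>\<^sup>+\<omega>. ennreal ((sp_fun R z \<omega>)\<^sup>2) \<partial>M) \<partial>lborel)"
      by (rule nn_integral_cmult) (use m2 D in measurable)
    finally show ?thesis .
  qed
  finally have "(\<integral>\<^sup>+\<omega>. ennreal ((sp_int_on D R \<omega>)\<^sup>2) \<partial>M) \<le> ennreal (moment_const 0 / A) *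
     (ennreal A * (\<integral>\<^sup>+z. indicator D z * (\<integral>\<^sup>+\<omega>. ennreal ((sp_fun R z \<omega>)\<^sup>2) \<partial>M) \<partial>lborel))"
    by (simp add: mult_left_mono)
  also have "\<dots> = ennreal (moment_const 0) * (\<integral>\<^sup>+z. indicator D z * (\<integral>\<^sup>+\<omega>. ennreal ((sp_fun R z \<omega>)\<^sup>2) \<partial>M) \<partial>lborel)"
    using A moment_const_nonneg[of 0] by (simp add: mult.assoc [symmetric] ennreal_mult [symmetric])
  finally show ?thesis .
qed

definition sp_scale :: "('a \<Rightarrow> real) \<Rightarrow> 'a sp \<Rightarrow> 'a sp" where
  "sp_scale Y R = map (\<lambda>(X, r). (\<lambda>\<omega>. Y \<omega> * X \<omega>, r)) R"

lemma sp_fun_scale: "sp_fun (sp_scale Y R) z \<omega> = Y \<omega> * sp_fun R z \<omega>"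
  by (induction R) (auto simp: sp_scale_def sp_fun_def distrib_left)

lemma sp_int_scale: "sp_int \<xi> (sp_scale Y R) \<omega> = Y \<omega> * sp_int \<xi> R \<omega>"
  by (induction R) (auto simp: sp_scale_def sp_int_def distrib_left)

lemma sp_fun_append: "sp_fun (R @ S) z \<omega> = sp_fun R z \<omega> + sp_fun S z \<omega>"
  by (simp add: sp_fun_def)

lemma sp_int_append: "sp_int \<xi> (R @ S) \<omega> = sp_int \<xi> R \<omega> + sp_int \<xi> S \<omega>"
  by (simp add: sp_int_def)

lemma sp_valid_append: "sp_valid M \<xi> R \<Longrightarrow> sp_valid M \<xi> S \<Longrightarrow> sp_valid M \<xi> (R @ S)"
  by (auto simp: sp_valid_def)

lemma sp_valid_scale:
  assumes R: "sp_valid M \<xi> R" and B: "\<And>\<omega>. \<omega> \<in> space M \<Longrightarrow> \<bar>Y \<omega>\<bar> \<le> B"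
    and Y: "\<And>X a b c d. (X, a, b, c, d) \<in> set R \<Longrightarrow> Y \<in> borel_measurable (nat_filt M \<xi> a)"
  shows "sp_valid M \<xi> (sp_scale Y R)"
proof -
  have "0 \<le> a \<and> a < b \<and> c < d \<and> X \<in> borel_measurable (nat_filt M \<xi> a) \<and> (\<exists>B. \<forall>\<omega>\<in>space M. \<bar>X \<omega>\<bar> \<le> B)"
    if "(X, a, b, c, d) \<in> set (sp_scale Y R)" for X a b c d
  proof -
    obtain X' where X': "(X', a, b, c, d) \<in> set R" "X = (\<lambda>\<omega>. Y \<omega> * X' \<omega>)"
      using \<open>(X, a, b, c, d) \<in> set (sp_scale Y R)\<close> unfolding sp_scale_def by auto
    have v: "0 \<le> a" "a < b" "c < d" "X' \<in> borel_measurable (nat_filt M \<xi> a)" "\<exists>B. \<forall>\<omega>\<in>space M. \<bar>X' \<omega>\<bar> \<le> B"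
      using R X'(1) unfolding sp_valid_def by auto
    obtain B' where B': "\<forall>\<omega>\<in>space M. \<bar>X' \<omega>\<bar> \<le> B'" using v(5) by auto
    have "\<bar>Y \<omega> * X' \<omega>\<bar> \<le> \<bar>B\<bar> * \<bar>B'\<bar>" if "\<omega> \<in> space M" for \<omega>
      unfolding abs_mult using B[OF that] B' that by (intro mult_mono) force+
    then show ?thesis using v Y[OF X'(1)] X'(2) by auto
  qed
  then show ?thesis unfolding sp_valid_def by blast
qed

text \<open>A difference of simple processes is again one, given by the concatenated list with the
  second coefficients negated.\<close>

lemma sp_int_diff_square_le:
  assumes R: "sp_valid M \<xi> R" "sp_valid M \<xi> S"
  shows "(\<integral>\<^sup>+\<omega>. ennreal ((sp_int \<xi> R \<omega> - sp_int \<xi> S \<omega>)\<^sup>2) \<partial>M)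
    \<le> ennreal (moment_const 0) * (\<integral>\<^sup>+z. \<integral>\<^sup>+\<omega>. ennreal ((sp_fun R z \<omega> - sp_fun S z \<omega>)\<^sup>2) \<partial>M \<partial>lborel)"
proof -
  have v: "sp_valid M \<xi> (R @ sp_scale (\<lambda>_. - 1) S)"
    by (intro sp_valid_append R sp_valid_scale[where B = 1]) auto
  show ?thesis
    using sp_int_on_square_le[OF v, of UNIV]
    by (simp add: sp_int_on_UNIV sp_int_append sp_fun_append sp_int_scale sp_fun_scale)
qed

section \<open>Approximation by simple processes\<close>

definition sp_approx :: "(real \<times> real \<Rightarrow> 'a \<Rightarrow> real) \<Rightarrow> (nat \<Rightarrow> 'a sp) \<Rightarrow> bool" where
  "sp_approx H R \<longleftrightarrow> (\<forall>k. sp_valid M \<xi> (R k)) \<and>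
    (\<lambda>k. \<integral>\<^sup>+z. \<integral>\<^sup>+\<omega>. ennreal ((sp_fun (R k) z \<omega> - H z \<omega>)\<^sup>2) \<partial>M \<partial>lborel) \<longlonglongrightarrow> 0"

definition L2_conv :: "(nat \<Rightarrow> 'a \<Rightarrow> real) \<Rightarrow> ('a \<Rightarrow> real) \<Rightarrow> bool" where
  "L2_conv J I \<longleftrightarrow> (\<lambda>k. \<integral>\<^sup>+\<omega>. ennreal ((J k \<omega> - I \<omega>)\<^sup>2) \<partial>M) \<longlonglongrightarrow> 0"

text \<open>Tonelli's theorem: later estimates work with the moments at a fixed space-time point, so
  the product integral is rewritten as an iterated one.\<close>

lemma walsh_integral_iff:
  "walsh_integral M \<xi> H I \<longleftrightarrow> (\<lambda>(z, \<omega>). H z \<omega>) \<in> borel_measurable (lborel \<Otimes>\<^sub>M M) \<and> I \<in> borel_measurable M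
    \<and> (\<exists>R. sp_approx H R \<and> L2_conv (\<lambda>k. sp_int \<xi> (R k)) I)"
proof -
  have fst_eq: "(\<integral>\<^sup>+(z, \<omega>). ennreal ((sp_fun R z \<omega> - H z \<omega>)\<^sup>2) \<partial>(lborel \<Otimes>\<^sub>M M))
     = (\<integral>\<^sup>+z. \<integral>\<^sup>+\<omega>. ennreal ((sp_fun R z \<omega> - H z \<omega>)\<^sup>2) \<partial>M \<partial>lborel)"
    if "(\<lambda>(z, \<omega>). H z \<omega>) \<in> borel_measurable (lborel \<Otimes>\<^sub>M M)" "sp_valid M \<xi> R" for R
  proof -
    have [measurable]: "(\<lambda>p. H (fst p) (snd p)) \<in> borel_measurable (lborel \<Otimes>\<^sub>M M)"
      "(\<lambda>p. sp_fun R (fst p) (snd p)) \<in> borel_measurable (lborel \<Otimes>\<^sub>M M)"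
      using that(1) sp_fun_measurable[OF that(2)] by (simp_all add: case_prod_beta)
    have "(\<lambda>p. ennreal ((sp_fun R (fst p) (snd p) - H (fst p) (snd p))\<^sup>2)) \<in> borel_measurable (lborel \<Otimes>\<^sub>M M)"
      by measurable
    from nn_integral_fst[OF this] show ?thesis by (simp add: case_prod_beta')
  qed
  have lim_eq: "(\<lambda>k. \<integral>\<^sup>+(z, \<omega>). ennreal ((sp_fun (R k) z \<omega> - H z \<omega>)\<^sup>2) \<partial>(lborel \<Otimes>\<^sub>M M))
     = (\<lambda>k. \<integral>\<^sup>+z. \<integral>\<^sup>+\<omega>. ennreal ((sp_fun (R k) z \<omega> - H z \<omega>)\<^sup>2) \<partial>M \<partial>lborel)"
    if "(\<lambda>(z, \<omega>). H z \<omega>) \<in> borel_measurable (lborel \<Otimes>\<^sub>M M)" "\<forall>k. sp_valid M \<xi> (R k)" for R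
    using that by (intro ext fst_eq) auto
  show ?thesis
  proof
    assume "walsh_integral M \<xi> H I"
    then obtain R where H: "(\<lambda>(z, \<omega>). H z \<omega>) \<in> borel_measurable (lborel \<Otimes>\<^sub>M M)" "I \<in> borel_measurable M"
      and R: "\<forall>k. sp_valid M \<xi> (R k)"
      "(\<lambda>k. \<integral>\<^sup>+(z, \<omega>). ennreal ((sp_fun (R k) z \<omega> - H z \<omega>)\<^sup>2) \<partial>(lborel \<Otimes>\<^sub>M M)) \<longlonglongrightarrow> 0"
      "L2_conv (\<lambda>k. sp_int \<xi> (R k)) I"
      unfolding walsh_integral_def L2_conv_def by blast
    then show "(\<lambda>(z, \<omega>). H z \<omega>) \<in> borel_measurable (lborel \<Otimes>\<^sub>M M) \<and> I \<in> borel_measurable M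
      \<and> (\<exists>R. sp_approx H R \<and> L2_conv (\<lambda>k. sp_int \<xi> (R k)) I)"
      unfolding lim_eq[OF H(1) R(1)] sp_approx_def by blast
  next
    assume "(\<lambda>(z, \<omega>). H z \<omega>) \<in> borel_measurable (lborel \<Otimes>\<^sub>M M) \<and> I \<in> borel_measurable M
      \<and> (\<exists>R. sp_approx H R \<and> L2_conv (\<lambda>k. sp_int \<xi> (R k)) I)"
    then obtain R where H: "(\<lambda>(z, \<omega>). H z \<omega>) \<in> borel_measurable (lborel \<Otimes>\<^sub>M M)" "I \<in> borel_measurable M"
      and R: "\<forall>k. sp_valid M \<xi> (R k)" "sp_approx H R" "L2_conv (\<lambda>k. sp_int \<xi> (R k)) I"
      unfolding sp_approx_def by blast
    then show "walsh_integral M \<xi> H I"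
      unfolding sp_approx_def lim_eq[OF H(1) R(1), symmetric] walsh_integral_def L2_conv_def by blast
  qed
qed

lemma joint_measurable:
  assumes "(\<lambda>(z, \<omega>). H z \<omega>) \<in> borel_measurable (lborel \<Otimes>\<^sub>M M)"
  shows "H z \<in> borel_measurable M"
    and "f \<in> borel_measurable borel \<Longrightarrow> (\<lambda>z. \<integral>\<^sup>+\<omega>. (f (H z \<omega>) :: ennreal) \<partial>M) \<in> borel_measurable lborel"
proof -
  have "(\<lambda>\<omega>. (case (z, \<omega>) of (z, \<omega>) \<Rightarrow> H z \<omega>)) \<in> borel_measurable M"
    by (rule measurable_compose[OF _ assms]) auto
  then show "H z \<in> borel_measurable M" by simp
  assume f [measurable]: "f \<in> borel_measurable borel"
  show "(\<lambda>z. \<integral>\<^sup>+\<omega>. (f (H z \<omega>) :: ennreal) \<partial>M) \<in> borel_measurable lborel"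
    by (rule borel_measurable_nn_integral) (use assms in measurable)
qed

lemma iterated_square_add_le:
  assumes f: "(\<lambda>(z, \<omega>). f z \<omega>) \<in> borel_measurable (lborel \<Otimes>\<^sub>M M)"
    and g: "(\<lambda>(z, \<omega>). g z \<omega>) \<in> borel_measurable (lborel \<Otimes>\<^sub>M M)"
  shows "(\<integral>\<^sup>+z. \<integral>\<^sup>+\<omega>. ennreal ((f z \<omega> + g z \<omega>)\<^sup>2) \<partial>M \<partial>lborel)
    \<le> 2 * (\<integral>\<^sup>+z. \<integral>\<^sup>+\<omega>. ennreal ((f z \<omega>)\<^sup>2) \<partial>M \<partial>lborel) + 2 * (\<integral>\<^sup>+z. \<integral>\<^sup>+\<omega>. ennreal ((g z \<omega>)\<^sup>2) \<partial>M \<partial>lborel)"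
proof -
  have m: "(\<lambda>z. \<integral>\<^sup>+\<omega>. ennreal ((f z \<omega>)\<^sup>2) \<partial>M) \<in> borel_measurable lborel"
    "(\<lambda>z. \<integral>\<^sup>+\<omega>. ennreal ((g z \<omega>)\<^sup>2) \<partial>M) \<in> borel_measurable lborel"
    using joint_measurable(2)[OF f, of "\<lambda>x. ennreal (x\<^sup>2)"] joint_measurable(2)[OF g, of "\<lambda>x. ennreal (x\<^sup>2)"]
    by simp_all
  have "(\<integral>\<^sup>+z. \<integral>\<^sup>+\<omega>. ennreal ((f z \<omega> + g z \<omega>)\<^sup>2) \<partial>M \<partial>lborel)
    \<le> (\<integral>\<^sup>+z. 2 * (\<integral>\<^sup>+\<omega>. ennreal ((f z \<omega>)\<^sup>2) \<partial>M) + 2 * (\<integral>\<^sup>+\<omega>. ennreal ((g z \<omega>)\<^sup>2) \<partial>M) \<partial>lborel)"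
    by (intro nn_integral_mono nn_integral_square_add_le joint_measurable(1)[OF f] joint_measurable(1)[OF g])
  also have "\<dots> = 2 * (\<integral>\<^sup>+z. \<integral>\<^sup>+\<omega>. ennreal ((f z \<omega>)\<^sup>2) \<partial>M \<partial>lborel) + 2 * (\<integral>\<^sup>+z. \<integral>\<^sup>+\<omega>. ennreal ((g z \<omega>)\<^sup>2) \<partial>M \<partial>lborel)"
    using m by (subst nn_integral_add) (auto simp: nn_integral_cmult)
  finally show ?thesis .
qed

lemma ennreal_tendsto_0_squeeze:
  fixes f g :: "nat \<Rightarrow> ennreal"
  assumes "g \<longlonglongrightarrow> 0" "\<And>k. f k \<le> g k" shows "f \<longlonglongrightarrow> 0"
  by (rule tendsto_sandwich[OF _ _ tendsto_const assms(1)]) (auto simp: assms(2))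

lemma ennreal_tendsto_0_lincomb:
  fixes f g :: "nat \<Rightarrow> ennreal"
  assumes "f \<longlonglongrightarrow> 0" "g \<longlonglongrightarrow> 0" "a < top" "b < top"
  shows "(\<lambda>k. a * f k + b * g k) \<longlonglongrightarrow> 0"
  using tendsto_add[OF ennreal_tendsto_cmult[OF assms(3,1)] ennreal_tendsto_cmult[OF assms(4,2)]] by simp

lemma L2_conv_add:
  assumes J: "\<And>k. J k \<in> borel_measurable M" "\<And>k. J' k \<in> borel_measurable M" "I \<in> borel_measurable M" "I' \<in> borel_measurable M"
    and "L2_conv J I" "L2_conv J' I'"
  shows "L2_conv (\<lambda>k \<omega>. J k \<omega> + J' k \<omega>) (\<lambda>\<omega>. I \<omega> + I' \<omega>)"
  unfolding L2_conv_def
proof (rule ennreal_tendsto_0_squeeze)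
  show "(\<lambda>k. 2 * (\<integral>\<^sup>+\<omega>. ennreal ((J k \<omega> - I \<omega>)\<^sup>2) \<partial>M) + 2 * (\<integral>\<^sup>+\<omega>. ennreal ((J' k \<omega> - I' \<omega>)\<^sup>2) \<partial>M)) \<longlonglongrightarrow> 0"
    using assms(5,6) unfolding L2_conv_def by (intro ennreal_tendsto_0_lincomb) auto
  fix k
  note [measurable] = J
  have eq: "J k \<omega> + J' k \<omega> - (I \<omega> + I' \<omega>) = (J k \<omega> - I \<omega>) + (J' k \<omega> - I' \<omega>)" for \<omega> by simp
  show "(\<integral>\<^sup>+\<omega>. ennreal ((J k \<omega> + J' k \<omega> - (I \<omega> + I' \<omega>))\<^sup>2) \<partial>M)
    \<le> 2 * (\<integral>\<^sup>+\<omega>. ennreal ((J k \<omega> - I \<omega>)\<^sup>2) \<partial>M) + 2 * (\<integral>\<^sup>+\<omega>. ennreal ((J' k \<omega> - I' \<omega>)\<^sup>2) \<partial>M)"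
    unfolding eq by (rule nn_integral_square_add_le) measurable
qed

lemma L2_conv_scale:
  assumes J: "\<And>k. J k \<in> borel_measurable M" "I \<in> borel_measurable M" "L2_conv J I"
    and Y: "\<And>\<omega>. \<omega> \<in> space M \<Longrightarrow> \<bar>Y \<omega>\<bar> \<le> B"
  shows "L2_conv (\<lambda>k \<omega>. Y \<omega> * J k \<omega>) (\<lambda>\<omega>. Y \<omega> * I \<omega>)"
  unfolding L2_conv_def
proof (rule ennreal_tendsto_0_squeeze)
  show "(\<lambda>k. ennreal (B\<^sup>2) * (\<integral>\<^sup>+\<omega>. ennreal ((J k \<omega> - I \<omega>)\<^sup>2) \<partial>M)) \<longlonglongrightarrow> 0"
    using ennreal_tendsto_cmult[of "ennreal (B\<^sup>2)"] assms(3) unfolding L2_conv_def by fastforce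
  fix k
  note [measurable] = J(1,2)
  have "(\<integral>\<^sup>+\<omega>. ennreal ((Y \<omega> * J k \<omega> - Y \<omega> * I \<omega>)\<^sup>2) \<partial>M) \<le> (\<integral>\<^sup>+\<omega>. ennreal (B\<^sup>2) * ennreal ((J k \<omega> - I \<omega>)\<^sup>2) \<partial>M)"
  proof (rule nn_integral_mono)
    fix \<omega> assume "\<omega> \<in> space M"
    then have "\<bar>Y \<omega>\<bar> \<le> \<bar>B\<bar>" using Y by force
    then have "(Y \<omega>)\<^sup>2 \<le> B\<^sup>2" by (simp add: abs_le_square_iff)
    then show "ennreal ((Y \<omega> * J k \<omega> - Y \<omega> * I \<omega>)\<^sup>2) \<le> ennreal (B\<^sup>2) * ennreal ((J k \<omega> - I \<omega>)\<^sup>2)"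
      by (simp add: ennreal_mult [symmetric] right_diff_distrib [symmetric] power_mult_distrib mult_right_mono)
  qed
  then show "(\<integral>\<^sup>+\<omega>. ennreal ((Y \<omega> * J k \<omega> - Y \<omega> * I \<omega>)\<^sup>2) \<partial>M) \<le> ennreal (B\<^sup>2) * (\<integral>\<^sup>+\<omega>. ennreal ((J k \<omega> - I \<omega>)\<^sup>2) \<partial>M)"
    by (simp add: nn_integral_cmult)
qed

text \<open>The definition provides some approximating sequence. By the mean-square bound the
  integrals of any other one have the same limit, so the sequence may be chosen to suit an argument,
  for instance cut off in time.\<close>

lemma walsh_approx_conv:
  assumes W: "walsh_integral M \<xi> H I" and R: "sp_approx H R"
  shows "L2_conv (\<lambda>k. sp_int \<xi> (R k)) I"
proof -
  obtain S where H: "(\<lambda>(z, \<omega>). H z \<omega>) \<in> borel_measurable (lborel \<Otimes>\<^sub>M M)" and I: "I \<in> borel_measurable M"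
    and S: "sp_approx H S" and SI: "L2_conv (\<lambda>k. sp_int \<xi> (S k)) I"
    using W unfolding walsh_integral_iff by blast
  have vR: "sp_valid M \<xi> (R k)" and vS: "sp_valid M \<xi> (S k)" for k using R S by (auto simp: sp_approx_def)
  have "L2_conv (\<lambda>k \<omega>. sp_int \<xi> (R k) \<omega> - sp_int \<xi> (S k) \<omega>) (\<lambda>_. 0)"
    unfolding L2_conv_def
  proof (rule ennreal_tendsto_0_squeeze)
    let ?N = "\<lambda>R k. \<integral>\<^sup>+z. \<integral>\<^sup>+\<omega>. ennreal ((sp_fun (R k) z \<omega> - H z \<omega>)\<^sup>2) \<partial>M \<partial>lborel"
    have "(\<lambda>k. 2 * ?N R k + 2 * ?N S k) \<longlonglongrightarrow> 0"
      using R S unfolding sp_approx_def by (intro ennreal_tendsto_0_lincomb) auto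
    then show "(\<lambda>k. ennreal (moment_const 0) * (2 * ?N R k + 2 * ?N S k)) \<longlonglongrightarrow> 0"
      using ennreal_tendsto_cmult[of "ennreal (moment_const 0)"] by fastforce
    fix k
    have "(\<integral>\<^sup>+z. \<integral>\<^sup>+\<omega>. ennreal ((sp_fun (R k) z \<omega> - sp_fun (S k) z \<omega>)\<^sup>2) \<partial>M \<partial>lborel)
       = (\<integral>\<^sup>+z. \<integral>\<^sup>+\<omega>. ennreal (((sp_fun (R k) z \<omega> - H z \<omega>) + (H z \<omega> - sp_fun (S k) z \<omega>))\<^sup>2) \<partial>M \<partial>lborel)"
      by simp
    also have "\<dots> \<le> 2 * ?N R k + 2 * (\<integral>\<^sup>+z. \<integral>\<^sup>+\<omega>. ennreal ((H z \<omega> - sp_fun (S k) z \<omega>)\<^sup>2) \<partial>M \<partial>lborel)"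
      by (rule iterated_square_add_le) (use H sp_fun_measurable[OF vR[of k]] sp_fun_measurable[OF vS[of k]] in measurable)
    also have "\<dots> = 2 * ?N R k + 2 * ?N S k" by (simp add: power2_commute)
    finally have "ennreal (moment_const 0) * (\<integral>\<^sup>+z. \<integral>\<^sup>+\<omega>. ennreal ((sp_fun (R k) z \<omega> - sp_fun (S k) z \<omega>)\<^sup>2) \<partial>M \<partial>lborel)
       \<le> ennreal (moment_const 0) * (2 * ?N R k + 2 * ?N S k)" by (rule mult_left_mono) simp
    then show "(\<integral>\<^sup>+\<omega>. ennreal ((sp_int \<xi> (R k) \<omega> - sp_int \<xi> (S k) \<omega> - 0)\<^sup>2) \<partial>M)
       \<le> ennreal (moment_const 0) * (2 * ?N R k + 2 * ?N S k)"
      using sp_int_diff_square_le[OF vR[of k] vS[of k]] by simp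
  qed
  from L2_conv_add[OF _ _ _ _ this SI] show ?thesis
    using sp_int_measurable[OF vR] sp_int_measurable[OF vS] I by simp
qed

end

lemma trunc_pow_mono_level:
  "0 \<le> L \<Longrightarrow> L \<le> L' \<Longrightarrow> trunc_pow q L x \<le> trunc_pow q L' x"
  unfolding trunc_pow_def by (intro mult_left_mono power_mono) auto

text \<open>Monotone convergence along integer levels; at each point the truncated power is
  eventually the pure one.\<close>

lemma nn_integral_power_le_of_trunc_pow:
  assumes Y [measurable]: "Y \<in> borel_measurable N"
    and le: "\<And>k::nat. (\<integral>\<^sup>+x. ennreal (trunc_pow q (real k) (Y x)) \<partial>N) \<le> B"
  shows "(\<integral>\<^sup>+x. ennreal ((Y x) ^ (2 * q + 2)) \<partial>N) \<le> B"
proof -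
  have "(\<lambda>k. \<integral>\<^sup>+x. ennreal (trunc_pow q (real k) (Y x)) \<partial>N) \<longlonglongrightarrow> (\<integral>\<^sup>+x. ennreal ((Y x) ^ (2 * q + 2)) \<partial>N)"
  proof (rule nn_integral_LIMSEQ)
    show "incseq (\<lambda>k x. ennreal (trunc_pow q (real k) (Y x)))"
      by (auto simp: incseq_def le_fun_def intro!: ennreal_leI trunc_pow_mono_level)
    show "(\<lambda>k. ennreal (trunc_pow q (real k) (Y x))) \<longlonglongrightarrow> ennreal ((Y x) ^ (2 * q + 2))" for x
    proof (rule tendsto_eventually)
      have "\<forall>\<^sub>F k in sequentially. (Y x)\<^sup>2 \<le> real k" by (rule eventually_ge_at_top[THEN filterlim_real_sequentially[unfolded filterlim_iff, rule_format]])
      then show "\<forall>\<^sub>F k in sequentially. ennreal (trunc_pow q (real k) (Y x)) = ennreal ((Y x) ^ (2 * q + 2))"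
        by eventually_elim (simp only: trunc_pow_eq_power)
    qed
  qed auto
  then show ?thesis using le by (intro LIMSEQ_le_const2) auto
qed

context gaussian_noise
begin

lemma walsh_lincomb:
  assumes W: "walsh_integral M \<xi> H I" and W': "walsh_integral M \<xi> H' I'"
  shows "walsh_integral M \<xi> (\<lambda>z \<omega>. a * H z \<omega> + b * H' z \<omega>) (\<lambda>\<omega>. a * I \<omega> + b * I' \<omega>)"
proof -
  obtain R where H: "(\<lambda>(z, \<omega>). H z \<omega>) \<in> borel_measurable (lborel \<Otimes>\<^sub>M M)" and I: "I \<in> borel_measurable M"
    and R: "sp_approx H R" and RI: "L2_conv (\<lambda>k. sp_int \<xi> (R k)) I"
    using W unfolding walsh_integral_iff by blast
  obtain S where H': "(\<lambda>(z, \<omega>). H' z \<omega>) \<in> borel_measurable (lborel \<Otimes>\<^sub>M M)" and I': "I' \<in> borel_measurable M"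
    and S: "sp_approx H' S" and SI: "L2_conv (\<lambda>k. sp_int \<xi> (S k)) I'"
    using W' unfolding walsh_integral_iff by blast
  have vR: "sp_valid M \<xi> (R k)" and vS: "sp_valid M \<xi> (S k)" for k using R S by (auto simp: sp_approx_def)
  define T where "T k = sp_scale (\<lambda>_. a) (R k) @ sp_scale (\<lambda>_. b) (S k)" for k
  have vT: "sp_valid M \<xi> (T k)" for k
    unfolding T_def
    by (intro sp_valid_append sp_valid_scale[where B = "\<bar>a\<bar>"] sp_valid_scale[where B = "\<bar>b\<bar>"] vR vS) auto
  have "(\<lambda>k. \<integral>\<^sup>+z. \<integral>\<^sup>+\<omega>. ennreal ((sp_fun (T k) z \<omega> - (a * H z \<omega> + b * H' z \<omega>))\<^sup>2) \<partial>M \<partial>lborel) \<longlonglongrightarrow> 0"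
  proof (rule ennreal_tendsto_0_squeeze)
    let ?N = "\<lambda>k. \<integral>\<^sup>+z. \<integral>\<^sup>+\<omega>. ennreal ((sp_fun (R k) z \<omega> - H z \<omega>)\<^sup>2) \<partial>M \<partial>lborel"
    let ?N' = "\<lambda>k. \<integral>\<^sup>+z. \<integral>\<^sup>+\<omega>. ennreal ((sp_fun (S k) z \<omega> - H' z \<omega>)\<^sup>2) \<partial>M \<partial>lborel"
    show "(\<lambda>k. (2 * ennreal (a\<^sup>2)) * ?N k + (2 * ennreal (b\<^sup>2)) * ?N' k) \<longlonglongrightarrow> 0"
      using R S unfolding sp_approx_def by (intro ennreal_tendsto_0_lincomb) (auto simp: ennreal_mult_less_top)
    fix k
    note m = H H' sp_fun_measurable[OF vR[of k]] sp_fun_measurable[OF vS[of k]]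
    have c: "(\<integral>\<^sup>+z. \<integral>\<^sup>+\<omega>. ennreal ((c * f z \<omega>)\<^sup>2) \<partial>M \<partial>lborel)
       = ennreal (c\<^sup>2) * (\<integral>\<^sup>+z. \<integral>\<^sup>+\<omega>. ennreal ((f z \<omega>)\<^sup>2) \<partial>M \<partial>lborel)"
      if f: "(\<lambda>(z, \<omega>). f z \<omega>) \<in> borel_measurable (lborel \<Otimes>\<^sub>M M)" for f c
      using joint_measurable(1)[OF f] joint_measurable(2)[OF f, of "\<lambda>x. ennreal (x\<^sup>2)"]
      by (simp add: power_mult_distrib ennreal_mult nn_integral_cmult)
    have f1: "(\<lambda>(z, \<omega>). sp_fun (R k) z \<omega> - H z \<omega>) \<in> borel_measurable (lborel \<Otimes>\<^sub>M M)"
      and f2: "(\<lambda>(z, \<omega>). sp_fun (S k) z \<omega> - H' z \<omega>) \<in> borel_measurable (lborel \<Otimes>\<^sub>M M)"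
      using m by measurable
    have "(\<integral>\<^sup>+z. \<integral>\<^sup>+\<omega>. ennreal ((sp_fun (T k) z \<omega> - (a * H z \<omega> + b * H' z \<omega>))\<^sup>2) \<partial>M \<partial>lborel)
      = (\<integral>\<^sup>+z. \<integral>\<^sup>+\<omega>. ennreal ((a * (sp_fun (R k) z \<omega> - H z \<omega>) + b * (sp_fun (S k) z \<omega> - H' z \<omega>))\<^sup>2) \<partial>M \<partial>lborel)"
      by (simp add: T_def sp_fun_append sp_fun_scale algebra_simps)
    also have "\<dots> \<le> 2 * (\<integral>\<^sup>+z. \<integral>\<^sup>+\<omega>. ennreal ((a * (sp_fun (R k) z \<omega> - H z \<omega>))\<^sup>2) \<partial>M \<partial>lborel)
       + 2 * (\<integral>\<^sup>+z. \<integral>\<^sup>+\<omega>. ennreal ((b * (sp_fun (S k) z \<omega> - H' z \<omega>))\<^sup>2) \<partial>M \<partial>lborel)"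
      by (rule iterated_square_add_le) (use f1 f2 in measurable)
    also have "\<dots> = (2 * ennreal (a\<^sup>2)) * ?N k + (2 * ennreal (b\<^sup>2)) * ?N' k"
      unfolding c[OF f1] c[OF f2] by (simp add: mult.assoc)
    finally show "(\<integral>\<^sup>+z. \<integral>\<^sup>+\<omega>. ennreal ((sp_fun (T k) z \<omega> - (a * H z \<omega> + b * H' z \<omega>))\<^sup>2) \<partial>M \<partial>lborel)
      \<le> (2 * ennreal (a\<^sup>2)) * ?N k + (2 * ennreal (b\<^sup>2)) * ?N' k" .
  qed
  then have "sp_approx (\<lambda>z \<omega>. a * H z \<omega> + b * H' z \<omega>) T" using vT by (simp add: sp_approx_def)
  moreover have "L2_conv (\<lambda>k. sp_int \<xi> (T k)) (\<lambda>\<omega>. a * I \<omega> + b * I' \<omega>)"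
  proof -
    note mR = sp_int_measurable[OF vR] and mS = sp_int_measurable[OF vS]
    have "L2_conv (\<lambda>k \<omega>. a * sp_int \<xi> (R k) \<omega> + b * sp_int \<xi> (S k) \<omega>) (\<lambda>\<omega>. a * I \<omega> + b * I' \<omega>)"
      by (intro L2_conv_add L2_conv_scale[where B = "\<bar>a\<bar>"] L2_conv_scale[where B = "\<bar>b\<bar>"] RI SI
          borel_measurable_times mR mS I I' borel_measurable_const) auto
    moreover have "sp_int \<xi> (T k) = (\<lambda>\<omega>. a * sp_int \<xi> (R k) \<omega> + b * sp_int \<xi> (S k) \<omega>)" for k
      by (rule ext) (simp add: T_def sp_int_append sp_int_scale)
    ultimately show ?thesis by simp
  qed
  moreover have "(\<lambda>(z, \<omega>). a * H z \<omega> + b * H' z \<omega>) \<in> borel_measurable (lborel \<Otimes>\<^sub>M M)"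
    using H H' by measurable
  moreover have "(\<lambda>\<omega>. a * I \<omega> + b * I' \<omega>) \<in> borel_measurable M" using I I' by measurable
  ultimately show ?thesis unfolding walsh_integral_iff by blast
qed

text \<open>Where \<open>H\<close> vanishes, replacing the approximation by 0 can only decrease the
  distance to \<open>H\<close>.\<close>

lemma sp_approx_restrict:
  assumes R: "sp_approx H R" and v: "\<And>k. sp_valid M \<xi> (S k)"
    and S: "\<And>k z \<omega>. sp_fun (S k) z \<omega> = indicator T z * sp_fun (R k) z \<omega>"
    and H: "AE z in lborel. z \<notin> T \<longrightarrow> (\<forall>\<omega>\<in>space M. H z \<omega> = 0)"
  shows "sp_approx H S"
proof -
  have "(\<integral>\<^sup>+z. \<integral>\<^sup>+\<omega>. ennreal ((sp_fun (S k) z \<omega> - H z \<omega>)\<^sup>2) \<partial>M \<partial>lborel)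
    \<le> (\<integral>\<^sup>+z. \<integral>\<^sup>+\<omega>. ennreal ((sp_fun (R k) z \<omega> - H z \<omega>)\<^sup>2) \<partial>M \<partial>lborel)" for k
  proof (rule nn_integral_mono_AE)
    show "AE z in lborel. (\<integral>\<^sup>+\<omega>. ennreal ((sp_fun (S k) z \<omega> - H z \<omega>)\<^sup>2) \<partial>M)
       \<le> (\<integral>\<^sup>+\<omega>. ennreal ((sp_fun (R k) z \<omega> - H z \<omega>)\<^sup>2) \<partial>M)"
      using H
    proof eventually_elim
      case (elim z)
      show ?case
        by (rule nn_integral_mono) (use elim in \<open>cases "z \<in> T"; auto simp: S\<close>)
    qed
  qed
  from ennreal_tendsto_0_squeeze[OF _ this] show ?thesis
    using R v unfolding sp_approx_def by simp
qed

section \<open>Cutting simple processes in time\<close>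

definition sp_before :: "real \<Rightarrow> 'a sp \<Rightarrow> 'a sp" where
  "sp_before t R = map (\<lambda>(X, a, b, c, d). (X, a, min b t, c, d)) (filter (\<lambda>(X, a, b, c, d). a < t) R)"

text \<open>A rectangle that straddles \<open>t\<close> has its start moved up to \<open>t\<close>;
  its coefficient stays admissible because the filtration increases. The filter removes the
  rectangles that would become empty.\<close>

definition sp_after :: "real \<Rightarrow> 'a sp \<Rightarrow> 'a sp" where
  "sp_after t R = map (\<lambda>(X, a, b, c, d). (X, max a t, b, c, d)) (filter (\<lambda>(X, a, b, c, d). t < b) R)"

lemma sp_fun_before: "sp_fun (sp_before t R) z \<omega> = indicator ({..t} \<times> UNIV) z * sp_fun R z \<omega>"
  by (induction R) (auto simp: sp_before_def sp_fun_def rect_def indicator_def)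

lemma sp_fun_after: "sp_fun (sp_after t R) z \<omega> = indicator ({t<..} \<times> UNIV) z * sp_fun R z \<omega>"
  by (induction R) (auto simp: sp_after_def sp_fun_def rect_def indicator_def)

lemma sp_valid_before: "sp_valid M \<xi> R \<Longrightarrow> sp_valid M \<xi> (sp_before t R)"
  by (auto simp: sp_valid_def sp_before_def)

lemma sp_valid_after:
  assumes "sp_valid M \<xi> R" shows "sp_valid M \<xi> (sp_after t R)"
proof -
  have "0 \<le> a \<and> a < b \<and> c < d \<and> X \<in> borel_measurable (nat_filt M \<xi> a)
      \<and> (\<exists>B. \<forall>\<omega>\<in>space M. \<bar>X \<omega>\<bar> \<le> B)"
    if "(X, a, b, c, d) \<in> set (sp_after t R)" for X a b c d
  proof -
    obtain a' where a': "(X, a', b, c, d) \<in> set R" "a = max a' t" "t < b"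
      using \<open>(X, a, b, c, d) \<in> set (sp_after t R)\<close> unfolding sp_after_def by auto
    have v: "0 \<le> a'" "a' < b" "c < d" "X \<in> borel_measurable (nat_filt M \<xi> a')" "\<exists>B. \<forall>\<omega>\<in>space M. \<bar>X \<omega>\<bar> \<le> B"
      using assms a'(1) unfolding sp_valid_def by auto
    have "0 \<le> a" "a < b" "a' \<le> a" using a' v(1,2) by auto
    with v(3,5) nat_filt_mono[OF _ v(4)] show ?thesis by blast
  qed
  then show ?thesis unfolding sp_valid_def by blast
qed

lemma sp_int_before_adapted:
  assumes R: "sp_valid M \<xi> R"
  shows "sp_int \<xi> (sp_before t R) \<in> borel_measurable (nat_filt M \<xi> t)"
proof -
  have noise: "\<xi> (indicator (rect a b c d)) \<in> borel_measurable (nat_filt M \<xi> t)"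
    if "0 \<le> a" "a \<le> b" "b \<le> t" for a b c d
  proof (rule measurableI)
    fix B :: "real set" assume "B \<in> sets borel"
    then show "\<xi> (indicator (rect a b c d)) -` B \<inter> space (nat_filt M \<xi> t) \<in> sets (nat_filt M \<xi> t)"
      unfolding sets_nat_filt space_nat_filt
      by (intro sigma_sets.Basic UnI1 CollectI exI conjI) (use that in auto)
  qed simp
  show ?thesis
    using R
  proof (induction R)
    case Nil
    then show ?case by (simp add: sp_before_def sp_int_def)
  next
    case (Cons r R)
    obtain X a b c d where r: "r = (X, a, b, c, d)" by (cases r) auto
    have v: "0 \<le> a" "a < b" "X \<in> borel_measurable (nat_filt M \<xi> a)" "sp_valid M \<xi> R"
      using Cons.prems by (auto simp: r sp_valid_def)
    note IH = Cons.IH[OF v(4)]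
    show ?case
    proof (cases "a < t")
      case True
      have "sp_int \<xi> (sp_before t (r # R)) = (\<lambda>\<omega>. X \<omega> * \<xi> (indicator (rect a (min b t) c d)) \<omega> + sp_int \<xi> (sp_before t R) \<omega>)"
        using True by (intro ext) (simp add: sp_before_def sp_int_def r)
      moreover have "X \<in> borel_measurable (nat_filt M \<xi> t)"
        by (rule nat_filt_mono[OF _ v(3)]) (use True in simp)
      ultimately show ?thesis
        using IH noise[of a "min b t" c d] v True by simp
    next
      case False
      then have "sp_before t (r # R) = sp_before t R" by (simp add: sp_before_def r)
      then show ?thesis using IH by simp
    qed
  qed
qed

text \<open>Approximants that stop at \<open>t\<close> are measurable at time \<open>t\<close>.
  Adapted approximation is enough for what follows, so no adapted version of \<open>I\<close> is
  constructed.\<close>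

lemma walsh_adapted_approx:
  assumes W: "walsh_integral M \<xi> H I"
    and H: "\<And>z \<omega>. t < fst z \<Longrightarrow> \<omega> \<in> space M \<Longrightarrow> H z \<omega> = 0"
  shows "\<exists>J. (\<forall>k. J k \<in> borel_measurable (nat_filt M \<xi> t)) \<and> L2_conv J I"
proof -
  obtain R where R: "sp_approx H R" using W unfolding walsh_integral_iff by blast
  then have v: "sp_valid M \<xi> (R k)" for k by (simp add: sp_approx_def)
  have "sp_approx H (\<lambda>k. sp_before t (R k))"
    by (rule sp_approx_restrict[OF R sp_valid_before[OF v] sp_fun_before]) (auto intro!: AE_I2 H)
  then have "L2_conv (\<lambda>k. sp_int \<xi> (sp_before t (R k))) I" by (rule walsh_approx_conv[OF W])
  then show ?thesis
    using sp_int_before_adapted[OF v] by (intro exI[of _ "\<lambda>k. sp_int \<xi> (sp_before t (R k))"]) simp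
qed

text \<open>With approximants that start no earlier than \<open>t\<close> the factor
  \<open>Y\<close> can be moved into each coefficient without losing adaptedness. Asking for
  vanishing only almost everywhere admits integrands that are nonzero on the line
  \<open>fst z = t\<close>.\<close>

lemma walsh_mult_adapted:
  assumes W: "walsh_integral M \<xi> H I"
    and H: "AE z in lborel. fst z \<le> t \<longrightarrow> (\<forall>\<omega>\<in>space M. H z \<omega> = 0)"
    and Y: "Y \<in> borel_measurable (nat_filt M \<xi> t)" "\<And>\<omega>. \<omega> \<in> space M \<Longrightarrow> \<bar>Y \<omega>\<bar> \<le> B"
  shows "walsh_integral M \<xi> (\<lambda>z \<omega>. Y \<omega> * H z \<omega>) (\<lambda>\<omega>. Y \<omega> * I \<omega>)"
proof -
  obtain R where Hm: "(\<lambda>(z, \<omega>). H z \<omega>) \<in> borel_measurable (lborel \<Otimes>\<^sub>M M)" and I: "I \<in> borel_measurable M"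
    and R: "sp_approx H R" using W unfolding walsh_integral_iff by blast
  then have v: "sp_valid M \<xi> (R k)" for k by (simp add: sp_approx_def)
  note va = sp_valid_after[OF v, of t]
  have mY: "Y \<in> borel_measurable M" by (rule measurable_nat_filt[OF Y(1)])
  have ap: "sp_approx H (\<lambda>k. sp_after t (R k))"
    by (rule sp_approx_restrict[OF R va sp_fun_after], rule eventually_mono[OF H]) auto
  define S where "S k = sp_scale Y (sp_after t (R k))" for k
  have vS: "sp_valid M \<xi> (S k)" for k
    unfolding S_def
    by (rule sp_valid_scale[OF va Y(2)])
      (auto simp: sp_after_def intro: nat_filt_mono[OF _ Y(1)])
  have "sp_approx (\<lambda>z \<omega>. Y \<omega> * H z \<omega>) S"
    unfolding sp_approx_def
  proof (intro conjI allI vS, rule ennreal_tendsto_0_squeeze)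
    let ?N = "\<lambda>k. \<integral>\<^sup>+z. \<integral>\<^sup>+\<omega>. ennreal ((sp_fun (sp_after t (R k)) z \<omega> - H z \<omega>)\<^sup>2) \<partial>M \<partial>lborel"
    show "(\<lambda>k. ennreal (B\<^sup>2) * ?N k) \<longlonglongrightarrow> 0"
      using ennreal_tendsto_cmult[of "ennreal (B\<^sup>2)"] ap unfolding sp_approx_def by fastforce
    fix k
    let ?f = "\<lambda>z \<omega>. sp_fun (sp_after t (R k)) z \<omega> - H z \<omega>"
    have f: "(\<lambda>(z, \<omega>). ?f z \<omega>) \<in> borel_measurable (lborel \<Otimes>\<^sub>M M)"
      using Hm sp_fun_measurable[OF va[of k]] by measurable
    have "(\<integral>\<^sup>+z. \<integral>\<^sup>+\<omega>. ennreal ((sp_fun (S k) z \<omega> - Y \<omega> * H z \<omega>)\<^sup>2) \<partial>M \<partial>lborel)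
      \<le> (\<integral>\<^sup>+z. \<integral>\<^sup>+\<omega>. ennreal (B\<^sup>2) * ennreal ((?f z \<omega>)\<^sup>2) \<partial>M \<partial>lborel)"
    proof (intro nn_integral_mono)
      fix z \<omega> assume "\<omega> \<in> space M"
      then have "\<bar>Y \<omega>\<bar> \<le> \<bar>B\<bar>" using Y(2) by force
      then have "(Y \<omega>)\<^sup>2 \<le> B\<^sup>2" by (simp add: abs_le_square_iff)
      then show "ennreal ((sp_fun (S k) z \<omega> - Y \<omega> * H z \<omega>)\<^sup>2) \<le> ennreal (B\<^sup>2) * ennreal ((?f z \<omega>)\<^sup>2)"
        by (simp add: S_def sp_fun_scale ennreal_mult [symmetric] right_diff_distrib [symmetric] power_mult_distrib mult_right_mono)
    qed
    also have "\<dots> = ennreal (B\<^sup>2) * ?N k"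
      using joint_measurable(1)[OF f] joint_measurable(2)[OF f, of "\<lambda>x. ennreal (x\<^sup>2)"]
      by (simp add: nn_integral_cmult)
    finally show "(\<integral>\<^sup>+z. \<integral>\<^sup>+\<omega>. ennreal ((sp_fun (S k) z \<omega> - Y \<omega> * H z \<omega>)\<^sup>2) \<partial>M \<partial>lborel) \<le> ennreal (B\<^sup>2) * ?N k" .
  qed
  moreover have "L2_conv (\<lambda>k. sp_int \<xi> (S k)) (\<lambda>\<omega>. Y \<omega> * I \<omega>)"
  proof -
    have "L2_conv (\<lambda>k \<omega>. Y \<omega> * sp_int \<xi> (sp_after t (R k)) \<omega>) (\<lambda>\<omega>. Y \<omega> * I \<omega>)"
      by (rule L2_conv_scale[OF sp_int_measurable[OF va] I walsh_approx_conv[OF W ap] Y(2)])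
    moreover have "sp_int \<xi> (S k) = (\<lambda>\<omega>. Y \<omega> * sp_int \<xi> (sp_after t (R k)) \<omega>)" for k
      by (rule ext) (simp add: S_def sp_int_scale)
    ultimately show ?thesis by simp
  qed
  moreover have "(\<lambda>(z, \<omega>). Y \<omega> * H z \<omega>) \<in> borel_measurable (lborel \<Otimes>\<^sub>M M)"
    using Hm mY by measurable
  moreover have "(\<lambda>\<omega>. Y \<omega> * I \<omega>) \<in> borel_measurable M" using I mY by measurable
  ultimately show ?thesis unfolding walsh_integral_iff by blast
qed

text \<open>The constant of \<open>trunc_pow_add\<close> enters twice, once for replacing
  \<open>I\<close> by an approximant and once for replacing the approximating process by
  \<open>H\<close> under the moment bound.\<close>

definition walsh_const :: "nat \<Rightarrow> real" where
  "walsh_const q = (2 * 4 ^ (q + 1))\<^sup>2 * moment_const q"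

lemma walsh_const_nonneg: "0 \<le> walsh_const q"
  by (simp add: walsh_const_def moment_const_nonneg)

text \<open>The truncated power is at most \<open>L ^ q\<close> times the square, so approximation
  errors tend to 0 for each fixed \<open>L\<close>, while the main term has a constant free of
  \<open>L\<close>. An approximant may be nonzero outside \<open>D\<close>; only its part on
  \<open>D\<close> is subject to the moment bound with area \<open>A\<close>, and the rest is small
  in mean square because \<open>H\<close> vanishes there.\<close>

lemma walsh_moment:
  assumes W: "walsh_integral M \<xi> H I"
    and D: "D \<in> sets borel" "emeasure lborel D \<le> ennreal A" and A: "0 < A" and L: "0 \<le> L"
    and H0: "\<And>z \<omega>. z \<notin> D \<Longrightarrow> \<omega> \<in> space M \<Longrightarrow> H z \<omega> = 0"
  shows "(\<integral>\<^sup>+\<omega>. ennreal (trunc_pow q L (I \<omega>)) \<partial>M)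
    \<le> ennreal (walsh_const q / A) * (\<integral>\<^sup>+z. \<integral>\<^sup>+\<omega>. ennreal (trunc_pow q L (sqrt A * H z \<omega>)) \<partial>M \<partial>lborel)"
proof -
  obtain R where H: "(\<lambda>(z, \<omega>). H z \<omega>) \<in> borel_measurable (lborel \<Otimes>\<^sub>M M)" and I [measurable]: "I \<in> borel_measurable M"
    and R: "sp_approx H R" and RI: "L2_conv (\<lambda>k. sp_int \<xi> (R k)) I"
    using W unfolding walsh_integral_iff by blast
  have v: "sp_valid M \<xi> (R k)" for k using R by (auto simp: sp_approx_def)
  define c where "c = (2 * 4 ^ (q + 1) :: real)"
  define K where "K = moment_const q"
  define T where "T = (\<integral>\<^sup>+z. \<integral>\<^sup>+\<omega>. ennreal (trunc_pow q L (sqrt A * H z \<omega>)) \<partial>M \<partial>lborel)"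
  define e where "e k = (\<integral>\<^sup>+\<omega>. ennreal ((sp_int \<xi> (R k) \<omega> - I \<omega>)\<^sup>2) \<partial>M)" for k
  define N where "N k = (\<integral>\<^sup>+z. \<integral>\<^sup>+\<omega>. ennreal ((sp_fun (R k) z \<omega> - H z \<omega>)\<^sup>2) \<partial>M \<partial>lborel)" for k
  define d where "d k = 2 * e k + (2 * ennreal (moment_const 0)) * N k" for k
  have lim: "e \<longlonglongrightarrow> 0" "N \<longlonglongrightarrow> 0"
    using R RI unfolding sp_approx_def L2_conv_def e_def N_def by auto
  then have dlim: "d \<longlonglongrightarrow> 0" unfolding d_def by (intro ennreal_tendsto_0_lincomb) (auto simp: ennreal_mult_less_top)
  have c0: "0 \<le> c" and K0: "0 \<le> K" by (auto simp: c_def K_def moment_const_nonneg)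
  have wc: "walsh_const q = c * c * K"
    unfolding walsh_const_def c_def K_def power2_eq_square ..
  have Lq: "0 \<le> L ^ q" using L by simp
  \<comment> \<open>The error part is estimated by its square at the price of \<open>L ^ q\<close>;
    the main part keeps the truncated power.\<close>
  have split: "ennreal (trunc_pow q L (x + y)) \<le> ennreal c * (ennreal (trunc_pow q L x) + ennreal (L ^ q) * ennreal (y\<^sup>2))" for x y
  proof -
    have "trunc_pow q L (x + y) \<le> c * (trunc_pow q L x + trunc_pow q L y)"
      unfolding c_def by (rule trunc_pow_add[OF L])
    also have "\<dots> \<le> c * (trunc_pow q L x + L ^ q * y\<^sup>2)"
      using c0 trunc_pow_le_square[OF L] by (intro mult_left_mono add_left_mono) auto
    finally have "ennreal (trunc_pow q L (x + y)) \<le> ennreal (c * (trunc_pow q L x + L ^ q * y\<^sup>2))" by (rule ennreal_leI)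
    then show ?thesis using c0 Lq trunc_pow_nonneg[OF L, of q x] by (simp add: ennreal_mult ennreal_plus)
  qed
  have main: "(\<integral>\<^sup>+\<omega>. ennreal (trunc_pow q L (I \<omega>)) \<partial>M)
     \<le> ennreal (walsh_const q / A) * T + (ennreal (c * c * K * L ^ q) * N k + ennreal (c * L ^ q) * d k)" for k
  proof -
    let ?J = "sp_int_on D (R k)"
    have J [measurable]: "?J \<in> borel_measurable M" "sp_int_on (- D) (R k) \<in> borel_measurable M"
      using D(1) by (auto intro!: sp_int_on_measurable v)
    note [measurable] = sp_int_measurable[OF v[of k]]
    \<comment> \<open>The difference consists of the approximation error of the integral and of the
      integral over the complement of \<open>D\<close>; both tend to 0 in mean square.\<close>
    have dk: "(\<integral>\<^sup>+\<omega>. ennreal ((I \<omega> - ?J \<omega>)\<^sup>2) \<partial>M) \<le> d k"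
    proof -
      have "(\<integral>\<^sup>+\<omega>. ennreal ((I \<omega> - ?J \<omega>)\<^sup>2) \<partial>M)
         = (\<integral>\<^sup>+\<omega>. ennreal (((I \<omega> - sp_int \<xi> (R k) \<omega>) + sp_int_on (- D) (R k) \<omega>)\<^sup>2) \<partial>M)"
      proof (rule nn_integral_cong_AE)
        show "AE \<omega> in M. ennreal ((I \<omega> - ?J \<omega>)\<^sup>2) = ennreal (((I \<omega> - sp_int \<xi> (R k) \<omega>) + sp_int_on (- D) (R k) \<omega>)\<^sup>2)"
          using sp_int_split[OF v[of k] D(1)] by eventually_elim simp
      qed
      also have "\<dots> \<le> 2 * (\<integral>\<^sup>+\<omega>. ennreal ((I \<omega> - sp_int \<xi> (R k) \<omega>)\<^sup>2) \<partial>M) + 2 * (\<integral>\<^sup>+\<omega>. ennreal ((sp_int_on (- D) (R k) \<omega>)\<^sup>2) \<partial>M)"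
        by (rule nn_integral_square_add_le) measurable
      also have "(\<integral>\<^sup>+\<omega>. ennreal ((I \<omega> - sp_int \<xi> (R k) \<omega>)\<^sup>2) \<partial>M) = e k" by (simp add: e_def power2_commute)
      also have "(\<integral>\<^sup>+\<omega>. ennreal ((sp_int_on (- D) (R k) \<omega>)\<^sup>2) \<partial>M) \<le> ennreal (moment_const 0) * N k"
      proof (rule order_trans[OF sp_int_on_square_le[OF v]])
        show "- D \<in> sets borel" using D(1) by auto
        show "ennreal (moment_const 0) * (\<integral>\<^sup>+z. indicator (- D) z * (\<integral>\<^sup>+\<omega>. ennreal ((sp_fun (R k) z \<omega>)\<^sup>2) \<partial>M) \<partial>lborel) \<le> ennreal (moment_const 0) * N k"
          unfolding N_def
        proof (intro mult_left_mono nn_integral_mono)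
          fix z
          show "indicator (- D) z * (\<integral>\<^sup>+\<omega>. ennreal ((sp_fun (R k) z \<omega>)\<^sup>2) \<partial>M) \<le> (\<integral>\<^sup>+\<omega>. ennreal ((sp_fun (R k) z \<omega> - H z \<omega>)\<^sup>2) \<partial>M)"
          proof (cases "z \<in> D")
            case False
            then have "(\<integral>\<^sup>+\<omega>. ennreal ((sp_fun (R k) z \<omega>)\<^sup>2) \<partial>M) = (\<integral>\<^sup>+\<omega>. ennreal ((sp_fun (R k) z \<omega> - H z \<omega>)\<^sup>2) \<partial>M)"
              by (intro nn_integral_cong) (simp add: H0)
            then show ?thesis using False by simp
          qed simp
        qed simp
      qed
      finally show ?thesis unfolding d_def by (simp add: mult.assoc mult_left_mono add_left_mono)
    qed
    have fm: "(\<lambda>(z, \<omega>). sp_fun (R k) z \<omega> - H z \<omega>) \<in> borel_measurable (lborel \<Otimes>\<^sub>M M)"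
      using H sp_fun_measurable[OF v[of k]] by measurable
    have Jk: "(\<integral>\<^sup>+\<omega>. ennreal (trunc_pow q L (?J \<omega>)) \<partial>M) \<le> ennreal (K / A) * (ennreal c * (T + ennreal (L ^ q) * (ennreal A * N k)))"
    proof -
      have "(\<integral>\<^sup>+\<omega>. ennreal (trunc_pow q L (?J \<omega>)) \<partial>M)
        \<le> ennreal (K / A) * (\<integral>\<^sup>+z. indicator D z * (\<integral>\<^sup>+\<omega>. ennreal (trunc_pow q L (sqrt A * sp_fun (R k) z \<omega>)) \<partial>M) \<partial>lborel)"
        unfolding K_def by (rule sp_moment[OF v D A L])
      also have "(\<integral>\<^sup>+z. indicator D z * (\<integral>\<^sup>+\<omega>. ennreal (trunc_pow q L (sqrt A * sp_fun (R k) z \<omega>)) \<partial>M) \<partial>lborel)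
        \<le> (\<integral>\<^sup>+z. ennreal c * ((\<integral>\<^sup>+\<omega>. ennreal (trunc_pow q L (sqrt A * H z \<omega>)) \<partial>M)
            + ennreal (L ^ q) * (ennreal A * (\<integral>\<^sup>+\<omega>. ennreal ((sp_fun (R k) z \<omega> - H z \<omega>)\<^sup>2) \<partial>M))) \<partial>lborel)"
      proof (rule nn_integral_mono)
        fix z
        have [measurable]: "H z \<in> borel_measurable M" "(\<lambda>\<omega>. sp_fun (R k) z \<omega> - H z \<omega>) \<in> borel_measurable M"
          by (rule joint_measurable(1)[OF H]) (rule joint_measurable(1)[OF fm])
        have "(\<integral>\<^sup>+\<omega>. ennreal (trunc_pow q L (sqrt A * sp_fun (R k) z \<omega>)) \<partial>M)
          \<le> (\<integral>\<^sup>+\<omega>. ennreal c * (ennreal (trunc_pow q L (sqrt A * H z \<omega>))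
               + ennreal (L ^ q) * (ennreal A * ennreal ((sp_fun (R k) z \<omega> - H z \<omega>)\<^sup>2))) \<partial>M)"
        proof (rule nn_integral_mono)
          fix \<omega>
          have "sqrt A * sp_fun (R k) z \<omega> = sqrt A * H z \<omega> + sqrt A * (sp_fun (R k) z \<omega> - H z \<omega>)" by (simp add: algebra_simps)
          moreover have "ennreal ((sqrt A * (sp_fun (R k) z \<omega> - H z \<omega>))\<^sup>2) = ennreal A * ennreal ((sp_fun (R k) z \<omega> - H z \<omega>)\<^sup>2)"
            using A by (simp add: power_mult_distrib ennreal_mult)
          ultimately show "ennreal (trunc_pow q L (sqrt A * sp_fun (R k) z \<omega>))
            \<le> ennreal c * (ennreal (trunc_pow q L (sqrt A * H z \<omega>))
               + ennreal (L ^ q) * (ennreal A * ennreal ((sp_fun (R k) z \<omega> - H z \<omega>)\<^sup>2)))"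
            using split[of "sqrt A * H z \<omega>" "sqrt A * (sp_fun (R k) z \<omega> - H z \<omega>)"] by simp
        qed
        also have "\<dots> = ennreal c * ((\<integral>\<^sup>+\<omega>. ennreal (trunc_pow q L (sqrt A * H z \<omega>)) \<partial>M)
            + ennreal (L ^ q) * (ennreal A * (\<integral>\<^sup>+\<omega>. ennreal ((sp_fun (R k) z \<omega> - H z \<omega>)\<^sup>2) \<partial>M)))"
          by (simp add: nn_integral_cmult nn_integral_add)
        finally show "indicator D z * (\<integral>\<^sup>+\<omega>. ennreal (trunc_pow q L (sqrt A * sp_fun (R k) z \<omega>)) \<partial>M) \<le> \<dots>"
          by (auto simp: indicator_def)
      qed
      also have "\<dots> = ennreal c * (T + ennreal (L ^ q) * (ennreal A * N k))"
      proof -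
        have [measurable]: "(\<lambda>z. \<integral>\<^sup>+\<omega>. ennreal (trunc_pow q L (sqrt A * H z \<omega>)) \<partial>M) \<in> borel_measurable lborel"
          using joint_measurable(2)[OF H, of "\<lambda>x. ennreal (trunc_pow q L (sqrt A * x))"] by simp
        have [measurable]: "(\<lambda>z. \<integral>\<^sup>+\<omega>. ennreal ((sp_fun (R k) z \<omega> - H z \<omega>)\<^sup>2) \<partial>M) \<in> borel_measurable lborel"
          using joint_measurable(2)[OF fm, of "\<lambda>x. ennreal (x\<^sup>2)"] by simp
        show ?thesis unfolding T_def N_def by (simp add: nn_integral_cmult nn_integral_add)
      qed
      finally show ?thesis by (simp add: mult_left_mono)
    qed
    have "(\<integral>\<^sup>+\<omega>. ennreal (trunc_pow q L (I \<omega>)) \<partial>M)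
       \<le> (\<integral>\<^sup>+\<omega>. ennreal c * (ennreal (trunc_pow q L (?J \<omega>)) + ennreal (L ^ q) * ennreal ((I \<omega> - ?J \<omega>)\<^sup>2)) \<partial>M)"
    proof (rule nn_integral_mono)
      fix \<omega> show "ennreal (trunc_pow q L (I \<omega>)) \<le> ennreal c * (ennreal (trunc_pow q L (?J \<omega>)) + ennreal (L ^ q) * ennreal ((I \<omega> - ?J \<omega>)\<^sup>2))"
        using split[of "?J \<omega>" "I \<omega> - ?J \<omega>"] by simp
    qed
    also have "\<dots> = ennreal c * ((\<integral>\<^sup>+\<omega>. ennreal (trunc_pow q L (?J \<omega>)) \<partial>M) + ennreal (L ^ q) * (\<integral>\<^sup>+\<omega>. ennreal ((I \<omega> - ?J \<omega>)\<^sup>2) \<partial>M))"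
      by (simp add: nn_integral_cmult nn_integral_add)
    also have "\<dots> \<le> ennreal c * (ennreal (K / A) * (ennreal c * (T + ennreal (L ^ q) * (ennreal A * N k))) + ennreal (L ^ q) * d k)"
      by (intro mult_left_mono add_mono Jk dk) auto
    also have "\<dots> = ennreal c * ennreal (K / A) * ennreal c * T
       + (ennreal c * ennreal (K / A) * ennreal c * ennreal (L ^ q) * ennreal A * N k + ennreal c * ennreal (L ^ q) * d k)"
      by (simp add: distrib_left mult.assoc add.assoc)
    also have "ennreal c * ennreal (K / A) * ennreal c = ennreal (walsh_const q / A)"
      using c0 K0 A by (simp add: ennreal_mult [symmetric] wc mult_ac)
    also have "ennreal (walsh_const q / A) * ennreal (L ^ q) * ennreal A = ennreal (c * c * K * L ^ q)"
      using c0 K0 A Lq by (simp add: ennreal_mult [symmetric] wc mult_ac)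
    also have "ennreal c * ennreal (L ^ q) = ennreal (c * L ^ q)" using c0 Lq by (simp add: ennreal_mult)
    finally show ?thesis .
  qed
  have "(\<lambda>k. ennreal (walsh_const q / A) * T + (ennreal (c * c * K * L ^ q) * N k + ennreal (c * L ^ q) * d k))
     \<longlonglongrightarrow> ennreal (walsh_const q / A) * T + 0"
    by (intro tendsto_add tendsto_const ennreal_tendsto_0_lincomb lim dlim) auto
  then show ?thesis unfolding T_def [symmetric]
    using main by (intro LIMSEQ_le_const[where X = "\<lambda>k. ennreal (walsh_const q / A) * T + (ennreal (c * c * K * L ^ q) * N k + ennreal (c * L ^ q) * d k)"]) auto
qed

text \<open>The bound is uniform in the level, so the truncation can be removed. Scaling by
  \<open>sqrt A\<close> yields \<open>A ^ (q + 1)\<close>, and division by \<open>A\<close> leaves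
  \<open>A ^ q\<close>.\<close>

lemma walsh_moment_power:
  assumes W: "walsh_integral M \<xi> H I"
    and D: "D \<in> sets borel" "emeasure lborel D \<le> ennreal A" and A: "0 < A"
    and H0: "\<And>z \<omega>. z \<notin> D \<Longrightarrow> \<omega> \<in> space M \<Longrightarrow> H z \<omega> = 0"
  shows "(\<integral>\<^sup>+\<omega>. ennreal ((I \<omega>) ^ (2 * q + 2)) \<partial>M)
    \<le> ennreal (walsh_const q * A ^ q) * (\<integral>\<^sup>+z. \<integral>\<^sup>+\<omega>. ennreal ((H z \<omega>) ^ (2 * q + 2)) \<partial>M \<partial>lborel)"
proof (rule nn_integral_power_le_of_trunc_pow)
  have H: "(\<lambda>(z, \<omega>). H z \<omega>) \<in> borel_measurable (lborel \<Otimes>\<^sub>M M)" and I: "I \<in> borel_measurable M"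
    using W unfolding walsh_integral_iff by blast+
  show "I \<in> borel_measurable M" by (rule I)
  fix k
  have "(\<integral>\<^sup>+\<omega>. ennreal (trunc_pow q (real k) (I \<omega>)) \<partial>M)
    \<le> ennreal (walsh_const q / A) * (\<integral>\<^sup>+z. \<integral>\<^sup>+\<omega>. ennreal (trunc_pow q (real k) (sqrt A * H z \<omega>)) \<partial>M \<partial>lborel)"
    by (rule walsh_moment[OF W D A _ H0]) auto
  also have "\<dots> \<le> ennreal (walsh_const q / A) * (\<integral>\<^sup>+z. \<integral>\<^sup>+\<omega>. ennreal (A ^ (q + 1)) * ennreal ((H z \<omega>) ^ (2 * q + 2)) \<partial>M \<partial>lborel)"
  proof (intro mult_left_mono nn_integral_mono)
    fix z \<omega>
    have e: "2 * q + 2 = 2 * (q + 1)" by simp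
    have "trunc_pow q (real k) (sqrt A * H z \<omega>) \<le> (sqrt A * H z \<omega>) ^ (2 * q + 2)"
      by (rule trunc_pow_le_power) simp
    also have "\<dots> = A ^ (q + 1) * (H z \<omega>) ^ (2 * q + 2)"
      using A unfolding e power_mult_distrib power_mult by simp
    finally show "ennreal (trunc_pow q (real k) (sqrt A * H z \<omega>)) \<le> ennreal (A ^ (q + 1)) * ennreal ((H z \<omega>) ^ (2 * q + 2))"
      using A by (subst ennreal_mult' [symmetric]) (auto intro!: ennreal_leI)
  qed simp
  also have "\<dots> = ennreal (walsh_const q / A) * (ennreal (A ^ (q + 1)) * (\<integral>\<^sup>+z. \<integral>\<^sup>+\<omega>. ennreal ((H z \<omega>) ^ (2 * q + 2)) \<partial>M \<partial>lborel))"
    using joint_measurable(1)[OF H] joint_measurable(2)[OF H, of "\<lambda>x. ennreal (x ^ (2 * q + 2))"]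
    by (simp add: nn_integral_cmult)
  also have "\<dots> = ennreal (walsh_const q * A ^ q) * (\<integral>\<^sup>+z. \<integral>\<^sup>+\<omega>. ennreal ((H z \<omega>) ^ (2 * q + 2)) \<partial>M \<partial>lborel)"
  proof -
    have "ennreal (walsh_const q / A) * ennreal (A ^ (q + 1)) = ennreal (walsh_const q * A ^ q)"
      using A walsh_const_nonneg[of q] by (subst ennreal_mult [symmetric]) auto
    then show ?thesis by (simp add: mult.assoc [symmetric])
  qed
  finally show "(\<integral>\<^sup>+\<omega>. ennreal (trunc_pow q (real k) (I \<omega>)) \<partial>M)
    \<le> ennreal (walsh_const q * A ^ q) * (\<integral>\<^sup>+z. \<integral>\<^sup>+\<omega>. ennreal ((H z \<omega>) ^ (2 * q + 2)) \<partial>M \<partial>lborel)" .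
qed

end

section \<open>Moments of mild solutions\<close>

definition wave_kernel :: "real \<Rightarrow> real \<Rightarrow> real \<times> real \<Rightarrow> real" where
  "wave_kernel t x z = indicator {0<..t} (fst z) * waveG (t - fst z) (x - snd z)"

text \<open>The domain of dependence of \<open>(T, x0)\<close> in nonnegative time. It contains the
  support of the kernel of each of its points, so a Gronwall argument closes on it.\<close>

definition past_cone :: "real \<Rightarrow> real \<Rightarrow> (real \<times> real) set" where
  "past_cone T x0 = {z. 0 \<le> fst z \<and> \<bar>snd z - x0\<bar> \<le> T - fst z}"

text \<open>In the characteristic coordinates \<open>y - s\<close> and \<open>y + s\<close> the
  light cone is a quadrant, which makes comparisons of kernels a matter of linear
  inequalities.\<close>

lemma wave_kernel_eq:
  "wave_kernel t x (s, y) = (if 0 < s \<and> x - t < y - s \<and> y + s < x + t then 1 / 2 else 0)"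
  by (auto simp: wave_kernel_def waveG_def indicator_def)

lemma wave_kernel_measurable [measurable]: "wave_kernel t x \<in> borel_measurable borel"
proof -
  have eq: "wave_kernel t x = (\<lambda>z. if 0 < fst z \<and> x - t < snd z - fst z \<and> snd z + fst z < x + t then 1 / 2 else 0)"
    by (rule ext) (metis prod.collapse wave_kernel_eq)
  show ?thesis unfolding eq borel_prod[symmetric] by measurable
qed

lemma wave_kernel_bounds: "0 \<le> wave_kernel t x z" "wave_kernel t x z \<le> 1 / 2"
  by (cases z; simp add: wave_kernel_eq)+

lemma wave_kernel_support:
  assumes "wave_kernel t x z \<noteq> 0"
  shows "0 < fst z" "fst z < t" "\<bar>snd z - x\<bar> < t - fst z"
  using assms by (cases z; auto simp: wave_kernel_eq split: if_splits)+

text \<open>Domains of dependence are nested, so one integral at the apex controls those at all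
  points of the cone.\<close>

lemma wave_kernel_mono:
  assumes "(t, x) \<in> past_cone T x0"
  shows "wave_kernel t x z \<le> wave_kernel T x0 z"
  using assms by (cases z) (auto simp: wave_kernel_eq past_cone_def)

lemma cone_backward:
  assumes "(t, x) \<in> past_cone T x0" "wave_kernel t x z \<noteq> 0"
  shows "z \<in> past_cone T x0"
  using assms(1) wave_kernel_support[OF assms(2)] by (cases z) (auto simp: past_cone_def)

lemma emeasure_finite_bound:
  assumes "emeasure N D < \<infinity>" obtains A where "0 < A" "emeasure N D \<le> ennreal A"
proof
  show "0 < measure N D + 1" by (simp add: add_nonneg_pos)
  show "emeasure N D \<le> ennreal (measure N D + 1)"
    using assms by (subst emeasure_eq_ennreal_measure) (auto intro!: ennreal_leI)
qed

text \<open>Integration in time against \<open>exp (\<kappa> * s)\<close> gains a factor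
  \<open>1 / \<kappa>\<close>; a large \<kappa> will make the stochastic term contractive.\<close>

lemma nn_integral_exp_strip:
  assumes "0 < \<kappa>" "0 \<le> t" "\<alpha> \<le> \<beta>"
  shows "(\<integral>\<^sup>+z. ennreal (exp (\<kappa> * fst z)) * indicator (rect 0 t \<alpha> \<beta>) z \<partial>lborel) \<le> ennreal ((\<beta> - \<alpha>) * exp (\<kappa> * t) / \<kappa>)"
proof -
  have m: "(\<lambda>z. ennreal (exp (\<kappa> * fst z)) * indicator (rect 0 t \<alpha> \<beta>) z) \<in> borel_measurable (lborel \<Otimes>\<^sub>M lborel)"
    unfolding rect_def by measurable
  have "(\<integral>\<^sup>+z. ennreal (exp (\<kappa> * fst z)) * indicator (rect 0 t \<alpha> \<beta>) z \<partial>lborel)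
    = (\<integral>\<^sup>+s. \<integral>\<^sup>+y. ennreal (exp (\<kappa> * s)) * indicator (rect 0 t \<alpha> \<beta>) (s, y) \<partial>lborel \<partial>lborel)"
    unfolding lborel_prod [symmetric] using lborel.nn_integral_fst[OF m] by simp
  also have "\<dots> = (\<integral>\<^sup>+s. ennreal (\<beta> - \<alpha>) * (ennreal (exp (\<kappa> * s)) * indicator {0<..t} s) \<partial>lborel)"
  proof (rule nn_integral_cong)
    fix s :: real
    have "(\<integral>\<^sup>+y. ennreal (exp (\<kappa> * s)) * indicator (rect 0 t \<alpha> \<beta>) (s, y) \<partial>lborel)
      = (\<integral>\<^sup>+y. (ennreal (exp (\<kappa> * s)) * indicator {0<..t} s) * indicator {\<alpha><..\<beta>} y \<partial>lborel)"
      by (intro nn_integral_cong) (auto simp: rect_def indicator_def)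
    also have "\<dots> = (ennreal (exp (\<kappa> * s)) * indicator {0<..t} s) * ennreal (\<beta> - \<alpha>)"
      using assms by (subst nn_integral_cmult_indicator) auto
    finally show "(\<integral>\<^sup>+y. ennreal (exp (\<kappa> * s)) * indicator (rect 0 t \<alpha> \<beta>) (s, y) \<partial>lborel)
      = ennreal (\<beta> - \<alpha>) * (ennreal (exp (\<kappa> * s)) * indicator {0<..t} s)" by (simp add: mult.commute)
  qed
  also have "\<dots> = ennreal (\<beta> - \<alpha>) * (\<integral>\<^sup>+s. ennreal (exp (\<kappa> * s)) * indicator {0<..t} s \<partial>lborel)"
    by (rule nn_integral_cmult) measurable
  also have "\<dots> \<le> ennreal (\<beta> - \<alpha>) * (\<integral>\<^sup>+s. ennreal (exp (\<kappa> * s)) * indicator {0..t} s \<partial>lborel)"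
    by (intro mult_left_mono nn_integral_mono) (auto simp: indicator_def)
  also have "(\<integral>\<^sup>+s. ennreal (exp (\<kappa> * s)) * indicator {0..t} s \<partial>lborel) = ennreal (exp (\<kappa> * t) / \<kappa> - exp (\<kappa> * 0) / \<kappa>)"
    by (rule nn_integral_FTC_Icc) (use assms in \<open>auto intro!: derivative_eq_intros\<close>)
  also have "\<dots> \<le> ennreal (exp (\<kappa> * t) / \<kappa>)" using assms by (intro ennreal_leI) auto
  also have "ennreal (\<beta> - \<alpha>) * ennreal (exp (\<kappa> * t) / \<kappa>) = ennreal ((\<beta> - \<alpha>) * exp (\<kappa> * t) / \<kappa>)"
    using assms by (simp add: ennreal_mult [symmetric])
  finally show ?thesis by (simp add: mult_left_mono)
qed

text \<open>An integrand is at finite mean-square distance from some simple process, and simple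
  processes are square integrable. For a mild solution this is the a priori bound to start
  from.\<close>

lemma (in gaussian_noise) walsh_square_finite:
  assumes W: "walsh_integral M \<xi> H I"
  shows "(\<integral>\<^sup>+z. \<integral>\<^sup>+\<omega>. ennreal ((H z \<omega>)\<^sup>2) \<partial>M \<partial>lborel) < \<infinity>"
proof -
  obtain R where H: "(\<lambda>(z, \<omega>). H z \<omega>) \<in> borel_measurable (lborel \<Otimes>\<^sub>M M)" and R: "sp_approx H R"
    using W unfolding walsh_integral_iff by blast
  let ?N = "\<lambda>k. \<integral>\<^sup>+z. \<integral>\<^sup>+\<omega>. ennreal ((sp_fun (R k) z \<omega> - H z \<omega>)\<^sup>2) \<partial>M \<partial>lborel"
  have v: "sp_valid M \<xi> (R k)" for k using R by (auto simp: sp_approx_def)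
  have "\<forall>\<^sub>F k in sequentially. ?N k < 1"
    using R unfolding sp_approx_def by (intro order_tendstoD(2)) auto
  then obtain k where k: "?N k < 1" by (meson eventually_happens' sequentially_bot)
  have simple: "(\<integral>\<^sup>+z. \<integral>\<^sup>+\<omega>. ennreal ((sp_fun S z \<omega>)\<^sup>2) \<partial>M \<partial>lborel) < \<infinity>" if "sp_valid M \<xi> S" for S
    using that
  proof (induction S)
    case Nil
    then show ?case by (simp add: sp_fun_def)
  next
    case (Cons r S)
    have v1: "sp_valid M \<xi> [r]" and v2: "sp_valid M \<xi> S" using Cons.prems by (auto simp: sp_valid_def)
    note V = sp_validD[OF v1, of 0, simplified]
    obtain B where B: "\<forall>\<omega>\<in>space M. \<bar>sp_coeff [r] 0 \<omega>\<bar> \<le> B" using V(2) by auto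
    have "(\<integral>\<^sup>+z. \<integral>\<^sup>+\<omega>. ennreal ((sp_fun [r] z \<omega>)\<^sup>2) \<partial>M \<partial>lborel)
       \<le> (\<integral>\<^sup>+z. ennreal (B\<^sup>2) * indicator (sp_rect [r] 0) z \<partial>lborel)"
    proof (rule nn_integral_mono)
      fix z
      have "(\<integral>\<^sup>+\<omega>. ennreal ((sp_fun [r] z \<omega>)\<^sup>2) \<partial>M) \<le> (\<integral>\<^sup>+\<omega>. ennreal (B\<^sup>2) * indicator (sp_rect [r] 0) z \<partial>M)"
      proof (rule nn_integral_mono)
        fix \<omega> assume "\<omega> \<in> space M"
        then have "\<bar>sp_coeff [r] 0 \<omega>\<bar> \<le> \<bar>B\<bar>" using B by force
        then have "(sp_coeff [r] 0 \<omega>)\<^sup>2 \<le> B\<^sup>2" by (simp add: abs_le_square_iff)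
        then show "ennreal ((sp_fun [r] z \<omega>)\<^sup>2) \<le> ennreal (B\<^sup>2) * indicator (sp_rect [r] 0) z"
          by (cases "z \<in> sp_rect [r] 0") (auto simp: sp_fun_eq intro!: ennreal_leI)
      qed
      then show "(\<integral>\<^sup>+\<omega>. ennreal ((sp_fun [r] z \<omega>)\<^sup>2) \<partial>M) \<le> ennreal (B\<^sup>2) * indicator (sp_rect [r] 0) z"
        by (simp add: emeasure_space_1)
    qed
    also have "\<dots> < \<infinity>" using V(3,4) by (subst nn_integral_cmult_indicator) (auto simp: ennreal_mult_less_top)
    finally have 1: "(\<integral>\<^sup>+z. \<integral>\<^sup>+\<omega>. ennreal ((sp_fun [r] z \<omega>)\<^sup>2) \<partial>M \<partial>lborel) < \<infinity>" .
    have "(\<integral>\<^sup>+z. \<integral>\<^sup>+\<omega>. ennreal ((sp_fun (r # S) z \<omega>)\<^sup>2) \<partial>M \<partial>lborel)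
      = (\<integral>\<^sup>+z. \<integral>\<^sup>+\<omega>. ennreal ((sp_fun [r] z \<omega> + sp_fun S z \<omega>)\<^sup>2) \<partial>M \<partial>lborel)"
      using sp_fun_append[of "[r]" S] by simp
    also have "\<dots> \<le> 2 * (\<integral>\<^sup>+z. \<integral>\<^sup>+\<omega>. ennreal ((sp_fun [r] z \<omega>)\<^sup>2) \<partial>M \<partial>lborel)
        + 2 * (\<integral>\<^sup>+z. \<integral>\<^sup>+\<omega>. ennreal ((sp_fun S z \<omega>)\<^sup>2) \<partial>M \<partial>lborel)"
      by (rule iterated_square_add_le[OF sp_fun_measurable[OF v1] sp_fun_measurable[OF v2]])
    also have "\<dots> < \<infinity>" using 1 Cons.IH[OF v2] by (simp add: ennreal_mult_less_top)
    finally show ?case .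
  qed
  have "(\<integral>\<^sup>+z. \<integral>\<^sup>+\<omega>. ennreal ((H z \<omega>)\<^sup>2) \<partial>M \<partial>lborel)
    = (\<integral>\<^sup>+z. \<integral>\<^sup>+\<omega>. ennreal (((H z \<omega> - sp_fun (R k) z \<omega>) + sp_fun (R k) z \<omega>)\<^sup>2) \<partial>M \<partial>lborel)" by simp
  also have "\<dots> \<le> 2 * (\<integral>\<^sup>+z. \<integral>\<^sup>+\<omega>. ennreal ((H z \<omega> - sp_fun (R k) z \<omega>)\<^sup>2) \<partial>M \<partial>lborel)
      + 2 * (\<integral>\<^sup>+z. \<integral>\<^sup>+\<omega>. ennreal ((sp_fun (R k) z \<omega>)\<^sup>2) \<partial>M \<partial>lborel)"
    by (rule iterated_square_add_le) (use H sp_fun_measurable[OF v[of k]] in measurable)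
  also have "(\<integral>\<^sup>+z. \<integral>\<^sup>+\<omega>. ennreal ((H z \<omega> - sp_fun (R k) z \<omega>)\<^sup>2) \<partial>M \<partial>lborel) = ?N k"
    by (simp add: power2_commute)
  also have "2 * ?N k + 2 * (\<integral>\<^sup>+z. \<integral>\<^sup>+\<omega>. ennreal ((sp_fun (R k) z \<omega>)\<^sup>2) \<partial>M \<partial>lborel) < \<infinity>"
    using k simple[OF v[of k]] by (auto simp: ennreal_mult_less_top intro: order.strict_trans)
  finally show ?thesis .
qed

text \<open>Linear growth of a Lipschitz nonlinearity carries over to truncated powers with
  constants free of \<open>L\<close>, as the absorption argument requires.\<close>

lemma trunc_pow_affine_le:
  assumes L: "0 \<le> L" and F: "\<bar>f\<bar> \<le> a + b * \<bar>y\<bar>" and "0 \<le> a" "0 \<le> b"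
  shows "trunc_pow q L f \<le> 2 * 4 ^ (q + 1) * (a ^ (2 * q + 2) + (b\<^sup>2 + b ^ (2 * q + 2)) * trunc_pow q L y)"
proof -
  have "\<bar>f\<bar> \<le> \<bar>a + b * \<bar>y\<bar>\<bar>" using F by simp
  then have "trunc_pow q L f \<le> trunc_pow q L (a + b * \<bar>y\<bar>)"
    by (intro trunc_pow_mono[OF L]) (simp only: abs_le_square_iff)
  also have "\<dots> \<le> 2 * 4 ^ (q + 1) * (trunc_pow q L a + trunc_pow q L (b * \<bar>y\<bar>))"
    by (rule trunc_pow_add[OF L])
  also have "\<dots> \<le> 2 * 4 ^ (q + 1) * (a ^ (2 * q + 2) + (b\<^sup>2 + b ^ (2 * q + 2)) * trunc_pow q L y)"
  proof (intro mult_left_mono add_mono trunc_pow_le_power[OF L])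
    have "trunc_pow q L (b * \<bar>y\<bar>) = trunc_pow q L (y * b)"
      by (simp add: trunc_pow_def power_mult_distrib mult.commute)
    then show "trunc_pow q L (b * \<bar>y\<bar>) \<le> (b\<^sup>2 + b ^ (2 * q + 2)) * trunc_pow q L y"
      using trunc_pow_mult[OF L, of q y b] by (simp add: mult.commute)
  qed simp
  finally show ?thesis .
qed

text \<open>The data enter only through a locally bounded Lipschitz function \<open>w\<close>, and
  only nonnegative times are considered; the time-reversed equation is another instance.\<close>

locale wave_field = gaussian_noise +
  fixes F :: "real \<Rightarrow> real" and v :: "real \<Rightarrow> real \<Rightarrow> 'a \<Rightarrow> real" and w :: "real \<Rightarrow> real \<Rightarrow> real" and K :: real
  assumes lip: "\<bar>F a - F b\<bar> \<le> K * \<bar>a - b\<bar>"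
    and field_measurable: "0 \<le> t \<Longrightarrow> v t x \<in> borel_measurable M"
    and mild: "0 \<le> t \<Longrightarrow> \<exists>I. walsh_integral M \<xi> (\<lambda>z \<omega>. wave_kernel t x z * F (v (fst z) (snd z) \<omega>)) I
       \<and> (AE \<omega> in M. v t x \<omega> = w t x + I \<omega>)"
    and w_bounded: "\<exists>W. \<forall>t x. 0 \<le> t \<longrightarrow> t \<le> T \<longrightarrow> \<bar>w t x\<bar> \<le> W"
    and w_lipschitz: "\<exists>C. \<forall>t t' x x'. 0 \<le> t \<longrightarrow> 0 \<le> t' \<longrightarrow> \<bar>w t x - w t' x'\<bar> \<le> C * (\<bar>t - t'\<bar> + \<bar>x - x'\<bar>)"
begin

lemma K_nonneg: "0 \<le> K"
  using lip[of 1 0] by simp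

lemma F_continuous: "continuous_on UNIV F"
proof -
  have "K-lipschitz_on UNIV F"
    by (rule lipschitz_onI) (use lip K_nonneg in \<open>auto simp: dist_real_def\<close>)
  then show ?thesis by (rule lipschitz_on_continuous_on)
qed

lemma F_measurable [measurable]: "F \<in> borel_measurable borel"
  by (rule borel_measurable_continuous_onI[OF F_continuous])

lemma second_moment_bound:
  assumes T: "0 \<le> T"
  shows "\<exists>B. \<forall>z\<in>past_cone T x0. (\<integral>\<^sup>+\<omega>. ennreal ((v (fst z) (snd z) \<omega>)\<^sup>2) \<partial>M) \<le> ennreal B"
proof -
  obtain W where W: "\<And>t x. 0 \<le> t \<Longrightarrow> t \<le> T \<Longrightarrow> \<bar>w t x\<bar> \<le> W" using w_bounded[of T] by blast
  let ?H = "\<lambda>t x z \<omega>. wave_kernel t x z * F (v (fst z) (snd z) \<omega>)"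
  let ?N = "\<lambda>t x. \<integral>\<^sup>+z. \<integral>\<^sup>+\<omega>. ennreal ((?H t x z \<omega>)\<^sup>2) \<partial>M \<partial>lborel"
  \<comment> \<open>The 1 subtracted on the left leaves a margin at the edge that the half-open
    rectangle excludes.\<close>
  define D where "D = rect 0 T (x0 - T - 1) (x0 + T)"
  obtain A where A: "0 < A" "emeasure lborel D \<le> ennreal A"
    unfolding D_def using emeasure_finite_bound[of lborel "rect 0 T (x0 - T - 1) (x0 + T)"]
      emeasure_rect by (metis less_top infinity_ennreal_def)
  have fin: "?N T x0 < \<infinity>" using mild[OF T, of x0] walsh_square_finite by blast
  define B where "B = 2 * W\<^sup>2 + 2 * (walsh_const 0 * enn2real (?N T x0))"
  have "(\<integral>\<^sup>+\<omega>. ennreal ((v t x \<omega>)\<^sup>2) \<partial>M) \<le> ennreal B" if tx: "(t, x) \<in> past_cone T x0" for t x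
  proof -
    have t: "0 \<le> t" "t \<le> T" using tx by (auto simp: past_cone_def)
    obtain I where I: "walsh_integral M \<xi> (?H t x) I" and v: "AE \<omega> in M. v t x \<omega> = w t x + I \<omega>"
      using mild[OF t(1)] by blast
    have Im [measurable]: "I \<in> borel_measurable M" using I by (simp add: walsh_integral_iff)
    have sub: "z \<in> D" if "wave_kernel t x z \<noteq> 0" for z
      using cone_backward[OF tx that] wave_kernel_support[OF that]
      by (cases z) (auto simp: D_def past_cone_def rect_def)
    have "(\<integral>\<^sup>+\<omega>. ennreal ((I \<omega>) ^ (2 * 0 + 2)) \<partial>M)
      \<le> ennreal (walsh_const 0 * A ^ 0) * (\<integral>\<^sup>+z. \<integral>\<^sup>+\<omega>. ennreal ((?H t x z \<omega>) ^ (2 * 0 + 2)) \<partial>M \<partial>lborel)"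
      by (rule walsh_moment_power[OF I _ A(2,1)]) (use sub in \<open>auto simp: D_def rect_borel\<close>)
    also have "(\<integral>\<^sup>+z. \<integral>\<^sup>+\<omega>. ennreal ((?H t x z \<omega>) ^ (2 * 0 + 2)) \<partial>M \<partial>lborel) \<le> ?N T x0"
    proof (intro nn_integral_mono)
      fix z \<omega>
      have "\<bar>?H t x z \<omega>\<bar> \<le> \<bar>?H T x0 z \<omega>\<bar>"
        unfolding abs_mult using wave_kernel_mono[OF tx, of z] wave_kernel_bounds(1)[of t x z]
        by (intro mult_right_mono) auto
      then have "(?H t x z \<omega>)\<^sup>2 \<le> (?H T x0 z \<omega>)\<^sup>2" by (simp only: abs_le_square_iff)
      then show "ennreal ((?H t x z \<omega>) ^ (2 * 0 + 2)) \<le> ennreal ((?H T x0 z \<omega>)\<^sup>2)"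
        by (simp add: power2_eq_square ennreal_leI)
    qed
    finally have I2: "(\<integral>\<^sup>+\<omega>. ennreal ((I \<omega>)\<^sup>2) \<partial>M) \<le> ennreal (walsh_const 0) * ?N T x0"
      by (simp add: mult_left_mono power2_eq_square)
    have "(\<integral>\<^sup>+\<omega>. ennreal ((v t x \<omega>)\<^sup>2) \<partial>M) = (\<integral>\<^sup>+\<omega>. ennreal ((w t x + I \<omega>)\<^sup>2) \<partial>M)"
      by (rule nn_integral_cong_AE) (use v in auto)
    also have "\<dots> \<le> 2 * (\<integral>\<^sup>+\<omega>. ennreal ((w t x)\<^sup>2) \<partial>M) + 2 * (\<integral>\<^sup>+\<omega>. ennreal ((I \<omega>)\<^sup>2) \<partial>M)"
      by (rule nn_integral_square_add_le) measurable
    also have "\<dots> \<le> 2 * ennreal (W\<^sup>2) + 2 * (ennreal (walsh_const 0) * ?N T x0)"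
    proof (intro add_mono mult_left_mono I2)
      have "\<bar>w t x\<bar> \<le> \<bar>W\<bar>" using W[OF t, of x] by linarith
      then have "(w t x)\<^sup>2 \<le> W\<^sup>2" by (simp only: abs_le_square_iff)
      then show "(\<integral>\<^sup>+\<omega>. ennreal ((w t x)\<^sup>2) \<partial>M) \<le> ennreal (W\<^sup>2)" by (simp add: emeasure_space_1 ennreal_leI)
    qed auto
    also have "\<dots> = ennreal B"
    proof -
      have "?N T x0 = ennreal (enn2real (?N T x0))" using fin by simp
      then show ?thesis
        unfolding B_def using walsh_const_nonneg[of 0] by (simp add: ennreal_plus ennreal_mult)
    qed
    finally show ?thesis .
  qed
  then show ?thesis by (intro exI[of _ B]) auto
qed

text \<open>The truncated moments are finite by the second moment bound, so the weighted supremum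
  \<open>n\<close> below satisfies \<open>n \<le> c + n / 2\<close>, with \<open>c\<close> independent of the truncation level.\<close>

lemma trunc_moment_bound:
  assumes T: "0 \<le> T"
  shows "\<exists>B. \<forall>L\<ge>0. \<forall>z\<in>past_cone T x0. (\<integral>\<^sup>+\<omega>. ennreal (trunc_pow q L (v (fst z) (snd z) \<omega>)) \<partial>M) \<le> ennreal B"
proof -
  obtain W where W: "\<And>t x. 0 \<le> t \<Longrightarrow> t \<le> T \<Longrightarrow> \<bar>w t x\<bar> \<le> W" using w_bounded[of T] by blast
  have W0: "0 \<le> W" using W[of 0 0] T by linarith
  obtain B2 where B2: "\<And>z. z \<in> past_cone T x0 \<Longrightarrow> (\<integral>\<^sup>+\<omega>. ennreal ((v (fst z) (snd z) \<omega>)\<^sup>2) \<partial>M) \<le> ennreal B2"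
    using second_moment_bound[OF T] by blast
  let ?H = "\<lambda>t x z \<omega>. wave_kernel t x z * F (v (fst z) (snd z) \<omega>)"
  define \<alpha> where "\<alpha> = x0 - T - 1"
  define \<beta> where "\<beta> = x0 + T"
  have \<alpha>\<beta>: "\<alpha> \<le> \<beta>" using T by (simp add: \<alpha>_def \<beta>_def)
  define D where "D = rect 0 T \<alpha> \<beta>"
  obtain A where A: "0 < A" "emeasure lborel D \<le> ennreal A"
    unfolding D_def using emeasure_finite_bound[of lborel "rect 0 T \<alpha> \<beta>"]
      emeasure_rect by (metis less_top infinity_ennreal_def)
  define c where "c = (2 * 4 ^ (q + 1) :: real)"
  define b where "b = sqrt A * K"
  define a1 where "a1 = c * (sqrt A * \<bar>F 0\<bar>) ^ (2 * q + 2)"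
  define a2 where "a2 = c * (b\<^sup>2 + b ^ (2 * q + 2))"
  define k1 where "k1 = walsh_const q / A"
  \<comment> \<open>This \<kappa> makes the coefficient with which \<open>n\<close> returns through
    the stochastic integral at most \<open>1 / 2\<close>; the added 1 keeps it positive.\<close>
  define \<kappa> where "\<kappa> = 2 * (c * k1 * a2 * (\<beta> - \<alpha>)) + 1"
  define C0 where "C0 = c * (W ^ (2 * q + 2) + k1 * (a1 * A))"
  have c0: "0 \<le> c" by (simp add: c_def)
  have b0: "0 \<le> b" using A K_nonneg by (simp add: b_def)
  have a0: "0 \<le> a1" "0 \<le> a2" using c0 b0 A by (auto simp: a1_def a2_def)
  have k10: "0 \<le> k1" using walsh_const_nonneg A by (simp add: k1_def)
  have \<kappa>: "0 < \<kappa>" unfolding \<kappa>_def using c0 k10 a0 \<alpha>\<beta> by (intro add_nonneg_pos mult_nonneg_nonneg) auto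
  have half: "c * k1 * a2 * (\<beta> - \<alpha>) / \<kappa> \<le> 1 / 2"
    using \<kappa> by (simp add: pos_divide_le_eq) (simp add: \<kappa>_def)
  have C00: "0 \<le> C0" unfolding C0_def using c0 W0 k10 a0 A by (intro mult_nonneg_nonneg add_nonneg_nonneg) auto
  have main: "(\<integral>\<^sup>+\<omega>. ennreal (trunc_pow q L (v (fst z) (snd z) \<omega>)) \<partial>M) \<le> ennreal (2 * C0 * exp (\<kappa> * T))"
    if L: "0 \<le> L" and z0: "z \<in> past_cone T x0" for L z
  proof -
    let ?f = "\<lambda>z. \<integral>\<^sup>+\<omega>. ennreal (trunc_pow q L (v (fst z) (snd z) \<omega>)) \<partial>M"
    define N where "N = (SUP z\<in>past_cone T x0. ennreal (exp (- \<kappa> * fst z)) * ?f z)"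
    \<comment> \<open>This bound depends on \<open>L\<close>, but it serves only to make the
      supremum finite.\<close>
    have "N \<le> ennreal (L ^ q * B2)"
      unfolding N_def
    proof (rule SUP_least)
      fix z assume z: "z \<in> past_cone T x0"
      then have t: "0 \<le> fst z" by (auto simp: past_cone_def)
      note [measurable] = field_measurable[OF t, of "snd z"]
      have "?f z \<le> (\<integral>\<^sup>+\<omega>. ennreal (L ^ q) * ennreal ((v (fst z) (snd z) \<omega>)\<^sup>2) \<partial>M)"
        using trunc_pow_le_square[OF L] L
        by (intro nn_integral_mono) (auto simp: ennreal_mult [symmetric] intro!: ennreal_leI)
      also have "\<dots> = ennreal (L ^ q) * (\<integral>\<^sup>+\<omega>. ennreal ((v (fst z) (snd z) \<omega>)\<^sup>2) \<partial>M)"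
        by (rule nn_integral_cmult) measurable
      also have "\<dots> \<le> ennreal (L ^ q) * ennreal B2" by (intro mult_left_mono B2 z) auto
      also have "\<dots> = ennreal (L ^ q * B2)" using L by (simp add: ennreal_mult')
      finally have "?f z \<le> ennreal (L ^ q * B2)" .
      moreover have "ennreal (exp (- \<kappa> * fst z)) \<le> 1" using t \<kappa> by simp
      ultimately have "ennreal (exp (- \<kappa> * fst z)) * ?f z \<le> 1 * ennreal (L ^ q * B2)" by (intro mult_mono) auto
      then show "ennreal (exp (- \<kappa> * fst z)) * ?f z \<le> ennreal (L ^ q * B2)" by simp
    qed
    then have "N < \<infinity>" by (simp add: order_le_less_trans[OF _ ennreal_less_top])
    then obtain n where n: "N = ennreal n" "0 \<le> n" by (cases N) auto
    have f_le: "?f z \<le> ennreal (n * exp (\<kappa> * fst z))" if z: "z \<in> past_cone T x0" for z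
    proof -
      have "ennreal (exp (- \<kappa> * fst z)) * ?f z \<le> ennreal n"
        unfolding n(1)[symmetric] N_def by (rule SUP_upper[OF z])
      then have "ennreal (exp (\<kappa> * fst z)) * (ennreal (exp (- \<kappa> * fst z)) * ?f z) \<le> ennreal (exp (\<kappa> * fst z)) * ennreal n"
        by (rule mult_left_mono) simp
      moreover have "ennreal (exp (\<kappa> * fst z)) * (ennreal (exp (- \<kappa> * fst z)) * ?f z) = ?f z"
        by (simp add: mult.assoc [symmetric] ennreal_mult [symmetric] exp_minus)
      ultimately show ?thesis using n(2) by (simp add: ennreal_mult [symmetric] mult.commute)
    qed
    have rec: "?f z \<le> ennreal (exp (\<kappa> * fst z) * (C0 + n / 2))" if z: "z \<in> past_cone T x0" for z
    proof -
      obtain t x where tx: "z = (t, x)" by (cases z)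
      have t: "0 \<le> t" "t \<le> T" using z tx by (auto simp: past_cone_def)
      obtain I where I: "walsh_integral M \<xi> (?H t x) I" and v: "AE \<omega> in M. v t x \<omega> = w t x + I \<omega>"
        using mild[OF t(1)] by blast
      have Im [measurable]: "I \<in> borel_measurable M" using I by (simp add: walsh_integral_iff)
      have sub: "y \<in> rect 0 t \<alpha> \<beta>" "y \<in> past_cone T x0" if "wave_kernel t x y \<noteq> 0" for y
        using cone_backward[OF _ that] z wave_kernel_support[OF that]
        by (cases y; auto simp: tx \<alpha>_def \<beta>_def past_cone_def rect_def)+
      have sub': "y \<in> D" if "wave_kernel t x y \<noteq> 0" for y
        using sub[OF that] t by (auto simp: D_def rect_def)
      \<comment> \<open>The moment at \<open>y\<close> is bounded through the weighted supremum. Its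
        term is confined to times up to \<open>t\<close>, so that integration returns the weight
        \<open>exp (\<kappa> * t)\<close>.\<close>
      have inner: "(\<integral>\<^sup>+\<omega>. ennreal (trunc_pow q L (sqrt A * ?H t x y \<omega>)) \<partial>M)
         \<le> ennreal a1 * indicator D y + ennreal (a2 * n) * (ennreal (exp (\<kappa> * fst y)) * indicator (rect 0 t \<alpha> \<beta>) y)" for y
      proof (cases "wave_kernel t x y = 0")
        case True
        then show ?thesis by simp
      next
        case False
        then have y: "0 \<le> fst y" using sub(2) by (auto simp: past_cone_def)
        note [measurable] = field_measurable[OF y, of "snd y"]
        have "(\<integral>\<^sup>+\<omega>. ennreal (trunc_pow q L (sqrt A * ?H t x y \<omega>)) \<partial>M)
          \<le> (\<integral>\<^sup>+\<omega>. ennreal a1 + ennreal a2 * ennreal (trunc_pow q L (v (fst y) (snd y) \<omega>)) \<partial>M)"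
        proof (rule nn_integral_mono)
          fix \<omega>
          let ?y = "v (fst y) (snd y) \<omega>"
          have "\<bar>wave_kernel t x y\<bar> * \<bar>F ?y\<bar> \<le> 1 * (\<bar>F 0\<bar> + K * \<bar>?y\<bar>)"
            using wave_kernel_bounds[of t x y] lip[of ?y 0] by (intro mult_mono) auto
          then have "sqrt A * (\<bar>wave_kernel t x y\<bar> * \<bar>F ?y\<bar>) \<le> sqrt A * (\<bar>F 0\<bar> + K * \<bar>?y\<bar>)"
            using A by (intro mult_left_mono) auto
          then have "\<bar>sqrt A * ?H t x y \<omega>\<bar> \<le> sqrt A * \<bar>F 0\<bar> + b * \<bar>?y\<bar>"
            using A by (simp add: abs_mult b_def algebra_simps)
          then have "trunc_pow q L (sqrt A * ?H t x y \<omega>) \<le> c * ((sqrt A * \<bar>F 0\<bar>) ^ (2 * q + 2) + (b\<^sup>2 + b ^ (2 * q + 2)) * trunc_pow q L ?y)"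
            unfolding c_def using A b0 by (intro trunc_pow_affine_le[OF L]) auto
          also have "\<dots> = a1 + a2 * trunc_pow q L ?y" by (simp add: a1_def a2_def distrib_left mult.assoc)
          finally show "ennreal (trunc_pow q L (sqrt A * ?H t x y \<omega>)) \<le> ennreal a1 + ennreal a2 * ennreal (trunc_pow q L ?y)"
            using a0 trunc_pow_nonneg[OF L, of q ?y]
            by (simp add: ennreal_mult [symmetric] ennreal_plus [symmetric] ennreal_leI del: ennreal_plus)
        qed
        also have "\<dots> = ennreal a1 + ennreal a2 * ?f y"
          by (subst nn_integral_add) (auto simp: nn_integral_cmult emeasure_space_1)
        also have "\<dots> \<le> ennreal a1 + ennreal a2 * ennreal (n * exp (\<kappa> * fst y))"
          by (intro add_left_mono mult_left_mono f_le sub(2) False) auto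
        also have "\<dots> = ennreal a1 + ennreal (a2 * n) * ennreal (exp (\<kappa> * fst y))"
          using a0 n(2) by (simp add: ennreal_mult mult.assoc)
        finally show ?thesis using sub(1)[OF False] sub'[OF False] by simp
      qed
      have "(\<integral>\<^sup>+\<omega>. ennreal (trunc_pow q L (I \<omega>)) \<partial>M)
        \<le> ennreal k1 * (\<integral>\<^sup>+y. \<integral>\<^sup>+\<omega>. ennreal (trunc_pow q L (sqrt A * ?H t x y \<omega>)) \<partial>M \<partial>lborel)"
        unfolding k1_def
        by (rule walsh_moment[OF I _ A(2,1) L]) (use sub' in \<open>auto simp: D_def rect_borel\<close>)
      also have "\<dots> \<le> ennreal k1 * (\<integral>\<^sup>+y. ennreal a1 * indicator D y
           + ennreal (a2 * n) * (ennreal (exp (\<kappa> * fst y)) * indicator (rect 0 t \<alpha> \<beta>) y) \<partial>lborel)"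
        by (intro mult_left_mono nn_integral_mono inner) auto
      also have "(\<integral>\<^sup>+y. ennreal a1 * indicator D y
           + ennreal (a2 * n) * (ennreal (exp (\<kappa> * fst y)) * indicator (rect 0 t \<alpha> \<beta>) y) \<partial>lborel)
        = ennreal a1 * emeasure lborel D + ennreal (a2 * n) * (\<integral>\<^sup>+y. ennreal (exp (\<kappa> * fst y)) * indicator (rect 0 t \<alpha> \<beta>) y \<partial>lborel)"
      proof -
        have [measurable]: "(\<lambda>y. ennreal (exp (\<kappa> * fst y)) * indicator (rect 0 t \<alpha> \<beta>) y) \<in> borel_measurable (borel :: (real \<times> real) measure)"
          using rect_borel unfolding borel_prod[symmetric] by measurable
        show ?thesis using rect_borel[of 0 T \<alpha> \<beta>] unfolding D_def
          by (subst nn_integral_add) (auto simp: nn_integral_cmult nn_integral_cmult_indicator)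
      qed
      also have "\<dots> \<le> ennreal a1 * ennreal A + ennreal (a2 * n) * ennreal ((\<beta> - \<alpha>) * exp (\<kappa> * t) / \<kappa>)"
        by (intro add_mono mult_left_mono A nn_integral_exp_strip \<kappa> t \<alpha>\<beta>) auto
      also have "\<dots> = ennreal (a1 * A + a2 * n * ((\<beta> - \<alpha>) * exp (\<kappa> * t) / \<kappa>))"
      proof -
        have x: "0 \<le> (\<beta> - \<alpha>) * exp (\<kappa> * t) / \<kappa>" using \<alpha>\<beta> \<kappa> by (intro divide_nonneg_pos mult_nonneg_nonneg) auto
        have an: "0 \<le> a2 * n" "0 \<le> a1 * A" using a0 n(2) A by auto
        have "ennreal a1 * ennreal A = ennreal (a1 * A)" using a0 A by (simp add: ennreal_mult)
        moreover have "ennreal (a2 * n) * ennreal ((\<beta> - \<alpha>) * exp (\<kappa> * t) / \<kappa>) = ennreal (a2 * n * ((\<beta> - \<alpha>) * exp (\<kappa> * t) / \<kappa>))"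
          by (rule ennreal_mult [OF an(1) x, symmetric])
        ultimately show ?thesis using an(2) mult_nonneg_nonneg[OF an(1) x] by (simp only: ennreal_plus)
      qed
      finally have I_le: "(\<integral>\<^sup>+\<omega>. ennreal (trunc_pow q L (I \<omega>)) \<partial>M)
        \<le> ennreal k1 * ennreal (a1 * A + a2 * n * ((\<beta> - \<alpha>) * exp (\<kappa> * t) / \<kappa>))" by (simp add: mult_left_mono)
      define e where "e = exp (\<kappa> * t)"
      have e1: "1 \<le> e" using t \<kappa> by (simp add: e_def)
      define s where "s = a1 * A + a2 * n * ((\<beta> - \<alpha>) * e / \<kappa>)"
      have s0: "0 \<le> s"
        unfolding s_def using a0 A n(2) \<alpha>\<beta> \<kappa> e1 by (intro add_nonneg_nonneg mult_nonneg_nonneg divide_nonneg_pos) auto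
      have "?f z = (\<integral>\<^sup>+\<omega>. ennreal (trunc_pow q L (w t x + I \<omega>)) \<partial>M)"
        by (rule nn_integral_cong_AE) (use v tx in auto)
      also have "\<dots> \<le> (\<integral>\<^sup>+\<omega>. ennreal (c * W ^ (2 * q + 2)) + ennreal c * ennreal (trunc_pow q L (I \<omega>)) \<partial>M)"
      proof (rule nn_integral_mono)
        fix \<omega>
        have "trunc_pow q L (w t x + I \<omega>) \<le> c * (trunc_pow q L (w t x) + trunc_pow q L (I \<omega>))"
          unfolding c_def by (rule trunc_pow_add[OF L])
        also have "\<dots> \<le> c * (W ^ (2 * q + 2) + trunc_pow q L (I \<omega>))"
        proof (intro mult_left_mono add_right_mono c0)
          have "\<bar>w t x\<bar> \<le> \<bar>W\<bar>" using W[OF t, of x] by linarith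
          then have "trunc_pow q L (w t x) \<le> trunc_pow q L W"
            by (intro trunc_pow_mono[OF L]) (simp only: abs_le_square_iff)
          also have "\<dots> \<le> W ^ (2 * q + 2)" by (rule trunc_pow_le_power[OF L])
          finally show "trunc_pow q L (w t x) \<le> W ^ (2 * q + 2)" .
        qed
        finally show "ennreal (trunc_pow q L (w t x + I \<omega>)) \<le> ennreal (c * W ^ (2 * q + 2)) + ennreal c * ennreal (trunc_pow q L (I \<omega>))"
          using c0 W0 trunc_pow_nonneg[OF L, of q "I \<omega>"]
          by (simp add: ennreal_mult [symmetric] ennreal_plus [symmetric] ennreal_leI distrib_left del: ennreal_plus)
      qed
      also have "\<dots> = ennreal (c * W ^ (2 * q + 2)) + ennreal c * (\<integral>\<^sup>+\<omega>. ennreal (trunc_pow q L (I \<omega>)) \<partial>M)"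
        by (subst nn_integral_add) (auto simp: nn_integral_cmult emeasure_space_1)
      also have "\<dots> \<le> ennreal (c * W ^ (2 * q + 2)) + ennreal c * (ennreal k1 * ennreal s)"
        unfolding s_def e_def by (intro add_left_mono mult_left_mono I_le) auto
      also have "\<dots> = ennreal (c * W ^ (2 * q + 2) + c * (k1 * s))"
        using c0 W0 k10 s0 by (simp add: ennreal_mult)
      \<comment> \<open>The part free of \<open>n\<close> is at most \<open>e * C0\<close> since
        \<open>e\<close> is at least 1; the rest carries the factor fixed by the choice of
        \<kappa>.\<close>
      also have "c * W ^ (2 * q + 2) + c * (k1 * s) \<le> e * (C0 + n / 2)"
      proof -
        have "c * W ^ (2 * q + 2) + c * (k1 * s) = 1 * C0 + (c * k1 * a2 * (\<beta> - \<alpha>) / \<kappa>) * (n * e)"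
          by (simp add: C0_def s_def distrib_left mult_ac)
        also have "\<dots> \<le> e * C0 + (1 / 2) * (n * e)"
          using n(2) e1 by (intro add_mono mult_right_mono half C00 e1 mult_nonneg_nonneg) auto
        finally show ?thesis by (simp add: algebra_simps)
      qed
      finally show ?thesis by (simp add: tx e_def ennreal_leI)
    qed
    have "N \<le> ennreal (C0 + n / 2)"
      unfolding N_def
    proof (rule SUP_least)
      fix z assume z: "z \<in> past_cone T x0"
      have "ennreal (exp (- \<kappa> * fst z)) * ?f z \<le> ennreal (exp (- \<kappa> * fst z)) * ennreal (exp (\<kappa> * fst z) * (C0 + n / 2))"
        by (rule mult_left_mono[OF rec[OF z]]) simp
      also have "\<dots> = ennreal (C0 + n / 2)"
        using C00 n(2) by (simp add: ennreal_mult [symmetric] mult.assoc [symmetric] exp_minus)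
      finally show "ennreal (exp (- \<kappa> * fst z)) * ?f z \<le> ennreal (C0 + n / 2)" .
    qed
    then have "ennreal n \<le> ennreal (C0 + n / 2)" unfolding n(1) .
    moreover have "0 \<le> C0 + n / 2" using C00 n(2) by simp
    ultimately have "n \<le> C0 + n / 2" using ennreal_le_iff by blast
    \<comment> \<open>Subtracting \<open>n / 2\<close> is legitimate since \<open>n\<close> is a
      real number; the result no longer contains \<open>L\<close>.\<close>
    then have "n \<le> 2 * C0" by simp
    moreover have "exp (\<kappa> * fst z) \<le> exp (\<kappa> * T)" using z0 \<kappa> by (auto simp: past_cone_def)
    ultimately have "n * exp (\<kappa> * fst z) \<le> 2 * C0 * exp (\<kappa> * T)"
      using n(2) C00 by (intro mult_mono) auto
    then show ?thesis using f_le[OF z0] by (meson ennreal_leI order_trans)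
  qed
  then show ?thesis by blast
qed

lemma moment_bound:
  assumes T: "0 \<le> T"
  shows "\<exists>B. \<forall>z\<in>past_cone T x0. (\<integral>\<^sup>+\<omega>. ennreal ((v (fst z) (snd z) \<omega>) ^ (2 * q + 2)) \<partial>M) \<le> ennreal B"
proof -
  obtain B where B: "\<forall>L\<ge>0. \<forall>z\<in>past_cone T x0. (\<integral>\<^sup>+\<omega>. ennreal (trunc_pow q L (v (fst z) (snd z) \<omega>)) \<partial>M) \<le> ennreal B"
    using trunc_moment_bound[OF T] by blast
  have "(\<integral>\<^sup>+\<omega>. ennreal ((v (fst z) (snd z) \<omega>) ^ (2 * q + 2)) \<partial>M) \<le> ennreal B" if "z \<in> past_cone T x0" for z
    by (rule nn_integral_power_le_of_trunc_pow)
      (use that B in \<open>auto intro!: field_measurable simp: past_cone_def\<close>)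
  then show ?thesis by blast
qed

end

section \<open>Hoelder continuity of the solution in the mean\<close>

lemma even_power_add_le:
  fixes a b :: real
  shows "(a + b) ^ (2 * q + 2) \<le> 2 ^ (2 * q + 2) * (a ^ (2 * q + 2) + b ^ (2 * q + 2))"
proof -
  let ?n = "2 * q + 2"
  have ev: "\<bar>x\<bar> ^ ?n = x ^ ?n" for x :: real by (rule power_even_abs) simp
  have "(a + b) ^ ?n = \<bar>a + b\<bar> ^ ?n" by (rule ev [symmetric])
  also have "\<dots> \<le> (2 * max \<bar>a\<bar> \<bar>b\<bar>) ^ ?n" by (intro power_mono) auto
  also have "\<dots> = 2 ^ ?n * max \<bar>a\<bar> \<bar>b\<bar> ^ ?n" by (rule power_mult_distrib)
  also have "max \<bar>a\<bar> \<bar>b\<bar> ^ ?n \<le> \<bar>a\<bar> ^ ?n + \<bar>b\<bar> ^ ?n" by (cases "\<bar>a\<bar> \<le> \<bar>b\<bar>") (auto simp: max_def)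
  also have "\<bar>a\<bar> ^ ?n + \<bar>b\<bar> ^ ?n = a ^ ?n + b ^ ?n" by (simp only: ev)
  finally show ?thesis by simp
qed

lemma nn_integral_power_add_le:
  fixes f g :: "'b \<Rightarrow> real"
  assumes [measurable]: "f \<in> borel_measurable N" "g \<in> borel_measurable N"
    and f: "(\<integral>\<^sup>+x. ennreal ((f x) ^ (2 * q + 2)) \<partial>N) \<le> ennreal a"
    and g: "(\<integral>\<^sup>+x. ennreal ((g x) ^ (2 * q + 2)) \<partial>N) \<le> ennreal b" and "0 \<le> a" "0 \<le> b"
  shows "(\<integral>\<^sup>+x. ennreal ((f x + g x) ^ (2 * q + 2)) \<partial>N) \<le> ennreal (2 ^ (2 * q + 2) * (a + b))"
proof -
  have ev: "0 \<le> x ^ (2 * q + 2)" for x :: real by (rule zero_le_even_power) simp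
  have "(\<integral>\<^sup>+x. ennreal ((f x + g x) ^ (2 * q + 2)) \<partial>N)
    \<le> (\<integral>\<^sup>+x. ennreal (2 ^ (2 * q + 2)) * (ennreal ((f x) ^ (2 * q + 2)) + ennreal ((g x) ^ (2 * q + 2))) \<partial>N)"
  proof (rule nn_integral_mono)
    fix x
    have "ennreal ((f x + g x) ^ (2 * q + 2)) \<le> ennreal (2 ^ (2 * q + 2) * ((f x) ^ (2 * q + 2) + (g x) ^ (2 * q + 2)))"
      by (rule ennreal_leI[OF even_power_add_le])
    also have "\<dots> = ennreal (2 ^ (2 * q + 2)) * (ennreal ((f x) ^ (2 * q + 2)) + ennreal ((g x) ^ (2 * q + 2)))"
      using ev[of "f x"] ev[of "g x"] by (subst ennreal_mult) (auto simp only: ennreal_plus zero_le_power zero_le_numeral add_nonneg_nonneg)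
    finally show "ennreal ((f x + g x) ^ (2 * q + 2))
      \<le> ennreal (2 ^ (2 * q + 2)) * (ennreal ((f x) ^ (2 * q + 2)) + ennreal ((g x) ^ (2 * q + 2)))" .
  qed
  also have "\<dots> = ennreal (2 ^ (2 * q + 2)) * ((\<integral>\<^sup>+x. ennreal ((f x) ^ (2 * q + 2)) \<partial>N) + (\<integral>\<^sup>+x. ennreal ((g x) ^ (2 * q + 2)) \<partial>N))"
    by (subst nn_integral_cmult) (auto simp del: power_Suc simp: nn_integral_add)
  also have "\<dots> \<le> ennreal (2 ^ (2 * q + 2)) * (ennreal a + ennreal b)"
    by (intro mult_left_mono add_mono f g) auto
  also have "\<dots> = ennreal (2 ^ (2 * q + 2) * (a + b))"
    using assms(5,6) by (subst ennreal_mult) (auto simp only: ennreal_plus zero_le_power zero_le_numeral add_nonneg_nonneg)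
  finally show ?thesis .
qed

lemma nn_integral_power_scale_le:
  fixes f g :: "'b \<Rightarrow> real"
  assumes [measurable]: "f \<in> borel_measurable N" and "g \<in> borel_measurable N"
    and le: "\<And>x. x \<in> space N \<Longrightarrow> \<bar>g x\<bar> \<le> c * \<bar>f x\<bar>" and "0 \<le> c"
    and f: "(\<integral>\<^sup>+x. ennreal ((f x) ^ (2 * q + 2)) \<partial>N) \<le> ennreal a"
  shows "(\<integral>\<^sup>+x. ennreal ((g x) ^ (2 * q + 2)) \<partial>N) \<le> ennreal (c ^ (2 * q + 2) * a)"
proof -
  let ?n = "2 * q + 2"
  have ev: "\<bar>x\<bar> ^ ?n = x ^ ?n" for x :: real by (rule power_even_abs) simp
  have "(\<integral>\<^sup>+x. ennreal ((g x) ^ ?n) \<partial>N) \<le> (\<integral>\<^sup>+x. ennreal (c ^ ?n) * ennreal ((f x) ^ ?n) \<partial>N)"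
  proof (rule nn_integral_mono)
    fix x assume "x \<in> space N"
    then have "\<bar>g x\<bar> ^ ?n \<le> (c * \<bar>f x\<bar>) ^ ?n" using le by (intro power_mono) auto
    then have "(g x) ^ ?n \<le> c ^ ?n * (f x) ^ ?n" by (simp only: power_mult_distrib ev)
    then show "ennreal ((g x) ^ ?n) \<le> ennreal (c ^ ?n) * ennreal ((f x) ^ ?n)"
      using \<open>0 \<le> c\<close> by (subst ennreal_mult' [symmetric]) (auto intro: ennreal_leI simp del: power_Suc)
  qed
  also have "\<dots> = ennreal (c ^ ?n) * (\<integral>\<^sup>+x. ennreal ((f x) ^ ?n) \<partial>N)"
    by (rule nn_integral_cmult) measurable
  also have "\<dots> \<le> ennreal (c ^ ?n) * ennreal a" by (intro mult_left_mono f) auto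
  also have "\<dots> = ennreal (c ^ ?n * a)" using \<open>0 \<le> c\<close> by (subst ennreal_mult') auto
  finally show ?thesis .
qed

text \<open>With \<open>c = - 1\<close> and \<open>c = 1\<close> these are the strips between two
  parallel characteristics. Each time slice has length \<open>\<beta> - \<alpha>\<close>.\<close>

lemma emeasure_characteristic_strip:
  assumes "0 \<le> T" "\<alpha> \<le> \<beta>"
  shows "emeasure lborel {z :: real \<times> real. 0 < fst z \<and> fst z \<le> T \<and> \<alpha> \<le> snd z + c * fst z \<and> snd z + c * fst z \<le> \<beta>}
     = ennreal (T * (\<beta> - \<alpha>))"
    and "{z :: real \<times> real. 0 < fst z \<and> fst z \<le> T \<and> \<alpha> \<le> snd z + c * fst z \<and> snd z + c * fst z \<le> \<beta>} \<in> sets borel"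
proof -
  let ?S = "{z :: real \<times> real. 0 < fst z \<and> fst z \<le> T \<and> \<alpha> \<le> snd z + c * fst z \<and> snd z + c * fst z \<le> \<beta>}"
  show S: "?S \<in> sets borel"
  proof -
    have "Measurable.pred (borel \<Otimes>\<^sub>M borel) (\<lambda>z :: real \<times> real. 0 < fst z \<and> fst z \<le> T \<and> \<alpha> \<le> snd z + c * fst z \<and> snd z + c * fst z \<le> \<beta>)"
      by measurable
    then show ?thesis by (simp add: pred_def borel_prod)
  qed
  then have S': "?S \<in> sets (lborel \<Otimes>\<^sub>M lborel)" unfolding lborel_prod by simp
  have "emeasure lborel ?S = (\<integral>\<^sup>+s. emeasure lborel (Pair s -` ?S) \<partial>lborel)"
    unfolding lborel_prod[symmetric] by (rule lborel.emeasure_pair_measure_alt[OF S'])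
  also have "\<dots> = (\<integral>\<^sup>+s. ennreal (\<beta> - \<alpha>) * indicator {0<..T} s \<partial>lborel)"
  proof (rule nn_integral_cong)
    fix s :: real
    have "Pair s -` ?S = (if 0 < s \<and> s \<le> T then {\<alpha> - c * s..\<beta> - c * s} else {})" by auto
    then show "emeasure lborel (Pair s -` ?S) = ennreal (\<beta> - \<alpha>) * indicator {0<..T} s"
      using assms by (auto simp: indicator_def)
  qed
  also have "\<dots> = ennreal (T * (\<beta> - \<alpha>))"
    using assms by (subst nn_integral_cmult_indicator) (auto simp: ennreal_mult [symmetric] mult.commute)
  finally show "emeasure lborel ?S = ennreal (T * (\<beta> - \<alpha>))" .
qed

context wave_field
begin

lemma F_moment_bound:
  assumes T: "0 \<le> T"
  shows "\<exists>B\<ge>0. \<forall>z\<in>past_cone T x0. (\<integral>\<^sup>+\<omega>. ennreal ((F (v (fst z) (snd z) \<omega>)) ^ (2 * q + 2)) \<partial>M) \<le> ennreal B"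
proof -
  obtain B' where "\<forall>z\<in>past_cone T x0. (\<integral>\<^sup>+\<omega>. ennreal ((v (fst z) (snd z) \<omega>) ^ (2 * q + 2)) \<partial>M) \<le> ennreal B'"
    using moment_bound[OF T] by blast
  then have B': "\<forall>z\<in>past_cone T x0. (\<integral>\<^sup>+\<omega>. ennreal ((v (fst z) (snd z) \<omega>) ^ (2 * q + 2)) \<partial>M) \<le> ennreal (max B' 0)"
    using order_trans[OF _ ennreal_leI[of B' "max B' 0"]] by (simp del: power_Suc power_add)
  define B where "B = 2 ^ (2 * q + 2) * (\<bar>F 0\<bar> ^ (2 * q + 2) + K ^ (2 * q + 2) * max B' 0)"
  have "(\<integral>\<^sup>+\<omega>. ennreal ((F (v (fst z) (snd z) \<omega>)) ^ (2 * q + 2)) \<partial>M) \<le> ennreal B" if z: "z \<in> past_cone T x0" for z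
  proof -
    have t: "0 \<le> fst z" using z by (auto simp: past_cone_def)
    note [measurable] = field_measurable[OF t, of "snd z"]
    let ?v = "v (fst z) (snd z)"
    have "(\<integral>\<^sup>+\<omega>. ennreal ((F 0 + (F (?v \<omega>) - F 0)) ^ (2 * q + 2)) \<partial>M) \<le> ennreal B"
      unfolding B_def
    proof (rule nn_integral_power_add_le)
      show "(\<integral>\<^sup>+\<omega>. ennreal ((F 0) ^ (2 * q + 2)) \<partial>M) \<le> ennreal (\<bar>F 0\<bar> ^ (2 * q + 2))"
        by (simp add: emeasure_space_1 power_even_abs del: power_Suc)
      show "(\<integral>\<^sup>+\<omega>. ennreal ((F (?v \<omega>) - F 0) ^ (2 * q + 2)) \<partial>M) \<le> ennreal (K ^ (2 * q + 2) * max B' 0)"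
        by (rule nn_integral_power_scale_le[of ?v]) (use lip[of _ 0] K_nonneg B' z in auto)
    qed (use K_nonneg in auto)
    then show ?thesis by simp
  qed
  moreover have "0 \<le> B" using K_nonneg by (simp add: B_def)
  ultimately show ?thesis by blast
qed

text \<open>In terms of norms: an integral whose kernel is at most 1 and lives on an area
  \<open>A\<close> has, up to a constant, the size \<open>sqrt A\<close> times the norm of the
  integrand. Kernel differences, diamonds and triangles are estimated in this form.\<close>

lemma increment_moment:
  assumes I: "walsh_integral M \<xi> (\<lambda>z \<omega>. k z * g z \<omega>) I"
    and k: "\<And>z. \<bar>k z\<bar> \<le> 1" "\<And>z. k z \<noteq> 0 \<Longrightarrow> z \<in> D"
    and D: "D \<in> sets borel" "emeasure lborel D \<le> ennreal A" "0 < A" and B: "0 \<le> B"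
    and g: "\<And>z. z \<in> D \<Longrightarrow> k z \<noteq> 0 \<Longrightarrow> (\<integral>\<^sup>+\<omega>. ennreal ((g z \<omega>) ^ (2 * q + 2)) \<partial>M) \<le> ennreal B"
  shows "(\<integral>\<^sup>+\<omega>. ennreal ((I \<omega>) ^ (2 * q + 2)) \<partial>M) \<le> ennreal (walsh_const q * B * A ^ (q + 1))"
proof -
  let ?n = "2 * q + 2"
  have ev: "0 \<le> x ^ ?n" for x :: real by (rule zero_le_even_power) simp
  have "(\<integral>\<^sup>+\<omega>. ennreal ((I \<omega>) ^ ?n) \<partial>M)
    \<le> ennreal (walsh_const q * A ^ q) * (\<integral>\<^sup>+z. \<integral>\<^sup>+\<omega>. ennreal ((k z * g z \<omega>) ^ ?n) \<partial>M \<partial>lborel)"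
    by (rule walsh_moment_power[OF I D]) (use k(2) in auto)
  also have "\<dots> \<le> ennreal (walsh_const q * A ^ q) * (\<integral>\<^sup>+z. ennreal B * indicator D z \<partial>lborel)"
  proof (intro mult_left_mono nn_integral_mono)
    fix z
    show "(\<integral>\<^sup>+\<omega>. ennreal ((k z * g z \<omega>) ^ ?n) \<partial>M) \<le> ennreal B * indicator D z"
    proof (cases "k z = 0")
      case False
      have "(\<integral>\<^sup>+\<omega>. ennreal ((k z * g z \<omega>) ^ ?n) \<partial>M) \<le> (\<integral>\<^sup>+\<omega>. ennreal ((g z \<omega>) ^ ?n) \<partial>M)"
      proof (intro nn_integral_mono ennreal_leI)
        fix \<omega>
        have "\<bar>k z\<bar> ^ ?n \<le> 1" using k(1) by (intro power_le_one) auto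
        then have "(k z) ^ ?n \<le> 1" using power_even_abs[of ?n "k z"] by simp
        then show "(k z * g z \<omega>) ^ ?n \<le> (g z \<omega>) ^ ?n"
          using mult_right_mono[OF _ ev[of "g z \<omega>"], of "(k z) ^ ?n" 1] by (simp only: power_mult_distrib mult_1_left)
      qed
      then show ?thesis using g[of z] k(2)[OF False] False by (simp del: power_Suc) 
    qed simp
  qed simp
  also have "(\<integral>\<^sup>+z. ennreal B * indicator D z \<partial>lborel) \<le> ennreal B * ennreal A"
    using D by (subst nn_integral_cmult_indicator) (auto intro: mult_left_mono)
  also have "ennreal (walsh_const q * A ^ q) * (ennreal B * ennreal A) = ennreal (walsh_const q * B * A ^ (q + 1))"
    using B D(3) walsh_const_nonneg[of q] by (simp add: ennreal_mult [symmetric] mult_ac)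
  finally show ?thesis by (simp add: mult_left_mono)
qed

text \<open>\<open>r ^ (q + 1)\<close> is the power \<open>2 * q + 2\<close> of
  \<open>sqrt r\<close>: two kernels whose apices are at distance \<open>r\<close> differ on an area
  of order \<open>r\<close>, and the data contribute only \<open>r ^ (2 * q + 2)\<close>.\<close>

lemma holder_moment:
  assumes T: "0 \<le> T"
  shows "\<exists>C\<ge>0. \<forall>t x t' x' r. (t, x) \<in> past_cone T x0 \<longrightarrow> (t', x') \<in> past_cone T x0 \<longrightarrow> 0 < r \<longrightarrow> r \<le> 1 \<longrightarrow>
    \<bar>t - t'\<bar> + \<bar>x - x'\<bar> \<le> r \<longrightarrow>
    (\<integral>\<^sup>+\<omega>. ennreal ((v t x \<omega> - v t' x' \<omega>) ^ (2 * q + 2)) \<partial>M) \<le> ennreal (C * r ^ (q + 1))"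
proof -
  let ?n = "2 * q + 2"
  obtain B where B: "0 \<le> B" "\<forall>z\<in>past_cone T x0. (\<integral>\<^sup>+\<omega>. ennreal ((F (v (fst z) (snd z) \<omega>)) ^ ?n) \<partial>M) \<le> ennreal B"
    using F_moment_bound[OF T] by blast
  obtain C' where "\<forall>t t' x x'. 0 \<le> t \<longrightarrow> 0 \<le> t' \<longrightarrow> \<bar>w t x - w t' x'\<bar> \<le> C' * (\<bar>t - t'\<bar> + \<bar>x - x'\<bar>)"
    using w_lipschitz by blast
  then have Cw: "\<bar>w t x - w t' x'\<bar> \<le> C' * (\<bar>t - t'\<bar> + \<bar>x - x'\<bar>)" if "0 \<le> t" "0 \<le> t'" for t t' x x'
    using that by blast
  have C'0: "0 \<le> C'" using Cw[of 1 0 0 0] by simp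
  define C where "C = 2 ^ ?n * (C' ^ ?n + walsh_const q * B * (2 * T + 1) ^ (q + 1))"
  have wB: "0 \<le> walsh_const q * B" using walsh_const_nonneg B(1) by simp
  have C0: "0 \<le> C" unfolding C_def using C'0 T
    by (intro mult_nonneg_nonneg[OF _ add_nonneg_nonneg[OF _ mult_nonneg_nonneg[OF wB]]]) auto
  have "(\<integral>\<^sup>+\<omega>. ennreal ((v t x \<omega> - v t' x' \<omega>) ^ ?n) \<partial>M) \<le> ennreal (C * r ^ (q + 1))"
    if z: "(t, x) \<in> past_cone T x0" and z': "(t', x') \<in> past_cone T x0" and r: "0 < r" "r \<le> 1" and d: "\<bar>t - t'\<bar> + \<bar>x - x'\<bar> \<le> r"
    for t x t' x' r
  proof -
    have t: "0 \<le> t" "0 \<le> t'" "t \<le> T" "t' \<le> T" using z z' by (auto simp: past_cone_def)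
    let ?g = "\<lambda>z \<omega>. F (v (fst z) (snd z) \<omega>)"
    obtain I where I: "walsh_integral M \<xi> (\<lambda>z \<omega>. wave_kernel t x z * ?g z \<omega>) I" "AE \<omega> in M. v t x \<omega> = w t x + I \<omega>"
      using mild[OF t(1)] by blast
    obtain I' where I': "walsh_integral M \<xi> (\<lambda>z \<omega>. wave_kernel t' x' z * ?g z \<omega>) I'" "AE \<omega> in M. v t' x' \<omega> = w t' x' + I' \<omega>"
      using mild[OF t(2)] by blast
    have [measurable]: "I \<in> borel_measurable M" "I' \<in> borel_measurable M" using I I' by (auto simp: walsh_integral_iff)
    let ?k = "\<lambda>z. wave_kernel t x z - wave_kernel t' x' z"
    have W: "walsh_integral M \<xi> (\<lambda>z \<omega>. ?k z * ?g z \<omega>) (\<lambda>\<omega>. I \<omega> - I' \<omega>)"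
      using walsh_lincomb[OF I(1) I'(1), of 1 "- 1"] by (simp add: left_diff_distrib)
    \<comment> \<open>The two kernels can differ at a point only if one of its characteristic
      coordinates lies between the corresponding coordinates of the two apices.\<close>
    define S1 where "S1 = {z :: real \<times> real. 0 < fst z \<and> fst z \<le> T \<and> min (x - t) (x' - t') \<le> snd z + (- 1) * fst z \<and> snd z + (- 1) * fst z \<le> max (x - t) (x' - t')}"
    define S2 where "S2 = {z :: real \<times> real. 0 < fst z \<and> fst z \<le> T \<and> min (x + t) (x' + t') \<le> snd z + 1 * fst z \<and> snd z + 1 * fst z \<le> max (x + t) (x' + t')}"
    have S1: "S1 \<in> sets borel" "emeasure lborel S1 = ennreal (T * (max (x - t) (x' - t') - min (x - t) (x' - t')))"
      unfolding S1_def by (rule emeasure_characteristic_strip; use T in simp)+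
    have S2: "S2 \<in> sets borel" "emeasure lborel S2 = ennreal (T * (max (x + t) (x' + t') - min (x + t) (x' + t')))"
      unfolding S2_def by (rule emeasure_characteristic_strip; use T in simp)+
    have "emeasure lborel (S1 \<union> S2) \<le> emeasure lborel S1 + emeasure lborel S2"
      by (rule emeasure_subadditive) (use S1 S2 in auto)
    also have "\<dots> \<le> ennreal (T * r) + ennreal (T * r)"
      unfolding S1 S2 using d T by (intro add_mono ennreal_leI mult_left_mono) auto
    \<comment> \<open>The added 1 keeps the area bound positive for \<open>T = 0\<close>.\<close>
    also have "\<dots> \<le> ennreal ((2 * T + 1) * r)"
      using T r by (subst ennreal_plus [symmetric]) (auto simp: algebra_simps intro!: ennreal_leI)
    finally have S: "emeasure lborel (S1 \<union> S2) \<le> ennreal ((2 * T + 1) * r)" .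
    have sub: "y \<in> S1 \<union> S2" if "?k y \<noteq> 0" for y
      using that t by (cases y) (auto simp: wave_kernel_eq S1_def S2_def split: if_splits)
    have kb: "\<bar>?k y\<bar> \<le> 1" for y
      using wave_kernel_bounds[of t x y] wave_kernel_bounds[of t' x' y] by linarith
    have II: "(\<integral>\<^sup>+\<omega>. ennreal ((I \<omega> - I' \<omega>) ^ ?n) \<partial>M) \<le> ennreal (walsh_const q * B * ((2 * T + 1) * r) ^ (q + 1))"
    proof (rule increment_moment[OF W kb sub _ S _ B(1)])
      show "S1 \<union> S2 \<in> sets borel" using S1 S2 by auto
      show "0 < (2 * T + 1) * r" using T r by simp
      fix y assume "?k y \<noteq> 0"
      then have "wave_kernel t x y \<noteq> 0 \<or> wave_kernel t' x' y \<noteq> 0" by auto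
      then have "y \<in> past_cone T x0" using cone_backward z z' by blast
      then show "(\<integral>\<^sup>+\<omega>. ennreal ((?g y \<omega>) ^ ?n) \<partial>M) \<le> ennreal B" using B(2) by blast
    qed
    have ww: "(\<integral>\<^sup>+\<omega>. ennreal ((w t x - w t' x') ^ ?n) \<partial>M) \<le> ennreal (C' ^ ?n * r ^ (q + 1))"
    proof -
      have "\<bar>w t x - w t' x'\<bar> \<le> C' * r"
        using Cw[OF t(1,2), of x x'] mult_left_mono[OF d C'0] by linarith
      then have "\<bar>w t x - w t' x'\<bar> ^ ?n \<le> (C' * r) ^ ?n" by (intro power_mono) auto
      also have "\<bar>w t x - w t' x'\<bar> ^ ?n = (w t x - w t' x') ^ ?n" by (rule power_even_abs) simp
      also have "(C' * r) ^ ?n = C' ^ ?n * r ^ ?n" by (rule power_mult_distrib)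
      \<comment> \<open>Here \<open>r\<close> \<le> 1 weakens the Lipschitz bound for the data to
        the Hoelder rate.\<close>
      also have "\<dots> \<le> C' ^ ?n * r ^ (q + 1)"
        using C'0 r by (intro mult_left_mono power_decreasing) auto
      finally show ?thesis by (simp add: emeasure_space_1 ennreal_leI del: power_Suc)
    qed
    have "(\<integral>\<^sup>+\<omega>. ennreal ((v t x \<omega> - v t' x' \<omega>) ^ ?n) \<partial>M)
      = (\<integral>\<^sup>+\<omega>. ennreal (((w t x - w t' x') + (I \<omega> - I' \<omega>)) ^ ?n) \<partial>M)"
    proof (rule nn_integral_cong_AE)
      show "AE \<omega> in M. ennreal ((v t x \<omega> - v t' x' \<omega>) ^ ?n) = ennreal (((w t x - w t' x') + (I \<omega> - I' \<omega>)) ^ ?n)"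
        using I(2) I'(2) by eventually_elim (simp add: algebra_simps del: power_Suc)
    qed
    also have "\<dots> \<le> ennreal (2 ^ ?n * (C' ^ ?n * r ^ (q + 1) + walsh_const q * B * ((2 * T + 1) * r) ^ (q + 1)))"
      by (rule nn_integral_power_add_le[OF _ _ ww II])
        (use C'0 r mult_nonneg_nonneg[OF wB, of "((2 * T + 1) * r) ^ (q + 1)"] T in \<open>simp_all del: power_Suc power_add\<close>)
    also have "2 ^ ?n * (C' ^ ?n * r ^ (q + 1) + walsh_const q * B * ((2 * T + 1) * r) ^ (q + 1)) = C * r ^ (q + 1)"
      unfolding C_def power_mult_distrib by (simp add: algebra_simps del: power_Suc power_add)
    finally show ?thesis .
  qed
  with C0 show ?thesis by blast
qed

end

section \<open>Increments over diamonds\<close>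

definition clip :: "real \<Rightarrow> real \<Rightarrow> real" where
  "clip m y = max (- m) (min m y)"

lemma clip_measurable [measurable]: "clip m \<in> borel_measurable borel"
  unfolding clip_def by measurable

lemma abs_clip_le: "0 \<le> m \<Longrightarrow> \<bar>clip m y\<bar> \<le> m"
  by (auto simp: clip_def)

lemma clip_diff_le: "\<bar>clip m a - clip m b\<bar> \<le> \<bar>a - b\<bar>"
  by (auto simp: clip_def max_def min_def)

text \<open>Where clipping acts, \<open>y\<^sup>2\<close> exceeds \<open>m\<^sup>2\<close>, so two
  additional powers of \<open>y\<close> pay for a factor \<open>1 / m\<^sup>2\<close>.\<close>

lemma clip_error_power:
  assumes "0 < m"
  shows "(y - clip m y) ^ (2 * q + 2) \<le> y ^ (2 * (q + 1) + 2) / m\<^sup>2"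
proof (cases "\<bar>y\<bar> \<le> m")
  case True
  then have "y - clip m y = 0" by (auto simp: clip_def)
  then show ?thesis by (simp add: zero_le_even_power del: power_Suc)
next
  case False
  let ?n = "2 * q + 2"
  have ev: "\<bar>x\<bar> ^ ?n = x ^ ?n" for x :: real by (rule power_even_abs) simp
  have "\<bar>y - clip m y\<bar> \<le> \<bar>y\<bar>" using False assms by (auto simp: clip_def max_def min_def)
  then have "\<bar>y - clip m y\<bar> ^ ?n \<le> \<bar>y\<bar> ^ ?n" by (intro power_mono) auto
  then have 1: "(y - clip m y) ^ ?n \<le> y ^ ?n" by (simp only: ev)
  have "\<bar>m\<bar> \<le> \<bar>y\<bar>" using False assms by simp
  then have "m\<^sup>2 \<le> y\<^sup>2" by (simp only: abs_le_square_iff)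
  then have "y ^ ?n * m\<^sup>2 \<le> y ^ ?n * y\<^sup>2" by (intro mult_left_mono zero_le_even_power) auto
  also have "y ^ ?n * y\<^sup>2 = y ^ (2 * (q + 1) + 2)" by (simp only: power_add [symmetric]) (simp add: algebra_simps)
  finally have "y ^ ?n \<le> y ^ (2 * (q + 1) + 2) / m\<^sup>2" using assms by (simp only: pos_le_divide_eq zero_less_power)
  with 1 show ?thesis by linarith
qed

context wave_field
begin

text \<open>A random factor can be moved into a stochastic integral if it is bounded and adapted,
  and the field is replaced by such a variable. The moment of the next even order makes clipping
  cheap, and between clipped variables convergence in mean square implies convergence in the order
  \<open>2 * q + 2\<close>.\<close>

lemma adapted_approximation:
  assumes t: "0 \<le> t" and \<delta>: "0 < \<delta>"
  shows "\<exists>Y B. Y \<in> borel_measurable (nat_filt M \<xi> t) \<and> (\<forall>\<omega>\<in>space M. \<bar>Y \<omega>\<bar> \<le> B)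
    \<and> (\<integral>\<^sup>+\<omega>. ennreal ((v t x \<omega> - Y \<omega>) ^ (2 * q + 2)) \<partial>M) \<le> ennreal \<delta>"
proof -
  let ?n = "2 * q + 2"
  note vm [measurable] = field_measurable[OF t, of x]
  have "(t, x) \<in> past_cone t x" using t by (simp add: past_cone_def)
  then obtain B0 where B0: "(\<integral>\<^sup>+\<omega>. ennreal ((v t x \<omega>) ^ (2 * (q + 1) + 2)) \<partial>M) \<le> ennreal B0"
    using moment_bound[OF t, of x "q + 1"] by fastforce
  \<comment> \<open>Two errors of size \<eta>, combined at the cost of a factor
    \<open>2 ^ ?n\<close>, add up to \<delta>.\<close>
  define \<eta> where "\<eta> = \<delta> / (2 * 2 ^ ?n)"
  have \<eta>: "0 < \<eta>" using \<delta> by (simp add: \<eta>_def)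
  \<comment> \<open>The level is chosen so that \<open>\<bar>B0\<bar> / m\<^sup>2\<close> is at most
    \<eta>.\<close>
  define m where "m = sqrt (\<bar>B0\<bar> / \<eta> + 1)"
  have m2: "m\<^sup>2 = \<bar>B0\<bar> / \<eta> + 1" unfolding m_def using \<eta> by (intro real_sqrt_pow2) auto
  have m: "0 < m" unfolding m_def using \<eta> by (simp add: add_nonneg_pos)
  have err: "(\<integral>\<^sup>+\<omega>. ennreal ((v t x \<omega> - clip m (v t x \<omega>)) ^ ?n) \<partial>M) \<le> ennreal \<eta>"
  proof -
    have "(\<integral>\<^sup>+\<omega>. ennreal ((v t x \<omega> - clip m (v t x \<omega>)) ^ ?n) \<partial>M)
      \<le> (\<integral>\<^sup>+\<omega>. ennreal (1 / m\<^sup>2) * ennreal ((v t x \<omega>) ^ (2 * (q + 1) + 2)) \<partial>M)"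
    proof (rule nn_integral_mono)
      fix \<omega>
      have "ennreal ((v t x \<omega> - clip m (v t x \<omega>)) ^ ?n) \<le> ennreal ((1 / m\<^sup>2) * (v t x \<omega>) ^ (2 * (q + 1) + 2))"
        using clip_error_power[OF m, of "v t x \<omega>" q] by (intro ennreal_leI) (simp del: power_Suc)
      then show "ennreal ((v t x \<omega> - clip m (v t x \<omega>)) ^ ?n) \<le> ennreal (1 / m\<^sup>2) * ennreal ((v t x \<omega>) ^ (2 * (q + 1) + 2))"
        by (subst (asm) ennreal_mult') (auto simp del: power_Suc)
    qed
    also have "\<dots> = ennreal (1 / m\<^sup>2) * (\<integral>\<^sup>+\<omega>. ennreal ((v t x \<omega>) ^ (2 * (q + 1) + 2)) \<partial>M)"
      by (rule nn_integral_cmult) measurable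
    also have "\<dots> \<le> ennreal (1 / m\<^sup>2) * ennreal \<bar>B0\<bar>"
      by (intro mult_left_mono order_trans[OF B0] ennreal_leI) auto
    also have "\<dots> = ennreal (\<bar>B0\<bar> / m\<^sup>2)" by (simp add: ennreal_mult' [symmetric])
    also have "\<bar>B0\<bar> / m\<^sup>2 \<le> \<eta>"
    proof -
      have "0 < \<bar>B0\<bar> / \<eta> + 1" using \<eta> by (simp add: add_nonneg_pos)
      moreover have "\<bar>B0\<bar> \<le> \<eta> * (\<bar>B0\<bar> / \<eta> + 1)" using \<eta> by (simp add: distrib_left)
      ultimately show ?thesis unfolding m2 by (simp only: pos_divide_le_eq)
    qed
    finally show ?thesis by (simp add: ennreal_leI)
  qed
  obtain I where I: "walsh_integral M \<xi> (\<lambda>z \<omega>. wave_kernel t x z * F (v (fst z) (snd z) \<omega>)) I"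
    "AE \<omega> in M. v t x \<omega> = w t x + I \<omega>"
    using mild[OF t] by blast
  have Im [measurable]: "I \<in> borel_measurable M" using I(1) by (simp add: walsh_integral_iff)
  have "\<exists>J. (\<forall>k. J k \<in> borel_measurable (nat_filt M \<xi> t)) \<and> L2_conv J I"
    by (rule walsh_adapted_approx[OF I(1)]) (use wave_kernel_support(2)[of t x] in force)
  then obtain J where J: "\<And>k. J k \<in> borel_measurable (nat_filt M \<xi> t)" and JI: "L2_conv J I" by blast
  \<comment> \<open>Differences of clipped variables are at most \<open>2 * m\<close>, so
    \<open>2 * q\<close> of their powers are bounded by this constant and two remain for the
    mean-square distance.\<close>
  let ?c = "(2 * m) ^ (2 * q)"
  have "(\<lambda>k. ennreal ?c * (\<integral>\<^sup>+\<omega>. ennreal ((J k \<omega> - I \<omega>)\<^sup>2) \<partial>M)) \<longlonglongrightarrow> ennreal ?c * 0"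
    using JI unfolding L2_conv_def by (intro ennreal_tendsto_cmult) auto
  then have "\<forall>\<^sub>F k in sequentially. ennreal ?c * (\<integral>\<^sup>+\<omega>. ennreal ((J k \<omega> - I \<omega>)\<^sup>2) \<partial>M) < ennreal \<eta>"
    using \<eta> by (intro order_tendstoD(2)[where y = 0]) auto
  then obtain k where k: "ennreal ?c * (\<integral>\<^sup>+\<omega>. ennreal ((J k \<omega> - I \<omega>)\<^sup>2) \<partial>M) < ennreal \<eta>"
    by (meson eventually_happens' sequentially_bot)
  have Jm [measurable]: "J k \<in> borel_measurable M" by (rule measurable_nat_filt[OF J])
  define Y where "Y \<omega> = clip m (w t x + J k \<omega>)" for \<omega>
  have Ym: "Y \<in> borel_measurable (nat_filt M \<xi> t)" unfolding Y_def using J[of k] by measurable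
  have Ym' [measurable]: "Y \<in> borel_measurable M" by (rule measurable_nat_filt[OF Ym])
  have Yb: "\<forall>\<omega>\<in>space M. \<bar>Y \<omega>\<bar> \<le> m" unfolding Y_def using abs_clip_le m by auto
  have err2: "(\<integral>\<^sup>+\<omega>. ennreal ((clip m (v t x \<omega>) - Y \<omega>) ^ ?n) \<partial>M) \<le> ennreal \<eta>"
  proof -
    have "(\<integral>\<^sup>+\<omega>. ennreal ((clip m (v t x \<omega>) - Y \<omega>) ^ ?n) \<partial>M) \<le> (\<integral>\<^sup>+\<omega>. ennreal ?c * ennreal ((J k \<omega> - I \<omega>)\<^sup>2) \<partial>M)"
    proof (rule nn_integral_mono_AE)
      show "AE \<omega> in M. ennreal ((clip m (v t x \<omega>) - Y \<omega>) ^ ?n) \<le> ennreal ?c * ennreal ((J k \<omega> - I \<omega>)\<^sup>2)"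
        using I(2)
      proof eventually_elim
        case (elim \<omega>)
        let ?d = "clip m (v t x \<omega>) - Y \<omega>"
        have "\<bar>?d\<bar> \<le> \<bar>J k \<omega> - I \<omega>\<bar>"
          unfolding Y_def elim using clip_diff_le[of m "w t x + I \<omega>" "w t x + J k \<omega>"] by simp
        then have 1: "?d\<^sup>2 \<le> (J k \<omega> - I \<omega>)\<^sup>2" by (simp only: abs_le_square_iff)
        have "\<bar>?d\<bar> \<le> 2 * m"
          using abs_clip_le[of m "v t x \<omega>"] abs_clip_le[of m "w t x + J k \<omega>"] m unfolding Y_def by linarith
        then have "\<bar>?d\<bar> ^ (2 * q) \<le> ?c" by (intro power_mono) auto
        then have 2: "?d ^ (2 * q) \<le> ?c" by (simp add: power_even_abs)
        have "?d ^ ?n = ?d ^ (2 * q) * ?d\<^sup>2" by (rule power_add)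
        also have "\<dots> \<le> ?c * (J k \<omega> - I \<omega>)\<^sup>2" using m by (intro mult_mono 1 2) auto
        finally have "ennreal (?d ^ ?n) \<le> ennreal (?c * (J k \<omega> - I \<omega>)\<^sup>2)" by (rule ennreal_leI)
        then show ?case using m by (subst (asm) ennreal_mult) auto
      qed
    qed
    also have "\<dots> = ennreal ?c * (\<integral>\<^sup>+\<omega>. ennreal ((J k \<omega> - I \<omega>)\<^sup>2) \<partial>M)"
      by (rule nn_integral_cmult) measurable
    also have "\<dots> \<le> ennreal \<eta>" using k by simp
    finally show ?thesis .
  qed
  have "(\<integral>\<^sup>+\<omega>. ennreal (((v t x \<omega> - clip m (v t x \<omega>)) + (clip m (v t x \<omega>) - Y \<omega>)) ^ ?n) \<partial>M) \<le> ennreal (2 ^ ?n * (\<eta> + \<eta>))"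
    by (rule nn_integral_power_add_le[OF _ _ err err2]) (use \<eta> in auto)
  moreover have "2 ^ ?n * (\<eta> + \<eta>) = \<delta>" unfolding \<eta>_def by (simp del: power_Suc power_add)
  ultimately have "(\<integral>\<^sup>+\<omega>. ennreal ((v t x \<omega> - Y \<omega>) ^ ?n) \<partial>M) \<le> ennreal \<delta>" by simp
  with Ym Yb show ?thesis by blast
qed

text \<open>Young's inequality with a weight \<open>s\<close> in place of the Cauchy-Schwarz
  inequality; the choice of \<open>s\<close> balances the two terms. With \<open>g = 1\<close> it
  also passes from the order \<open>4 * q + 4\<close> to the order \<open>2 * q + 2\<close>.\<close>

lemma nn_integral_power_product_le:
  fixes f g :: "'a \<Rightarrow> real"
  assumes [measurable]: "f \<in> borel_measurable M" "g \<in> borel_measurable M" and s: "0 < s"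
    and f: "(\<integral>\<^sup>+\<omega>. ennreal ((f \<omega>) ^ (4 * q + 4)) \<partial>M) \<le> ennreal a"
    and g: "(\<integral>\<^sup>+\<omega>. ennreal ((g \<omega>) ^ (4 * q + 4)) \<partial>M) \<le> ennreal b" and "0 \<le> a" "0 \<le> b"
  shows "(\<integral>\<^sup>+\<omega>. ennreal ((f \<omega> * g \<omega>) ^ (2 * q + 2)) \<partial>M) \<le> ennreal (s * a + b / s)"
proof -
  let ?n = "2 * q + 2"
  have sq: "(x ^ ?n)\<^sup>2 = x ^ (4 * q + 4)" for x :: real
  proof -
    have "?n * 2 = 4 * q + 4" by simp
    then show ?thesis by (simp only: power_mult [symmetric])
  qed
  have "(\<integral>\<^sup>+\<omega>. ennreal ((f \<omega> * g \<omega>) ^ ?n) \<partial>M)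
    \<le> (\<integral>\<^sup>+\<omega>. ennreal s * ennreal ((f \<omega>) ^ (4 * q + 4)) + ennreal (1 / s) * ennreal ((g \<omega>) ^ (4 * q + 4)) \<partial>M)"
  proof (rule nn_integral_mono)
    fix \<omega>
    let ?A = "(f \<omega>) ^ ?n" and ?B = "(g \<omega>) ^ ?n"
    have r: "sqrt s \<noteq> 0" using s by simp
    have "?A * ?B = (sqrt s * ?A) * (?B / sqrt s)" using r by simp
    also have "\<dots> \<le> (sqrt s * ?A)\<^sup>2 + (?B / sqrt s)\<^sup>2"
      using abs_mult_le_squares[of "sqrt s * ?A" "?B / sqrt s"] by linarith
    also have "\<dots> = s * (f \<omega>) ^ (4 * q + 4) + (1 / s) * (g \<omega>) ^ (4 * q + 4)"
      using s by (simp only: power_mult_distrib power_divide sq real_sqrt_pow2 less_imp_le) simp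
    finally have "ennreal ((f \<omega> * g \<omega>) ^ ?n) \<le> ennreal (s * (f \<omega>) ^ (4 * q + 4) + (1 / s) * (g \<omega>) ^ (4 * q + 4))"
      unfolding power_mult_distrib by (rule ennreal_leI)
    also have "\<dots> = ennreal s * ennreal ((f \<omega>) ^ (4 * q + 4)) + ennreal (1 / s) * ennreal ((g \<omega>) ^ (4 * q + 4))"
    proof -
      have "0 \<le> x ^ (4 * q + 4)" for x :: real by (rule zero_le_even_power) simp
      then have "ennreal (s * (f \<omega>) ^ (4 * q + 4) + (1 / s) * (g \<omega>) ^ (4 * q + 4))
        = ennreal (s * (f \<omega>) ^ (4 * q + 4)) + ennreal ((1 / s) * (g \<omega>) ^ (4 * q + 4))"
        using s by (intro ennreal_plus mult_nonneg_nonneg) auto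
      also have "\<dots> = ennreal s * ennreal ((f \<omega>) ^ (4 * q + 4)) + ennreal (1 / s) * ennreal ((g \<omega>) ^ (4 * q + 4))"
        using s by (intro arg_cong2[where f = "(+)"] ennreal_mult') auto
      finally show ?thesis .
    qed
    finally show "ennreal ((f \<omega> * g \<omega>) ^ ?n)
      \<le> ennreal s * ennreal ((f \<omega>) ^ (4 * q + 4)) + ennreal (1 / s) * ennreal ((g \<omega>) ^ (4 * q + 4))" .
  qed
  also have "\<dots> = ennreal s * (\<integral>\<^sup>+\<omega>. ennreal ((f \<omega>) ^ (4 * q + 4)) \<partial>M) + ennreal (1 / s) * (\<integral>\<^sup>+\<omega>. ennreal ((g \<omega>) ^ (4 * q + 4)) \<partial>M)"
    by (subst nn_integral_add) (auto simp: nn_integral_cmult simp del: power_Suc power_add)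
  also have "\<dots> \<le> ennreal s * ennreal a + ennreal (1 / s) * ennreal b"
    by (intro add_mono mult_left_mono f g) auto
  also have "\<dots> = ennreal (s * a + b / s)"
    using s assms(6,7) by (simp add: ennreal_mult [symmetric] ennreal_plus [symmetric] del: ennreal_plus)
  finally show ?thesis .
qed

text \<open>The field at the reference point \<open>(t', x')\<close> need not be known at time \<open>t0\<close>, so the
  integrand is first frozen at \<open>(t0, x0)\<close>, the earliest point of the support of \<open>k\<close>.\<close>

lemma frozen_coefficient_moment:
  assumes T: "0 \<le> T"
  shows "\<exists>C\<ge>0. \<forall>t0 x0 t' x' \<epsilon> k I J. 0 \<le> t0 \<longrightarrow> 0 < \<epsilon> \<longrightarrow> 4 * \<epsilon> \<le> 1 \<longrightarrow>
     (\<forall>s y. t0 \<le> s \<longrightarrow> s \<le> t0 + 2 * \<epsilon> \<longrightarrow> \<bar>y - x0\<bar> \<le> 2 * \<epsilon> \<longrightarrow> (s, y) \<in> past_cone T X0) \<longrightarrow>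
     (t', x') \<in> past_cone T X0 \<longrightarrow> \<bar>t' - t0\<bar> + \<bar>x' - x0\<bar> \<le> 4 * \<epsilon> \<longrightarrow>
     (\<forall>z. \<bar>k z\<bar> \<le> 1) \<longrightarrow>
     (\<forall>z. k z \<noteq> 0 \<longrightarrow> t0 \<le> fst z \<and> fst z \<le> t0 + 2 * \<epsilon> \<and> \<bar>snd z - x0\<bar> \<le> 2 * \<epsilon>) \<longrightarrow>
     walsh_integral M \<xi> (\<lambda>z \<omega>. k z * F (v (fst z) (snd z) \<omega>)) I \<longrightarrow>
     walsh_integral M \<xi> (\<lambda>z \<omega>. k z * 1) J \<longrightarrow>
     (\<integral>\<^sup>+\<omega>. ennreal ((I \<omega> - F (v t' x' \<omega>) * J \<omega>) ^ (2 * q + 2)) \<partial>M) \<le> ennreal (C * (\<epsilon> ^ (q + 1)) ^ 3)"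
proof -
  let ?n = "2 * q + 2"
  \<comment> \<open>Taken with \<open>2 * q + 1\<close> in place of \<open>q\<close>, the moment
    bounds give the doubled order required for products.\<close>
  have n4: "2 * (2 * q + 1) + 2 = 4 * q + 4" by simp
  obtain C1 where C1: "0 \<le> C1" "\<forall>t x t' x' r. (t, x) \<in> past_cone T X0 \<longrightarrow> (t', x') \<in> past_cone T X0 \<longrightarrow> 0 < r \<longrightarrow> r \<le> 1 \<longrightarrow>
    \<bar>t - t'\<bar> + \<bar>x - x'\<bar> \<le> r \<longrightarrow>
    (\<integral>\<^sup>+\<omega>. ennreal ((v t x \<omega> - v t' x' \<omega>) ^ (2 * q + 2)) \<partial>M) \<le> ennreal (C1 * r ^ (q + 1))"
    using holder_moment[OF T, of X0 q] by blast
  obtain C2 where C2: "0 \<le> C2" "\<forall>t x t' x' r. (t, x) \<in> past_cone T X0 \<longrightarrow> (t', x') \<in> past_cone T X0 \<longrightarrow> 0 < r \<longrightarrow> r \<le> 1 \<longrightarrow>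
    \<bar>t - t'\<bar> + \<bar>x - x'\<bar> \<le> r \<longrightarrow>
    (\<integral>\<^sup>+\<omega>. ennreal ((v t x \<omega> - v t' x' \<omega>) ^ (4 * q + 4)) \<partial>M) \<le> ennreal (C2 * r ^ (2 * q + 2))"
    using holder_moment[OF T, of X0 "2 * q + 1"] unfolding n4 by fastforce
  define p4 where "p4 = (4 :: real) ^ (q + 1)"
  define P where "P = (2 :: real) ^ ?n"
  define P2 where "P2 = (2 :: real) ^ (4 * q + 4)"
  define B1 where "B1 = K ^ ?n * (P * (C1 * p4 + 2))"
  define D1 where "D1 = walsh_const q * B1 * 10 ^ (q + 1)"
  define B2 where "B2 = K ^ (4 * q + 4) * (P2 * (1 + C2 * p4\<^sup>2))"
  define D2 where "D2 = walsh_const (2 * q + 1) * 1 * 10 ^ (2 * q + 2)"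
  define C where "C = P * (D1 + (B2 + D2))"
  have K0: "0 \<le> K ^ m" for m using K_nonneg by simp
  have nn: "0 \<le> P" "0 \<le> P2" "0 \<le> p4" by (simp_all add: P_def P2_def p4_def)
  have B1: "0 \<le> B1" unfolding B1_def by (intro mult_nonneg_nonneg add_nonneg_nonneg K0 nn C1(1)) simp
  have B2: "0 \<le> B2" unfolding B2_def by (intro mult_nonneg_nonneg add_nonneg_nonneg K0 nn C2(1)) simp_all
  have D1: "0 \<le> D1" unfolding D1_def using B1 walsh_const_nonneg by (intro mult_nonneg_nonneg) auto
  have D2: "0 \<le> D2" unfolding D2_def using walsh_const_nonneg by (intro mult_nonneg_nonneg) auto
  have C0: "0 \<le> C" unfolding C_def using nn B2 D1 D2 by (intro mult_nonneg_nonneg add_nonneg_nonneg) auto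
  have "(\<integral>\<^sup>+\<omega>. ennreal ((I \<omega> - F (v t' x' \<omega>) * J \<omega>) ^ ?n) \<partial>M) \<le> ennreal (C * (\<epsilon> ^ (q + 1)) ^ 3)"
    if t0: "0 \<le> t0" and \<epsilon>: "0 < \<epsilon>" "4 * \<epsilon> \<le> 1"
      and box: "\<forall>s y. t0 \<le> s \<longrightarrow> s \<le> t0 + 2 * \<epsilon> \<longrightarrow> \<bar>y - x0\<bar> \<le> 2 * \<epsilon> \<longrightarrow> (s, y) \<in> past_cone T X0"
      and ref: "(t', x') \<in> past_cone T X0" "\<bar>t' - t0\<bar> + \<bar>x' - x0\<bar> \<le> 4 * \<epsilon>"
      and k1: "\<forall>z. \<bar>k z\<bar> \<le> 1"
      and ks: "\<forall>z. k z \<noteq> 0 \<longrightarrow> t0 \<le> fst z \<and> fst z \<le> t0 + 2 * \<epsilon> \<and> \<bar>snd z - x0\<bar> \<le> 2 * \<epsilon>"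
      and WI: "walsh_integral M \<xi> (\<lambda>z \<omega>. k z * F (v (fst z) (snd z) \<omega>)) I"
      and WJ: "walsh_integral M \<xi> (\<lambda>z \<omega>. k z * 1) J"
    for t0 x0 t' x' \<epsilon> k I J
  proof -
    \<comment> \<open>In this unit a Hoelder error raised to the power \<open>2 * q + 2\<close> is
      of order \<open>h\<close>, the factor from the area is of order \<open>h\<^sup>2\<close>, and
      the claim is a bound of order \<open>h ^ 3\<close>.\<close>
    define h where "h = \<epsilon> ^ (q + 1)"
    have h: "0 < h" using \<epsilon> by (simp add: h_def)
    have r4: "(4 * \<epsilon>) ^ (q + 1) = p4 * h" unfolding p4_def h_def by (rule power_mult_distrib)
    have e2: "2 * q + 2 = (q + 1) * 2" by simp
    have r8: "(4 * \<epsilon>) ^ (2 * q + 2) = p4\<^sup>2 * h\<^sup>2" unfolding e2 power_mult r4 by (rule power_mult_distrib)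
    have base: "(t0, x0) \<in> past_cone T X0" using box \<epsilon> by auto
    have t': "0 \<le> t'" using ref by (auto simp: past_cone_def)
    \<comment> \<open>The tolerance \<open>h\<^sup>2\<close> at the order \<open>4 * q + 4\<close>
      is the size of the Hoelder error itself, so replacing the field by \<open>Y\<close> does not
      affect the rate.\<close>
    obtain Y B where Y: "Y \<in> borel_measurable (nat_filt M \<xi> t0)" and YB: "\<forall>\<omega>\<in>space M. \<bar>Y \<omega>\<bar> \<le> B"
      and Y4: "(\<integral>\<^sup>+\<omega>. ennreal ((v t0 x0 \<omega> - Y \<omega>) ^ (4 * q + 4)) \<partial>M) \<le> ennreal (h\<^sup>2)"
      using adapted_approximation[OF t0, of "h\<^sup>2" x0 "2 * q + 1"] h unfolding n4 by auto
    have Ym [measurable]: "Y \<in> borel_measurable M" by (rule measurable_nat_filt[OF Y])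
    note [measurable] = field_measurable[OF t0, of x0] field_measurable[OF t', of x']
    have Im [measurable]: "I \<in> borel_measurable M" "J \<in> borel_measurable M" using WI WJ by (auto simp: walsh_integral_iff)
    \<comment> \<open>The weight \<open>1 / h\<close> makes both terms of Young's inequality equal
      to \<open>h\<close>.\<close>
    have Y2: "(\<integral>\<^sup>+\<omega>. ennreal ((v t0 x0 \<omega> - Y \<omega>) ^ ?n) \<partial>M) \<le> ennreal (2 * h)"
    proof -
      have "(\<integral>\<^sup>+\<omega>. ennreal (((v t0 x0 \<omega> - Y \<omega>) * 1) ^ ?n) \<partial>M) \<le> ennreal ((1 / h) * h\<^sup>2 + 1 / (1 / h))"
        by (rule nn_integral_power_product_le[OF _ _ _ Y4]) (use h in \<open>auto simp: emeasure_space_1\<close>)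
      also have "(1 / h) * h\<^sup>2 + 1 / (1 / h) = 2 * h" using h by (simp add: power2_eq_square)
      finally show ?thesis by simp
    qed
    \<comment> \<open>The margins of \<open>\<epsilon> / 8\<close> take in the lower and the left
      edge of the box, which a half-open rectangle excludes; the area stays below
      \<open>10 * \<epsilon>\<^sup>2\<close>.\<close>
    define D where "D = rect (t0 - \<epsilon> / 8) (t0 + 2 * \<epsilon>) (x0 - 2 * \<epsilon> - \<epsilon> / 8) (x0 + 2 * \<epsilon>)"
    define A where "A = 10 * \<epsilon>\<^sup>2"
    have D: "D \<in> sets borel" unfolding D_def by (rule rect_borel)
    have A: "0 < A" using \<epsilon> by (simp add: A_def)
    have DA: "emeasure lborel D \<le> ennreal A"
    proof -
      have "emeasure lborel D = emeasure lborel {t0 - \<epsilon> / 8<..t0 + 2 * \<epsilon>} * emeasure lborel {x0 - 2 * \<epsilon> - \<epsilon> / 8<..x0 + 2 * \<epsilon>}"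
        unfolding D_def rect_def lborel_prod[symmetric] by (rule lborel.emeasure_pair_measure_Times) auto
      also have "\<dots> = ennreal ((17 / 8 * \<epsilon>) * (33 / 8 * \<epsilon>))"
        using \<epsilon> by (simp add: ennreal_mult [symmetric])
      also have "\<dots> \<le> ennreal A" unfolding A_def using \<epsilon> by (intro ennreal_leI) (simp add: power2_eq_square)
      finally show ?thesis .
    qed
    have Ah: "A ^ (q + 1) = 10 ^ (q + 1) * h\<^sup>2"
      unfolding A_def h_def power_mult_distrib by (simp only: power_mult [symmetric] mult.commute)
    have Ah2: "A ^ (2 * q + 2) = 10 ^ (2 * q + 2) * (h\<^sup>2)\<^sup>2"
    proof -
      have "A ^ (2 * q + 2) = (10 ^ (q + 1) * h\<^sup>2)\<^sup>2" unfolding e2 power_mult Ah ..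
      also have "\<dots> = 10 ^ (2 * q + 2) * (h\<^sup>2)\<^sup>2" unfolding e2 power_mult power_mult_distrib ..
      finally show ?thesis .
    qed
    have kD: "z \<in> D" if "k z \<noteq> 0" for z
      using ks[rule_format, OF that] \<epsilon> by (cases z) (auto simp: D_def rect_def)
    have kcone: "z \<in> past_cone T X0" if "k z \<noteq> 0" for z
      using ks[rule_format, OF that] box by (cases z) auto
    have FY: "(\<lambda>\<omega>. F (Y \<omega>)) \<in> borel_measurable (nat_filt M \<xi> t0)" using Y by measurable
    have FYB: "\<bar>F (Y \<omega>)\<bar> \<le> \<bar>F 0\<bar> + K * \<bar>B\<bar>" if "\<omega> \<in> space M" for \<omega>
    proof -
      have "\<bar>Y \<omega>\<bar> \<le> \<bar>B\<bar>" using YB that by force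
      then have "K * \<bar>Y \<omega>\<bar> \<le> K * \<bar>B\<bar>" by (rule mult_left_mono[OF _ K_nonneg])
      then show ?thesis using lip[of "Y \<omega>" 0] by simp
    qed
    \<comment> \<open>The kernel may be nonzero exactly at time \<open>t0\<close>; that line is a
      null set.\<close>
    have null: "AE z in lborel. fst z \<le> t0 \<longrightarrow> (\<forall>\<omega>\<in>space M. k z * 1 = 0)"
    proof -
      have "{t0} \<times> (UNIV :: real set) \<in> null_sets lborel"
      proof -
        have "emeasure lborel ({t0} \<times> (UNIV :: real set)) = emeasure lborel {t0} * emeasure lborel (UNIV :: real set)"
          unfolding lborel_prod[symmetric] by (rule lborel.emeasure_pair_measure_Times) auto
        then show ?thesis by (auto intro!: null_setsI simp: borel_Times)
      qed
      then have "AE z in lborel. z \<notin> {t0} \<times> (UNIV :: real set)" by (rule AE_not_in)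
      then show ?thesis
      proof eventually_elim
        case (elim z)
        then show ?case using ks[rule_format, of z] by (cases z) force
      qed
    qed
    have WY: "walsh_integral M \<xi> (\<lambda>z \<omega>. F (Y \<omega>) * (k z * 1)) (\<lambda>\<omega>. F (Y \<omega>) * J \<omega>)"
      by (rule walsh_mult_adapted[OF WJ null FY FYB])
    have W: "walsh_integral M \<xi> (\<lambda>z \<omega>. k z * (F (v (fst z) (snd z) \<omega>) - F (Y \<omega>))) (\<lambda>\<omega>. I \<omega> - F (Y \<omega>) * J \<omega>)"
      using walsh_lincomb[OF WI WY, of 1 "- 1"] by (simp add: algebra_simps)
    \<comment> \<open>The integrand is now a difference of nearby values, hence a Hoelder error of
      order \<open>h\<close>, over an area that contributes \<open>h\<^sup>2\<close>.\<close>
    have part1: "(\<integral>\<^sup>+\<omega>. ennreal ((I \<omega> - F (Y \<omega>) * J \<omega>) ^ ?n) \<partial>M) \<le> ennreal (D1 * h ^ 3)"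
    proof -
      have "(\<integral>\<^sup>+\<omega>. ennreal ((F (v (fst z) (snd z) \<omega>) - F (Y \<omega>)) ^ ?n) \<partial>M) \<le> ennreal (B1 * h)"
        if "k z \<noteq> 0" for z
      proof -
        have z: "0 \<le> fst z" "(fst z, snd z) \<in> past_cone T X0" using kcone[OF that] by (auto simp: past_cone_def)
        note [measurable] = field_measurable[OF z(1), of "snd z"]
        have d: "\<bar>fst z - t0\<bar> + \<bar>snd z - x0\<bar> \<le> 4 * \<epsilon>" using ks[rule_format, OF that] by auto
        have H: "(\<integral>\<^sup>+\<omega>. ennreal ((v (fst z) (snd z) \<omega> - v t0 x0 \<omega>) ^ ?n) \<partial>M) \<le> ennreal (C1 * (p4 * h))"
          using C1(2)[rule_format, OF z(2) base _ \<epsilon>(2) d] \<epsilon>(1) unfolding r4 by simp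
        have "(\<integral>\<^sup>+\<omega>. ennreal (((v (fst z) (snd z) \<omega> - v t0 x0 \<omega>) + (v t0 x0 \<omega> - Y \<omega>)) ^ ?n) \<partial>M)
           \<le> ennreal (P * (C1 * (p4 * h) + 2 * h))"
          unfolding P_def by (rule nn_integral_power_add_le[OF _ _ H Y2]) (use C1(1) nn h in auto)
        then have "(\<integral>\<^sup>+\<omega>. ennreal ((v (fst z) (snd z) \<omega> - Y \<omega>) ^ ?n) \<partial>M) \<le> ennreal (P * (C1 * (p4 * h) + 2 * h))"
          by (simp del: power_Suc power_add)
        then have "(\<integral>\<^sup>+\<omega>. ennreal ((F (v (fst z) (snd z) \<omega>) - F (Y \<omega>)) ^ ?n) \<partial>M) \<le> ennreal (K ^ ?n * (P * (C1 * (p4 * h) + 2 * h)))"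
          by (intro nn_integral_power_scale_le[of "\<lambda>\<omega>. v (fst z) (snd z) \<omega> - Y \<omega>"]) (use lip K_nonneg in auto)
        also have "K ^ ?n * (P * (C1 * (p4 * h) + 2 * h)) = B1 * h" by (simp only: B1_def algebra_simps)
        finally show ?thesis .
      qed
      then have "(\<integral>\<^sup>+\<omega>. ennreal ((I \<omega> - F (Y \<omega>) * J \<omega>) ^ ?n) \<partial>M) \<le> ennreal (walsh_const q * (B1 * h) * A ^ (q + 1))"
        by (intro increment_moment[OF W _ kD D DA A]) (use k1 B1 h in auto)
      also have "walsh_const q * (B1 * h) * A ^ (q + 1) = D1 * h ^ 3"
        unfolding Ah D1_def by (simp only: power3_eq_cube power2_eq_square mult_ac)
      finally show ?thesis .
    qed
    have J4: "(\<integral>\<^sup>+\<omega>. ennreal ((J \<omega>) ^ (4 * q + 4)) \<partial>M) \<le> ennreal (D2 * (h\<^sup>2)\<^sup>2)"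
    proof -
      have "(\<integral>\<^sup>+\<omega>. ennreal ((J \<omega>) ^ (2 * (2 * q + 1) + 2)) \<partial>M) \<le> ennreal (walsh_const (2 * q + 1) * 1 * A ^ (2 * q + 1 + 1))"
        by (rule increment_moment[OF WJ _ kD D DA A]) (use k1 in \<open>auto simp: emeasure_space_1\<close>)
      also have "2 * q + 1 + 1 = 2 * q + 2" by simp
      also have "walsh_const (2 * q + 1) * 1 * A ^ (2 * q + 2) = D2 * (h\<^sup>2)\<^sup>2" unfolding Ah2 D2_def by (simp only: mult_ac)
      finally show ?thesis unfolding n4 .
    qed
    have F4: "(\<integral>\<^sup>+\<omega>. ennreal ((F (Y \<omega>) - F (v t' x' \<omega>)) ^ (4 * q + 4)) \<partial>M) \<le> ennreal (B2 * h\<^sup>2)"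
    proof -
      have d: "\<bar>t0 - t'\<bar> + \<bar>x0 - x'\<bar> \<le> 4 * \<epsilon>" using ref(2) by linarith
      have H: "(\<integral>\<^sup>+\<omega>. ennreal ((v t0 x0 \<omega> - v t' x' \<omega>) ^ (2 * (2 * q + 1) + 2)) \<partial>M) \<le> ennreal (C2 * (p4\<^sup>2 * h\<^sup>2))"
        using C2(2)[rule_format, OF base ref(1) _ \<epsilon>(2) d] \<epsilon>(1) unfolding r8 n4 by simp
      have Y4': "(\<integral>\<^sup>+\<omega>. ennreal ((Y \<omega> - v t0 x0 \<omega>) ^ (2 * (2 * q + 1) + 2)) \<partial>M) \<le> ennreal (h\<^sup>2)"
      proof -
        have "(Y \<omega> - v t0 x0 \<omega>) ^ (4 * q + 4) = (v t0 x0 \<omega> - Y \<omega>) ^ (4 * q + 4)" for \<omega>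
          by (metis even_add even_mult_iff even_numeral minus_diff_eq power_minus_even)
        then show ?thesis using Y4 unfolding n4 by simp
      qed
      have "(\<integral>\<^sup>+\<omega>. ennreal (((Y \<omega> - v t0 x0 \<omega>) + (v t0 x0 \<omega> - v t' x' \<omega>)) ^ (2 * (2 * q + 1) + 2)) \<partial>M)
         \<le> ennreal (2 ^ (2 * (2 * q + 1) + 2) * (h\<^sup>2 + C2 * (p4\<^sup>2 * h\<^sup>2)))"
        by (rule nn_integral_power_add_le[OF _ _ Y4' H]) (use C2(1) nn h in auto)
      then have "(\<integral>\<^sup>+\<omega>. ennreal ((Y \<omega> - v t' x' \<omega>) ^ (2 * (2 * q + 1) + 2)) \<partial>M) \<le> ennreal (P2 * (h\<^sup>2 + C2 * (p4\<^sup>2 * h\<^sup>2)))"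
        unfolding P2_def n4 by (simp del: power_Suc power_add)
      then have "(\<integral>\<^sup>+\<omega>. ennreal ((F (Y \<omega>) - F (v t' x' \<omega>)) ^ (2 * (2 * q + 1) + 2)) \<partial>M)
        \<le> ennreal (K ^ (2 * (2 * q + 1) + 2) * (P2 * (h\<^sup>2 + C2 * (p4\<^sup>2 * h\<^sup>2))))"
        by (intro nn_integral_power_scale_le[of "\<lambda>\<omega>. Y \<omega> - v t' x' \<omega>"]) (use lip K_nonneg in auto)
      also have "K ^ (2 * (2 * q + 1) + 2) * (P2 * (h\<^sup>2 + C2 * (p4\<^sup>2 * h\<^sup>2))) = B2 * h\<^sup>2"
        unfolding n4 B2_def by (simp only: algebra_simps)
      finally show ?thesis unfolding n4 .
    qed
    \<comment> \<open>With weight \<open>h\<close> in Young's inequality the Hoelder part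
      \<open>h\<^sup>2\<close> and the noise part \<open>(h\<^sup>2)\<^sup>2\<close>, both of order
      \<open>4 * q + 4\<close>, come to \<open>h ^ 3\<close>.\<close>
    have part2: "(\<integral>\<^sup>+\<omega>. ennreal (((F (Y \<omega>) - F (v t' x' \<omega>)) * J \<omega>) ^ ?n) \<partial>M) \<le> ennreal ((B2 + D2) * h ^ 3)"
    proof -
      have "(\<integral>\<^sup>+\<omega>. ennreal (((F (Y \<omega>) - F (v t' x' \<omega>)) * J \<omega>) ^ ?n) \<partial>M) \<le> ennreal (h * (B2 * h\<^sup>2) + D2 * (h\<^sup>2)\<^sup>2 / h)"
        by (rule nn_integral_power_product_le[OF _ _ h F4 J4]) (use B2 D2 in auto)
      also have "h * (B2 * h\<^sup>2) + D2 * (h\<^sup>2)\<^sup>2 / h = (B2 + D2) * h ^ 3"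
        using h by (simp add: power3_eq_cube power2_eq_square algebra_simps)
      finally show ?thesis .
    qed
    have "(\<integral>\<^sup>+\<omega>. ennreal (((I \<omega> - F (Y \<omega>) * J \<omega>) + (F (Y \<omega>) - F (v t' x' \<omega>)) * J \<omega>) ^ ?n) \<partial>M)
       \<le> ennreal (P * (D1 * h ^ 3 + (B2 + D2) * h ^ 3))"
      unfolding P_def by (rule nn_integral_power_add_le[OF _ _ part1 part2]) (use D1 B2 D2 h in auto)
    also have "P * (D1 * h ^ 3 + (B2 + D2) * h ^ 3) = C * h ^ 3" by (simp only: C_def algebra_simps)
    finally show ?thesis unfolding h_def [symmetric] by (simp add: algebra_simps del: power_Suc power_add)
  qed
  with C0 show ?thesis by blast
qed

end

section \<open>Reflection in time and the initial data\<close>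

definition time_reflection :: "real \<times> real \<Rightarrow> real \<times> real" where
  "time_reflection z = (- fst z, snd z)"

lemma time_reflection_measurable [measurable]: "time_reflection \<in> borel_measurable borel"
  unfolding time_reflection_def by (intro borel_measurable_continuous_onI continuous_intros)

lemma distr_time_reflection: "distr lborel borel time_reflection = lborel"
proof -
  \<comment> \<open>The time axis is the basis vector \<open>(1, 0)\<close>; reflection scales the
    axes by -1 and 1, so the Jacobian has modulus 1.\<close>
  let ?c = "\<lambda>j :: real \<times> real. if j = (1, 0) then - 1 else 1 :: real"
  have T: "time_reflection = (\<lambda>x. 0 + (\<Sum>j\<in>Basis. (?c j * (x \<bullet> j)) *\<^sub>R j))"
    by (rule ext) (auto simp: time_reflection_def Basis_prod_def sum.union_disjoint zero_prod_def)
  have "lborel = density (distr lborel borel time_reflection) (\<lambda>_. (\<Prod>j\<in>Basis. \<bar>?c j\<bar>))"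
    unfolding T by (rule lborel_affine_euclidean) simp
  also have "(\<Prod>j\<in>Basis. \<bar>?c j\<bar>) = 1" by (intro prod.neutral) auto
  finally show ?thesis by (simp add: density_1)
qed

lemma reflect_noise_eq: "reflect_noise \<xi> \<phi> = \<xi> (\<lambda>z. \<phi> (time_reflection z))"
  unfolding reflect_noise_def time_reflection_def by (simp add: case_prod_beta')

lemma integral_time_reflection:
  fixes f :: "real \<times> real \<Rightarrow> real"
  assumes "f \<in> borel_measurable borel"
  shows "(\<integral>z. f (time_reflection z) \<partial>lborel) = (\<integral>z. f z \<partial>lborel)"
    and "integrable lborel (\<lambda>z. f (time_reflection z)) = integrable lborel f"
proof -
  have m: "time_reflection \<in> measurable lborel borel" by simp
  show "(\<integral>z. f (time_reflection z) \<partial>lborel) = (\<integral>z. f z \<partial>lborel)"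
    using integral_distr[OF m assms] by (simp add: distr_time_reflection)
  show "integrable lborel (\<lambda>z. f (time_reflection z)) = integrable lborel f"
    using integrable_distr_eq[OF m assms] by (simp add: distr_time_reflection)
qed

lemma L2fun_time_reflection: "L2fun \<phi> \<Longrightarrow> L2fun (\<lambda>z. \<phi> (time_reflection z))"
  using integral_time_reflection(2)[of "\<lambda>z. (\<phi> z)\<^sup>2"] by (auto simp: L2fun_def)

text \<open>Time reflection preserves Lebesgue measure and is therefore an isometry on test
  functions; each clause is the old one for reflected test functions.\<close>

lemma white_noise_reflect:
  assumes "white_noise M \<xi>" shows "white_noise M (reflect_noise \<xi>)"
  unfolding white_noise_def
proof (intro conjI allI impI)
  show "prob_space M" using assms by (simp add: white_noise_def)
  show "reflect_noise \<xi> \<phi> \<in> borel_measurable M" if "L2fun \<phi>" for \<phi>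
    using assms L2fun_time_reflection[OF that] by (simp add: white_noise_def reflect_noise_eq)
  show "centered_gaussian M (\<lambda>\<omega>. \<Sum>i\<in>I. c i * reflect_noise \<xi> (\<phi>s i) \<omega>)"
    if "finite I" "\<forall>i\<in>I. L2fun (\<phi>s i)" for I :: "nat set" and \<phi>s c
  proof -
    have L2: "\<forall>i\<in>I. L2fun (\<lambda>z. \<phi>s i (time_reflection z))" using that L2fun_time_reflection by blast
    have "\<forall>(I :: nat set) \<phi>s c. finite I \<longrightarrow> (\<forall>i\<in>I. L2fun (\<phi>s i)) \<longrightarrow>
       centered_gaussian M (\<lambda>\<omega>. \<Sum>i\<in>I. c i * \<xi> (\<phi>s i) \<omega>)"
      using assms unfolding white_noise_def by (elim conjE)
    from this[rule_format, OF that(1), of "\<lambda>i z. \<phi>s i (time_reflection z)" c] show ?thesis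
      unfolding reflect_noise_eq using L2 by simp
  qed
  show "(\<integral>\<omega>. reflect_noise \<xi> \<phi> \<omega> * reflect_noise \<xi> \<psi> \<omega> \<partial>M) = (\<integral>z. \<phi> z * \<psi> z \<partial>lborel)"
    if "L2fun \<phi>" "L2fun \<psi>" for \<phi> \<psi>
  proof -
    have "(\<integral>\<omega>. reflect_noise \<xi> \<phi> \<omega> * reflect_noise \<xi> \<psi> \<omega> \<partial>M)
      = (\<integral>z. \<phi> (time_reflection z) * \<psi> (time_reflection z) \<partial>lborel)"
      using assms L2fun_time_reflection that unfolding white_noise_def reflect_noise_eq by blast
    also have "\<dots> = (\<integral>z. \<phi> z * \<psi> z \<partial>lborel)"
      using integral_time_reflection(1)[of "\<lambda>z. \<phi> z * \<psi> z"] L2funD(1)[OF that(1)] L2funD(1)[OF that(2)] by simp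
    finally show ?thesis .
  qed
qed

section \<open>The homogeneous solution by d'Alembert's formula\<close>

definition profile :: "(real \<Rightarrow> real) \<Rightarrow> (real \<Rightarrow> real) \<Rightarrow> real \<Rightarrow> real \<Rightarrow> real" where
  "profile u0 u1 t x = (u0 (x + t) + u0 (x - t)) / 2 + integral {x - t..x + t} u1 / 2"

lemma interval_integral_split:
  fixes f :: "real \<Rightarrow> real"
  assumes "continuous_on UNIV f" "c \<le> a" "a \<le> b"
  shows "integral {a..b} f = integral {c..b} f - integral {c..a} f"
proof -
  have "f integrable_on {c..b}"
    by (rule integrable_continuous_interval) (use assms in \<open>auto intro: continuous_on_subset\<close>)
  then show ?thesis using Henstock_Kurzweil_Integration.integral_combine[of c a b f] assms by simp
qed

text \<open>Both integrals are measured from a common left end, so that each endpoint can be moved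
  separately.\<close>

lemma interval_integral_lipschitz:
  fixes f :: "real \<Rightarrow> real"
  assumes f: "continuous_on UNIV f" "\<And>x. \<bar>f x\<bar> \<le> U" and "a \<le> b" "a' \<le> b'"
  shows "\<bar>integral {a..b} f - integral {a'..b'} f\<bar> \<le> U * (\<bar>a - a'\<bar> + \<bar>b - b'\<bar>)"
proof -
  have 1: "\<bar>integral {c..d} f - integral {c..d'} f\<bar> \<le> U * \<bar>d - d'\<bar>" if "c \<le> d" "d \<le> d'" for c d d'
  proof -
    have "integral {c..d'} f - integral {c..d} f = integral {d..d'} f"
      using interval_integral_split[OF f(1) that] by simp
    moreover have "\<bar>integral {d..d'} f\<bar> \<le> U * (d' - d)"
      using integral_bound[of d d' f U] that f by (auto intro: continuous_on_subset)
    ultimately show ?thesis using that by simp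
  qed
  have G: "\<bar>integral {c..d} f - integral {c..d'} f\<bar> \<le> U * \<bar>d - d'\<bar>" if "c \<le> d" "c \<le> d'" for c d d'
    using 1[of c d d'] 1[of c d' d] that by (cases "d \<le> d'") (auto simp: abs_minus_commute)
  define c where "c = min a a'"
  have c: "c \<le> a" "c \<le> a'" by (auto simp: c_def)
  have "integral {a..b} f = integral {c..b} f - integral {c..a} f"
    "integral {a'..b'} f = integral {c..b'} f - integral {c..a'} f"
    using interval_integral_split[OF f(1)] c assms(3,4) by auto
  then show ?thesis
    using G[of c b b'] G[of c a a'] c assms(3,4) by (simp add: distrib_left)
qed

lemma profile_regular:
  assumes u0: "C1b u0" and u1: "Cb u1"
  shows "\<exists>W. \<forall>t x. 0 \<le> t \<longrightarrow> t \<le> T \<longrightarrow> \<bar>profile u0 u1 t x\<bar> \<le> W"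
    and "\<exists>C. \<forall>t t' x x'. 0 \<le> t \<longrightarrow> 0 \<le> t' \<longrightarrow> \<bar>profile u0 u1 t x - profile u0 u1 t' x'\<bar> \<le> C * (\<bar>t - t'\<bar> + \<bar>x - x'\<bar>)"
proof -
  obtain d where d: "\<And>x. (u0 has_real_derivative d x) (at x)" "bounded (range u0)" "bounded (range d)"
    using u0 unfolding C1b_def by blast
  obtain U0 where U0: "\<And>x. \<bar>u0 x\<bar> \<le> U0" using d(2) unfolding bounded_real by auto
  obtain E where E: "\<And>x. \<bar>d x\<bar> \<le> E" using d(3) unfolding bounded_real by auto
  obtain U1 where U1: "\<And>x. \<bar>u1 x\<bar> \<le> U1" using u1 unfolding Cb_def bounded_real by auto
  have c1: "continuous_on UNIV u1" using u1 by (simp add: Cb_def)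
  have U10: "0 \<le> U1" using U1[of 0] by linarith
  have E0: "0 \<le> E" using E[of 0] by linarith
  have lip0: "\<bar>u0 a - u0 b\<bar> \<le> E * \<bar>a - b\<bar>" for a b
    using field_differentiable_bound[of UNIV u0 d E a b] d(1) E by auto
  have average: "\<bar>(a + b) / 2 + c / 2\<bar> \<le> U + r" if "\<bar>a\<bar> \<le> U" "\<bar>b\<bar> \<le> U" "\<bar>c\<bar> \<le> 2 * r" for a b c U r :: real
    using that unfolding abs_le_iff by argo
  show "\<exists>W. \<forall>t x. 0 \<le> t \<longrightarrow> t \<le> T \<longrightarrow> \<bar>profile u0 u1 t x\<bar> \<le> W"
  proof (intro exI allI impI)
    fix t x :: real assume t: "0 \<le> t" "t \<le> T"
    have "\<bar>integral {x - t..x + t} u1 - integral {x - t..x - t} u1\<bar> \<le> U1 * (\<bar>x - t - (x - t)\<bar> + \<bar>x + t - (x - t)\<bar>)"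
      by (rule interval_integral_lipschitz[OF c1 U1]) (use t in auto)
    then have "\<bar>integral {x - t..x + t} u1\<bar> \<le> U1 * (2 * t)" using t by simp
    also have "\<dots> \<le> U1 * (2 * T)" using t U10 by (intro mult_left_mono) auto
    also have "\<dots> = 2 * (U1 * T)" by simp
    finally show "\<bar>profile u0 u1 t x\<bar> \<le> U0 + U1 * T"
      unfolding profile_def by (rule average[OF U0 U0])
  qed
  show "\<exists>C. \<forall>t t' x x'. 0 \<le> t \<longrightarrow> 0 \<le> t' \<longrightarrow> \<bar>profile u0 u1 t x - profile u0 u1 t' x'\<bar> \<le> C * (\<bar>t - t'\<bar> + \<bar>x - x'\<bar>)"
  proof (intro exI allI impI)
    fix t t' x x' :: real assume t: "0 \<le> t" "0 \<le> t'"
    let ?r = "\<bar>t - t'\<bar> + \<bar>x - x'\<bar>"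
    have "\<bar>u0 (x + t) - u0 (x' + t')\<bar> \<le> E * \<bar>(x + t) - (x' + t')\<bar>" by (rule lip0)
    also have "\<dots> \<le> E * ?r" by (intro mult_left_mono E0) linarith
    finally have a: "\<bar>u0 (x + t) - u0 (x' + t')\<bar> \<le> E * ?r" .
    have "\<bar>u0 (x - t) - u0 (x' - t')\<bar> \<le> E * \<bar>(x - t) - (x' - t')\<bar>" by (rule lip0)
    also have "\<dots> \<le> E * ?r" by (intro mult_left_mono E0) linarith
    finally have b: "\<bar>u0 (x - t) - u0 (x' - t')\<bar> \<le> E * ?r" .
    have "\<bar>integral {x - t..x + t} u1 - integral {x' - t'..x' + t'} u1\<bar> \<le> U1 * (\<bar>x - t - (x' - t')\<bar> + \<bar>x + t - (x' + t')\<bar>)"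
      by (rule interval_integral_lipschitz[OF c1 U1]) (use t in auto)
    also have "\<dots> \<le> U1 * (2 * ?r)"
    proof (intro mult_left_mono U10)
      have "\<bar>x - t - (x' - t')\<bar> \<le> ?r" "\<bar>x + t - (x' + t')\<bar> \<le> ?r" by linarith+
      then show "\<bar>x - t - (x' - t')\<bar> + \<bar>x + t - (x' + t')\<bar> \<le> 2 * ?r"
        unfolding mult_2 by (rule add_mono)
    qed
    also have "\<dots> = 2 * (U1 * ?r)" by simp
    finally have c: "\<bar>integral {x - t..x + t} u1 - integral {x' - t'..x' + t'} u1\<bar> \<le> 2 * (U1 * ?r)" .
    have "profile u0 u1 t x - profile u0 u1 t' x' = (u0 (x + t) - u0 (x' + t') + (u0 (x - t) - u0 (x' - t'))) / 2
       + (integral {x - t..x + t} u1 - integral {x' - t'..x' + t'} u1) / 2"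
      unfolding profile_def by argo
    then show "\<bar>profile u0 u1 t x - profile u0 u1 t' x'\<bar> \<le> (E + U1) * ?r"
      unfolding distrib_right[of E] using average[OF a b c] by simp
  qed
qed

text \<open>The homogeneous solution is a function of \<open>x + t\<close> plus a function of
  \<open>x - t\<close>, and each of these cancels over the corners of a characteristic diamond. The
  primitive of \<open>u1\<close> is taken from \<open>c\<close>, the smallest endpoint that
  occurs.\<close>

lemma profile_diamond:
  assumes u1: "continuous_on UNIV u1" and "0 \<le> t" "0 \<le> \<epsilon>"
  shows "profile u0 u1 (t + 2 * \<epsilon>) x - profile u0 u1 (t + \<epsilon>) (x - \<epsilon>) - profile u0 u1 (t + \<epsilon>) (x + \<epsilon>)
    + profile u0 u1 t x = 0"
proof -
  define c where "c = x - t - 2 * \<epsilon>"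
  have s: "integral {a..b} u1 = integral {c..b} u1 - integral {c..a} u1" if "c \<le> a" "a \<le> b" for a b
    by (rule interval_integral_split[OF u1 that])
  have e: "x + (t + 2 * \<epsilon>) = x + t + 2 * \<epsilon>" "x - (t + 2 * \<epsilon>) = c" "x - \<epsilon> + (t + \<epsilon>) = x + t"
    "x - \<epsilon> - (t + \<epsilon>) = c" "x + \<epsilon> + (t + \<epsilon>) = x + t + 2 * \<epsilon>" "x + \<epsilon> - (t + \<epsilon>) = x - t"
    by (simp_all add: c_def)
  have "integral {x - t..x + t} u1 = integral {c..x + t} u1 - integral {c..x - t} u1"
    "integral {x - t..x + t + 2 * \<epsilon>} u1 = integral {c..x + t + 2 * \<epsilon>} u1 - integral {c..x - t} u1"
    by (rule s; use assms in \<open>simp add: c_def\<close>)+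
  then show ?thesis unfolding profile_def e by (simp add: add_divide_distrib diff_divide_distrib)
qed

lemma profile_zero: "profile (\<lambda>_. 0) (\<lambda>_. 0) t x = 0"
  by (simp add: profile_def)

lemma mild_solution_fwd_iff:
  "mild_solution_fwd M \<xi> F u0 u1 v \<longleftrightarrow> (\<forall>t\<ge>0. \<forall>x. v t x \<in> borel_measurable M \<and>
     (\<exists>I. walsh_integral M \<xi> (\<lambda>z \<omega>. wave_kernel t x z * F (v (fst z) (snd z) \<omega>)) I
       \<and> (AE \<omega> in M. v t x \<omega> = profile u0 u1 t x + I \<omega>)))"
  unfolding mild_solution_fwd_def profile_def wave_kernel_def by (simp add: case_prod_beta')

section \<open>Diamonds and triangles at nonnegative times\<close>

locale wave_pair = gaussian_noise +
  fixes F u0 u1 :: "real \<Rightarrow> real" and K :: real and v Z :: "real \<Rightarrow> real \<Rightarrow> 'a \<Rightarrow> real"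
  assumes F_lipschitz: "\<bar>F a - F b\<bar> \<le> K * \<bar>a - b\<bar>"
    and u0: "C1b u0" and u1: "Cb u1"
    and v: "mild_solution_fwd M \<xi> F u0 u1 v"
    and Z: "mild_solution_fwd M \<xi> (\<lambda>_. 1) (\<lambda>_. 0) (\<lambda>_. 0) Z"

sublocale wave_pair \<subseteq> wave_field M \<xi> F v "profile u0 u1" K
  using F_lipschitz v profile_regular[OF u0 u1] by unfold_locales (simp_all add: mild_solution_fwd_iff)

context wave_pair
begin

lemma Z_measurable: "0 \<le> t \<Longrightarrow> Z t x \<in> borel_measurable M"
  using Z by (simp add: mild_solution_fwd_iff)

lemma Z_mild: "0 \<le> t \<Longrightarrow> \<exists>J. walsh_integral M \<xi> (\<lambda>z \<omega>. wave_kernel t x z * 1) J \<and> (AE \<omega> in M. Z t x \<omega> = J \<omega>)"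
  using Z by (simp add: mild_solution_fwd_iff profile_zero)

lemma walsh_integral_zero:
  assumes "walsh_integral M \<xi> H I" "\<And>z \<omega>. H z \<omega> = 0"
  shows "AE \<omega> in M. I \<omega> = 0"
proof -
  have [measurable]: "I \<in> borel_measurable M" using assms(1) by (simp add: walsh_integral_iff)
  have "(\<integral>\<^sup>+\<omega>. ennreal ((I \<omega>) ^ (2 * 0 + 2)) \<partial>M) \<le> ennreal (walsh_const 0 * 1 ^ 0)
      * (\<integral>\<^sup>+z. \<integral>\<^sup>+\<omega>. ennreal ((H z \<omega>) ^ (2 * 0 + 2)) \<partial>M \<partial>lborel)"
    by (rule walsh_moment_power[OF assms(1), of "{}"]) (auto simp: assms(2))
  then have "(\<integral>\<^sup>+\<omega>. ennreal ((I \<omega>)\<^sup>2) \<partial>M) = 0" by (simp add: assms(2) power2_eq_square)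
  then have "AE \<omega> in M. ennreal ((I \<omega>)\<^sup>2) = 0" by (subst (asm) nn_integral_0_iff_AE) auto
  then show ?thesis by eventually_elim simp
qed

text \<open>At time 0 the kernel vanishes, but the mild equation still contains a random variable
  that represents its integral; that variable is known to be 0 only almost everywhere.\<close>

lemma initial_values:
  "AE \<omega> in M. v 0 x \<omega> = u0 x" "AE \<omega> in M. Z 0 x \<omega> = 0"
proof -
  have k: "wave_kernel 0 x z = 0" for z by (cases z) (simp add: wave_kernel_eq)
  obtain I where I: "walsh_integral M \<xi> (\<lambda>z \<omega>. wave_kernel 0 x z * F (v (fst z) (snd z) \<omega>)) I"
    "AE \<omega> in M. v 0 x \<omega> = profile u0 u1 0 x + I \<omega>" using mild[of 0 x] by auto
  have "AE \<omega> in M. I \<omega> = 0" by (rule walsh_integral_zero[OF I(1)]) (simp add: k)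
  then show "AE \<omega> in M. v 0 x \<omega> = u0 x" using I(2) by eventually_elim (simp add: profile_def)
  obtain J where J: "walsh_integral M \<xi> (\<lambda>z \<omega>. wave_kernel 0 x z * 1) J" "AE \<omega> in M. Z 0 x \<omega> = J \<omega>"
    using Z_mild[of 0 x] by auto
  have "AE \<omega> in M. J \<omega> = 0" by (rule walsh_integral_zero[OF J(1)]) (simp add: k)
  then show "AE \<omega> in M. Z 0 x \<omega> = 0" using J(2) by eventually_elim simp
qed

text \<open>For nonnegative \<open>t\<close> and positive \<epsilon> this is, up to boundary points,
  half the indicator of the diamond with lowest corner \<open>(t, x)\<close> and highest corner
  \<open>(t + 2 * \<epsilon>, x)\<close>: in characteristic coordinates the four quadrants combine
  to a product of two interval indicators.\<close>

definition diamond_kernel :: "real \<Rightarrow> real \<Rightarrow> real \<Rightarrow> real \<times> real \<Rightarrow> real" where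
  "diamond_kernel \<epsilon> t x z = wave_kernel (t + 2 * \<epsilon>) x z - wave_kernel (t + \<epsilon>) (x - \<epsilon>) z
     - wave_kernel (t + \<epsilon>) (x + \<epsilon>) z + wave_kernel t x z"

lemma diamond_kernel_bound: "0 < \<epsilon> \<Longrightarrow> \<bar>diamond_kernel \<epsilon> t x z\<bar> \<le> 1"
  by (cases z) (auto simp: diamond_kernel_def wave_kernel_eq)

lemma diamond_kernel_support:
  assumes "0 < \<epsilon>" "diamond_kernel \<epsilon> t x z \<noteq> 0"
  shows "t \<le> fst z \<and> fst z \<le> t + 2 * \<epsilon> \<and> \<bar>snd z - x\<bar> \<le> 2 * \<epsilon>"
  using assms by (cases z) (auto simp: diamond_kernel_def wave_kernel_eq split: if_splits)

lemma walsh_diamond: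
  assumes "walsh_integral M \<xi> (\<lambda>z \<omega>. wave_kernel (t + 2 * \<epsilon>) x z * g z \<omega>) I1"
    "walsh_integral M \<xi> (\<lambda>z \<omega>. wave_kernel (t + \<epsilon>) (x - \<epsilon>) z * g z \<omega>) I2"
    "walsh_integral M \<xi> (\<lambda>z \<omega>. wave_kernel (t + \<epsilon>) (x + \<epsilon>) z * g z \<omega>) I3"
    "walsh_integral M \<xi> (\<lambda>z \<omega>. wave_kernel t x z * g z \<omega>) I4"
  shows "walsh_integral M \<xi> (\<lambda>z \<omega>. diamond_kernel \<epsilon> t x z * g z \<omega>) (\<lambda>\<omega>. I1 \<omega> - I2 \<omega> - I3 \<omega> + I4 \<omega>)"
  using walsh_lincomb[OF walsh_lincomb[OF assms(1,2), of 1 "- 1"] walsh_lincomb[OF assms(3,4), of "- 1" 1], of 1 1]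
  by (simp add: diamond_kernel_def algebra_simps)

text \<open>The lowest corner \<open>(t, y)\<close> is kept apart from the reference point
  \<open>(\<tau>, x)\<close>, since the latter will be the lowest, a lateral or the highest corner
  of the diamond, according to the increment and the direction of time.\<close>

lemma diamond_moment:
  assumes \<tau>: "0 \<le> \<tau>"
  shows "\<exists>C\<ge>0. \<forall>t y \<epsilon>. 0 \<le> t \<longrightarrow> t \<le> \<tau> \<longrightarrow> \<tau> - t \<le> 2 * \<epsilon> \<longrightarrow> \<bar>y - x\<bar> \<le> \<epsilon> \<longrightarrow> 0 < \<epsilon> \<longrightarrow> 4 * \<epsilon> \<le> 1 \<longrightarrow>
    (\<integral>\<^sup>+\<omega>. ennreal ((delta2 \<epsilon> (\<lambda>s y. v s y \<omega>) t y - F (v \<tau> x \<omega>) * delta2 \<epsilon> (\<lambda>s y. Z s y \<omega>) t y) ^ (2 * q + 2)) \<partial>M)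
      \<le> ennreal (C * (\<epsilon> ^ (q + 1)) ^ 3)"
proof -
  \<comment> \<open>With \<epsilon> at most \<open>1 / 4\<close>, the margin 3 keeps a box around
    every such diamond inside the cone.\<close>
  have "0 \<le> \<tau> + 3" using \<tau> by simp
  from frozen_coefficient_moment[OF this, of x q] obtain C where C: "0 \<le> C"
    "\<And>t0 x0 t' x' \<epsilon> k I J. 0 \<le> t0 \<Longrightarrow> 0 < \<epsilon> \<Longrightarrow> 4 * \<epsilon> \<le> 1 \<Longrightarrow>
     (\<forall>s y. t0 \<le> s \<longrightarrow> s \<le> t0 + 2 * \<epsilon> \<longrightarrow> \<bar>y - x0\<bar> \<le> 2 * \<epsilon> \<longrightarrow> (s, y) \<in> past_cone (\<tau> + 3) x) \<Longrightarrow>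
     (t', x') \<in> past_cone (\<tau> + 3) x \<Longrightarrow> \<bar>t' - t0\<bar> + \<bar>x' - x0\<bar> \<le> 4 * \<epsilon> \<Longrightarrow>
     (\<forall>z. \<bar>k z\<bar> \<le> 1) \<Longrightarrow>
     (\<forall>z. k z \<noteq> 0 \<longrightarrow> t0 \<le> fst z \<and> fst z \<le> t0 + 2 * \<epsilon> \<and> \<bar>snd z - x0\<bar> \<le> 2 * \<epsilon>) \<Longrightarrow>
     walsh_integral M \<xi> (\<lambda>z \<omega>. k z * F (v (fst z) (snd z) \<omega>)) I \<Longrightarrow>
     walsh_integral M \<xi> (\<lambda>z \<omega>. k z * 1) J \<Longrightarrow>
     (\<integral>\<^sup>+\<omega>. ennreal ((I \<omega> - F (v t' x' \<omega>) * J \<omega>) ^ (2 * q + 2)) \<partial>M) \<le> ennreal (C * (\<epsilon> ^ (q + 1)) ^ 3)"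
    by blast
  have "(\<integral>\<^sup>+\<omega>. ennreal ((delta2 \<epsilon> (\<lambda>s y. v s y \<omega>) t y - F (v \<tau> x \<omega>) * delta2 \<epsilon> (\<lambda>s y. Z s y \<omega>) t y) ^ (2 * q + 2)) \<partial>M)
      \<le> ennreal (C * (\<epsilon> ^ (q + 1)) ^ 3)"
    if t: "0 \<le> t" "t \<le> \<tau>" "\<tau> - t \<le> 2 * \<epsilon>" and y: "\<bar>y - x\<bar> \<le> \<epsilon>" and \<epsilon>: "0 < \<epsilon>" "4 * \<epsilon> \<le> 1" for t y \<epsilon>
  proof -
    have pos: "0 \<le> t + 2 * \<epsilon>" "0 \<le> t + \<epsilon>" using t \<epsilon> by auto
    obtain I1 where I1: "walsh_integral M \<xi> (\<lambda>z \<omega>. wave_kernel (t + 2 * \<epsilon>) y z * F (v (fst z) (snd z) \<omega>)) I1"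
      "AE \<omega> in M. v (t + 2 * \<epsilon>) y \<omega> = profile u0 u1 (t + 2 * \<epsilon>) y + I1 \<omega>" using mild[OF pos(1)] by blast
    obtain I2 where I2: "walsh_integral M \<xi> (\<lambda>z \<omega>. wave_kernel (t + \<epsilon>) (y - \<epsilon>) z * F (v (fst z) (snd z) \<omega>)) I2"
      "AE \<omega> in M. v (t + \<epsilon>) (y - \<epsilon>) \<omega> = profile u0 u1 (t + \<epsilon>) (y - \<epsilon>) + I2 \<omega>" using mild[OF pos(2)] by blast
    obtain I3 where I3: "walsh_integral M \<xi> (\<lambda>z \<omega>. wave_kernel (t + \<epsilon>) (y + \<epsilon>) z * F (v (fst z) (snd z) \<omega>)) I3"
      "AE \<omega> in M. v (t + \<epsilon>) (y + \<epsilon>) \<omega> = profile u0 u1 (t + \<epsilon>) (y + \<epsilon>) + I3 \<omega>" using mild[OF pos(2)] by blast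
    obtain I4 where I4: "walsh_integral M \<xi> (\<lambda>z \<omega>. wave_kernel t y z * F (v (fst z) (snd z) \<omega>)) I4"
      "AE \<omega> in M. v t y \<omega> = profile u0 u1 t y + I4 \<omega>" using mild[OF t(1)] by blast
    obtain J1 where J1: "walsh_integral M \<xi> (\<lambda>z \<omega>. wave_kernel (t + 2 * \<epsilon>) y z * 1) J1"
      "AE \<omega> in M. Z (t + 2 * \<epsilon>) y \<omega> = J1 \<omega>" using Z_mild[OF pos(1)] by blast
    obtain J2 where J2: "walsh_integral M \<xi> (\<lambda>z \<omega>. wave_kernel (t + \<epsilon>) (y - \<epsilon>) z * 1) J2"
      "AE \<omega> in M. Z (t + \<epsilon>) (y - \<epsilon>) \<omega> = J2 \<omega>" using Z_mild[OF pos(2)] by blast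
    obtain J3 where J3: "walsh_integral M \<xi> (\<lambda>z \<omega>. wave_kernel (t + \<epsilon>) (y + \<epsilon>) z * 1) J3"
      "AE \<omega> in M. Z (t + \<epsilon>) (y + \<epsilon>) \<omega> = J3 \<omega>" using Z_mild[OF pos(2)] by blast
    obtain J4 where J4: "walsh_integral M \<xi> (\<lambda>z \<omega>. wave_kernel t y z * 1) J4"
      "AE \<omega> in M. Z t y \<omega> = J4 \<omega>" using Z_mild[OF t(1)] by blast
    let ?I = "\<lambda>\<omega>. I1 \<omega> - I2 \<omega> - I3 \<omega> + I4 \<omega>" and ?J = "\<lambda>\<omega>. J1 \<omega> - J2 \<omega> - J3 \<omega> + J4 \<omega>"
    have c1: "continuous_on UNIV u1" using u1 by (simp add: Cb_def)
    have "(\<integral>\<^sup>+\<omega>. ennreal ((delta2 \<epsilon> (\<lambda>s y. v s y \<omega>) t y - F (v \<tau> x \<omega>) * delta2 \<epsilon> (\<lambda>s y. Z s y \<omega>) t y) ^ (2 * q + 2)) \<partial>M)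
       = (\<integral>\<^sup>+\<omega>. ennreal ((?I \<omega> - F (v \<tau> x \<omega>) * ?J \<omega>) ^ (2 * q + 2)) \<partial>M)"
    proof (rule nn_integral_cong_AE)
      show "AE \<omega> in M. ennreal ((delta2 \<epsilon> (\<lambda>s y. v s y \<omega>) t y - F (v \<tau> x \<omega>) * delta2 \<epsilon> (\<lambda>s y. Z s y \<omega>) t y) ^ (2 * q + 2))
         = ennreal ((?I \<omega> - F (v \<tau> x \<omega>) * ?J \<omega>) ^ (2 * q + 2))"
        using I1(2) I2(2) I3(2) I4(2) J1(2) J2(2) J3(2) J4(2)
      proof eventually_elim
        case (elim \<omega>)
        have "delta2 \<epsilon> (\<lambda>s y. v s y \<omega>) t y = ?I \<omega>"
          unfolding delta2_def elim using profile_diamond[OF c1 t(1), of \<epsilon> u0 y] \<epsilon>(1) by linarith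
        moreover have "delta2 \<epsilon> (\<lambda>s y. Z s y \<omega>) t y = ?J \<omega>" unfolding delta2_def elim ..
        ultimately show ?case by simp
      qed
    qed
    also have "\<dots> \<le> ennreal (C * (\<epsilon> ^ (q + 1)) ^ 3)"
    proof (rule C(2)[of t \<epsilon> y \<tau> x "diamond_kernel \<epsilon> t y" ?I ?J])
      show "walsh_integral M \<xi> (\<lambda>z \<omega>. diamond_kernel \<epsilon> t y z * F (v (fst z) (snd z) \<omega>)) ?I"
        by (rule walsh_diamond[OF I1(1) I2(1) I3(1) I4(1)])
      show "walsh_integral M \<xi> (\<lambda>z \<omega>. diamond_kernel \<epsilon> t y z * 1) ?J"
        by (rule walsh_diamond[OF J1(1) J2(1) J3(1) J4(1)])
    qed (use t y \<epsilon> diamond_kernel_bound diamond_kernel_support in \<open>auto simp: past_cone_def\<close>)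
    finally show ?thesis .
  qed
  with C(1) show ?thesis by blast
qed

text \<open>At the point \<open>(\<epsilon>, y)\<close> the support of the whole kernel is a
  triangle resting on time 0. With the data removed, the field there is the contribution of half a
  diamond.\<close>

lemma triangle_moment:
  "\<exists>C\<ge>0. \<forall>y \<epsilon>. \<bar>y - x\<bar> \<le> \<epsilon> \<longrightarrow> 0 < \<epsilon> \<longrightarrow> 4 * \<epsilon> \<le> 1 \<longrightarrow>
    (\<integral>\<^sup>+\<omega>. ennreal (((v \<epsilon> y \<omega> - profile u0 u1 \<epsilon> y) - F (v 0 x \<omega>) * Z \<epsilon> y \<omega>) ^ (2 * q + 2)) \<partial>M)
      \<le> ennreal (C * (\<epsilon> ^ (q + 1)) ^ 3)"
proof -
  have "0 \<le> (3 :: real)" by simp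
  from frozen_coefficient_moment[OF this, of x q] obtain C where C: "0 \<le> C"
    "\<And>t0 x0 t' x' \<epsilon> k I J. 0 \<le> t0 \<Longrightarrow> 0 < \<epsilon> \<Longrightarrow> 4 * \<epsilon> \<le> 1 \<Longrightarrow>
     (\<forall>s y. t0 \<le> s \<longrightarrow> s \<le> t0 + 2 * \<epsilon> \<longrightarrow> \<bar>y - x0\<bar> \<le> 2 * \<epsilon> \<longrightarrow> (s, y) \<in> past_cone 3 x) \<Longrightarrow>
     (t', x') \<in> past_cone 3 x \<Longrightarrow> \<bar>t' - t0\<bar> + \<bar>x' - x0\<bar> \<le> 4 * \<epsilon> \<Longrightarrow>
     (\<forall>z. \<bar>k z\<bar> \<le> 1) \<Longrightarrow>
     (\<forall>z. k z \<noteq> 0 \<longrightarrow> t0 \<le> fst z \<and> fst z \<le> t0 + 2 * \<epsilon> \<and> \<bar>snd z - x0\<bar> \<le> 2 * \<epsilon>) \<Longrightarrow>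
     walsh_integral M \<xi> (\<lambda>z \<omega>. k z * F (v (fst z) (snd z) \<omega>)) I \<Longrightarrow>
     walsh_integral M \<xi> (\<lambda>z \<omega>. k z * 1) J \<Longrightarrow>
     (\<integral>\<^sup>+\<omega>. ennreal ((I \<omega> - F (v t' x' \<omega>) * J \<omega>) ^ (2 * q + 2)) \<partial>M) \<le> ennreal (C * (\<epsilon> ^ (q + 1)) ^ 3)"
    by blast
  have "(\<integral>\<^sup>+\<omega>. ennreal (((v \<epsilon> y \<omega> - profile u0 u1 \<epsilon> y) - F (v 0 x \<omega>) * Z \<epsilon> y \<omega>) ^ (2 * q + 2)) \<partial>M)
      \<le> ennreal (C * (\<epsilon> ^ (q + 1)) ^ 3)"
    if y: "\<bar>y - x\<bar> \<le> \<epsilon>" and \<epsilon>: "0 < \<epsilon>" "4 * \<epsilon> \<le> 1" for y \<epsilon>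
  proof -
    obtain I where I: "walsh_integral M \<xi> (\<lambda>z \<omega>. wave_kernel \<epsilon> y z * F (v (fst z) (snd z) \<omega>)) I"
      "AE \<omega> in M. v \<epsilon> y \<omega> = profile u0 u1 \<epsilon> y + I \<omega>" using mild[of \<epsilon> y] \<epsilon> by auto
    obtain J where J: "walsh_integral M \<xi> (\<lambda>z \<omega>. wave_kernel \<epsilon> y z * 1) J"
      "AE \<omega> in M. Z \<epsilon> y \<omega> = J \<omega>" using Z_mild[of \<epsilon> y] \<epsilon> by auto
    have "(\<integral>\<^sup>+\<omega>. ennreal (((v \<epsilon> y \<omega> - profile u0 u1 \<epsilon> y) - F (v 0 x \<omega>) * Z \<epsilon> y \<omega>) ^ (2 * q + 2)) \<partial>M)
      = (\<integral>\<^sup>+\<omega>. ennreal ((I \<omega> - F (v 0 x \<omega>) * J \<omega>) ^ (2 * q + 2)) \<partial>M)"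
    proof (rule nn_integral_cong_AE)
      show "AE \<omega> in M. ennreal (((v \<epsilon> y \<omega> - profile u0 u1 \<epsilon> y) - F (v 0 x \<omega>) * Z \<epsilon> y \<omega>) ^ (2 * q + 2))
        = ennreal ((I \<omega> - F (v 0 x \<omega>) * J \<omega>) ^ (2 * q + 2))"
        using I(2) J(2) by eventually_elim (simp del: power_Suc power_add)
    qed
    also have "\<dots> \<le> ennreal (C * (\<epsilon> ^ (q + 1)) ^ 3)"
    proof (rule C(2)[of 0 \<epsilon> y 0 x "wave_kernel \<epsilon> y" I J])
      show "\<forall>z. \<bar>wave_kernel \<epsilon> y z\<bar> \<le> 1"
      proof
        show "\<bar>wave_kernel \<epsilon> y z\<bar> \<le> 1" for z using wave_kernel_bounds[of \<epsilon> y z] by linarith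
      qed
      show "\<forall>z. wave_kernel \<epsilon> y z \<noteq> 0 \<longrightarrow> 0 \<le> fst z \<and> fst z \<le> 0 + 2 * \<epsilon> \<and> \<bar>snd z - y\<bar> \<le> 2 * \<epsilon>"
      proof (intro allI impI)
        fix z assume "wave_kernel \<epsilon> y z \<noteq> 0"
        from wave_kernel_support[OF this] show "0 \<le> fst z \<and> fst z \<le> 0 + 2 * \<epsilon> \<and> \<bar>snd z - y\<bar> \<le> 2 * \<epsilon>"
          by auto
      qed
    qed (use y \<epsilon> I(1) J(1) in \<open>auto simp: past_cone_def\<close>)
    finally show ?thesis .
  qed
  with C(1) show ?thesis by blast
qed

end

text \<open>Measured in the unit \<open>\<delta> = \<epsilon> powr (3 / 2)\<close>, the power
  \<open>p\<close> of a variable is at most 1 plus its power \<open>2 * q + 2\<close>. This gives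
  integrability and the norm bound together; the root of order \<open>p\<close> of
  \<open>1 + C\<close> is at most \<open>1 + C\<close>.\<close>

lemma (in prob_space) lp_norm_le_of_moment:
  assumes [measurable]: "D \<in> borel_measurable M" and p: "2 \<le> p" "p \<le> real (2 * q + 2)"
    and \<epsilon>: "0 < \<epsilon>" and C: "0 \<le> C"
    and le: "(\<integral>\<^sup>+\<omega>. ennreal ((D \<omega>) ^ (2 * q + 2)) \<partial>M) \<le> ennreal (C * (\<epsilon> ^ (q + 1)) ^ 3)"
  shows "integrable M (\<lambda>\<omega>. \<bar>D \<omega>\<bar> powr p)" and "lp_norm M p D \<le> (1 + C) * \<epsilon> powr (3 / 2)"
proof -
  let ?n = "2 * q + 2"
  define \<delta> where "\<delta> = \<epsilon> powr (3 / 2)"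
  have \<delta>: "0 < \<delta>" using \<epsilon> by (simp add: \<delta>_def)
  have \<delta>n: "\<delta> ^ ?n = (\<epsilon> ^ (q + 1)) ^ 3"
  proof -
    have "\<delta> ^ 2 = \<epsilon> ^ 3"
    proof -
      have "\<delta> ^ 2 = \<epsilon> powr 3"
        unfolding \<delta>_def power2_eq_square by (simp add: powr_add [symmetric])
      also have "\<dots> = \<epsilon> ^ 3" using \<epsilon> by simp
      finally show ?thesis .
    qed
    moreover have "?n = 2 * (q + 1)" by simp
    ultimately have "\<delta> ^ ?n = (\<epsilon> ^ 3) ^ (q + 1)" by (simp only: power_mult)
    then show ?thesis by (simp only: power_mult [symmetric] mult.commute)
  qed
  have ev: "0 \<le> y ^ ?n" for y :: real by (rule zero_le_even_power) simp
  have ev': "\<bar>y\<bar> ^ ?n = y ^ ?n" for y :: real by (rule power_even_abs) simp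
  have "(\<integral>\<^sup>+\<omega>. ennreal ((D \<omega>) ^ ?n) \<partial>M) < \<infinity>"
    using le by (rule order_le_less_trans) simp
  then have int: "integrable M (\<lambda>\<omega>. (D \<omega>) ^ ?n)"
    by (intro integrableI_nonneg AE_I2 ev borel_measurable_power assms(1))
  have moment: "(\<integral>\<omega>. (D \<omega>) ^ ?n \<partial>M) \<le> C * \<delta> ^ ?n"
  proof -
    have "ennreal (\<integral>\<omega>. (D \<omega>) ^ ?n \<partial>M) \<le> ennreal (C * \<delta> ^ ?n)"
      using le unfolding \<delta>n nn_integral_eq_integral[OF int AE_I2[OF ev]] .
    then show ?thesis using C \<delta> by (subst (asm) ennreal_le_iff) auto
  qed
  have pw: "\<bar>y\<bar> powr p \<le> \<delta> powr p * (1 + y ^ ?n / \<delta> ^ ?n)" for y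
  proof -
    let ?a = "\<bar>y\<bar> / \<delta>"
    have a0: "0 \<le> ?a" using \<delta> by simp
    have "?a powr p \<le> 1 + ?a ^ ?n"
    proof (cases "?a \<le> 1")
      case True
      then have "?a powr p \<le> 1" using a0 p by (intro powr_le1) auto
      then show ?thesis using a0 by (simp add: add_increasing2 del: power_Suc power_add)
    next
      case False
      then have "?a powr p \<le> ?a powr real ?n" using p by (intro powr_mono) auto
      also have "\<dots> = ?a ^ ?n" using False by (intro powr_realpow) linarith
      finally show ?thesis by simp
    qed
    also have "?a ^ ?n = y ^ ?n / \<delta> ^ ?n" by (simp only: power_divide ev')
    finally have "\<delta> powr p * ?a powr p \<le> \<delta> powr p * (1 + y ^ ?n / \<delta> ^ ?n)" by (rule mult_left_mono) simp
    moreover have "\<delta> powr p * ?a powr p = \<bar>y\<bar> powr p" using \<delta> by (simp add: powr_mult [symmetric])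
    ultimately show ?thesis by simp
  qed
  have int2: "integrable M (\<lambda>\<omega>. \<delta> powr p * (1 + (D \<omega>) ^ ?n / \<delta> ^ ?n))"
    using int by (auto simp del: power_Suc power_add)
  show intp: "integrable M (\<lambda>\<omega>. \<bar>D \<omega>\<bar> powr p)"
  proof (rule Bochner_Integration.integrable_bound[OF int2])
    show "AE \<omega> in M. norm (\<bar>D \<omega>\<bar> powr p) \<le> norm (\<delta> powr p * (1 + (D \<omega>) ^ ?n / \<delta> ^ ?n))"
      using pw by (auto intro!: AE_I2 order_trans[OF _ abs_ge_self] simp del: power_Suc power_add)
  qed measurable
  have "(\<integral>\<omega>. \<bar>D \<omega>\<bar> powr p \<partial>M) \<le> (\<integral>\<omega>. \<delta> powr p * (1 + (D \<omega>) ^ ?n / \<delta> ^ ?n) \<partial>M)"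
    by (rule integral_mono[OF intp int2 pw])
  also have "\<dots> = \<delta> powr p * (1 + (\<integral>\<omega>. (D \<omega>) ^ ?n \<partial>M) / \<delta> ^ ?n)"
    using int by (simp add: prob_space del: power_Suc power_add)
  also have "\<dots> \<le> \<delta> powr p * (1 + C)"
    using moment \<delta> by (intro mult_left_mono add_left_mono) (auto simp: pos_divide_le_eq simp del: power_Suc power_add)
  finally have "(\<integral>\<omega>. \<bar>D \<omega>\<bar> powr p \<partial>M) \<le> \<delta> powr p * (1 + C)" .
  then have "lp_norm M p D \<le> (\<delta> powr p * (1 + C)) powr (1 / p)"
    unfolding lp_norm_def using p by (intro powr_mono2) (auto intro!: Bochner_Integration.integral_nonneg)
  also have "\<dots> = \<delta> * (1 + C) powr (1 / p)"
    using \<delta> C p by (simp add: powr_mult powr_powr)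
  also have "\<dots> \<le> \<delta> * (1 + C) powr 1"
    using \<delta> C p by (intro mult_left_mono powr_mono) auto
  finally show "lp_norm M p D \<le> (1 + C) * \<epsilon> powr (3 / 2)"
    using C by (simp add: \<delta>_def mult.commute)
qed

section \<open>Both directions of time\<close>

lemma wave_pair_intro:
  assumes "white_noise M \<xi>" "\<And>a b. \<bar>F a - F b\<bar> \<le> K * \<bar>a - b\<bar>" "C1b u0" "Cb u1"
    "mild_solution_fwd M \<xi> F u0 u1 v" "mild_solution_fwd M \<xi> (\<lambda>_. 1) (\<lambda>_. 0) (\<lambda>_. 0) Z"
  shows "wave_pair M \<xi> F u0 u1 K v Z"
  using assms by unfold_locales

text \<open>At time \<open>0\<close> the diamond of \<open>delta1\<close> splits into a forward and a backward triangle. The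
  data contribute \<open>u0 (x + 2 * \<epsilon>) + u0 x\<close> to the two tips together, the value at the other two
  corners.\<close>

lemma time_zero_moment:
  assumes P: "wave_pair M \<xi> F u0 u1 K u Z"
    and P': "wave_pair M (reflect_noise \<xi>) F u0 (\<lambda>x. - u1 x) K (\<lambda>t x. u (- t) x) (\<lambda>t x. Z (- t) x)"
  shows "\<exists>C\<ge>0. \<forall>\<epsilon>. 0 < \<epsilon> \<longrightarrow> 4 * \<epsilon> \<le> 1 \<longrightarrow>
    (\<integral>\<^sup>+\<omega>. ennreal ((delta1 \<epsilon> (\<lambda>s y. u s y \<omega>) 0 x - F (u 0 x \<omega>) * delta1 \<epsilon> (\<lambda>s y. Z s y \<omega>) 0 x) ^ (2 * q + 2)) \<partial>M)
      \<le> ennreal (C * (\<epsilon> ^ (q + 1)) ^ 3)"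
proof -
  interpret P: wave_pair M \<xi> F u0 u1 K u Z by (rule P)
  interpret P': wave_pair M "reflect_noise \<xi>" F u0 "\<lambda>x. - u1 x" K "\<lambda>t x. u (- t) x" "\<lambda>t x. Z (- t) x" by (rule P')
  obtain C1 where C1: "0 \<le> C1" "\<And>y \<epsilon>. \<bar>y - x\<bar> \<le> \<epsilon> \<Longrightarrow> 0 < \<epsilon> \<Longrightarrow> 4 * \<epsilon> \<le> 1 \<Longrightarrow>
    (\<integral>\<^sup>+\<omega>. ennreal (((u \<epsilon> y \<omega> - profile u0 u1 \<epsilon> y) - F (u 0 x \<omega>) * Z \<epsilon> y \<omega>) ^ (2 * q + 2)) \<partial>M)
      \<le> ennreal (C1 * (\<epsilon> ^ (q + 1)) ^ 3)"
    using P.triangle_moment[of x q] by blast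
  obtain C2 where C2: "0 \<le> C2" "\<And>y \<epsilon>. \<bar>y - x\<bar> \<le> \<epsilon> \<Longrightarrow> 0 < \<epsilon> \<Longrightarrow> 4 * \<epsilon> \<le> 1 \<Longrightarrow>
    (\<integral>\<^sup>+\<omega>. ennreal (((u (- \<epsilon>) y \<omega> - profile u0 (\<lambda>x. - u1 x) \<epsilon> y) - F (u (- 0) x \<omega>) * Z (- \<epsilon>) y \<omega>) ^ (2 * q + 2)) \<partial>M)
      \<le> ennreal (C2 * (\<epsilon> ^ (q + 1)) ^ 3)"
    using P'.triangle_moment[of x q] by blast
  have "(\<integral>\<^sup>+\<omega>. ennreal ((delta1 \<epsilon> (\<lambda>s y. u s y \<omega>) 0 x - F (u 0 x \<omega>) * delta1 \<epsilon> (\<lambda>s y. Z s y \<omega>) 0 x) ^ (2 * q + 2)) \<partial>M)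
      \<le> ennreal (2 ^ (2 * q + 2) * (C1 + C2) * (\<epsilon> ^ (q + 1)) ^ 3)" if \<epsilon>: "0 < \<epsilon>" "4 * \<epsilon> \<le> 1" for \<epsilon>
  proof -
    let ?y = "x + \<epsilon>"
    let ?a = "\<lambda>\<omega>. (u \<epsilon> ?y \<omega> - profile u0 u1 \<epsilon> ?y) - F (u 0 x \<omega>) * Z \<epsilon> ?y \<omega>"
    let ?b = "\<lambda>\<omega>. (u (- \<epsilon>) ?y \<omega> - profile u0 (\<lambda>x. - u1 x) \<epsilon> ?y) - F (u (- 0) x \<omega>) * Z (- \<epsilon>) ?y \<omega>"
    \<comment> \<open>The reflected problem has velocity \<open>- u1\<close>, so the velocity terms
      cancel.\<close>
    have prof: "profile u0 u1 \<epsilon> ?y + profile u0 (\<lambda>x. - u1 x) \<epsilon> ?y = u0 (x + 2 * \<epsilon>) + u0 x"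
    proof -
      have e: "x + \<epsilon> + \<epsilon> = x + 2 * \<epsilon>" "x + \<epsilon> - \<epsilon> = x" by simp_all
      show ?thesis unfolding profile_def e by (simp add: integral_neg add_divide_distrib)
    qed
    have meas: "u \<epsilon> ?y \<in> borel_measurable M" "u 0 x \<in> borel_measurable M" "Z \<epsilon> ?y \<in> borel_measurable M"
      "u (- \<epsilon>) ?y \<in> borel_measurable M" "Z (- \<epsilon>) ?y \<in> borel_measurable M"
      using \<epsilon> P.field_measurable P.Z_measurable P'.field_measurable[of \<epsilon>] P'.Z_measurable[of \<epsilon>] by auto
    note [measurable] = meas P.F_measurable
    have "(\<integral>\<^sup>+\<omega>. ennreal ((delta1 \<epsilon> (\<lambda>s y. u s y \<omega>) 0 x - F (u 0 x \<omega>) * delta1 \<epsilon> (\<lambda>s y. Z s y \<omega>) 0 x) ^ (2 * q + 2)) \<partial>M)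
      = (\<integral>\<^sup>+\<omega>. ennreal ((?a \<omega> + ?b \<omega>) ^ (2 * q + 2)) \<partial>M)"
    proof (rule nn_integral_cong_AE)
      show "AE \<omega> in M. ennreal ((delta1 \<epsilon> (\<lambda>s y. u s y \<omega>) 0 x - F (u 0 x \<omega>) * delta1 \<epsilon> (\<lambda>s y. Z s y \<omega>) 0 x) ^ (2 * q + 2))
         = ennreal ((?a \<omega> + ?b \<omega>) ^ (2 * q + 2))"
        using P.initial_values(1)[of x] P.initial_values(1)[of "x + 2 * \<epsilon>"]
          P.initial_values(2)[of x] P.initial_values(2)[of "x + 2 * \<epsilon>"]
      proof eventually_elim
        case (elim \<omega>)
        have "delta1 \<epsilon> (\<lambda>s y. u s y \<omega>) 0 x - F (u 0 x \<omega>) * delta1 \<epsilon> (\<lambda>s y. Z s y \<omega>) 0 x = - (?a \<omega> + ?b \<omega>)"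
        proof -
          have du: "delta1 \<epsilon> (\<lambda>s y. u s y \<omega>) 0 x = u0 (x + 2 * \<epsilon>) + u0 x - u (- \<epsilon>) ?y \<omega> - u \<epsilon> ?y \<omega>"
            using elim by (simp add: delta1_def)
          have dZ: "delta1 \<epsilon> (\<lambda>s y. Z s y \<omega>) 0 x = - Z (- \<epsilon>) ?y \<omega> - Z \<epsilon> ?y \<omega>"
            using elim by (simp add: delta1_def)
          show ?thesis unfolding du dZ prof [symmetric] by (simp add: algebra_simps)
        qed
        moreover have "(- r) ^ (2 * q + 2) = r ^ (2 * q + 2)" for r :: real by (rule power_minus_even) simp
        ultimately show ?case by (simp only:)
      qed
    qed
    also have "\<dots> \<le> ennreal (2 ^ (2 * q + 2) * (C1 * (\<epsilon> ^ (q + 1)) ^ 3 + C2 * (\<epsilon> ^ (q + 1)) ^ 3))"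
    proof (rule nn_integral_power_add_le)
      show "(\<integral>\<^sup>+\<omega>. ennreal (?a \<omega> ^ (2 * q + 2)) \<partial>M) \<le> ennreal (C1 * (\<epsilon> ^ (q + 1)) ^ 3)"
        by (rule C1(2)) (use \<epsilon> in auto)
      show "(\<integral>\<^sup>+\<omega>. ennreal (?b \<omega> ^ (2 * q + 2)) \<partial>M) \<le> ennreal (C2 * (\<epsilon> ^ (q + 1)) ^ 3)"
        by (rule C2(2)) (use \<epsilon> in auto)
      show "?a \<in> borel_measurable M" by measurable
      show "?b \<in> borel_measurable M" unfolding minus_zero by measurable
    qed (use C1(1) C2(1) \<epsilon> in auto)
    finally show ?thesis by (simp only: distrib_left distrib_right mult.assoc)
  qed
  moreover have "0 \<le> 2 ^ (2 * q + 2) * (C1 + C2)" using C1(1) C2(1) by simp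
  ultimately show ?thesis by blast
qed

text \<open>Away from time 0 a small diamond stays in one half plane. \<open>delta1\<close> at
  \<open>(t, x)\<close> is minus \<open>delta2\<close> at
  \<open>(t - \<epsilon>, x + \<epsilon>)\<close>, and the sign disappears in the even power. At
  time 0 only the diamond of \<open>delta1\<close> meets both half planes.\<close>

lemma increment_moments:
  assumes P: "wave_pair M \<xi> F u0 u1 K u Z"
    and P': "wave_pair M (reflect_noise \<xi>) F u0 (\<lambda>x. - u1 x) K (\<lambda>t x. u (- t) x) (\<lambda>t x. Z (- t) x)"
  shows "\<exists>C \<epsilon>0. 0 \<le> C \<and> 0 < \<epsilon>0 \<and> (\<forall>\<epsilon>. 0 < \<epsilon> \<longrightarrow> \<epsilon> \<le> \<epsilon>0 \<longrightarrow>
    (\<integral>\<^sup>+\<omega>. ennreal ((delta1 \<epsilon> (\<lambda>s y. u s y \<omega>) t x - F (u t x \<omega>) * delta1 \<epsilon> (\<lambda>s y. Z s y \<omega>) t x) ^ (2 * q + 2)) \<partial>M)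
      \<le> ennreal (C * (\<epsilon> ^ (q + 1)) ^ 3) \<and>
    (\<integral>\<^sup>+\<omega>. ennreal ((delta2 \<epsilon> (\<lambda>s y. u s y \<omega>) t x - F (u t x \<omega>) * delta2 \<epsilon> (\<lambda>s y. Z s y \<omega>) t x) ^ (2 * q + 2)) \<partial>M)
      \<le> ennreal (C * (\<epsilon> ^ (q + 1)) ^ 3))"
proof -
  interpret P: wave_pair M \<xi> F u0 u1 K u Z by (rule P)
  interpret P': wave_pair M "reflect_noise \<xi>" F u0 "\<lambda>x. - u1 x" K "\<lambda>t x. u (- t) x" "\<lambda>t x. Z (- t) x" by (rule P')
  have ev: "(- r) ^ (2 * q + 2) = r ^ (2 * q + 2)" for r :: real by (rule power_minus_even) simp
  consider "0 < t" | "t = 0" | "t < 0" by linarith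
  then show ?thesis
  proof cases
    case 1
    obtain C where C: "0 \<le> C" "\<And>s y \<epsilon>. 0 \<le> s \<Longrightarrow> s \<le> t \<Longrightarrow> t - s \<le> 2 * \<epsilon> \<Longrightarrow> \<bar>y - x\<bar> \<le> \<epsilon> \<Longrightarrow> 0 < \<epsilon> \<Longrightarrow> 4 * \<epsilon> \<le> 1 \<Longrightarrow>
      (\<integral>\<^sup>+\<omega>. ennreal ((delta2 \<epsilon> (\<lambda>s y. u s y \<omega>) s y - F (u t x \<omega>) * delta2 \<epsilon> (\<lambda>s y. Z s y \<omega>) s y) ^ (2 * q + 2)) \<partial>M)
      \<le> ennreal (C * (\<epsilon> ^ (q + 1)) ^ 3)"
      using P.diamond_moment[OF less_imp_le[OF 1], of x q] by blast
    show ?thesis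
    proof (intro exI conjI allI impI)
      show "0 \<le> C" by (rule C(1))
      \<comment> \<open>\<open>1 / 4\<close> is the bound under which the diamond estimate holds,
        and \<open>t / 2\<close> keeps the lowest corner at nonnegative time.\<close>
      show "0 < min (1 / 4) (t / 2)" using 1 by simp
      fix \<epsilon> :: real assume \<epsilon>: "0 < \<epsilon>" "\<epsilon> \<le> min (1 / 4) (t / 2)"
      have "delta1 \<epsilon> (\<lambda>s y. u s y \<omega>) t x - F (u t x \<omega>) * delta1 \<epsilon> (\<lambda>s y. Z s y \<omega>) t x
        = - (delta2 \<epsilon> (\<lambda>s y. u s y \<omega>) (t - \<epsilon>) (x + \<epsilon>) - F (u t x \<omega>) * delta2 \<epsilon> (\<lambda>s y. Z s y \<omega>) (t - \<epsilon>) (x + \<epsilon>))" for \<omega>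
        by (simp add: delta1_def delta2_def algebra_simps)
      then show "(\<integral>\<^sup>+\<omega>. ennreal ((delta1 \<epsilon> (\<lambda>s y. u s y \<omega>) t x - F (u t x \<omega>) * delta1 \<epsilon> (\<lambda>s y. Z s y \<omega>) t x) ^ (2 * q + 2)) \<partial>M)
          \<le> ennreal (C * (\<epsilon> ^ (q + 1)) ^ 3)"
        using C(2)[of "t - \<epsilon>" \<epsilon> "x + \<epsilon>"] \<epsilon> by (simp only: ev)
      show "(\<integral>\<^sup>+\<omega>. ennreal ((delta2 \<epsilon> (\<lambda>s y. u s y \<omega>) t x - F (u t x \<omega>) * delta2 \<epsilon> (\<lambda>s y. Z s y \<omega>) t x) ^ (2 * q + 2)) \<partial>M)
          \<le> ennreal (C * (\<epsilon> ^ (q + 1)) ^ 3)"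
        by (rule C(2)) (use \<epsilon> 1 in auto)
    qed
  next
    case 2
    obtain C1 where C1: "0 \<le> C1" "\<And>\<epsilon>. 0 < \<epsilon> \<Longrightarrow> 4 * \<epsilon> \<le> 1 \<Longrightarrow>
      (\<integral>\<^sup>+\<omega>. ennreal ((delta1 \<epsilon> (\<lambda>s y. u s y \<omega>) 0 x - F (u 0 x \<omega>) * delta1 \<epsilon> (\<lambda>s y. Z s y \<omega>) 0 x) ^ (2 * q + 2)) \<partial>M)
      \<le> ennreal (C1 * (\<epsilon> ^ (q + 1)) ^ 3)"
      using time_zero_moment[OF P P', of x q] by blast
    obtain C2 where C2: "0 \<le> C2" "\<And>s y \<epsilon>. 0 \<le> s \<Longrightarrow> s \<le> 0 \<Longrightarrow> 0 - s \<le> 2 * \<epsilon> \<Longrightarrow> \<bar>y - x\<bar> \<le> \<epsilon> \<Longrightarrow> 0 < \<epsilon> \<Longrightarrow> 4 * \<epsilon> \<le> 1 \<Longrightarrow>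
      (\<integral>\<^sup>+\<omega>. ennreal ((delta2 \<epsilon> (\<lambda>s y. u s y \<omega>) s y - F (u 0 x \<omega>) * delta2 \<epsilon> (\<lambda>s y. Z s y \<omega>) s y) ^ (2 * q + 2)) \<partial>M)
      \<le> ennreal (C2 * (\<epsilon> ^ (q + 1)) ^ 3)"
      using P.diamond_moment[OF order_refl, of x q] by blast
    have mono: "ennreal (C1 * (\<epsilon> ^ (q + 1)) ^ 3) \<le> ennreal ((C1 + C2) * (\<epsilon> ^ (q + 1)) ^ 3)"
      "ennreal (C2 * (\<epsilon> ^ (q + 1)) ^ 3) \<le> ennreal ((C1 + C2) * (\<epsilon> ^ (q + 1)) ^ 3)" if "0 < \<epsilon>" for \<epsilon> :: real
      using that C1(1) C2(1) by (auto intro!: ennreal_leI mult_right_mono simp del: power_Suc)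
    show ?thesis
    proof (intro exI conjI allI impI)
      show "0 \<le> C1 + C2" using C1 C2 by simp
      show "0 < (1 / 4 :: real)" by simp
      fix \<epsilon> :: real assume \<epsilon>: "0 < \<epsilon>" "\<epsilon> \<le> 1 / 4"
      show "(\<integral>\<^sup>+\<omega>. ennreal ((delta1 \<epsilon> (\<lambda>s y. u s y \<omega>) t x - F (u t x \<omega>) * delta1 \<epsilon> (\<lambda>s y. Z s y \<omega>) t x) ^ (2 * q + 2)) \<partial>M)
          \<le> ennreal ((C1 + C2) * (\<epsilon> ^ (q + 1)) ^ 3)"
        unfolding 2 by (rule order_trans[OF C1(2) mono(1)]) (use \<epsilon> in auto)
      show "(\<integral>\<^sup>+\<omega>. ennreal ((delta2 \<epsilon> (\<lambda>s y. u s y \<omega>) t x - F (u t x \<omega>) * delta2 \<epsilon> (\<lambda>s y. Z s y \<omega>) t x) ^ (2 * q + 2)) \<partial>M)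
          \<le> ennreal ((C1 + C2) * (\<epsilon> ^ (q + 1)) ^ 3)"
        unfolding 2 by (rule order_trans[OF C2(2) mono(2)]) (use \<epsilon> in auto)
    qed
  next
    case 3
    then have t: "0 \<le> - t" by simp
    obtain C where C: "0 \<le> C" "\<And>s y \<epsilon>. 0 \<le> s \<Longrightarrow> s \<le> - t \<Longrightarrow> - t - s \<le> 2 * \<epsilon> \<Longrightarrow> \<bar>y - x\<bar> \<le> \<epsilon> \<Longrightarrow> 0 < \<epsilon> \<Longrightarrow> 4 * \<epsilon> \<le> 1 \<Longrightarrow>
      (\<integral>\<^sup>+\<omega>. ennreal ((delta2 \<epsilon> (\<lambda>s y. u (- s) y \<omega>) s y - F (u (- (- t)) x \<omega>) * delta2 \<epsilon> (\<lambda>s y. Z (- s) y \<omega>) s y) ^ (2 * q + 2)) \<partial>M)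
      \<le> ennreal (C * (\<epsilon> ^ (q + 1)) ^ 3)"
      using P'.diamond_moment[OF t, of x q] by blast
    show ?thesis
    proof (intro exI conjI allI impI)
      show "0 \<le> C" by (rule C(1))
      show "0 < min (1 / 4) (- t / 2)" using 3 by simp
      fix \<epsilon> :: real assume \<epsilon>: "0 < \<epsilon>" "\<epsilon> \<le> min (1 / 4) (- t / 2)"
      have "delta1 \<epsilon> (\<lambda>s y. u s y \<omega>) t x - F (u t x \<omega>) * delta1 \<epsilon> (\<lambda>s y. Z s y \<omega>) t x
        = - (delta2 \<epsilon> (\<lambda>s y. u (- s) y \<omega>) (- t - \<epsilon>) (x + \<epsilon>)
          - F (u (- (- t)) x \<omega>) * delta2 \<epsilon> (\<lambda>s y. Z (- s) y \<omega>) (- t - \<epsilon>) (x + \<epsilon>))" for \<omega>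
        by (simp add: delta1_def delta2_def algebra_simps)
      then show "(\<integral>\<^sup>+\<omega>. ennreal ((delta1 \<epsilon> (\<lambda>s y. u s y \<omega>) t x - F (u t x \<omega>) * delta1 \<epsilon> (\<lambda>s y. Z s y \<omega>) t x) ^ (2 * q + 2)) \<partial>M)
          \<le> ennreal (C * (\<epsilon> ^ (q + 1)) ^ 3)"
        using C(2)[of "- t - \<epsilon>" \<epsilon> "x + \<epsilon>"] \<epsilon> by (simp only: ev)
      \<comment> \<open>Time reversal exchanges the highest and the lowest corner: the diamond now
        starts at time \<open>- t - 2 * \<epsilon>\<close>, and the reference point becomes its top.
        Hence the bound \<open>- t / 2\<close> on \<epsilon>.\<close>
      have "delta2 \<epsilon> (\<lambda>s y. u s y \<omega>) t x - F (u t x \<omega>) * delta2 \<epsilon> (\<lambda>s y. Z s y \<omega>) t x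
        = delta2 \<epsilon> (\<lambda>s y. u (- s) y \<omega>) (- t - 2 * \<epsilon>) x
          - F (u (- (- t)) x \<omega>) * delta2 \<epsilon> (\<lambda>s y. Z (- s) y \<omega>) (- t - 2 * \<epsilon>) x" for \<omega>
        by (simp add: delta2_def algebra_simps)
      then show "(\<integral>\<^sup>+\<omega>. ennreal ((delta2 \<epsilon> (\<lambda>s y. u s y \<omega>) t x - F (u t x \<omega>) * delta2 \<epsilon> (\<lambda>s y. Z s y \<omega>) t x) ^ (2 * q + 2)) \<partial>M)
          \<le> ennreal (C * (\<epsilon> ^ (q + 1)) ^ 3)"
        using C(2)[of "- t - 2 * \<epsilon>" \<epsilon> x] \<epsilon> by simp
    qed
  qed
qed

theorem theorem1p4:
  fixes M :: "'a measure"
    and \<xi> :: "(real \<times> real \<Rightarrow> real) \<Rightarrow> 'a \<Rightarrow> real"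
    and F u0 u1 :: "real \<Rightarrow> real"
    and u Z :: "real \<Rightarrow> real \<Rightarrow> 'a \<Rightarrow> real"
  assumes "white_noise M \<xi>"
    and "\<exists>L. L-lipschitz_on UNIV F"
    and "C1b u0" and "Cb u1"
    and "wave_solution M \<xi> F u0 u1 u"
    and "wave_solution M \<xi> (\<lambda>_. 1) (\<lambda>_. 0) (\<lambda>_. 0) Z"
  shows "\<forall>t x (p::real). 2 \<le> p \<longrightarrow>
     (\<exists>C \<epsilon>0. \<epsilon>0 > 0 \<and> (\<forall>\<epsilon>. 0 < \<epsilon> \<and> \<epsilon> \<le> \<epsilon>0 \<longrightarrow>
        (let D1 = (\<lambda>\<omega>. delta1 \<epsilon> (\<lambda>s y. u s y \<omega>) t x - F (u t x \<omega>) * delta1 \<epsilon> (\<lambda>s y. Z s y \<omega>) t x);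
             D2 = (\<lambda>\<omega>. delta2 \<epsilon> (\<lambda>s y. u s y \<omega>) t x - F (u t x \<omega>) * delta2 \<epsilon> (\<lambda>s y. Z s y \<omega>) t x)
         in integrable M (\<lambda>\<omega>. \<bar>D1 \<omega>\<bar> powr p) \<and> integrable M (\<lambda>\<omega>. \<bar>D2 \<omega>\<bar> powr p) \<and>
            lp_norm M p D1 + lp_norm M p D2 \<le> C * \<epsilon> powr (3/2))))"
proof (intro allI impI)
  fix t x p :: real assume p: "2 \<le> p"
  obtain L where L: "L-lipschitz_on UNIV F" using assms(2) by blast
  have lip: "\<bar>F a - F b\<bar> \<le> L * \<bar>a - b\<bar>" for a b
    using lipschitz_onD[OF L, of a b] by (simp add: dist_real_def)
  have Cb: "Cb (\<lambda>x. - u1 x)"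
    using assms(4) by (auto simp: Cb_def bounded_real intro!: continuous_intros)
  have P: "wave_pair M \<xi> F u0 u1 L u Z"
    using assms(5,6) by (intro wave_pair_intro assms(1,3,4) lip) (simp_all add: wave_solution_def)
  have P': "wave_pair M (reflect_noise \<xi>) F u0 (\<lambda>x. - u1 x) L (\<lambda>t x. u (- t) x) (\<lambda>t x. Z (- t) x)"
    using assms(5,6) by (intro wave_pair_intro white_noise_reflect assms(1,3) Cb lip) (simp_all add: wave_solution_def)
  interpret P: wave_pair M \<xi> F u0 u1 L u Z by (rule P)
  interpret P': wave_pair M "reflect_noise \<xi>" F u0 "\<lambda>x. - u1 x" L "\<lambda>t x. u (- t) x" "\<lambda>t x. Z (- t) x" by (rule P')
  have u_meas [measurable]: "u s y \<in> borel_measurable M" for s y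
    using P.field_measurable[of s y] P'.field_measurable[of "- s" y] by (cases "0 \<le> s") auto
  have Z_meas [measurable]: "Z s y \<in> borel_measurable M" for s y
    using P.Z_measurable[of s y] P'.Z_measurable[of "- s" y] by (cases "0 \<le> s") auto
  note [measurable] = P.F_measurable
  \<comment> \<open>Any \<open>q\<close> with \<open>p\<close> at most \<open>2 * q + 2\<close>
    serves; rounding \<open>p\<close> up is a convenient choice.\<close>
  define q where "q = nat \<lceil>p\<rceil>"
  have q: "p \<le> real (2 * q + 2)" unfolding q_def by linarith
  let ?D1 = "\<lambda>\<epsilon> \<omega>. delta1 \<epsilon> (\<lambda>s y. u s y \<omega>) t x - F (u t x \<omega>) * delta1 \<epsilon> (\<lambda>s y. Z s y \<omega>) t x"
  let ?D2 = "\<lambda>\<epsilon> \<omega>. delta2 \<epsilon> (\<lambda>s y. u s y \<omega>) t x - F (u t x \<omega>) * delta2 \<epsilon> (\<lambda>s y. Z s y \<omega>) t x"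
  obtain C \<epsilon>0 where C: "0 \<le> C" "0 < \<epsilon>0" "\<And>\<epsilon>. 0 < \<epsilon> \<Longrightarrow> \<epsilon> \<le> \<epsilon>0 \<Longrightarrow>
    (\<integral>\<^sup>+\<omega>. ennreal (?D1 \<epsilon> \<omega> ^ (2 * q + 2)) \<partial>M) \<le> ennreal (C * (\<epsilon> ^ (q + 1)) ^ 3) \<and>
    (\<integral>\<^sup>+\<omega>. ennreal (?D2 \<epsilon> \<omega> ^ (2 * q + 2)) \<partial>M) \<le> ennreal (C * (\<epsilon> ^ (q + 1)) ^ 3)"
    using increment_moments[OF P P', of t x q] by blast
  have bound: "integrable M (\<lambda>\<omega>. \<bar>?D1 \<epsilon> \<omega>\<bar> powr p) \<and> integrable M (\<lambda>\<omega>. \<bar>?D2 \<epsilon> \<omega>\<bar> powr p) \<and>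
      lp_norm M p (?D1 \<epsilon>) + lp_norm M p (?D2 \<epsilon>) \<le> (2 * (1 + C)) * \<epsilon> powr (3 / 2)"
    if \<epsilon>: "0 < \<epsilon>" "\<epsilon> \<le> \<epsilon>0" for \<epsilon>
  proof -
    have m: "?D1 \<epsilon> \<in> borel_measurable M" "?D2 \<epsilon> \<in> borel_measurable M"
      unfolding delta1_def delta2_def by measurable
    note D1 = P.lp_norm_le_of_moment[OF m(1) p q \<epsilon>(1) C(1)] and D2 = P.lp_norm_le_of_moment[OF m(2) p q \<epsilon>(1) C(1)]
    note c = conjunct1[OF C(3)[OF \<epsilon>]] conjunct2[OF C(3)[OF \<epsilon>]]
    have "lp_norm M p (?D1 \<epsilon>) + lp_norm M p (?D2 \<epsilon>) \<le> (1 + C) * \<epsilon> powr (3 / 2) + (1 + C) * \<epsilon> powr (3 / 2)"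
      by (rule add_mono[OF D1(2)[OF c(1)] D2(2)[OF c(2)]])
    then show ?thesis using D1(1)[OF c(1)] D2(1)[OF c(2)] by (simp add: algebra_simps)
  qed
  show "\<exists>C \<epsilon>0. \<epsilon>0 > 0 \<and> (\<forall>\<epsilon>. 0 < \<epsilon> \<and> \<epsilon> \<le> \<epsilon>0 \<longrightarrow>
        (let D1 = (\<lambda>\<omega>. delta1 \<epsilon> (\<lambda>s y. u s y \<omega>) t x - F (u t x \<omega>) * delta1 \<epsilon> (\<lambda>s y. Z s y \<omega>) t x);
             D2 = (\<lambda>\<omega>. delta2 \<epsilon> (\<lambda>s y. u s y \<omega>) t x - F (u t x \<omega>) * delta2 \<epsilon> (\<lambda>s y. Z s y \<omega>) t x)
         in integrable M (\<lambda>\<omega>. \<bar>D1 \<omega>\<bar> powr p) \<and> integrable M (\<lambda>\<omega>. \<bar>D2 \<omega>\<bar> powr p) \<and>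
            lp_norm M p D1 + lp_norm M p D2 \<le> C * \<epsilon> powr (3/2)))"
    unfolding Let_def
    by (rule exI[of _ "2 * (1 + C)"], rule exI[of _ \<epsilon>0], intro conjI[OF C(2)] allI impI, elim conjE, rule bound)
qed

end
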